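(* (a) Let $X\in\{S,C\}$, and call a matroid $M$ $X$-Gårding if its generating function $X_M$ is a Gårding polynomial. The class of $X$-Gårding matroids is closed under direct sums, series connections, parallel connections, deletion, and contraction. (b) Let $M$ be a matroid on a ground set $E$ of $n$ elements belonging to one of the following classes: cycle matroids of series--parallel networks; uniform matroids; matroids obtained from uniform matroids by removing one basis; matroids with at most six elements. Then: (1) the spanning-set, cospanning-set and basis generating functions $S_M$, $C_M$, $B_M$ are Gårding; (2) consequently $S_M,C_M,B_M$, as well as the independent-set generating function $I_M$, are Rayleigh; (3) their univariate specializations are ultra log-concave: for each $X\in\{S,C,B,I\}$ and each $a\in\mathbb{R}_{\ge0}^E$ such that $X_M(ta)\not\equiv0$, writing $X_M(ta)=\sum_{k=0}^na_kt^k$, the sequence $(a_k)_{k=0}^n$ is ultra log-concave; and the Mason-type inequalities hold: if $I_k$ is the number of independent sets of $M$ of size $k$, then $I_k^2\ge\left(1+\frac1k\right)\left(1+\frac1{n-k}\right)I_{k-1}I_{k+1}$ for $1\le k\le n-1$.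
   Context: Let $\Gamma_n^+=\{x\in\mathbb{R}^n:x_i>0\ \forall i\}$. A set $R\subset\mathbb{R}^n$ passes the positive ray test (PRT) if $R+\overline{\Gamma_n^+}\subset R$. A nonzero multi-affine polynomial $f$ (degree at most 1 in each variable) is Gårding if some nonempty connected component of $\{f>0\}$ passes PRT. A multi-affine $f$ with nonnegative coefficients is Rayleigh if $f\,\partial_i\partial_jf-\partial_if\,\partial_jf\le0$ on $\Gamma_n^+$ for all $i\ne j$. For a finite matroid $M$ on $E$, variables $w=(w_e)_{e\in E}$ and $w_T=\prod_{e\in T}w_e$: $I_M=\sum_{I\text{ independent}}w_I$; $B_M=\sum_{B\text{ basis}}w_B$; $S_M=\sum_{T\text{ spanning}}w_T$ where $T\subseteq E$ is spanning if it contains a basis; $C_M=\sum_{X\subseteq E,\ E\setminus X\text{ independent}}w_X$. The generating function of a minor is regarded as a polynomial in the variables indexed by its own ground set. A nonnegative sequence is log-concave if it has no internal zeros (a zero between two positive terms) and $a_k^2\ge a_{k-1}a_{k+1}$; $(a_k)_{k=0}^n$ is ultra log-concave if $(a_k/\binom nk)_{k=0}^n$ is log-concave. Series and parallel connections: let $M_1,M_2$ be matroids on $E_1,E_2$ with $E_1\cap E_2=\{e\}$. If $e$ is neither a loop nor a coloop of $M_1$ or $M_2$, the parallel connection $P(M_1,M_2)$ is the matroid on $E_1\cup E_2$ whose circuits are the circuits of $M_1$, those of $M_2$, and the sets $(C_1\cup C_2)\setminus\{e\}$ with $C_i$ a circuit of $M_i$ containing $e$; the series connection $S(M_1,M_2)$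 is the matroid on $E_1\cup E_2$ whose circuits are the circuits of $M_1\setminus e$, those of $M_2\setminus e$, and the sets $C_1\cup C_2$ with $C_i$ a circuit of $M_i$ containing $e$. If $e$ is a loop of $M_1$: $P=M_1\oplus(M_2/e)$, $S=(M_1/e)\oplus M_2$. If $e$ is a coloop of $M_1$: $P=(M_1\setminus e)\oplus M_2$, $S=M_1\oplus(M_2\setminus e)$; symmetrically in $M_1,M_2$. A series--parallel network is a graph obtained from a connected single-edge graph (one loop, or $K_2$) by a sequence of operations each adding an edge parallel to an existing edge or subdividing an edge. The uniform matroid $U_{r,n}$ has all $r$-subsets of $[n]$ as bases; "removing one basis" gives, for $1\le r\le n-1$, the matroid $\widehat U_{r,n}$ whose bases are all $r$-subsets of $[n]$ other than $\{1,\dots,r\}$ (up to relabelling). *)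

theory Defs
  imports "HOL-Analysis.Analysis"
begin

text \<open>
  Polynomials in real variables indexed by a finite set \<open>E\<close> are represented by the functions they
  induce on \<open>\<real>\<^sup>E\<close>, the set of extensional functions \<open>E \<rightarrow>\<^sub>E UNIV\<close>. Its topology, as a subspace of
  the product topology on \<open>'a \<Rightarrow> real\<close>, is the Euclidean one. What a polynomial does off this
  set is irrelevant.
\<close>

definition real_space :: "'a set \<Rightarrow> ('a \<Rightarrow> real) set" where
  "real_space E = (E \<rightarrow>\<^sub>E UNIV)"

definition pos_orthant :: "'a set \<Rightarrow> ('a \<Rightarrow> real) set" where
  "pos_orthant E = (E \<rightarrow>\<^sub>E {0<..})"

definition passes_PRT :: "'a set \<Rightarrow> ('a \<Rightarrow> real) set \<Rightarrow> bool" where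
  "passes_PRT E R \<longleftrightarrow> (\<forall>x\<in>R. \<forall>v\<in>closure (pos_orthant E). (\<lambda>e\<in>E. x e + v e) \<in> R)"

definition multi_affine_with :: "'a set \<Rightarrow> ('a set \<Rightarrow> real) \<Rightarrow> (('a \<Rightarrow> real) \<Rightarrow> real) \<Rightarrow> bool" where
  "multi_affine_with E c f \<longleftrightarrow>
     finite E \<and> (\<forall>x\<in>real_space E. f x = (\<Sum>T\<in>Pow E. c T * (\<Prod>e\<in>T. x e)))"

definition multi_affine :: "'a set \<Rightarrow> (('a \<Rightarrow> real) \<Rightarrow> real) \<Rightarrow> bool" where
  "multi_affine E f \<longleftrightarrow> (\<exists>c. multi_affine_with E c f)"

definition garding :: "'a set \<Rightarrow> (('a \<Rightarrow> real) \<Rightarrow> real) \<Rightarrow> bool" where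
  "garding E f \<longleftrightarrow> multi_affine E f \<and> (\<exists>x\<in>real_space E. f x \<noteq> 0) \<and>
     (\<exists>R\<in>components {x \<in> real_space E. f x > 0}. R \<noteq> {} \<and> passes_PRT E R)"

definition partial_deriv :: "'a \<Rightarrow> (('a \<Rightarrow> real) \<Rightarrow> real) \<Rightarrow> ('a \<Rightarrow> real) \<Rightarrow> real" where
  "partial_deriv i f x = deriv (\<lambda>t. f (x(i := t))) (x i)"

definition rayleigh :: "'a set \<Rightarrow> (('a \<Rightarrow> real) \<Rightarrow> real) \<Rightarrow> bool" where
  "rayleigh E f \<longleftrightarrow> (\<exists>c. (\<forall>T\<subseteq>E. 0 \<le> c T) \<and> multi_affine_with E c f) \<and>
     (\<forall>i\<in>E. \<forall>j\<in>E. i \<noteq> j \<longrightarrow> (\<forall>x\<in>pos_orthant E.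
        f x * partial_deriv i (partial_deriv j f) x
          - partial_deriv i f x * partial_deriv j f x \<le> 0))"

definition log_concave :: "nat \<Rightarrow> (nat \<Rightarrow> real) \<Rightarrow> bool" where
  "log_concave n a \<longleftrightarrow> (\<forall>k\<le>n. 0 \<le> a k) \<and>
     (\<forall>i j k. i < j \<and> j < k \<and> k \<le> n \<and> 0 < a i \<and> 0 < a k \<longrightarrow> a j \<noteq> 0) \<and>
     (\<forall>k. 1 \<le> k \<and> k < n \<longrightarrow> (a k)\<^sup>2 \<ge> a (k - 1) * a (k + 1))"

definition ultra_log_concave :: "nat \<Rightarrow> (nat \<Rightarrow> real) \<Rightarrow> bool" where
  "ultra_log_concave n a \<longleftrightarrow> log_concave n (\<lambda>k. a k / real (n choose k))"

record 'a set_system =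
  ground :: "'a set"
  indeps :: "'a set set"

locale matroid =
  fixes M :: "'a set_system"
  assumes finite_ground: "finite (ground M)"
    and indeps_subset: "I \<in> indeps M \<Longrightarrow> I \<subseteq> ground M"
    and empty_indep: "{} \<in> indeps M"
    and indep_subset: "I \<in> indeps M \<Longrightarrow> J \<subseteq> I \<Longrightarrow> J \<in> indeps M"
    and augment: "I \<in> indeps M \<Longrightarrow> J \<in> indeps M \<Longrightarrow> card I < card J
                    \<Longrightarrow> \<exists>x\<in>J - I. insert x I \<in> indeps M"

definition bases :: "'a set_system \<Rightarrow> 'a set set" where
  "bases M = {B \<in> indeps M. \<forall>I\<in>indeps M. B \<subseteq> I \<longrightarrow> I = B}"

definition spanning_sets :: "'a set_system \<Rightarrow> 'a set set" where
  "spanning_sets M = {T. T \<subseteq> ground M \<and> (\<exists>B\<in>bases M. B \<subseteq> T)}"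

definition circuits :: "'a set_system \<Rightarrow> 'a set set" where
  "circuits M = {C. C \<subseteq> ground M \<and> C \<notin> indeps M \<and> (\<forall>D. D \<subset> C \<longrightarrow> D \<in> indeps M)}"

definition is_loop :: "'a set_system \<Rightarrow> 'a \<Rightarrow> bool" where
  "is_loop M e \<longleftrightarrow> e \<in> ground M \<and> {e} \<notin> indeps M"

definition is_coloop :: "'a set_system \<Rightarrow> 'a \<Rightarrow> bool" where
  "is_coloop M e \<longleftrightarrow> e \<in> ground M \<and> (\<forall>B\<in>bases M. e \<in> B)"

definition delete :: "'a set_system \<Rightarrow> 'a set \<Rightarrow> 'a set_system" where
  "delete M X = \<lparr>ground = ground M - X, indeps = {I \<in> indeps M. I \<inter> X = {}}\<rparr>"

text \<open>
  A set is independent in the contraction if adding a maximal independent subset \<open>J\<close> of the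
  contracted set keeps it independent; for a matroid the choice of \<open>J\<close> does not matter.
\<close>

definition contract :: "'a set_system \<Rightarrow> 'a set \<Rightarrow> 'a set_system" where
  "contract M X = \<lparr>ground = ground M - X,
     indeps = {I. I \<subseteq> ground M - X \<and> (\<exists>J\<in>bases (delete M (ground M - X)). I \<union> J \<in> indeps M)}\<rparr>"

text \<open>Only meaningful if the ground sets are disjoint.\<close>

definition direct_sum :: "'a set_system \<Rightarrow> 'a set_system \<Rightarrow> 'a set_system" where
  "direct_sum M\<^sub>1 M\<^sub>2 = \<lparr>ground = ground M\<^sub>1 \<union> ground M\<^sub>2,
     indeps = {I \<union> J | I J. I \<in> indeps M\<^sub>1 \<and> J \<in> indeps M\<^sub>2}\<rparr>"

definition of_circuits :: "'a set \<Rightarrow> 'a set set \<Rightarrow> 'a set_system" where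
  "of_circuits E \<C> = \<lparr>ground = E, indeps = {I. I \<subseteq> E \<and> \<not> (\<exists>C\<in>\<C>. C \<subseteq> I)}\<rparr>"

text \<open>
  Connections are taken at \<open>e\<close>, where \<open>ground M\<^sub>1 \<inter> ground M\<^sub>2 = {e}\<close>. When several of the degenerate
  cases apply, they give the same matroid, so the order of the tests is immaterial.
\<close>

definition parallel_connection :: "'a \<Rightarrow> 'a set_system \<Rightarrow> 'a set_system \<Rightarrow> 'a set_system" where
  "parallel_connection e M\<^sub>1 M\<^sub>2 =
     (if is_loop M\<^sub>1 e then direct_sum M\<^sub>1 (contract M\<^sub>2 {e})
      else if is_loop M\<^sub>2 e then direct_sum (contract M\<^sub>1 {e}) M\<^sub>2
      else if is_coloop M\<^sub>1 e then direct_sum (delete M\<^sub>1 {e}) M\<^sub>2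
      else if is_coloop M\<^sub>2 e then direct_sum M\<^sub>1 (delete M\<^sub>2 {e})
      else of_circuits (ground M\<^sub>1 \<union> ground M\<^sub>2)
        (circuits M\<^sub>1 \<union> circuits M\<^sub>2 \<union>
         {(C\<^sub>1 \<union> C\<^sub>2) - {e} | C\<^sub>1 C\<^sub>2. C\<^sub>1 \<in> circuits M\<^sub>1 \<and> e \<in> C\<^sub>1 \<and> C\<^sub>2 \<in> circuits M\<^sub>2 \<and> e \<in> C\<^sub>2}))"

definition series_connection :: "'a \<Rightarrow> 'a set_system \<Rightarrow> 'a set_system \<Rightarrow> 'a set_system" where
  "series_connection e M\<^sub>1 M\<^sub>2 =
     (if is_loop M\<^sub>1 e then direct_sum (contract M\<^sub>1 {e}) M\<^sub>2
      else if is_loop M\<^sub>2 e then direct_sum M\<^sub>1 (contract M\<^sub>2 {e})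
      else if is_coloop M\<^sub>1 e then direct_sum M\<^sub>1 (delete M\<^sub>2 {e})
      else if is_coloop M\<^sub>2 e then direct_sum (delete M\<^sub>1 {e}) M\<^sub>2
      else of_circuits (ground M\<^sub>1 \<union> ground M\<^sub>2)
        (circuits (delete M\<^sub>1 {e}) \<union> circuits (delete M\<^sub>2 {e}) \<union>
         {C\<^sub>1 \<union> C\<^sub>2 | C\<^sub>1 C\<^sub>2. C\<^sub>1 \<in> circuits M\<^sub>1 \<and> e \<in> C\<^sub>1 \<and> C\<^sub>2 \<in> circuits M\<^sub>2 \<and> e \<in> C\<^sub>2}))"

definition gen_fun :: "'a set set \<Rightarrow> ('a \<Rightarrow> real) \<Rightarrow> real" where
  "gen_fun \<T> w = (\<Sum>T\<in>\<T>. \<Prod>e\<in>T. w e)"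

definition I_poly :: "'a set_system \<Rightarrow> ('a \<Rightarrow> real) \<Rightarrow> real" where
  "I_poly M = gen_fun (indeps M)"

definition B_poly :: "'a set_system \<Rightarrow> ('a \<Rightarrow> real) \<Rightarrow> real" where
  "B_poly M = gen_fun (bases M)"

definition S_poly :: "'a set_system \<Rightarrow> ('a \<Rightarrow> real) \<Rightarrow> real" where
  "S_poly M = gen_fun (spanning_sets M)"

definition C_poly :: "'a set_system \<Rightarrow> ('a \<Rightarrow> real) \<Rightarrow> real" where
  "C_poly M = gen_fun {X. X \<subseteq> ground M \<and> ground M - X \<in> indeps M}"

definition garding_matroid ::
  "('a set_system \<Rightarrow> ('a \<Rightarrow> real) \<Rightarrow> real) \<Rightarrow> 'a set_system \<Rightarrow> bool" where
  "garding_matroid X M \<longleftrightarrow> matroid M \<and> garding (ground M) (X M)"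

definition uniform_matroid :: "'a set_system \<Rightarrow> bool" where
  "uniform_matroid M \<longleftrightarrow> matroid M \<and>
     (\<exists>r\<le>card (ground M). bases M = {B. B \<subseteq> ground M \<and> card B = r})"

definition uniform_minus_basis :: "'a set_system \<Rightarrow> bool" where
  "uniform_minus_basis M \<longleftrightarrow> matroid M \<and>
     (\<exists>r A. 1 \<le> r \<and> r \<le> card (ground M) - 1 \<and> A \<subseteq> ground M \<and> card A = r \<and>
        bases M = {B. B \<subseteq> ground M \<and> card B = r} - {A})"

text \<open>
  Multigraphs: \<open>ends G f\<close> is the set of endpoints of the edge \<open>f\<close>, a singleton if \<open>f\<close> is a loop.
\<close>

record ('v, 'a) multigraph =
  verts :: "'v set"
  edges :: "'a set"
  ends :: "'a \<Rightarrow> 'v set"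

text \<open>
  The edge set of a closed walk without repeated vertices or edges; length one gives the loops,
  length two the pairs of parallel edges.
\<close>

definition is_cycle :: "('v, 'a) multigraph \<Rightarrow> 'a set \<Rightarrow> bool" where
  "is_cycle G C \<longleftrightarrow> (\<exists>vs fs. vs \<noteq> [] \<and> length fs = length vs \<and> distinct vs \<and> distinct fs \<and>
     set vs \<subseteq> verts G \<and> set fs \<subseteq> edges G \<and> set fs = C \<and>
     (\<forall>i<length vs. ends G (fs ! i) = {vs ! i, vs ! ((i + 1) mod length vs)}))"

definition cycle_matroid :: "('v, 'a) multigraph \<Rightarrow> 'a set_system" where
  "cycle_matroid G = of_circuits (edges G) {C. is_cycle G C}"

text \<open>Subdividing the edge \<open>f\<close> keeps the name \<open>f\<close> for one of its two halves.\<close>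

inductive series_parallel_network :: "('v, 'a) multigraph \<Rightarrow> bool" where
  single_loop: "\<phi> f = {u} \<Longrightarrow> series_parallel_network \<lparr>verts = {u}, edges = {f}, ends = \<phi>\<rparr>"
| K\<^sub>2: "u \<noteq> v \<Longrightarrow> \<phi> f = {u, v} \<Longrightarrow>
    series_parallel_network \<lparr>verts = {u, v}, edges = {f}, ends = \<phi>\<rparr>"
| add_parallel: "series_parallel_network G \<Longrightarrow> f \<in> edges G \<Longrightarrow> g \<notin> edges G \<Longrightarrow>
    series_parallel_network
      \<lparr>verts = verts G, edges = insert g (edges G), ends = (ends G)(g := ends G f)\<rparr>"
| subdivide: "series_parallel_network G \<Longrightarrow> f \<in> edges G \<Longrightarrow> g \<notin> edges G \<Longrightarrow>
    ends G f = {u, v} \<Longrightarrow> w \<notin> verts G \<Longrightarrow>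
    series_parallel_network
      \<lparr>verts = insert w (verts G), edges = insert g (edges G),
       ends = (ends G)(f := {u, w}, g := {w, v})\<rparr>"

end

theory Submission
  imports Defs
begin

text \<open>
A multi-affine polynomial with non-negative coefficients is encoded by its coefficient function
\<open>c\<close>; \<open>ma E c\<close> evaluates it, and \<open>pd E c T\<close> is its derivative in all variables of \<open>T\<close>, the
polynomial of \<open>link c T\<close>. The whole development rests on an algebraic form of the Garding property.
Let \<open>posR\<close> be the set of points where all iterated derivatives (the polynomial included) are
positive, and \<open>nnR\<close> the set where they are non-negative. A component of \<open>{f > 0}\<close> that passes the
ray test lies in \<open>nnR\<close>, because a polynomial that stays positive along all rays has non-negative
leading coefficients. If the top coefficient is positive, \<open>f\<close> is Garding iff every point of \<open>nnR\<close>
with \<open>f > 0\<close> lies in \<open>posR\<close>; this is the predicate \<open>gard\<close>, and \<open>garding_iff_gard\<close> is the equivalence.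

This form is inductive. Writing \<open>f = A + x B\<close> for one variable \<open>x\<close>, the link \<open>B\<close> inherits \<open>gard\<close>
(contraction), \<open>A\<close> does if its top coefficient is positive (deletion, \<open>gard_slice\<close>), and conversely
\<open>f\<close> is \<open>gard\<close> as soon as \<open>B\<close> is and \<open>A\<close> is non-positive where \<open>B\<close> vanishes on \<open>nnR\<close>
(\<open>gard_criterion\<close>). A consequence is \<open>gard_single_pair\<close>: two links and one Rayleigh inequality suffice.
For spanning and cospanning sets coefficients increase with the set, so \<open>A \<le> B\<close>
(\<open>slice_le_link\<close>), and this is what makes the polynomials of series and parallel connections
satisfy the criterion. Duality of matroids exchanges spanning and cospanning sets and
the two connections, so every closure statement is needed only once.

Series-parallel networks are built by parallel and series extensions. For uniform matroids and for
the removal of one basis, the criterion becomes an inequality on the zero set, proved by smoothing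
a negative coordinate against a positive one. A matroid with at most six elements is
decomposed by loops, coloops, parallel and series pairs; what remains has rank or corank at most
two, or has rank three and six elements with 3-element non-bases meeting pairwise in at most one point, and
four configurations are then settled by explicit inequalities for one pair.

The Garding property gives the Rayleigh inequalities. Averaging over a transposition preserves
\<open>gard\<close>, again by \<open>gard_single_pair\<close>, hence so does full symmetrization; the Rayleigh inequality of
the symmetrized polynomial at the origin of the remaining variables is the Newton inequality, and
rescaling the variables gives ultra log-concavity along every ray. Bases are the limit of rescaled
spanning sets, and independent sets arise from cospanning sets by inverting the variables; the
Rayleigh and the Newton inequalities survive both operations.
\<close>

section \<open>Multi-affine polynomials and their derivatives\<close>

definition ma :: "'a set => ('a set => real) => ('a => real) => real" where
 "ma E c x = (\<Sum>T\<in>Pow E. c T * prod x T)"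

text \<open>
 The link is the coefficient function of a derivative, or of a contraction.
\<close>

definition link :: "('a set => real) => 'a set => 'a set => real" where
 "link c T = (\<lambda>U. c (U \<union> T))"

definition pd :: "'a set => ('a set => real) => 'a set => ('a => real) => real" where
 "pd E c T x = ma (E - T) (link c T) x"

lemma link_apply: "link c T U = c (U \<union> T)"
 by (simp add: link_def)

lemma link_empty [simp]: "link c {} = c"
 by (simp add: link_def)

lemma link_link: "link (link c S) T = link c (S \<union> T)"
 by (auto simp: link_def Un_ac)

lemma pd_empty [simp]: "pd E c {} x = ma E c x"
 by (simp add: pd_def)

lemma pd_link:
 "pd (E - S) (link c S) T x = pd E c (S \<union> T) x"
 by (simp add: pd_def link_link Diff_Diff_Int Diff_eq Int_assoc)

lemma ma_cong:
 assumes "\<And>T. T \<subseteq> E ==> c T = d T" "\<And>e. e \<in> E ==> x e = y e"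
 shows "ma E c x = ma E d y"
 unfolding ma_def
proof (rule sum.cong [OF refl])
 fix T assume "T \<in> Pow E"
 then have "c T = d T" "prod x T = prod y T"
  using assms by (auto intro!: prod.cong)
 then show "c T * prod x T = d T * prod y T" by simp
qed

lemma pd_cong:
 assumes "\<And>U. T \<subseteq> U ==> U \<subseteq> E ==> c U = d U" "\<And>e. e \<in> E - T ==> x e = y e" "T \<subseteq> E"
 shows "pd E c T x = pd E d T y"
 unfolding pd_def using assms by (intro ma_cong) (auto simp: link_def)

lemma ma_empty [simp]: "ma {} c x = c {}"
 by (simp add: ma_def)

lemma ma_insert:
 assumes "finite E" "e \<notin> E"
 shows "ma (insert e E) c x = ma E c x + x e * ma E (link c {e}) x"
proof -
 have "Pow E \<inter> insert e ` Pow E = {}" using assms(2) by auto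
 then have "ma (insert e E) c x = ma E c x + (\<Sum>T\<in>insert e ` Pow E. c T * prod x T)"
  unfolding ma_def Pow_insert using assms(1) by (subst sum.union_disjoint) auto
 also have "(\<Sum>T\<in>insert e ` Pow E. c T * prod x T) = (\<Sum>T\<in>Pow E. c (insert e T) * prod x (insert e T))"
  using assms(2) by (subst sum.reindex) (auto simp: inj_on_def o_def)
 also have "\<dots> = (\<Sum>T\<in>Pow E. x e * (c (insert e T) * prod x T))"
 proof (rule sum.cong [OF refl])
  fix T assume "T \<in> Pow E"
  then have "e \<notin> T" "finite T" using assms finite_subset by auto
  then show "c (insert e T) * prod x (insert e T) = x e * (c (insert e T) * prod x T)" by simp
 qed
 finally show ?thesis by (simp add: ma_def link_def sum_distrib_left)
qed

lemma ma_split: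
 assumes "finite E" "e \<in> E"
 shows "ma E c x = ma (E - {e}) c x + x e * pd E c {e} x"
 using ma_insert [of "E - {e}" e c x] assms by (simp add: insert_absorb pd_def)

lemma pd_split:
 assumes "finite E" "e \<in> E - T"
 shows "pd E c T x = pd (E - {e}) c T x + x e * pd E c (insert e T) x"
proof -
 have "E - T - {e} = E - {e} - T" "E - insert e T = E - T - {e}" by auto
 then show ?thesis
  unfolding pd_def using ma_split [of "E - T" e "link c T" x] assms
  by (simp add: pd_def link_link Un_commute)
qed

lemma taylor:
 assumes "finite E"
 shows "ma E c (\<lambda>e. x e + v e) = (\<Sum>V\<in>Pow E. pd E c V x * prod v V)"
 using assms
proof (induction E arbitrary: c rule: finite_induct)
 case (insert e E)
 have dis: "Pow E \<inter> insert e ` Pow E = {}" using insert.hyps by auto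
 have inj: "inj_on (insert e) (Pow E)" using insert.hyps by (auto simp: inj_on_def)
 have 1: "pd (insert e E) c V x = pd E c V x + x e * pd E (link c {e}) V x" if "V \<subseteq> E" for V
 proof -
  have "insert e E - V = insert e (E - V)" "e \<notin> E - V" "finite (E - V)"
   using insert.hyps that by auto
  then show ?thesis by (simp add: pd_def ma_insert link_link Un_commute)
 qed
 have 2: "pd (insert e E) c (insert e V) x * prod v (insert e V) = v e * (pd E (link c {e}) V x * prod v V)"
  if "V \<subseteq> E" for V
 proof -
  have "e \<notin> V" "finite V" "insert e E - insert e V = E - V"
   using insert.hyps that finite_subset by auto
  then show ?thesis by (simp add: pd_def link_link)
 qed
 have "ma (insert e E) c (\<lambda>e. x e + v e)
   = ma E c (\<lambda>e. x e + v e) + (x e + v e) * ma E (link c {e}) (\<lambda>e. x e + v e)"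
  using insert.hyps by (simp add: ma_insert)
 also have "\<dots> = (\<Sum>V\<in>Pow E. pd E c V x * prod v V)
   + (x e + v e) * (\<Sum>V\<in>Pow E. pd E (link c {e}) V x * prod v V)"
  by (simp add: insert.IH)
 also have "\<dots> = (\<Sum>V\<in>Pow E. pd (insert e E) c V x * prod v V)
   + (\<Sum>V\<in>Pow E. pd (insert e E) c (insert e V) x * prod v (insert e V))"
 proof -
  have "(\<Sum>V\<in>Pow E. pd (insert e E) c V x * prod v V)
    = (\<Sum>V\<in>Pow E. pd E c V x * prod v V) + x e * (\<Sum>V\<in>Pow E. pd E (link c {e}) V x * prod v V)"
   by (simp add: 1 sum.distrib algebra_simps sum_distrib_left)
  moreover have "(\<Sum>V\<in>Pow E. pd (insert e E) c (insert e V) x * prod v (insert e V))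
    = v e * (\<Sum>V\<in>Pow E. pd E (link c {e}) V x * prod v V)"
   by (simp add: 2 sum_distrib_left)
  ultimately show ?thesis by (simp add: algebra_simps)
 qed
 also have "\<dots> = (\<Sum>V\<in>Pow (insert e E). pd (insert e E) c V x * prod v V)"
  unfolding Pow_insert using insert.hyps(1) dis
  by (subst sum.union_disjoint) (auto simp: sum.reindex [OF inj])
 finally show ?case .
qed (simp add: pd_def)

lemma taylor_pd:
 assumes "finite E"
 shows "pd E c T (\<lambda>e. x e + v e) = (\<Sum>V\<in>Pow (E - T). pd E c (T \<union> V) x * prod v V)"
proof -
 have "pd E c T (\<lambda>e. x e + v e) = (\<Sum>V\<in>Pow (E - T). pd (E - T) (link c T) V x * prod v V)"
  unfolding pd_def [of E c T] using assms by (simp add: taylor)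
 then show ?thesis by (simp add: pd_link)
qed

lemma continuous_ma [continuous_intros]:
 assumes "\<And>e. e \<in> E ==> continuous F (\<lambda>t. x t e)"
 shows "continuous F (\<lambda>t. ma E c (x t))"
 unfolding ma_def using assms by (intro continuous_intros) auto

lemma continuous_on_ma [continuous_intros]:
 assumes "\<And>e. e \<in> E ==> continuous_on S (\<lambda>t. x t e)"
 shows "continuous_on S (\<lambda>t. ma E c (x t))"
 unfolding ma_def using assms by (intro continuous_intros) auto

lemma continuous_on_pd [continuous_intros]:
 assumes "\<And>e. e \<in> E ==> continuous_on S (\<lambda>t. x t e)"
 shows "continuous_on S (\<lambda>t. pd E c T (x t))"
 unfolding pd_def using assms by (intro continuous_intros) auto

lemma tendsto_ma [tendsto_intros]:
 assumes "\<And>e. e \<in> E ==> ((\<lambda>t. x t e) \<longlongrightarrow> y e) F"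
 shows "((\<lambda>t. ma E c (x t)) \<longlongrightarrow> ma E c y) F"
 unfolding ma_def using assms by (intro tendsto_intros) auto

lemma tendsto_pd [tendsto_intros]:
 assumes "\<And>e. e \<in> E ==> ((\<lambda>t. x t e) \<longlongrightarrow> y e) F"
 shows "((\<lambda>t. pd E c T (x t)) \<longlongrightarrow> pd E c T y) F"
 unfolding pd_def using assms by (intro tendsto_intros) auto

text \<open>
 Otherwise the leading term makes the polynomial negative far out on the ray.
\<close>

lemma leading_coeff_nonneg:
 fixes d :: "'a set => real"
 assumes fin: "finite T" and nn: "\<And>t. 0 <= t ==> 0 <= (\<Sum>V\<in>Pow T. d V * t ^ card V)"
 shows "0 <= d T"
proof (rule ccontr)
 assume neg: "\<not> 0 <= d T"
 define K where "K = (\<Sum>V\<in>Pow T - {T}. \<bar>d V\<bar>)"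
 define t where "t = 1 + K / \<bar>d T\<bar>"
 have K: "0 <= K" unfolding K_def by (simp add: sum_nonneg)
 have t1: "1 <= t" using K unfolding t_def by (simp add: divide_nonneg_nonneg)
 have "(\<Sum>V\<in>Pow T - {T}. d V * t ^ card V) <= (\<Sum>V\<in>Pow T - {T}. \<bar>d V\<bar> * t ^ (card T - 1))"
 proof (rule sum_mono)
  fix V assume "V \<in> Pow T - {T}"
  then have "card V < card T" using fin by (auto intro: psubset_card_mono)
  then have "t ^ card V <= t ^ (card T - 1)" using t1 by (intro power_increasing) auto
  then have "\<bar>d V\<bar> * t ^ card V <= \<bar>d V\<bar> * t ^ (card T - 1)" by (intro mult_left_mono) auto
  moreover have "d V * t ^ card V <= \<bar>d V\<bar> * t ^ card V" using t1 by (intro mult_right_mono) auto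
  ultimately show "d V * t ^ card V <= \<bar>d V\<bar> * t ^ (card T - 1)" by linarith
 qed
 then have 1: "(\<Sum>V\<in>Pow T - {T}. d V * t ^ card V) <= K * t ^ (card T - 1)"
  by (simp add: K_def sum_distrib_right)
 have "(\<Sum>V\<in>Pow T. d V * t ^ card V) = d T * t ^ card T + (\<Sum>V\<in>Pow T - {T}. d V * t ^ card V)"
  using fin by (subst sum.remove [of _ T]) auto
 then have 2: "0 <= d T * t ^ card T + K * t ^ (card T - 1)"
  using nn [of t] t1 1 by linarith
 show False
 proof (cases "card T = 0")
  case True
  then have "T = {}" using fin by simp
  then show False using nn [of 0] neg by simp
 next
  case False
  then have "t ^ card T = t * t ^ (card T - 1)" by (simp add: power_eq_if)
  then have "0 <= (d T * t + K) * t ^ (card T - 1)" using 2 by (simp add: algebra_simps)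
  moreover have "0 < t ^ (card T - 1)" using t1 by simp
  ultimately have "0 <= d T * t + K" by (metis mult_neg_pos not_le)
  moreover have "d T * t + K = d T" using neg by (simp add: t_def field_simps)
  ultimately show False using neg by simp
 qed
qed

section \<open>Coefficient functions of Garding polynomials\<close>

definition posR :: "'a set => ('a set => real) => ('a => real) set" where
 "posR E c = {x. \<forall>T\<subseteq>E. 0 < pd E c T x}"

definition nnR :: "'a set => ('a set => real) => ('a => real) set" where
 "nnR E c = {x. \<forall>T\<subseteq>E. 0 <= pd E c T x}"

text \<open>
 Positivity of \<open>c E\<close> makes all derivatives non-zero polynomials; it holds for spanning and for
 cospanning sets, but not for bases, which are reached through \<open>wgard\<close>.
\<close>

definition gard :: "'a set => ('a set => real) => bool" where
 "gard E c \<longleftrightarrow> finite E & (\<forall>T\<subseteq>E. 0 <= c T) & 0 < c E \<and>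
   (\<forall>x\<in>nnR E c. 0 < ma E c x --> x \<in> posR E c)"

lemma gardD:
 assumes "gard E c"
 shows "finite E" "\<And>T. T \<subseteq> E ==> 0 <= c T" "0 < c E"
  "\<And>x. x \<in> nnR E c ==> 0 < ma E c x ==> x \<in> posR E c"
 using assms by (auto simp: gard_def)

lemma pd_top: "pd E c E x = c E"
 by (simp add: pd_def link_def)

lemma posR_D: "x \<in> posR E c ==> T \<subseteq> E ==> 0 < pd E c T x"
 by (simp add: posR_def)

lemma nnR_D: "x \<in> nnR E c ==> T \<subseteq> E ==> 0 <= pd E c T x"
 by (simp add: nnR_def)

lemma posR_D0: "x \<in> posR E c ==> 0 < ma E c x"
 using posR_D [of x E c "{}"] by simp

lemma nnR_D0: "x \<in> nnR E c ==> 0 <= ma E c x"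
 using nnR_D [of x E c "{}"] by simp

lemma posR_subset_nnR: "x \<in> posR E c ==> x \<in> nnR E c"
 by (auto simp: posR_def nnR_def less_imp_le)

lemma posR_cong:
 assumes "\<And>e. e \<in> E ==> x e = y e" "\<And>T. T \<subseteq> E ==> c T = d T"
 shows "x \<in> posR E c \<longleftrightarrow> y \<in> posR E d"
proof -
 have "pd E c T x = pd E d T y" if "T \<subseteq> E" for T
  using that assms by (intro pd_cong) auto
 then show ?thesis by (simp add: posR_def)
qed

lemma nnR_cong:
 assumes "\<And>e. e \<in> E ==> x e = y e" "\<And>T. T \<subseteq> E ==> c T = d T"
 shows "x \<in> nnR E c \<longleftrightarrow> y \<in> nnR E d"
proof -
 have "pd E c T x = pd E d T y" if "T \<subseteq> E" for T
  using that assms by (intro pd_cong) auto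
 then show ?thesis by (simp add: nnR_def)
qed

lemma posR_coeff_cong:
 assumes "\<And>T. T \<subseteq> E ==> c T = d T" shows "x \<in> posR E c \<longleftrightarrow> x \<in> posR E d"
 using assms by (intro posR_cong) auto

lemma nnR_coeff_cong:
 assumes "\<And>T. T \<subseteq> E ==> c T = d T" shows "x \<in> nnR E c \<longleftrightarrow> x \<in> nnR E d"
 using assms by (intro nnR_cong) auto

lemma gard_cong:
 assumes "\<And>T. T \<subseteq> E ==> c T = d T"
 shows "gard E c \<longleftrightarrow> gard E d"
proof -
 have "ma E c x = ma E d x" "x \<in> posR E c \<longleftrightarrow> x \<in> posR E d" "x \<in> nnR E c \<longleftrightarrow> x \<in> nnR E d" for x
  using assms by (auto intro!: ma_cong posR_cong nnR_cong)
 then show ?thesis using assms by (auto simp: gard_def)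
qed

lemma posR_link:
 assumes "x \<in> posR E c" "S \<subseteq> E" shows "x \<in> posR (E - S) (link c S)"
proof -
 have "S \<union> T \<subseteq> E" if "T \<subseteq> E - S" for T using that assms(2) by auto
 then show ?thesis using assms(1) by (simp add: posR_def pd_link)
qed

lemma nnR_link:
 assumes "x \<in> nnR E c" "S \<subseteq> E" shows "x \<in> nnR (E - S) (link c S)"
proof -
 have "S \<union> T \<subseteq> E" if "T \<subseteq> E - S" for T using that assms(2) by auto
 then show ?thesis using assms(1) by (simp add: nnR_def pd_link)
qed

lemma nnR_add:
 assumes "finite E" "x \<in> nnR E c" "\<And>e. e \<in> E ==> 0 <= v e"
 shows "(\<lambda>e. x e + v e) \<in> nnR E c"
 unfolding nnR_def
proof (intro CollectI allI impI)
 fix T assume T: "T \<subseteq> E"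
 show "0 <= pd E c T (\<lambda>e. x e + v e)"
  unfolding taylor_pd [OF assms(1)]
  using T assms by (intro sum_nonneg mult_nonneg_nonneg prod_nonneg nnR_D [OF assms(2)]) auto
qed

lemma pd_add_ge:
 assumes "finite E" "x \<in> nnR E c" "\<And>e. e \<in> E ==> 0 <= v e" "T \<subseteq> E" "V \<subseteq> E - T"
 shows "pd E c (T \<union> V) x * prod v V <= pd E c T (\<lambda>e. x e + v e)"
 unfolding taylor_pd [OF assms(1)]
 using assms by (intro member_le_sum) (auto intro!: mult_nonneg_nonneg prod_nonneg nnR_D [OF assms(2)])

lemma posR_add:
 assumes "finite E" "x \<in> posR E c" "\<And>e. e \<in> E ==> 0 <= v e"
 shows "(\<lambda>e. x e + v e) \<in> posR E c"
 unfolding posR_def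
proof (intro CollectI allI impI)
 fix T assume T: "T \<subseteq> E"
 have "pd E c (T \<union> {}) x * prod v {} <= pd E c T (\<lambda>e. x e + v e)"
  using assms T posR_subset_nnR by (intro pd_add_ge) auto
 then show "0 < pd E c T (\<lambda>e. x e + v e)" using posR_D [OF assms(2) T] by simp
qed

lemma nnR_add_pos:
 assumes "finite E" "0 < c E" "x \<in> nnR E c" "\<And>e. e \<in> E ==> 0 < v e"
 shows "(\<lambda>e. x e + v e) \<in> posR E c"
 unfolding posR_def
proof (intro CollectI allI impI)
 fix T assume T: "T \<subseteq> E"
 have "pd E c (T \<union> (E - T)) x * prod v (E - T) <= pd E c T (\<lambda>e. x e + v e)"
  using assms T by (intro pd_add_ge) (auto simp: less_imp_le)
 moreover have "T \<union> (E - T) = E" using T by auto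
 moreover have "0 < prod v (E - T)" using assms by (intro prod_pos) auto
 ultimately show "0 < pd E c T (\<lambda>e. x e + v e)" using assms(2)
  by (simp add: pd_top) (meson less_le_trans mult_pos_pos)
qed

lemma orthant_nnR:
 assumes "\<And>T. T \<subseteq> E ==> 0 <= c T" "\<And>e. e \<in> E ==> 0 <= x e"
 shows "x \<in> nnR E c"
 unfolding nnR_def pd_def ma_def link_def
proof (intro CollectI allI impI sum_nonneg mult_nonneg_nonneg prod_nonneg)
 fix T U assume "T \<subseteq> E" "U \<in> Pow (E - T)"
 then have "U \<union> T \<subseteq> E" by auto
 then show "0 <= c (U \<union> T)" by (rule assms(1))
qed (use assms(2) in auto)

lemma orthant_posR:
 assumes "finite E" "\<And>T. T \<subseteq> E ==> 0 <= c T" "0 < c E" "\<And>e. e \<in> E ==> 0 < x e"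
 shows "x \<in> posR E c"
proof -
 have "(\<lambda>e. 0 :: real) \<in> nnR E c" using assms by (intro orthant_nnR) auto
 then have "(\<lambda>e. 0 + x e) \<in> posR E c" using assms by (intro nnR_add_pos) auto
 then show ?thesis by simp
qed

lemma tendsto_shift_real [tendsto_intros]:
 "((\<lambda>t::real. a + t) \<longlongrightarrow> a) (at_right 0)"
proof -
 have "((\<lambda>t::real. a + t) \<longlongrightarrow> a + 0) (at_right 0)" by (intro tendsto_intros)
 then show ?thesis by simp
qed

lemma pd_update:
 assumes "finite E" "e \<in> E" "T \<subseteq> E - {e}"
 shows "pd E c T (x(e := s)) = pd (E - {e}) c T x + s * pd E c (insert e T) x"
proof -
 have "pd E c T (x(e := s)) = pd (E - {e}) c T (x(e := s)) + s * pd E c (insert e T) (x(e := s))"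
  using pd_split [of E e T c "x(e := s)"] assms by (simp add: subset_Diff_insert)
 moreover have "pd (E - {e}) c T (x(e := s)) = pd (E - {e}) c T x"
  using assms by (intro pd_cong) auto
 moreover have "pd E c (insert e T) (x(e := s)) = pd E c (insert e T) x"
  using assms by (intro pd_cong) auto
 ultimately show ?thesis by simp
qed

lemma ma_update:
 assumes "finite E" "e \<in> E"
 shows "ma E c (x(e := s)) = ma (E - {e}) c x + s * pd E c {e} x"
 using pd_update [OF assms, of "{}" c x s] by simp

lemma posR_linkD:
 assumes "x \<in> posR (E - {e}) (link c {e})" "T \<subseteq> E - {e}"
 shows "0 < pd E c (insert e T) x"
 using posR_D [OF assms] pd_link [of E "{e}" c T x] by simp

lemma ma_link: "ma (E - S) (link c S) x = pd E c S x"
 by (simp add: pd_def)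

text \<open>
 Over a point of \<open>posR\<close> of the link all derivatives are increasing affine functions of the
 variable \<open>e\<close>. At the largest of their roots the point is in \<open>nnR\<close> but not in \<open>posR\<close>, so by \<open>gard\<close>
 the polynomial itself has this root.
\<close>

lemma nnR_fiber:
 assumes g: "gard E c" and e: "e \<in> E" and x: "x \<in> posR (E - {e}) (link c {e})"
  and nn: "0 <= ma E c x"
 shows "x \<in> nnR E c"
proof -
 have fin: "finite E" using g by (rule gardD)
 define A where "A T = pd (E - {e}) c T x" for T
 define B where "B T = pd E c (insert e T) x" for T
 have B: "0 < B T" if "T \<subseteq> E - {e}" for T
  using posR_linkD [OF x that] by (simp add: B_def)
 have val: "pd E c T (x(e := s)) = A T + s * B T" if "T \<subseteq> E - {e}" for T s
  using pd_update [OF fin e that] by (simp add: A_def B_def)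
 have val': "pd E c T (x(e := s)) = B (T - {e})" if "T \<subseteq> E" "e \<in> T" for T s
  using that by (auto simp: B_def insert_absorb intro!: pd_cong)
 have reg: "x(e := s) \<in> nnR E c" if "\<And>T. T \<subseteq> E - {e} ==> - A T / B T <= s" for s
  unfolding nnR_def
 proof (intro CollectI allI impI)
  fix T assume T: "T \<subseteq> E"
  show "0 <= pd E c T (x(e := s))"
  proof (cases "e \<in> T")
   case True
   then have "T - {e} \<subseteq> E - {e}" using T by auto
   then show ?thesis using val' [OF T True] B by (simp add: less_imp_le)
  next
   case False
   then have "T \<subseteq> E - {e}" using T by auto
   then show ?thesis using val [of T s] that [of T] B [of T] by (simp add: field_simps)
  qed
 qed
 define R where "R = (\<lambda>T. - A T / B T) ` Pow (E - {e})"
 have R: "finite R" "R ~= {}" using fin by (auto simp: R_def)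
 define s where "s = Max R"
 have "s \<in> R" unfolding s_def using R by (rule Max_in)
 then obtain T where T: "T \<subseteq> E - {e}" "s = - A T / B T" by (auto simp: R_def)
 have le: "- A T / B T <= s" if "T \<subseteq> E - {e}" for T
  unfolding s_def using R that by (intro Max_ge) (auto simp: R_def)
 have "pd E c T (x(e := s)) = 0" 
 proof -
  have "B T ~= 0" using B [OF T(1)] by simp
  then have "A T + (- A T / B T) * B T = 0" by simp
  then show ?thesis unfolding val [OF T(1), of s] by (subst T(2))
 qed
 then have "x(e := s) \<notin> posR E c" using T(1) by (auto simp: posR_def)
 then have "ma E c (x(e := s)) <= 0" using gardD(4) [OF g reg [OF le]] by force
 then have "A {} + s * B {} <= 0" using val [of "{}" s] by simp
 moreover have "0 <= A {} + x e * B {}" using val [of "{}" "x e"] nn by simp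
 ultimately have "(s - x e) * B {} <= 0" by (simp add: algebra_simps)
 then have "s <= x e" using B [of "{}"] by (simp add: mult_le_0_iff)
 then have "- A T / B T <= x e" if "T \<subseteq> E - {e}" for T using le [OF that] by linarith
 then have "x(e := x e) \<in> nnR E c" by (rule reg)
 then show ?thesis by simp
qed

text \<open>
 Over a point at which the link is positive, a large value of the variable \<open>e\<close> makes every derivative non-negative.
\<close>

lemma gard_link1:
 assumes g: "gard E c" and e: "e \<in> E"
 shows "gard (E - {e}) (link c {e})"
proof -
 have fin: "finite E" using g by (rule gardD)
 show ?thesis unfolding gard_def
 proof (intro conjI ballI impI allI)
  show "0 <= link c {e} T" if "T \<subseteq> E - {e}" for T
   using that e gardD(2) [OF g, of "insert e T"] by (auto simp: link_def)
  show "0 < link c {e} (E - {e})" using gardD(3) [OF g] e by (simp add: link_def insert_absorb)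
  fix x assume x: "x \<in> nnR (E - {e}) (link c {e})" and B: "0 < ma (E - {e}) (link c {e}) x"
  define y where "y = x(e := - ma (E - {e}) c x / pd E c {e} x + 1)"
  define z where "z t = (\<lambda>k. y k + t)" for t :: real
  have B': "0 < pd E c {e} x" using B by (simp add: ma_link)
  have y: "0 < ma E c y"
   unfolding y_def ma_update [OF fin e] using B' by (simp add: field_simps)
  have "((\<lambda>t. ma E c (z t)) \<longlongrightarrow> ma E c y) (at_right 0)"
   unfolding z_def by (intro tendsto_intros)
  then have "\<forall>\<^sub>F t in at_right 0. 0 < ma E c (z t)" using y by (rule order_tendstoD)
  moreover have "\<forall>\<^sub>F t in at_right (0::real). 0 < t" by (simp add: eventually_at_right_less)
  ultimately have ev: "\<forall>\<^sub>F t in at_right 0. z t \<in> nnR E c"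
  proof eventually_elim
   case (elim t)
   have "(\<lambda>k. x k + t) \<in> posR (E - {e}) (link c {e})"
    using fin x elim gardD(3) [OF g] e by (intro nnR_add_pos) (auto simp: link_def insert_absorb)
   then have "z t \<in> posR (E - {e}) (link c {e})"
    by (subst posR_cong [where y="\<lambda>k. x k + t" and d = "link c {e}"]) (auto simp: z_def y_def)
   then show ?case using elim g e by (intro nnR_fiber) auto
  qed
  have "y \<in> nnR E c" unfolding nnR_def
  proof (intro CollectI allI impI)
   fix T assume T: "T \<subseteq> E"
   have "((\<lambda>t. pd E c T (z t)) \<longlongrightarrow> pd E c T y) (at_right 0)"
    unfolding z_def by (intro tendsto_intros)
   moreover have "\<forall>\<^sub>F t in at_right 0. 0 <= pd E c T (z t)"
    using ev by eventually_elim (rule nnR_D [OF _ T])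
   ultimately show "0 <= pd E c T y" by (rule tendsto_lowerbound) simp
  qed
  then have "y \<in> posR E c" using y gardD(4) [OF g] by simp
  then have "y \<in> posR (E - {e}) (link c {e})" using e by (intro posR_link) auto
  then show "x \<in> posR (E - {e}) (link c {e})"
   by (subst posR_cong [where y = y and d = "link c {e}"]) (auto simp: y_def)
 qed (use fin in auto)
qed

lemma gard_link:
 assumes g: "gard E c" and S: "S \<subseteq> E"
 shows "gard (E - S) (link c S)"
proof -
 have "finite S" using gardD(1) [OF g] S finite_subset by auto
 then show ?thesis using S
 proof (induction S rule: finite_induct)
  case (insert e S)
  have "gard (E - S - {e}) (link (link c S) {e})" using insert by (intro gard_link1) auto
  moreover have "E - S - {e} = E - insert e S" by auto
  ultimately show ?case by (simp add: link_link Un_commute)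
 qed (use g in auto)
qed

text \<open>
 The root of an affine fibre moves down along rays of the orthant.
\<close>

lemma ratio_mono:
 assumes g: "gard E c" and e: "e \<in> E" and x: "x \<in> nnR (E - {e}) (link c {e})"
  and v: "\<And>k. k \<in> E - {e} ==> 0 <= v k"
 shows "ma (E - {e}) c x * pd E c {e} (\<lambda>k. x k + v k)
    <= ma (E - {e}) c (\<lambda>k. x k + v k) * pd E c {e} x"
proof -
 have fin: "finite E" using g by (rule gardD)
 have strict: "ma (E - {e}) c z * pd E c {e} (\<lambda>k. z k + v k)
    <= ma (E - {e}) c (\<lambda>k. z k + v k) * pd E c {e} z" if z: "z \<in> posR (E - {e}) (link c {e})" for z
 proof -
  have B: "0 < pd E c {e} z" using posR_linkD [OF z, of "{}"] by simp
  define s where "s = - ma (E - {e}) c z / pd E c {e} z"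
  have "z(e := s) \<in> posR (E - {e}) (link c {e})"
   using z by (subst posR_cong [where y = z and d = "link c {e}"]) auto
  moreover have "ma E c (z(e := s)) = 0"
   unfolding ma_update [OF fin e] using B by (simp add: s_def)
  ultimately have zs: "z(e := s) \<in> nnR E c" using g e by (intro nnR_fiber) auto
  have "(\<lambda>k. (z(e := s)) k + (v(e := 0)) k) \<in> nnR E c"
   by (rule nnR_add [OF fin zs]) (use v in auto)
  moreover have "(\<lambda>k. (z(e := s)) k + (v(e := 0)) k) = (\<lambda>k. z k + v k)(e := s)" by auto
  ultimately have "0 <= ma (E - {e}) c (\<lambda>k. z k + v k) + s * pd E c {e} (\<lambda>k. z k + v k)"
   using nnR_D0 ma_update [OF fin e] by metis
  then have "0 <= (ma (E - {e}) c (\<lambda>k. z k + v k) + s * pd E c {e} (\<lambda>k. z k + v k)) * pd E c {e} z"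
   using B by simp
  then show ?thesis using B by (simp add: s_def field_simps)
 qed
 have ev: "\<forall>\<^sub>F t in at_right (0::real).
   ma (E - {e}) c (\<lambda>k. x k + t) * pd E c {e} (\<lambda>k. (x k + t) + v k)
    <= ma (E - {e}) c (\<lambda>k. (x k + t) + v k) * pd E c {e} (\<lambda>k. x k + t)"
  using eventually_at_right_less [of 0]
 proof eventually_elim
  case (elim t)
  show ?case
   using elim x fin gardD(3) [OF g] e
   by (intro strict nnR_add_pos) (auto simp: link_def insert_absorb)
 qed
 have lim: "((\<lambda>t. (x k + t) + v k) \<longlongrightarrow> x k + v k) (at_right 0)" for k
  by (intro tendsto_intros)
 show ?thesis
  by (rule tendsto_le [OF _ _ _ ev]) (auto intro!: tendsto_intros lim)
qed

text \<open>
 The limiting case of \<open>ratio_mono\<close>: this condition is also sufficient, see \<open>gard_criterion\<close>.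
\<close>

lemma link_zero_imp_nonpos:
 assumes g: "gard E c" and e: "e \<in> E" and x: "x \<in> nnR (E - {e}) (link c {e})"
  and z: "pd E c {e} x = 0"
 shows "ma (E - {e}) c x <= 0"
proof -
 have fin: "finite E" using g by (rule gardD)
 have "(\<lambda>k. x k + 1) \<in> posR (E - {e}) (link c {e})"
  using x fin gardD(3) [OF g] e by (intro nnR_add_pos) (auto simp: link_def insert_absorb)
 then have "0 < pd E c {e} (\<lambda>k. x k + 1)" using posR_linkD [of _ _ _ _ "{}"] by force
 moreover have "ma (E - {e}) c x * pd E c {e} (\<lambda>k. x k + 1) <= 0"
  using ratio_mono [OF g e x, of "\<lambda>k. 1"] z by simp
 ultimately show ?thesis by (simp add: mult_le_0_iff)
qed

section \<open>Deletion and sufficient criteria\<close>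

lemma taylor_dir:
 assumes "finite E" "T \<subseteq> E - S"
 shows "pd E c S (\<lambda>k. x k + (if k \<in> T then t else 0)) = (\<Sum>V\<in>Pow T. pd E c (S \<union> V) x * t ^ card V)"
proof -
 have "pd E c S (\<lambda>k. x k + (if k \<in> T then t else 0))
   = (\<Sum>V\<in>Pow (E - S). pd E c (S \<union> V) x * (\<Prod>k\<in>V. if k \<in> T then t else 0))"
  using assms(1) by (rule taylor_pd)
 also have "\<dots> = (\<Sum>V\<in>Pow T. pd E c (S \<union> V) x * (\<Prod>k\<in>V. if k \<in> T then t else 0))"
 proof (rule sum.mono_neutral_right)
  show "\<forall>V\<in>Pow (E - S) - Pow T. pd E c (S \<union> V) x * (\<Prod>k\<in>V. if k \<in> T then t else 0) = 0"
  proof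
   fix V assume V: "V \<in> Pow (E - S) - Pow T"
   then obtain k where "k \<in> V" "k \<notin> T" by auto
   moreover have "finite V" using V assms(1) finite_subset [of V E] by auto
   ultimately have "(\<Prod>k\<in>V. if k \<in> T then t else 0) = 0" by (intro prod_zero) auto
   then show "pd E c (S \<union> V) x * (\<Prod>k\<in>V. if k \<in> T then t else 0) = 0" by simp
  qed
 qed (use assms in auto)
 also have "\<dots> = (\<Sum>V\<in>Pow T. pd E c (S \<union> V) x * t ^ card V)"
 proof (rule sum.cong [OF refl])
  fix V assume "V \<in> Pow T"
  then have "(\<Prod>k\<in>V. if k \<in> T then t else 0) = (\<Prod>k\<in>V. t)" by (intro prod.cong) auto
  then show "pd E c (S \<union> V) x * (\<Prod>k\<in>V. if k \<in> T then t else 0) = pd E c (S \<union> V) x * t ^ card V"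
   by simp
 qed
 finally show ?thesis .
qed

text \<open>
 The condition \<open>C\<close> rules out points of \<open>nnR\<close> with a positive value at which the link vanishes;
 everywhere else the assumption on the link makes the derivatives in \<open>e\<close> positive, and the remaining
 ones are then controlled along the fibre.
\<close>

lemma gard_criterion:
 assumes fin: "finite E" and e: "e \<in> E" and nn: "\<And>T. T \<subseteq> E ==> 0 <= c T"
  and g: "gard (E - {e}) (link c {e})"
  and C: "\<And>x. x \<in> nnR (E - {e}) (link c {e}) ==> pd E c {e} x = 0 ==> ma (E - {e}) c x <= 0"
 shows "gard E c"
proof -
 define F where "F = E - {e}"
 define A where "A = ma F c"
 define B where "B = ma F (link c {e})"
 have finF: "finite F" using fin by (simp add: F_def)
 have Beq: "B x = pd E c {e} x" for x by (simp add: B_def F_def ma_link)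
 note g' = g [folded F_def] and C' = C [folded F_def A_def, folded Beq]
 have upd: "ma F d (x(k := s)) = ma F d x + (s - x k) * pd F d {k} x" if "k \<in> F" for d k s x
  using ma_update [OF finF that, of d x s] ma_split [OF finF that, of d x] by (simp add: algebra_simps)
 have ray: "A x * pd F (link c {e}) {k} x <= B x * pd F c {k} x"
  if x: "x \<in> posR F (link c {e})" and k: "k \<in> F" for x k
 proof -
  define b where "b = pd F (link c {e}) {k} x"
  have b: "0 < b" using posR_D [OF x, of "{k}"] k by (simp add: b_def)
  define y where "y = x(k := x k - B x / b)"
  have By: "B y = 0" using b unfolding B_def y_def upd [OF k] by (simp add: b_def)
  have "x \<in> posR (F - {k}) (link (link c {e}) {k})" using x k by (intro posR_link) auto
  then have "y \<in> posR (F - {k}) (link (link c {e}) {k})"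
   by (subst posR_cong [where y = x and d = "link (link c {e}) {k}"]) (auto simp: y_def)
  then have "y \<in> nnR F (link c {e})" using By by (intro nnR_fiber [OF g' k]) (auto simp: B_def)
  then have "A y <= 0" using By C' by simp
  then have "A x + (- B x / b) * pd F c {k} x <= 0" unfolding A_def y_def upd [OF k] by simp
  then have "(A x + (- B x / b) * pd F c {k} x) * b <= 0" using b by (simp add: mult_le_0_iff)
  then show ?thesis using b by (simp add: b_def [symmetric] field_simps)
 qed
 have step: "A x * B (x(k := x k + t)) <= A (x(k := x k + t)) * B x"
  if "x \<in> posR F (link c {e})" "k \<in> F" "0 <= t" for x k t
 proof -
  have "t * (A x * pd F (link c {e}) {k} x) <= t * (B x * pd F c {k} x)"
   using ray that by (intro mult_left_mono) auto
  then show ?thesis unfolding A_def B_def upd [OF that(2)] by (simp add: algebra_simps)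
 qed
 have ratio: "A x * B (\<lambda>k. if k \<in> S then x k + t else x k) <= A (\<lambda>k. if k \<in> S then x k + t else x k) * B x"
  if x: "x \<in> posR F (link c {e})" and S: "S \<subseteq> F" and t: "0 <= t" for x S t
 proof -
  have "finite S" using S finF finite_subset by auto
  then show ?thesis using S
  proof (induction S rule: finite_induct)
   case (insert k S)
   define y where "y = (\<lambda>k. if k \<in> S then x k + t else x k)"
   define z where "z = (\<lambda>j. if j \<in> insert k S then x j + t else x j)"
   have zy: "z = y(k := y k + t)" using insert.hyps by (auto simp: z_def y_def)
   have "(\<lambda>j. x j + (if j \<in> S then t else 0)) \<in> posR F (link c {e})"
    using t by (intro posR_add finF x) auto
   then have y: "y \<in> posR F (link c {e})"
    by (subst posR_cong [where y = "\<lambda>j. x j + (if j \<in> S then t else 0)" and d = "link c {e}"])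
     (auto simp: y_def)
   have z: "z \<in> posR F (link c {e})"
   proof -
    have "(\<lambda>j. x j + (if j \<in> insert k S then t else 0)) \<in> posR F (link c {e})"
     using t by (intro posR_add finF x) auto
    then show ?thesis
     by (subst posR_cong [where y = "\<lambda>j. x j + (if j \<in> insert k S then t else 0)" and d = "link c {e}"])
      (auto simp: z_def)
   qed
   have pos: "0 < B y" "0 < B z" "0 < B x"
    using y z x by (auto simp: B_def posR_D0)
   have 1: "A x * B y <= A y * B x" using insert by (simp add: y_def)
   have 2: "A y * B z <= A z * B y" using step [OF y, of k t] insert.prems t by (simp add: zy)
   have "(A x * B y) * B z <= (A y * B x) * B z" using 1 pos by (intro mult_right_mono) auto
   also have "\<dots> = (A y * B z) * B x" by simp
   also have "\<dots> <= (A z * B y) * B x" using 2 pos by (intro mult_right_mono) auto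
   finally have "(A x * B z) * B y <= (A z * B x) * B y" by (simp add: algebra_simps)
   then have "A x * B z <= A z * B x" using pos by simp
   then show ?case by (simp add: z_def)
  qed simp
 qed
 show ?thesis unfolding gard_def
 proof (intro conjI ballI impI)
  show "\<forall>T\<subseteq>E. 0 <= c T" using nn by auto
  show "0 < c E" using gardD(3) [OF g] e by (simp add: link_def insert_absorb)
  fix x assume x: "x \<in> nnR E c" and pos: "0 < ma E c x"
  have fx: "ma E c x = A x + x e * B x" using ma_split [OF fin e] by (simp add: A_def F_def Beq)
  have xF: "x \<in> nnR F (link c {e})" unfolding F_def using x e by (intro nnR_link) auto
  have "B x ~= 0" using C' [OF xF] pos fx by auto
  then have Bx: "0 < B x" using nnR_D0 [OF xF] by (simp add: B_def)
  then have xp: "x \<in> posR F (link c {e})" using gardD(4) [OF g' xF] by (simp add: B_def)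
  show "x \<in> posR E c" unfolding posR_def
  proof (intro CollectI allI impI)
   fix T assume T: "T \<subseteq> E"
   show "0 < pd E c T x"
   proof (cases "e \<in> T")
    case True
    then show ?thesis using posR_linkD [of x E e c "T - {e}"] xp T by (auto simp: F_def insert_absorb)
   next
    case False
    then have TF: "T \<subseteq> F" using T by (auto simp: F_def)
    have fT: "finite T" using T fin finite_subset by auto
    define d where "d V = pd E c V x * B x - ma E c x * pd E c (insert e V) x" for V
    have "0 <= (\<Sum>V\<in>Pow T. d V * t ^ card V)" if t: "0 <= t" for t
    proof -
     define y where "y = (\<lambda>k. x k + (if k \<in> T then t else 0))"
     have y': "y = (\<lambda>k. if k \<in> T then x k + t else x k)" by (auto simp: y_def)
     have "A x * B y <= A y * B x" using ratio [OF xp TF t] by (simp add: y')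
     moreover have "ma E c y = A y + x e * B y"
      using ma_split [OF fin e, of c y] False by (simp add: A_def F_def Beq y_def)
     ultimately have "0 <= ma E c y * B x - ma E c x * B y" by (simp add: fx algebra_simps)
     moreover have "ma E c y = (\<Sum>V\<in>Pow T. pd E c V x * t ^ card V)"
      unfolding y_def using taylor_dir [OF fin, of T "{}" c x t] T by simp
     moreover have "B y = (\<Sum>V\<in>Pow T. pd E c (insert e V) x * t ^ card V)"
      unfolding y_def Beq using taylor_dir [OF fin, of T "{e}" c x t] T False by auto
     ultimately show ?thesis
      by (simp add: d_def algebra_simps sum_distrib_left sum_subtractf)
    qed
    then have "0 <= d T" by (rule leading_coeff_nonneg [OF fT])
    moreover have "0 < ma E c x * pd E c (insert e T) x"
     using pos posR_linkD [of x E e c T] xp TF by (simp add: F_def)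
    ultimately have "0 < pd E c T x * B x" by (simp add: d_def)
    then show ?thesis using Bx by (simp add: zero_less_mult_iff)
   qed
  qed
 qed (use fin in auto)
qed

text \<open>
 With \<open>f = P + Q1 x + Q2 y + R x y\<close> the Rayleigh inequality bounds \<open>P + Q2 y\<close> by a multiple of
 \<open>Q1 + R y\<close>, with a factor that stays bounded on approach to the boundary. So condition \<open>C\<close> of
 \<open>gard_criterion\<close> holds in the limit.
\<close>

lemma gard_single_pair:
 assumes fin: "finite E" and ij: "i \<in> E" "j \<in> E" "i ~= j" and nn: "\<And>T. T \<subseteq> E ==> 0 <= c T"
  and gi: "gard (E - {i}) (link c {i})" and gj: "gard (E - {j}) (link c {j})"
  and ray: "\<And>x. x \<in> posR (E - {i,j}) (link c {i,j}) ==>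
    ma (E - {i,j}) c x * pd E c {i,j} x <= pd (E - {j}) c {i} x * pd (E - {i}) c {j} x"
 shows "gard E c"
proof (rule gard_criterion [OF fin ij(2) nn gj])
 fix x assume x: "x \<in> nnR (E - {j}) (link c {j})" and Bx: "pd E c {j} x = 0"
 define P where "P = ma (E - {i,j}) c"
 define Q1 where "Q1 = pd (E - {j}) c {i}"
 define Q2 where "Q2 = pd (E - {i}) c {j}"
 define R where "R = pd E c {i,j}"
 define y where "y t = (\<lambda>k. x k + t)" for t :: real
 have cE: "0 < c E" using gardD(3) [OF gj] ij by (simp add: link_def insert_absorb)
 have sets: "E - {j} - {i} = E - {i,j}" "E - {i} - {j} = E - {i,j}" by auto
 have links: "link (link c {j}) {i} = link c {i,j}" "link (link c {i}) {j} = link c {i,j}"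
  by (auto simp: link_link insert_commute)
 have yj: "y t \<in> posR (E - {j}) (link c {j})" if "0 < t" for t
  unfolding y_def using that x fin cE ij
  by (intro nnR_add_pos) (auto simp: link_def insert_absorb)
 have yij: "y t \<in> posR (E - {i,j}) (link c {i,j})" if "0 < t" for t
  using posR_link [OF yj [OF that], of "{i}"] ij by (simp add: sets links)
 have Apoly: "ma (E - {j}) c z = P z + z i * Q1 z" for z
  using ma_split [of "E - {j}" i c z] fin ij by (simp add: P_def Q1_def sets)
 have Bpoly: "pd E c {j} z = Q2 z + z i * R z" for z
  using pd_split [of E i "{j}" c z] fin ij by (simp add: Q2_def R_def)
 have Rpos: "0 < R (y t)" if "0 < t" for t
  using posR_D0 [OF yij [OF that]] by (simp add: R_def ma_link)
 have key: "R (y t) * ma (E - {j}) c (y t) <= Q1 (y t) * pd E c {j} (y t)" if "0 < t" for t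
  using ray [OF yij [OF that]] unfolding Apoly Bpoly P_def Q1_def Q2_def R_def
  by (simp add: algebra_simps)
 have Q1R: "Q1 (y t) * R (y 1) <= Q1 (y 1) * R (y t)" if "0 < t" "t <= 1" for t
 proof -
  have eq: "(\<lambda>k. y t k + (1 - t)) = y 1" by (auto simp: y_def)
  have "ma (E - {i} - {j}) (link c {i}) (y t) * pd (E - {i}) (link c {i}) {j} (\<lambda>k. y t k + (1 - t))
   <= ma (E - {i} - {j}) (link c {i}) (\<lambda>k. y t k + (1 - t)) * pd (E - {i}) (link c {i}) {j} (y t)"
   using ij that posR_subset_nnR [OF yij [OF that(1)]]
   by (intro ratio_mono [OF gi]) (auto simp: sets links)
  moreover have "ma (E - {i} - {j}) (link c {i}) z = Q1 z" for z
   unfolding Q1_def pd_def by (simp add: Diff_Diff_Int sets insert_commute)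
  moreover have "pd (E - {i}) (link c {i}) {j} z = R z" for z
   unfolding R_def by (simp add: pd_link insert_commute)
  ultimately show ?thesis by (simp add: eq)
 qed
 define \<kappa> where "\<kappa> = Q1 (y 1) / R (y 1)"
 have bound: "ma (E - {j}) c (y t) <= \<kappa> * pd E c {j} (y t)" if t: "0 < t" "t <= 1" for t
 proof -
  have "Q1 (y t) <= \<kappa> * R (y t)" using Q1R [OF t] Rpos [of 1] by (simp add: \<kappa>_def field_simps)
  moreover have "0 < pd E c {j} (y t)" using posR_D0 [OF yj [OF t(1)]] by (simp add: ma_link)
  ultimately have "Q1 (y t) * pd E c {j} (y t) <= \<kappa> * R (y t) * pd E c {j} (y t)"
   by (intro mult_right_mono) auto
  then have "R (y t) * ma (E - {j}) c (y t) <= R (y t) * (\<kappa> * pd E c {j} (y t))"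
   using key [OF t(1)] by (simp add: mult_ac)
  then show ?thesis using Rpos [OF t(1)] by simp
 qed
 have "\<forall>\<^sub>F t in at_right (0::real). t \<in> {0<..<1}" by (rule eventually_at_right_real) simp
 then have ev: "\<forall>\<^sub>F t in at_right 0. ma (E - {j}) c (y t) <= \<kappa> * pd E c {j} (y t)"
  by eventually_elim (rule bound, auto)
 have "ma (E - {j}) c x <= \<kappa> * pd E c {j} x"
  by (rule tendsto_le [OF _ _ _ ev]) (auto simp: y_def intro!: tendsto_intros)
 then show "ma (E - {j}) c x <= 0" using Bx by simp
qed

text \<open>
 The two sets agree where the polynomial is positive, so along such a path being in \<open>posR\<close> is an
 open and closed condition.
\<close>

lemma path_into_posR:
 assumes g: "gard E c" and s0: "0 <= s0"
  and start: "(\<lambda>k. x k + s0 * u k) \<in> nnR E c"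
  and pos: "\<And>s. 0 <= s ==> s <= s0 ==> 0 < ma E c (\<lambda>k. x k + s * u k)"
 shows "x \<in> posR E c"
proof -
 have fin: "finite E" using g by (rule gardD)
 define p where "p s = (\<lambda>k. x k + s * u k)" for s :: real
 define S where "S = {0..s0} \<inter> (\<Inter>T\<in>Pow E. {s. 0 <= pd E c T (p s)})"
 have "closed {s. 0 <= pd E c T (p s)}" for T
  unfolding p_def by (intro closed_Collect_le continuous_intros)
 then have "compact S" unfolding S_def by (intro compact_Int_closed closed_INT) auto
 moreover have "s0 \<in> S" using s0 start by (auto simp: S_def p_def nnR_def)
 ultimately obtain m where m: "m \<in> S" and min: "\<And>s. s \<in> S ==> m <= s"
  using compact_attains_inf [of S] by auto
 have "p m \<in> nnR E c" "0 <= m" "m <= s0" using m by (auto simp: S_def nnR_def)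
 then have pm: "p m \<in> posR E c" using gardD(4) [OF g] pos by (simp add: p_def)
 have "\<not> 0 < m"
 proof
  assume m0: "0 < m"
  have "\<forall>\<^sub>F s in at_left m. 0 < pd E c T (p s)" if "T \<in> Pow E" for T
  proof -
   have "((\<lambda>s. pd E c T (p s)) \<longlongrightarrow> pd E c T (p m)) (at_left m)"
    unfolding p_def by (intro tendsto_intros)
   then show ?thesis using posR_D [OF pm] that by (intro order_tendstoD) auto
  qed
  then have "\<forall>\<^sub>F s in at_left m. \<forall>T\<in>Pow E. 0 < pd E c T (p s)"
   using fin by (intro eventually_ball_finite) auto
  moreover have "\<forall>\<^sub>F s in at_left m. s \<in> {0<..<m}" using m0 by (rule eventually_at_left_real)
  ultimately have "\<forall>\<^sub>F s in at_left m. (\<forall>T\<in>Pow E. 0 < pd E c T (p s)) & s \<in> {0<..<m}"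
   by eventually_elim auto
  then obtain s where s: "\<forall>T\<in>Pow E. 0 < pd E c T (p s)" "s \<in> {0<..<m}"
   using eventually_happens' [OF trivial_limit_at_left_real] by blast
  then have "s \<in> S" using \<open>m <= s0\<close> by (auto simp: S_def less_imp_le)
  then show False using min s(2) by force
 qed
 then have "m = 0" using \<open>0 <= m\<close> by simp
 then show ?thesis using pm by (simp add: p_def)
qed

text \<open>
 Deletion. At a point of \<open>nnR\<close> of the slice, letting the variable \<open>e\<close> run down to zero gives
 a path along which the polynomial stays positive.
\<close>

lemma gard_slice:
 assumes g: "gard E c" and e: "e \<in> E" and top: "0 < c (E - {e})"
 shows "gard (E - {e}) c"
  and "\<And>x. x \<in> nnR (E - {e}) c ==> x(e := 0) \<in> nnR E c"
  and "\<And>x. x \<in> posR (E - {e}) c ==> x(e := 0) \<in> posR E c"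
proof -
 have fin: "finite E" using g by (rule gardD)
 show pos: "x(e := 0) \<in> posR E c" if x: "x \<in> posR (E - {e}) c" for x
 proof -
  define u where "u k = (if k = e then 0 else 1 :: real)" for k
  define s0 where "s0 = (\<Sum>k\<in>E. \<bar>x k\<bar>)"
  have "\<bar>x k\<bar> <= s0" if "k \<in> E" for k unfolding s0_def using that fin by (intro member_le_sum) auto
  then have le: "0 <= x k + s0" if "k \<in> E" for k using that by force
  show ?thesis
  proof (rule path_into_posR [OF g, where u = u and ?s0.0 = s0])
   show "0 <= s0" by (simp add: s0_def sum_nonneg)
   show "(\<lambda>k. (x(e := 0)) k + s0 * u k) \<in> nnR E c"
    using le gardD(2) [OF g] by (intro orthant_nnR) (auto simp: u_def)
   fix s :: real assume s: "0 <= s"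
   have "(\<lambda>k. (x(e := 0)) k + s * u k) = (\<lambda>k. x k + s)(e := 0)" by (auto simp: u_def)
   then have "ma E c (\<lambda>k. (x(e := 0)) k + s * u k) = ma (E - {e}) c (\<lambda>k. x k + s)"
    using ma_update [OF fin e, of c "\<lambda>k. x k + s" 0] by simp
   moreover have "(\<lambda>k. x k + s) \<in> posR (E - {e}) c" using s x fin by (intro posR_add) auto
   ultimately show "0 < ma E c (\<lambda>k. (x(e := 0)) k + s * u k)" by (simp add: posR_D0)
  qed
 qed
 show nn: "x(e := 0) \<in> nnR E c" if x: "x \<in> nnR (E - {e}) c" for x
  unfolding nnR_def
 proof (intro CollectI allI impI)
  fix T assume T: "T \<subseteq> E"
  have "((\<lambda>t. pd E c T (\<lambda>k. (x(e := 0)) k + (if k = e then 0 else t))) \<longlongrightarrow> pd E c T (x(e := 0))) (at_right 0)"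
  proof (rule tendsto_pd)
   show "((\<lambda>t. (x(e := 0)) k + (if k = e then 0 else t)) \<longlongrightarrow> (x(e := 0)) k) (at_right 0)" for k
    by (cases "k = e") (auto intro!: tendsto_intros)
  qed
  moreover have "\<forall>\<^sub>F t in at_right (0::real). 0 <= pd E c T (\<lambda>k. (x(e := 0)) k + (if k = e then 0 else t))"
   using eventually_at_right_less [of 0]
  proof eventually_elim
   case (elim t)
   have "(\<lambda>k. x k + t) \<in> posR (E - {e}) c" using elim x fin top by (intro nnR_add_pos) auto
   then have "(\<lambda>k. x k + t)(e := 0) \<in> posR E c" by (rule pos)
   moreover have "(\<lambda>k. x k + t)(e := 0) = (\<lambda>k. (x(e := 0)) k + (if k = e then 0 else t))" by auto
   ultimately show ?case using T posR_D [of _ E c T] by (metis less_imp_le)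
  qed
  ultimately show "0 <= pd E c T (x(e := 0))" by (rule tendsto_lowerbound) simp
 qed
 show "gard (E - {e}) c" unfolding gard_def
 proof (intro conjI ballI impI)
  show "\<forall>T\<subseteq>E - {e}. 0 <= c T" using gardD(2) [OF g] by auto
  fix x assume x: "x \<in> nnR (E - {e}) c" and p: "0 < ma (E - {e}) c x"
  have "ma E c (x(e := 0)) = ma (E - {e}) c x" using ma_update [OF fin e, of c x 0] by simp
  then have xp: "x(e := 0) \<in> posR E c" using nn [OF x] p gardD(4) [OF g] by simp
  show "x \<in> posR (E - {e}) c" unfolding posR_def
  proof (intro CollectI allI impI)
   fix T assume T: "T \<subseteq> E - {e}"
   then have "T \<subseteq> E" by auto
   then have "0 < pd E c T (x(e := 0))" by (rule posR_D [OF xp])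
   then show "0 < pd (E - {e}) c T x" using pd_update [OF fin e T, of c x 0] by simp
  qed
 qed (use fin top in auto)
qed

lemma nnR_slice:
 assumes g: "gard E c" and e: "e \<in> E" and top: "0 < c (E - {e})" and x: "x \<in> nnR (E - {e}) c"
 shows "x \<in> nnR (E - {e}) (link c {e})"
proof -
 have "x(e := 0) \<in> nnR (E - {e}) (link c {e})"
  using gard_slice(2) [OF g e top x] e by (intro nnR_link) auto
 then show ?thesis by (subst nnR_cong [where y = "x(e := 0)" and d = "link c {e}"]) auto
qed

lemma posR_slice:
 assumes g: "gard E c" and e: "e \<in> E" and top: "0 < c (E - {e})" and x: "x \<in> posR (E - {e}) c"
 shows "x \<in> posR (E - {e}) (link c {e})"
proof -
 have "x(e := 0) \<in> posR (E - {e}) (link c {e})"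
  using gard_slice(3) [OF g e top x] e by (intro posR_link) auto
 then show ?thesis by (subst posR_cong [where y = "x(e := 0)" and d = "link c {e}"]) auto
qed

text \<open>
 The inequality of top coefficients propagates to all points of \<open>nnR\<close> because the quotient of slice and link
 is monotone along the orthant and tends to the quotient of the top coefficients.
\<close>

lemma slice_le_link:
 assumes g: "gard E c" and e: "e \<in> E" and le: "c (E - {e}) <= c E"
  and x: "x \<in> nnR (E - {e}) (link c {e})"
 shows "ma (E - {e}) c x <= pd E c {e} x"
proof -
 have fin: "finite E" using g by (rule gardD)
 define A where "A = ma (E - {e}) c x"
 define B where "B = pd E c {e} x"
 define d where "d V = pd (E - {e}) c V x * B - A * pd E c (insert e V) x" for V
 have "0 <= (\<Sum>V\<in>Pow (E - {e}). d V * t ^ card V)" if t: "0 <= t" for t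
 proof -
  define v where "v k = (if k \<in> E - {e} then t else 0)" for k
  have 1: "A * pd E c {e} (\<lambda>k. x k + v k) <= ma (E - {e}) c (\<lambda>k. x k + v k) * B"
   unfolding A_def B_def using t by (intro ratio_mono [OF g e x]) (auto simp: v_def)
  have 2: "ma (E - {e}) c (\<lambda>k. x k + v k) = (\<Sum>V\<in>Pow (E - {e}). pd (E - {e}) c V x * t ^ card V)"
   unfolding v_def using taylor_dir [of "E - {e}" "E - {e}" "{}" c x t] fin by simp
  have 3: "pd E c {e} (\<lambda>k. x k + v k) = (\<Sum>V\<in>Pow (E - {e}). pd E c (insert e V) x * t ^ card V)"
   unfolding v_def using taylor_dir [of E "E - {e}" "{e}" c x t] fin by simp
  have 4: "(\<Sum>V\<in>Pow (E - {e}). d V * t ^ card V)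
    = (\<Sum>V\<in>Pow (E - {e}). pd (E - {e}) c V x * t ^ card V) * B
     - A * (\<Sum>V\<in>Pow (E - {e}). pd E c (insert e V) x * t ^ card V)"
   by (simp add: d_def left_diff_distrib right_diff_distrib sum_subtractf sum_distrib_left sum_distrib_right mult_ac)
  show ?thesis using 1 unfolding 4 2 3 by (simp only: diff_ge_0_iff_ge)
 qed
 then have "0 <= d (E - {e})" by (rule leading_coeff_nonneg [OF finite_Diff [OF fin]])
 moreover have "insert e (E - {e}) = E" using e by auto
 ultimately have "A * c E <= c (E - {e}) * B" by (simp add: d_def pd_top)
 also have "\<dots> <= c E * B" using le nnR_D0 [OF x] by (intro mult_right_mono) (auto simp: B_def ma_link)
 finally have "A * c E <= B * c E" by (simp only: mult.commute)
 then have "A <= B" using gardD(3) [OF g] by (rule mult_right_le_imp_le)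
 then show ?thesis by (simp only: A_def B_def)
qed

section \<open>Products and connections\<close>

lemma ma_add: "ma E (\<lambda>T. c T + d T) x = ma E c x + ma E d x"
 by (simp add: ma_def sum.distrib algebra_simps)

lemma ma_diff: "ma E (\<lambda>T. c T - d T) x = ma E c x - ma E d x"
 by (simp add: ma_def sum_subtractf algebra_simps)

lemma ma_scale: "ma E (\<lambda>T. r * c T) x = r * ma E c x"
 by (simp add: ma_def sum_distrib_left mult_ac)

lemma ma_prod:
 assumes "finite E2" "finite E1" "E1 \<inter> E2 = {}"
 shows "ma (E1 \<union> E2) (\<lambda>T. c1 (T \<inter> E1) * c2 (T \<inter> E2)) x = ma E1 c1 x * ma E2 c2 x"
 using assms
proof (induction E2 arbitrary: c2 rule: finite_induct)
 case empty
 have "ma E1 (\<lambda>T. c1 (T \<inter> E1) * c2 {}) x = ma E1 (\<lambda>T. c2 {} * c1 T) x"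
  by (intro ma_cong) (auto simp: Int_absorb2)
 also have "\<dots> = ma E1 c1 x * c2 {}" by (simp add: ma_scale)
 finally show ?case by simp
next
 case (insert e E2)
 let ?C = "\<lambda>T. c1 (T \<inter> E1) * c2 (T \<inter> insert e E2)"
 have e: "e \<notin> E1" using insert.prems by auto
 have "ma (insert e (E1 \<union> E2)) ?C x = ma (E1 \<union> E2) ?C x + x e * ma (E1 \<union> E2) (link ?C {e}) x"
  using insert e by (intro ma_insert) auto
 also have "ma (E1 \<union> E2) ?C x = ma (E1 \<union> E2) (\<lambda>T. c1 (T \<inter> E1) * c2 (T \<inter> E2)) x"
 proof (rule ma_cong [OF _ refl])
  fix T assume "T \<subseteq> E1 \<union> E2"
  then have "T \<inter> insert e E2 = T \<inter> E2" using e insert.hyps by auto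
  then show "?C T = c1 (T \<inter> E1) * c2 (T \<inter> E2)" by simp
 qed
 also have "ma (E1 \<union> E2) (link ?C {e}) x
   = ma (E1 \<union> E2) (\<lambda>T. c1 (T \<inter> E1) * link c2 {e} (T \<inter> E2)) x"
 proof (rule ma_cong [OF _ refl])
  fix T assume "T \<subseteq> E1 \<union> E2"
  have "(T \<union> {e}) \<inter> insert e E2 = T \<inter> E2 \<union> {e}" "(T \<union> {e}) \<inter> E1 = T \<inter> E1"
   using e by auto
  then show "link ?C {e} T = c1 (T \<inter> E1) * link c2 {e} (T \<inter> E2)" by (simp add: link_def)
 qed
 finally have "ma (insert e (E1 \<union> E2)) ?C x
   = ma E1 c1 x * ma E2 c2 x + x e * (ma E1 c1 x * ma E2 (link c2 {e}) x)"
  using insert by simp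
 then show ?case using insert.hyps by (simp add: ma_insert algebra_simps)
qed

lemma pd_prod:
 assumes "finite E2" "finite E1" "E1 \<inter> E2 = {}"
 shows "pd (E1 \<union> E2) (\<lambda>T. c1 (T \<inter> E1) * c2 (T \<inter> E2)) T x
  = pd E1 c1 (T \<inter> E1) x * pd E2 c2 (T \<inter> E2) x"
proof -
 have "E1 \<union> E2 - T = (E1 - T \<inter> E1) \<union> (E2 - T \<inter> E2)" by auto
 then have "pd (E1 \<union> E2) (\<lambda>T. c1 (T \<inter> E1) * c2 (T \<inter> E2)) T x
  = ma ((E1 - T \<inter> E1) \<union> (E2 - T \<inter> E2)) (link (\<lambda>T. c1 (T \<inter> E1) * c2 (T \<inter> E2)) T) x"
  by (simp add: pd_def)
 also have "\<dots> = ma ((E1 - T \<inter> E1) \<union> (E2 - T \<inter> E2))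
   (\<lambda>U. link c1 (T \<inter> E1) (U \<inter> (E1 - T \<inter> E1)) * link c2 (T \<inter> E2) (U \<inter> (E2 - T \<inter> E2))) x"
 proof (rule ma_cong [OF _ refl])
  fix U assume "U \<subseteq> (E1 - T \<inter> E1) \<union> (E2 - T \<inter> E2)"
  then have "(U \<union> T) \<inter> E1 = U \<inter> (E1 - T \<inter> E1) \<union> T \<inter> E1"
   "(U \<union> T) \<inter> E2 = U \<inter> (E2 - T \<inter> E2) \<union> T \<inter> E2"
   using assms(3) by auto
  then show "link (\<lambda>T. c1 (T \<inter> E1) * c2 (T \<inter> E2)) T U
   = link c1 (T \<inter> E1) (U \<inter> (E1 - T \<inter> E1)) * link c2 (T \<inter> E2) (U \<inter> (E2 - T \<inter> E2))"
   by (simp add: link_def)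
 qed
 also have "\<dots> = pd E1 c1 (T \<inter> E1) x * pd E2 c2 (T \<inter> E2) x"
  unfolding pd_def using assms by (intro ma_prod) auto
 finally show ?thesis .
qed

text \<open>
 Derivatives of the product by all variables of one factor isolate the other factor.
\<close>

lemma nnR_prodD:
 assumes "finite E2" "finite E1" "E1 \<inter> E2 = {}" "0 < c1 E1" "0 < c2 E2"
  and x: "x \<in> nnR (E1 \<union> E2) (\<lambda>T. c1 (T \<inter> E1) * c2 (T \<inter> E2))"
 shows "x \<in> nnR E1 c1" "x \<in> nnR E2 c2"
proof -
 note pd = pd_prod [OF assms(1-3), of c1 c2 _ x]
 show "x \<in> nnR E1 c1" unfolding nnR_def
 proof (intro CollectI allI impI)
  fix T assume T: "T \<subseteq> E1"
  have "(T \<union> E2) \<inter> E1 = T" "(T \<union> E2) \<inter> E2 = E2" using T assms by auto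
  then show "0 <= pd E1 c1 T x"
   using nnR_D [OF x, of "T \<union> E2"] pd [of "T \<union> E2"] T assms(5)
   by (simp add: pd_top zero_le_mult_iff) force
 qed
 show "x \<in> nnR E2 c2" unfolding nnR_def
 proof (intro CollectI allI impI)
  fix T assume T: "T \<subseteq> E2"
  have "(T \<union> E1) \<inter> E2 = T" "(T \<union> E1) \<inter> E1 = E1" using T assms by auto
  then show "0 <= pd E2 c2 T x"
   using nnR_D [OF x, of "T \<union> E1"] pd [of "T \<union> E1"] T assms(4)
   by (simp add: pd_top zero_le_mult_iff) force
 qed
qed

lemma gard_prod:
 assumes g1: "gard E1 c1" and g2: "gard E2 c2" and dis: "E1 \<inter> E2 = {}"
 shows "gard (E1 \<union> E2) (\<lambda>T. c1 (T \<inter> E1) * c2 (T \<inter> E2))"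
 unfolding gard_def
proof (intro conjI ballI impI allI)
 note fin = gardD(1) [OF g1] gardD(1) [OF g2]
 show "finite (E1 \<union> E2)" using fin by simp
 show "0 <= c1 (T \<inter> E1) * c2 (T \<inter> E2)" for T
  using gardD(2) [OF g1] gardD(2) [OF g2] by simp
 have "(E1 \<union> E2) \<inter> E1 = E1" "(E1 \<union> E2) \<inter> E2 = E2" by auto
 then show "0 < c1 ((E1 \<union> E2) \<inter> E1) * c2 ((E1 \<union> E2) \<inter> E2)"
  using gardD(3) [OF g1] gardD(3) [OF g2] by simp
 fix x assume x: "x \<in> nnR (E1 \<union> E2) (\<lambda>T. c1 (T \<inter> E1) * c2 (T \<inter> E2))"
  and pos: "0 < ma (E1 \<union> E2) (\<lambda>T. c1 (T \<inter> E1) * c2 (T \<inter> E2)) x"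
 have nn: "x \<in> nnR E1 c1" "x \<in> nnR E2 c2"
  using nnR_prodD [OF fin(2,1) dis _ _ x] gardD(3) [OF g1] gardD(3) [OF g2] by auto
 have "0 < ma E1 c1 x * ma E2 c2 x" using pos ma_prod [OF fin(2,1) dis] by metis
 then have "0 < ma E1 c1 x" "0 < ma E2 c2 x"
  using nn [THEN nnR_D0] by (auto simp: zero_less_mult_iff)
 then have "x \<in> posR E1 c1" "x \<in> posR E2 c2"
  using nn gardD(4) [OF g1] gardD(4) [OF g2] by auto
 then show "x \<in> posR (E1 \<union> E2) (\<lambda>T. c1 (T \<inter> E1) * c2 (T \<inter> E2))"
  unfolding posR_def by (auto simp: pd_prod [OF fin(2,1) dis])
qed

text \<open>
 If \<open>f1 = A1 + x B1\<close> and \<open>f2 = A2 + x B2\<close>, this is the polynomial \<open>x B1 B2 + (A1 B2 + A2 B1 - A1 A2)\<close>.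
\<close>

definition par_coeff :: "'a => 'a set => 'a set => ('a set => real) => ('a set => real) => 'a set => real" where
 "par_coeff e E1 E2 c1 c2 T =
   (if e \<in> T then c1 (T \<inter> E1) * c2 (T \<inter> E2)
   else c1 (T \<inter> E1) * c2 (insert e (T \<inter> E2)) + c1 (insert e (T \<inter> E1)) * c2 (T \<inter> E2)
    - c1 (T \<inter> E1) * c2 (T \<inter> E2))"

text \<open>
 In the notation of \<open>par_coeff\<close>: \<open>A1 A2 + x (A1 B2 + A2 B1 - A1 A2)\<close>.
\<close>

definition ser_coeff :: "'a => 'a set => 'a set => ('a set => real) => ('a set => real) => 'a set => real" where
 "ser_coeff e E1 E2 c1 c2 T =
   (if e \<in> T then par_coeff e E1 E2 c1 c2 (T - {e}) else c1 (T \<inter> E1) * c2 (T \<inter> E2))"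

lemma connection_polys:
 assumes fin: "finite E1" "finite E2" and int: "E1 \<inter> E2 = {e}"
 defines "F \<equiv> E1 \<union> E2 - {e}"
 shows "ma F (par_coeff e E1 E2 c1 c2) x
   = ma (E1 - {e}) c1 x * pd E2 c2 {e} x + pd E1 c1 {e} x * ma (E2 - {e}) c2 x
    - ma (E1 - {e}) c1 x * ma (E2 - {e}) c2 x"
  and "ma F (ser_coeff e E1 E2 c1 c2) x = ma (E1 - {e}) c1 x * ma (E2 - {e}) c2 x"
  and "\<And>T. T \<subseteq> F ==> link (par_coeff e E1 E2 c1 c2) {e} T
   = link c1 {e} (T \<inter> (E1 - {e})) * link c2 {e} (T \<inter> (E2 - {e}))"
  and "\<And>T. T \<subseteq> F ==> link (ser_coeff e E1 E2 c1 c2) {e} T = par_coeff e E1 E2 c1 c2 T"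
proof -
 define F1 where "F1 = E1 - {e}"
 define F2 where "F2 = E2 - {e}"
 have F: "F = F1 \<union> F2" by (auto simp: F_def F1_def F2_def)
 have FF: "finite F2" "finite F1" "F1 \<inter> F2 = {}" using fin int by (auto simp: F1_def F2_def)
 have int': "T \<inter> E1 = T \<inter> F1" "T \<inter> E2 = T \<inter> F2" "e \<notin> T" if "T \<subseteq> F" for T
  using that by (auto simp: F_def F1_def F2_def)
 have B: "pd E1 c1 {e} x = ma F1 (link c1 {e}) x" "pd E2 c2 {e} x = ma F2 (link c2 {e}) x"
  by (simp_all add: pd_def F1_def F2_def)
 have "ma F (par_coeff e E1 E2 c1 c2) x = ma F (\<lambda>T. c1 (T \<inter> F1) * link c2 {e} (T \<inter> F2)
   + link c1 {e} (T \<inter> F1) * c2 (T \<inter> F2) - c1 (T \<inter> F1) * c2 (T \<inter> F2)) x"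
  by (intro ma_cong) (auto simp: par_coeff_def int' link_def)
 also have "\<dots> = ma F1 c1 x * ma F2 (link c2 {e}) x + ma F1 (link c1 {e}) x * ma F2 c2 x
   - ma F1 c1 x * ma F2 c2 x"
  unfolding ma_diff ma_add F ma_prod [OF FF] ..
 finally show "ma F (par_coeff e E1 E2 c1 c2) x
   = ma (E1 - {e}) c1 x * pd E2 c2 {e} x + pd E1 c1 {e} x * ma (E2 - {e}) c2 x
    - ma (E1 - {e}) c1 x * ma (E2 - {e}) c2 x"
  by (simp add: B F1_def F2_def)
 have "ma F (ser_coeff e E1 E2 c1 c2) x = ma F (\<lambda>T. c1 (T \<inter> F1) * c2 (T \<inter> F2)) x"
  by (intro ma_cong) (auto simp: ser_coeff_def int')
 then show "ma F (ser_coeff e E1 E2 c1 c2) x = ma (E1 - {e}) c1 x * ma (E2 - {e}) c2 x"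
  unfolding F ma_prod [OF FF] by (simp add: F1_def F2_def)
 fix T assume T: "T \<subseteq> F"
 have "(T \<union> {e}) \<inter> E1 = T \<inter> F1 \<union> {e}" "(T \<union> {e}) \<inter> E2 = T \<inter> F2 \<union> {e}"
  using int by (auto simp: F1_def F2_def)
 then show "link (par_coeff e E1 E2 c1 c2) {e} T
   = link c1 {e} (T \<inter> (E1 - {e})) * link c2 {e} (T \<inter> (E2 - {e}))"
  by (simp add: link_def par_coeff_def F1_def F2_def)
 have "T \<union> {e} - {e} = T" using int'(3) [OF T] by auto
 then show "link (ser_coeff e E1 E2 c1 c2) {e} T = par_coeff e E1 E2 c1 c2 T"
  by (simp add: link_def ser_coeff_def)
qed

lemma par_coeff_nonneg:
 assumes "gard E1 c1" "gard E2 c2" "E1 \<inter> E2 = {e}"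
  and m1: "\<And>T. T \<subseteq> E1 ==> c1 T <= c1 (insert e T)"
 shows "0 <= par_coeff e E1 E2 c1 c2 T"
proof -
 have e: "e \<in> E1" "e \<in> E2" using assms by auto
 have "0 <= c1 (T \<inter> E1)" "0 <= c2 (T \<inter> E2)" "0 <= c2 (insert e (T \<inter> E2))"
  "0 <= c1 (insert e (T \<inter> E1)) - c1 (T \<inter> E1)"
  using gardD(2) [OF assms(1)] gardD(2) [OF assms(2)] e m1 by auto
 then have "0 <= c1 (T \<inter> E1) * c2 (insert e (T \<inter> E2)) + (c1 (insert e (T \<inter> E1)) - c1 (T \<inter> E1)) * c2 (T \<inter> E2)"
   "0 <= c1 (T \<inter> E1) * c2 (T \<inter> E2)"
  by auto
 then show ?thesis by (auto simp: par_coeff_def algebra_simps)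
qed

text \<open>
 The link \<open>B1 B2\<close> is a product. Where it vanishes, say \<open>B1 = 0\<close>, also \<open>A1 <= 0\<close>, and the rest
 equals \<open>A1 (B2 - A2)\<close>, which is non-positive as \<open>A2 <= B2\<close>.
\<close>

lemma gard_parallel:
 assumes g1: "gard E1 c1" and g2: "gard E2 c2" and int: "E1 \<inter> E2 = {e}"
  and m1: "\<And>T. T \<subseteq> E1 ==> c1 T <= c1 (insert e T)"
  and m2: "\<And>T. T \<subseteq> E2 ==> c2 T <= c2 (insert e T)"
 shows "gard (E1 \<union> E2) (par_coeff e E1 E2 c1 c2)"
proof (rule gard_criterion)
 have e: "e \<in> E1" "e \<in> E2" using int by auto
 note fin = gardD(1) [OF g1] gardD(1) [OF g2]
 note polys = connection_polys [OF fin int, where ?c1.0 = c1 and ?c2.0 = c2]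
 define F1 where "F1 = E1 - {e}"
 define F2 where "F2 = E2 - {e}"
 have F: "E1 \<union> E2 - {e} = F1 \<union> F2" by (auto simp: F1_def F2_def)
 have FF: "finite F2" "finite F1" "F1 \<inter> F2 = {}" using fin int by (auto simp: F1_def F2_def)
 have l1: "gard F1 (link c1 {e})" and l2: "gard F2 (link c2 {e})"
  unfolding F1_def F2_def using gard_link1 [OF g1 e(1)] gard_link1 [OF g2 e(2)] by auto
 have "gard (F1 \<union> F2) (link (par_coeff e E1 E2 c1 c2) {e})
  \<longleftrightarrow> gard (F1 \<union> F2) (\<lambda>T. link c1 {e} (T \<inter> F1) * link c2 {e} (T \<inter> F2))"
  using polys(3) by (intro gard_cong) (simp add: F F1_def F2_def)
 then show "gard (E1 \<union> E2 - {e}) (link (par_coeff e E1 E2 c1 c2) {e})"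
  using gard_prod [OF l1 l2 FF(3)] by (simp add: F)
 show "finite (E1 \<union> E2)" "e \<in> E1 \<union> E2" using fin e by auto
 show "0 <= par_coeff e E1 E2 c1 c2 T" for T
  using g1 g2 int m1 by (rule par_coeff_nonneg)
 fix x assume x: "x \<in> nnR (E1 \<union> E2 - {e}) (link (par_coeff e E1 E2 c1 c2) {e})"
  and z: "pd (E1 \<union> E2) (par_coeff e E1 E2 c1 c2) {e} x = 0"
 have x': "x \<in> nnR (F1 \<union> F2) (\<lambda>T. link c1 {e} (T \<inter> F1) * link c2 {e} (T \<inter> F2))"
  using x polys(3) by (subst nnR_cong [where y = x and d = "link (par_coeff e E1 E2 c1 c2) {e}"])
   (auto simp: F F1_def F2_def)
 have nn: "x \<in> nnR F1 (link c1 {e})" "x \<in> nnR F2 (link c2 {e})"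
  using nnR_prodD [OF FF _ _ x'] gardD(3) [OF l1] gardD(3) [OF l2] by auto
 define A1 where "A1 = ma F1 c1 x"
 define A2 where "A2 = ma F2 c2 x"
 define B1 where "B1 = pd E1 c1 {e} x"
 define B2 where "B2 = pd E2 c2 {e} x"
 have "pd (E1 \<union> E2) (par_coeff e E1 E2 c1 c2) {e} x
   = ma (F1 \<union> F2) (\<lambda>T. link c1 {e} (T \<inter> F1) * link c2 {e} (T \<inter> F2)) x"
  unfolding pd_def F using polys(3) by (intro ma_cong) (auto simp: F F1_def F2_def)
 also have "\<dots> = B1 * B2" unfolding ma_prod [OF FF] by (simp add: B1_def B2_def pd_def F1_def F2_def)
 finally have BB: "B1 * B2 = 0" using z by simp
 have le: "A1 <= B1" "A2 <= B2"
  using slice_le_link [OF g1 e(1) _ nn(1) [unfolded F1_def]]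
   slice_le_link [OF g2 e(2) _ nn(2) [unfolded F2_def]] m1 [of "E1 - {e}"] m2 [of "E2 - {e}"] e
  by (auto simp: A1_def A2_def B1_def B2_def F1_def F2_def insert_absorb)
 have np: "B1 = 0 ==> A1 <= 0" "B2 = 0 ==> A2 <= 0"
  using link_zero_imp_nonpos [OF g1 e(1) nn(1) [unfolded F1_def]]
   link_zero_imp_nonpos [OF g2 e(2) nn(2) [unfolded F2_def]]
  by (auto simp: A1_def A2_def B1_def B2_def F1_def F2_def)
 have "A1 * B2 + B1 * A2 - A1 * A2 <= 0"
 proof (cases "B1 = 0")
  case True
  then have "A1 * (B2 - A2) <= 0" using np le by (simp add: mult_le_0_iff)
  then show ?thesis using True by (simp add: algebra_simps)
 next
  case False
  then have "B2 = 0" using BB by simp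
  then have "A2 * (B1 - A1) <= 0" using np le by (simp add: mult_le_0_iff)
  then show ?thesis using \<open>B2 = 0\<close> by (simp add: algebra_simps)
 qed
 then show "ma (E1 \<union> E2 - {e}) (par_coeff e E1 E2 c1 c2) x <= 0"
  unfolding polys(1) by (simp add: A1_def A2_def B1_def B2_def F1_def F2_def)
qed

text \<open>
 The link is the slice of the parallel polynomial, which is \<open>A1 B2 + B1 A2 - A1 A2\<close>. Positivity of
 the top coefficient of \<open>A1\<close> is what makes this slice a \<open>gard\<close> polynomial.
\<close>

lemma gard_series:
 assumes g1: "gard E1 c1" and g2: "gard E2 c2" and int: "E1 \<inter> E2 = {e}"
  and m1: "\<And>T. T \<subseteq> E1 ==> c1 T <= c1 (insert e T)"
  and m2: "\<And>T. T \<subseteq> E2 ==> c2 T <= c2 (insert e T)"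
  and top: "0 < c1 (E1 - {e})"
 shows "gard (E1 \<union> E2) (ser_coeff e E1 E2 c1 c2)"
proof (rule gard_criterion)
 have e: "e \<in> E1" "e \<in> E2" using int by auto
 note fin = gardD(1) [OF g1] gardD(1) [OF g2]
 note polys = connection_polys [OF fin int, where ?c1.0 = c1 and ?c2.0 = c2]
 define F1 where "F1 = E1 - {e}"
 define F2 where "F2 = E2 - {e}"
 have F: "E1 \<union> E2 - {e} = F1 \<union> F2" by (auto simp: F1_def F2_def)
 have FF: "finite F2" "finite F1" "F1 \<inter> F2 = {}" using fin int by (auto simp: F1_def F2_def)
 have l1: "gard F1 (link c1 {e})" and l2: "gard F2 (link c2 {e})"
  unfolding F1_def F2_def using gard_link1 [OF g1 e(1)] gard_link1 [OF g2 e(2)] by auto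
 have par: "gard (E1 \<union> E2) (par_coeff e E1 E2 c1 c2)"
  using gard_parallel [OF g1 g2 int m1 m2] .
 have ee: "e \<in> E1 \<union> E2" using e by simp
 have ptop: "0 < par_coeff e E1 E2 c1 c2 (E1 \<union> E2 - {e})"
 proof -
  have s: "(E1 \<union> E2 - {e}) \<inter> E1 = E1 - {e}" "(E1 \<union> E2 - {e}) \<inter> E2 = E2 - {e}" by auto
  have "0 <= c2 (E2 - {e})" "c1 (E1 - {e}) <= c1 E1" "0 < c2 E2"
   using gardD(2) [OF g2] gardD(3) [OF g2] m1 [of "E1 - {e}"] e by (auto simp: insert_absorb)
  then have "0 < c1 (E1 - {e}) * c2 E2" "0 <= (c1 E1 - c1 (E1 - {e})) * c2 (E2 - {e})"
   using top by auto
  then show ?thesis using e by (simp add: par_coeff_def s insert_absorb algebra_simps)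
 qed
 have sc: "link (ser_coeff e E1 E2 c1 c2) {e} T = par_coeff e E1 E2 c1 c2 T" if "T \<subseteq> E1 \<union> E2 - {e}" for T
  using polys(4) that by simp
 show "gard (E1 \<union> E2 - {e}) (link (ser_coeff e E1 E2 c1 c2) {e})"
  using gard_slice(1) [OF par ee ptop]
   gard_cong [of "E1 \<union> E2 - {e}" "link (ser_coeff e E1 E2 c1 c2) {e}", OF sc] by simp
 show "finite (E1 \<union> E2)" "e \<in> E1 \<union> E2" using fin e by auto
 show "0 <= ser_coeff e E1 E2 c1 c2 T" for T
  using par_coeff_nonneg [OF g1 g2 int m1] gardD(2) [OF g1] gardD(2) [OF g2]
  by (auto simp: ser_coeff_def)
 fix x assume x: "x \<in> nnR (E1 \<union> E2 - {e}) (link (ser_coeff e E1 E2 c1 c2) {e})"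
  and z: "pd (E1 \<union> E2) (ser_coeff e E1 E2 c1 c2) {e} x = 0"
 have "x \<in> nnR (E1 \<union> E2 - {e}) (par_coeff e E1 E2 c1 c2)"
  using x nnR_coeff_cong [of "E1 \<union> E2 - {e}" "link (ser_coeff e E1 E2 c1 c2) {e}" _ x, OF sc]
  by simp
 then have x1: "x \<in> nnR (E1 \<union> E2 - {e}) (link (par_coeff e E1 E2 c1 c2) {e})"
  by (rule nnR_slice [OF par ee ptop])
 have x': "x \<in> nnR (F1 \<union> F2) (\<lambda>T. link c1 {e} (T \<inter> F1) * link c2 {e} (T \<inter> F2))"
  using x1 polys(3) by (subst nnR_cong [where y = x and d = "link (par_coeff e E1 E2 c1 c2) {e}"])
   (auto simp: F F1_def F2_def)
 have nn: "x \<in> nnR F1 (link c1 {e})" "x \<in> nnR F2 (link c2 {e})"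
  using nnR_prodD [OF FF _ _ x'] gardD(3) [OF l1] gardD(3) [OF l2] by auto
 define A1 where "A1 = ma F1 c1 x"
 define A2 where "A2 = ma F2 c2 x"
 define B1 where "B1 = pd E1 c1 {e} x"
 define B2 where "B2 = pd E2 c2 {e} x"
 have "pd (E1 \<union> E2) (ser_coeff e E1 E2 c1 c2) {e} x = ma (E1 \<union> E2 - {e}) (par_coeff e E1 E2 c1 c2) x"
  unfolding pd_def by (rule ma_cong [OF sc refl])
 then have sum: "A1 * B2 + B1 * A2 - A1 * A2 = 0"
  using z polys(1) [of x] by (simp add: A1_def A2_def B1_def B2_def F1_def F2_def)
 have le: "A1 <= B1" "A2 <= B2"
  using slice_le_link [OF g1 e(1) _ nn(1) [unfolded F1_def]]
   slice_le_link [OF g2 e(2) _ nn(2) [unfolded F2_def]] m1 [of "E1 - {e}"] m2 [of "E2 - {e}"] e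
  by (auto simp: A1_def A2_def B1_def B2_def F1_def F2_def insert_absorb)
 have B: "0 <= B1" "0 <= B2" using nn [THEN nnR_D0] by (simp_all add: B1_def B2_def pd_def F1_def F2_def)
 have "A1 * A2 <= 0"
 proof (rule ccontr)
  assume "\<not> ?thesis"
  then consider "0 < A1" "0 < A2" | "A1 < 0" "A2 < 0"
   by (auto simp: not_le zero_less_mult_iff)
  then show False
  proof cases
   case 1
   have "0 <= A1 * (B2 - A2)" "0 < B1 * A2" using 1 le by auto
   then show False using sum by (simp add: algebra_simps)
  next
   case 2
   have "A1 * B2 <= 0" "B1 * A2 <= 0" "0 < A1 * A2" using 2 B
    by (auto simp: mult_le_0_iff mult_neg_neg)
   then show False using sum by simp
  qed
 qed
 then show "ma (E1 \<union> E2 - {e}) (ser_coeff e E1 E2 c1 c2) x <= 0"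
  unfolding polys(2) by (simp add: A1_def A2_def F1_def F2_def)
qed

section \<open>Symmetrization and the Newton inequalities\<close>

lemma gard_orthant:
 assumes "gard E c" "\<And>e. e \<in> E ==> 0 < x e" shows "x \<in> posR E c"
 using gardD(1) [OF assms(1)] gardD(2) [OF assms(1)] gardD(3) [OF assms(1)] assms(2)
 by (rule orthant_posR)

text \<open>
 The root of the polynomial in the variable \<open>i\<close> is monotone in the variable \<open>j\<close>; the inequality expresses this.
\<close>

lemma gard_rayleigh:
 assumes g: "gard E c" and ij: "i \<in> E" "j \<in> E" "i ~= j"
  and x: "x \<in> posR (E - {i,j}) (link c {i,j})"
 shows "ma (E - {i,j}) c x * pd E c {i,j} x <= pd (E - {j}) c {i} x * pd (E - {i}) c {j} x"
proof -
 have fin: "finite E" using g by (rule gardD)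
 define P where "P = ma (E - {i,j}) c x"
 define Q1 where "Q1 = pd (E - {j}) c {i} x"
 define Q2 where "Q2 = pd (E - {i}) c {j} x"
 define R where "R = pd E c {i,j} x"
 have sets: "E - {j} - {i} = E - {i,j}" by auto
 have links: "link (link c {j}) {i} = link c {i,j}" by (auto simp: link_link insert_commute)
 have R: "0 < R" using posR_D0 [OF x] by (simp add: R_def ma_link)
 define y where "y = x(i := - Q2 / R)"
 have By: "pd E c {j} y = 0"
  using pd_update [OF fin ij(1), of "{j}" c x "- Q2 / R"] ij R
  by (simp add: y_def Q2_def R_def)
 have "y \<in> posR (E - {i,j}) (link c {i,j})"
  using x by (subst posR_cong [where y = x and d = "link c {i,j}"]) (auto simp: y_def)
 then have "y \<in> nnR (E - {j}) (link c {j})"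
  using By ij by (intro nnR_fiber [OF gard_link1 [OF g ij(2)], of i]) (auto simp: sets links ma_link)
 then have "ma (E - {j}) c y <= 0" using By by (rule link_zero_imp_nonpos [OF g ij(2)])
 moreover have "ma (E - {j}) c y = P + (- Q2 / R) * Q1"
  unfolding y_def using ma_update [of "E - {j}" i c x] fin ij by (simp add: sets P_def Q1_def)
 ultimately have "(P + (- Q2 / R) * Q1) * R <= 0" using R by (simp add: mult_le_0_iff)
 then have "P * R <= Q1 * Q2" using R by (simp add: field_simps)
 then show ?thesis by (simp only: P_def Q1_def Q2_def R_def)
qed

lemma gard_scale:
 assumes g: "gard E c" and a: "\<And>e. e \<in> E ==> 0 < a e"
 shows "gard E (\<lambda>T. c T * prod a T)"
proof -
 have fin: "finite E" using g by (rule gardD)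
 have pos: "0 < prod a T" if "T \<subseteq> E" for T using that a by (intro prod_pos) auto
 have pd: "pd E (\<lambda>T. c T * prod a T) T x = prod a T * pd E c T (\<lambda>e. a e * x e)" if T: "T \<subseteq> E" for T x
  unfolding pd_def ma_def sum_distrib_left
 proof (rule sum.cong [OF refl])
  fix U assume "U \<in> Pow (E - T)"
  then have "finite U" "finite T" "U \<inter> T = {}" using T fin finite_subset by blast+
  then have "prod a (U \<union> T) = prod a U * prod a T" by (rule prod.union_disjoint)
  then show "link (\<lambda>T. c T * prod a T) T U * prod x U = prod a T * (link c T U * (\<Prod>e\<in>U. a e * x e))"
   by (simp add: link_def prod.distrib mult_ac)
 qed
 show ?thesis unfolding gard_def
 proof (intro conjI ballI impI allI)
  show "0 <= c T * prod a T" if "T \<subseteq> E" for T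
   using gardD(2) [OF g that] pos [OF that] by simp
  show "0 < c E * prod a E" using gardD(3) [OF g] pos by simp
  fix x assume x: "x \<in> nnR E (\<lambda>T. c T * prod a T)" and p: "0 < ma E (\<lambda>T. c T * prod a T) x"
  have "(\<lambda>e. a e * x e) \<in> nnR E c"
   unfolding nnR_def
  proof (intro CollectI allI impI)
   fix T assume T: "T \<subseteq> E"
   have "0 <= prod a T * pd E c T (\<lambda>e. a e * x e)" using nnR_D [OF x T] by (simp add: pd [OF T])
   then show "0 <= pd E c T (\<lambda>e. a e * x e)" using pos [OF T] by (simp add: zero_le_mult_iff)
  qed
  moreover have "0 < ma E c (\<lambda>e. a e * x e)" using p pd [of "{}" x] by simp
  ultimately have "(\<lambda>e. a e * x e) \<in> posR E c" by (rule gardD(4) [OF g])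
  then show "x \<in> posR E (\<lambda>T. c T * prod a T)" using pos by (auto simp: posR_def pd)
 qed (use fin in auto)
qed

text \<open>
 The law of a random exchange of two variables.
\<close>

definition swap_avg :: "real => 'a => 'a => ('a set => real) => 'a set => real" where
 "swap_avg \<theta> i j c T = \<theta> * c T + (1 - \<theta>) * c (Transposition.transpose i j ` T)"

lemma swap_avg_both: "i \<in> T ==> j \<in> T ==> swap_avg \<theta> i j c T = c T"
proof -
 assume "i \<in> T" "j \<in> T"
 then have "Transposition.transpose i j ` T = T" by simp
 then show ?thesis by (simp add: swap_avg_def algebra_simps)
qed

lemma swap_avg_neither: "i \<notin> T ==> j \<notin> T ==> swap_avg \<theta> i j c T = c T"
proof -
 assume "i \<notin> T" "j \<notin> T"
 then have "Transposition.transpose i j ` T = T" by simp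
 then show ?thesis by (simp add: swap_avg_def algebra_simps)
qed

lemma swap_avg_insert:
 assumes "i \<notin> T" "j \<notin> T"
 shows "swap_avg \<theta> i j c (insert i T) = \<theta> * c (insert i T) + (1 - \<theta>) * c (insert j T)"
  "swap_avg \<theta> i j c (insert j T) = \<theta> * c (insert j T) + (1 - \<theta>) * c (insert i T)"
proof -
 have "Transposition.transpose i j ` T = T" using assms by simp
 then show "swap_avg \<theta> i j c (insert i T) = \<theta> * c (insert i T) + (1 - \<theta>) * c (insert j T)"
  "swap_avg \<theta> i j c (insert j T) = \<theta> * c (insert j T) + (1 - \<theta>) * c (insert i T)"
  by (simp_all add: swap_avg_def)
qed

lemma swap_avg_commute: "swap_avg \<theta> i j c = swap_avg \<theta> j i c"
 by (simp add: swap_avg_def transpose_commute fun_eq_iff)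

text \<open>
 The average again satisfies the Rayleigh inequality for the exchanged pair, since
 \<open>Q1 Q2\<close> can only increase when \<open>Q1\<close> and \<open>Q2\<close> are mixed with their sum fixed. The links at both
 elements of the pair are mixtures, whose property has to be shown first.
\<close>

lemma gard_swap_avg:
 assumes g: "gard E c" and ij: "i \<in> E" "j \<in> E" "i ~= j" and \<theta>: "0 <= \<theta>" "\<theta> <= 1"
 shows "gard E (swap_avg \<theta> i j c)"
proof -
 have fin: "finite E" using g by (rule gardD)
 have mv: "ma (E - {i,j}) (link (swap_avg \<theta> i j c) {j}) x
   = \<theta> * ma (E - {i,j}) (link c {j}) x + (1 - \<theta>) * ma (E - {i,j}) (link c {i}) x" for i j x
 proof -
  have "ma (E - {i,j}) (link (swap_avg \<theta> i j c) {j}) x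
   = ma (E - {i,j}) (\<lambda>T. \<theta> * link c {j} T + (1 - \<theta>) * link c {i} T) x"
  proof (rule ma_cong [OF _ refl])
   fix T assume "T \<subseteq> E - {i,j}"
   then show "link (swap_avg \<theta> i j c) {j} T = \<theta> * link c {j} T + (1 - \<theta>) * link c {i} T"
    using swap_avg_insert(2) [of i T j \<theta> c] by (auto simp: link_def)
  qed
  then show ?thesis by (simp only: ma_add ma_scale)
 qed
 have both: "link (swap_avg \<theta> i j c) {i,j} T = link c {i,j} T" for i j T
  by (simp add: link_def swap_avg_both)
 have side: "gard (E - {j}) (link (swap_avg \<theta> i j c) {j})" if ij: "i \<in> E" "j \<in> E" "i ~= j" for i j
 proof (rule gard_criterion)
  have sets: "E - {j} - {i} = E - {i,j}" by auto
  have links: "link (link d {j}) {i} = link d {i,j}" for d :: "'a set => real"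
   by (auto simp: link_link insert_commute)
  have gij: "gard (E - {i,j}) (link c {i,j})" using ij by (intro gard_link [OF g]) auto
  then show "gard (E - {j} - {i}) (link (link (swap_avg \<theta> i j c) {j}) {i})"
   unfolding sets links using gard_cong [of "E - {i,j}" "link (swap_avg \<theta> i j c) {i,j}", OF both] by simp
  show "0 <= link (swap_avg \<theta> i j c) {j} T" if "T \<subseteq> E - {j}" for T
  proof -
   have "Transposition.transpose i j ` (insert j T) \<subseteq> E" using that ij by (auto simp: Transposition.transpose_def)
   then have "0 <= c (insert j T)" "0 <= c (Transposition.transpose i j ` (insert j T))"
    using that ij by (auto intro!: gardD(2) [OF g])
   then show ?thesis using \<theta> by (simp add: link_def swap_avg_def)
  qed
  fix x assume "x \<in> nnR (E - {j} - {i}) (link (link (swap_avg \<theta> i j c) {j}) {i})"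
   and z: "pd (E - {j}) (link (swap_avg \<theta> i j c) {j}) {i} x = 0"
  then have x: "x \<in> nnR (E - {i,j}) (link c {i,j})"
   unfolding sets links using nnR_coeff_cong [of "E - {i,j}" "link (swap_avg \<theta> i j c) {i,j}", OF both] by simp
  have R0: "pd E c {i,j} x = 0"
  proof -
   have "pd (E - {j}) (link (swap_avg \<theta> i j c) {j}) {i} x = ma (E - {i,j}) (link (swap_avg \<theta> i j c) {i,j}) x"
    unfolding pd_def sets links ..
   also have "\<dots> = ma (E - {i,j}) (link c {i,j}) x" by (rule ma_cong [OF both refl])
   finally show ?thesis using z by (simp add: ma_link)
  qed
  have 1: "ma (E - {i,j}) (link c {j}) x <= 0"
   using link_zero_imp_nonpos [OF gard_link1 [OF g ij(2)], of i x] x R0 ij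
   by (simp add: sets links pd_link insert_commute)
  have sets': "E - {i} - {j} = E - {i,j}" by auto
  have links': "link (link c {i}) {j} = link c {i,j}"
   unfolding link_link by (rule arg_cong [where f = "link c"]) auto
  have 2: "ma (E - {i,j}) (link c {i}) x <= 0"
   using link_zero_imp_nonpos [OF gard_link1 [OF g ij(1)], of j x] x R0 ij
   by (simp add: sets' links' pd_link insert_commute)
  show "ma (E - {j} - {i}) (link (swap_avg \<theta> i j c) {j}) x <= 0"
   unfolding sets mv using 1 2 \<theta> by (intro add_nonpos_nonpos mult_nonneg_nonpos) auto
 qed (use fin ij in auto)
 show ?thesis
 proof (rule gard_single_pair [OF fin ij])
  show "gard (E - {j}) (link (swap_avg \<theta> i j c) {j})" using ij by (rule side)
  show "gard (E - {i}) (link (swap_avg \<theta> i j c) {i})"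
   using side [of j i] ij by (simp add: swap_avg_commute)
  show "0 <= swap_avg \<theta> i j c T" if "T \<subseteq> E" for T
  proof -
   have "Transposition.transpose i j ` T \<subseteq> E" using that ij by (auto simp: Transposition.transpose_def)
   then show ?thesis using that \<theta> gardD(2) [OF g] by (simp add: swap_avg_def)
  qed
  fix x assume "x \<in> posR (E - {i,j}) (link (swap_avg \<theta> i j c) {i,j})"
  then have x: "x \<in> posR (E - {i,j}) (link c {i,j})"
   using posR_coeff_cong [of "E - {i,j}" "link (swap_avg \<theta> i j c) {i,j}", OF both] by simp
  define Q1 where "Q1 = ma (E - {i,j}) (link c {i}) x"
  define Q2 where "Q2 = ma (E - {i,j}) (link c {j}) x"
  have s: "E - {j} - {i} = E - {i,j}" "E - {i} - {j} = E - {i,j}" "E - {j,i} = E - {i,j}" by auto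
  have P: "ma (E - {i,j}) (swap_avg \<theta> i j c) x = ma (E - {i,j}) c x"
   by (intro ma_cong refl swap_avg_neither) auto
  have R: "pd E (swap_avg \<theta> i j c) {i,j} x = pd E c {i,j} x"
   unfolding pd_def by (rule ma_cong [OF both refl])
  have 1: "pd (E - {j}) (swap_avg \<theta> i j c) {i} x = \<theta> * Q1 + (1 - \<theta>) * Q2"
   unfolding pd_def s using mv [of j i x] by (simp add: swap_avg_commute s Q1_def Q2_def)
  have 2: "pd (E - {i}) (swap_avg \<theta> i j c) {j} x = \<theta> * Q2 + (1 - \<theta>) * Q1"
   unfolding pd_def s mv by (simp add: Q1_def Q2_def)
  have "ma (E - {i,j}) c x * pd E c {i,j} x <= Q1 * Q2"
   using gard_rayleigh [OF g ij x] by (simp add: pd_def s Q1_def Q2_def)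
  also have "(\<theta> * Q1 + (1 - \<theta>) * Q2) * (\<theta> * Q2 + (1 - \<theta>) * Q1) - Q1 * Q2 = \<theta> * (1 - \<theta>) * (Q1 - Q2)\<^sup>2"
   by (simp add: power2_eq_square algebra_simps)
  then have "Q1 * Q2 <= (\<theta> * Q1 + (1 - \<theta>) * Q2) * (\<theta> * Q2 + (1 - \<theta>) * Q1)"
   using \<theta> by (smt (verit) mult_nonneg_nonneg zero_le_power2)
  finally show "ma (E - {i,j}) (swap_avg \<theta> i j c) x * pd E (swap_avg \<theta> i j c) {i,j} x
   <= pd (E - {j}) (swap_avg \<theta> i j c) {i} x * pd (E - {i}) (swap_avg \<theta> i j c) {j} x"
   unfolding P R 1 2 .
 qed
qed

text \<open>
 The average over all permutations of \<open>F\<close>, written as a mean over subsets of equal size.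
\<close>

definition symm :: "'a set => ('a set => real) => 'a set => real" where
 "symm F c T = (\<Sum>K | K \<subseteq> F & card K = card (T \<inter> F). c (K \<union> (T - F))) / real (card F choose card (T \<inter> F))"

lemma card_subsets_containing:
 assumes "finite F" "l \<in> F"
 shows "real (card {K. K \<subseteq> F & card K = k & l \<in> K}) * real (card F) = real k * real (card F choose k)"
proof (cases k)
 case 0
 have "{K. K \<subseteq> F & card K = 0 & l \<in> K} = {}" using assms(2) by (auto dest!: finite_subset [OF _ assms(1)])
 then have "card {K. K \<subseteq> F & card K = 0 & l \<in> K} = 0" by (simp only: card.empty)
 then show ?thesis unfolding 0 by (simp only: of_nat_0 mult_zero_left)
next
 case (Suc k')
 have "{K. K \<subseteq> F & card K = k & l \<in> K} = insert l ` {K. K \<subseteq> F - {l} & card K = k'}"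
 proof (intro set_eqI iffI)
  fix K assume K: "K \<in> {K. K \<subseteq> F & card K = k & l \<in> K}"
  then have 1: "K = insert l (K - {l})" and 2: "card (K - {l}) = k'" "K - {l} \<subseteq> F - {l}"
   using Suc assms(1) finite_subset [of K F] by auto
  show "K \<in> insert l ` {K. K \<subseteq> F - {l} & card K = k'}"
   by (subst 1, rule imageI) (simp only: mem_Collect_eq 2 simp_thms)
 next
  fix K assume "K \<in> insert l ` {K. K \<subseteq> F - {l} & card K = k'}"
  then obtain J where J: "J \<subseteq> F - {l}" "card J = k'" "K = insert l J" by auto
  then have "finite J" "l \<notin> J" using assms(1) finite_subset [of J F] by auto
  then show "K \<in> {K. K \<subseteq> F & card K = k & l \<in> K}" using J assms(2) Suc by auto
 qed
 moreover have "inj_on (insert l) {K. K \<subseteq> F - {l} & card K = k'}" by (auto simp: inj_on_def)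
 ultimately have "card {K. K \<subseteq> F & card K = k & l \<in> K} = card F - 1 choose k'"
  using assms by (simp add: card_image n_subsets)
 moreover have "card F * (card F - 1 choose k') = k * (card F choose k)"
  using Suc_times_binomial [of k' "card F - 1"] assms Suc
  by (metis One_nat_def Suc_pred card_gt_0_iff empty_iff)
 ultimately show ?thesis by (metis mult.commute of_nat_mult)
qed

text \<open>
 A random exchange of the new point with each old one in turn, with the right laziness, extends the
 uniform mean over an \<open>r\<close>-element set to one over \<open>r + 1\<close> elements.
\<close>

lemma lazy_swap_mean:
 fixes a b k r :: real
 assumes "0 <= r"
 shows "k * (1 / (r + 1) * a + (1 - 1 / (r + 1)) * b) + (r - k) * a = r * (((r + 1 - k) * a + k * b) / (r + 1))"
  and "k * a + (r - k) * (1 / (r + 1) * a + (1 - 1 / (r + 1)) * b) = r * (((r - k) * b + (k + 1) * a) / (r + 1))"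
proof -
 define q where "q = r + 1"
 have q: "q ~= 0" and r: "r = q - 1" using assms by (auto simp: q_def)
 show "k * (1 / (r + 1) * a + (1 - 1 / (r + 1)) * b) + (r - k) * a = r * (((r + 1 - k) * a + k * b) / (r + 1))"
  "k * a + (r - k) * (1 / (r + 1) * a + (1 - 1 / (r + 1)) * b) = r * (((r - k) * b + (k + 1) * a) / (r + 1))"
  unfolding r using q by (simp_all add: field_simps)
qed

text \<open>
 Induction on \<open>F\<close> by the averages of \<open>lazy_swap_mean\<close>, each of which preserves \<open>gard\<close>.
\<close>

lemma gard_symm:
 assumes "finite F" "F \<subseteq> E" "gard E c"
 shows "gard E (symm F c)"
 using assms
proof (induction F arbitrary: c rule: finite_induct)
 case empty
 have "symm {} c T = c T" for T
 proof -
  have "{K :: 'a set. K = {} & card K = 0} = {{}}" by auto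
  then show ?thesis by (simp add: symm_def)
 qed
 then show ?case using empty by (simp add: gard_cong [of E "symm {} c" c])
next
 case (insert n F)
 define m where "m = card F"
 define N where "N k = {K. K \<subseteq> F & card K = k}" for k
 define \<beta> where "\<beta> k W = (\<Sum>K\<in>N k. c (K \<union> W)) / real (m choose k)" for k W
 have finE: "finite E" by (rule gardD(1) [OF insert.prems(2)])
 have finN: "finite (N k)" for k unfolding N_def using insert.hyps(1) by auto
 have cardN: "card (N k) = m choose k" for k unfolding N_def m_def using insert.hyps(1) by (rule n_subsets)
 have sumN: "(\<Sum>K\<in>N k. c (K \<union> W)) = real (m choose k) * \<beta> k W" for k W
 proof (cases "m choose k = 0")
  case True
  then have "N k = {}" using cardN [of k] finN [of k] by (metis card_0_eq)
  then show ?thesis using True by simp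
 qed (simp add: \<beta>_def)
 have symm_F: "symm F d T = (\<Sum>K\<in>N (card (T \<inter> F)). d (K \<union> (T - F))) / real (m choose card (T \<inter> F))" for d T
  by (simp add: symm_def N_def m_def)
 have symm_c: "symm F c (K \<union> W) = \<beta> (card K) W" if "K \<subseteq> F" "W \<inter> F = {}" for K W
 proof -
  have "(K \<union> W) \<inter> F = K" "K \<union> W - F = W" using that by auto
  then show ?thesis by (simp add: symm_F \<beta>_def)
 qed
 have new: "symm (insert n F) c T =
   ((real m + 1 - real k) * \<beta> k W + real k * \<beta> (k - 1) (insert n W)) / (real m + 1)"
  if k: "k = card (T \<inter> insert n F)" and W: "W = T - insert n F" for T k W
 proof -
  have "k <= card (insert n F)" unfolding k using insert.hyps(1) by (intro card_mono) auto
  then have km: "k <= m + 1" using insert.hyps by (simp add: m_def)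
  have split: "{K. K \<subseteq> insert n F & card K = k} = N k \<union> (if k = 0 then {} else insert n ` N (k - 1))"
  proof (intro set_eqI iffI)
   fix K assume K: "K \<in> {K. K \<subseteq> insert n F & card K = k}"
   then have fK: "finite K" using insert.hyps(1) finite_subset [of K "insert n F"] by auto
   show "K \<in> N k \<union> (if k = 0 then {} else insert n ` N (k - 1))"
   proof (cases "n \<in> K")
    case True
    then have 1: "K = insert n (K - {n})" and 2: "K - {n} \<in> N (k - 1)" "k ~= 0"
     using K fK by (auto simp: N_def card_gt_0_iff)
    have "K \<in> insert n ` N (k - 1)" by (subst 1, rule imageI, rule 2)
    then show ?thesis using 2 by simp
   qed (use K in \<open>auto simp: N_def\<close>)
  next
   fix K assume "K \<in> N k \<union> (if k = 0 then {} else insert n ` N (k - 1))"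
   then consider "K \<in> N k" | J where "k ~= 0" "J \<in> N (k - 1)" "K = insert n J" by (auto split: if_splits)
   then show "K \<in> {K. K \<subseteq> insert n F & card K = k}"
   proof cases
    case 2
    then have "finite J" "n \<notin> J" using insert.hyps finite_subset [of J F] by (auto simp: N_def)
    then show ?thesis using 2 by (auto simp: N_def)
   qed (auto simp: N_def)
  qed
  have b1: "(real m + 1) * real (m choose k) = (real m + 1 - real k) * real (m + 1 choose k)"
  proof (cases "k = m + 1")
   case False
   then have "k <= m" using km by simp
   then have "Suc m * (m choose k) = (Suc m - k) * (Suc m choose k)"
    using binomial_absorb_comp [of "Suc m" k] by simp
   then have "real (Suc m) * real (m choose k) = real (Suc m - k) * real (Suc m choose k)"
    by (simp only: of_nat_mult [symmetric])
   moreover have "real (Suc m) = real m + 1" "real (Suc m - k) = real m + 1 - real k"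
    using \<open>k <= m\<close> by auto
   ultimately show ?thesis by (simp only: Suc_eq_plus1)
  qed simp
  have b2: "(real m + 1) * real (m choose (k - 1)) = real k * real (m + 1 choose k)" if "k ~= 0"
  proof -
   have "Suc m * (m choose (k - 1)) = k * (Suc m choose k)"
    using Suc_times_binomial [of "k - 1" m] that by simp
   then have "real (Suc m) * real (m choose (k - 1)) = real k * real (Suc m choose k)"
    by (simp only: of_nat_mult [symmetric])
   moreover have "real (Suc m) = real m + 1" by simp
   ultimately show ?thesis by (simp only: Suc_eq_plus1)
  qed
  have pos: "0 < real (m + 1 choose k)" using km by simp
  have "(\<Sum>K | K \<subseteq> insert n F & card K = k. c (K \<union> W))
    = real (m choose k) * \<beta> k W + (if k = 0 then 0 else real (m choose (k - 1)) * \<beta> (k - 1) (insert n W))"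
  proof (cases "k = 0")
   case True
   then show ?thesis unfolding split by (simp only: sumN if_True Un_empty_right add_0_right simp_thms)
  next
   case False
   have dis: "N k \<inter> insert n ` N (k - 1) = {}" using insert.hyps by (auto simp: N_def)
   have inj: "inj_on (insert n) (N (k - 1))" using insert.hyps by (auto simp: inj_on_def N_def)
   have "(\<Sum>K\<in>N k \<union> insert n ` N (k - 1). c (K \<union> W))
     = (\<Sum>K\<in>N k. c (K \<union> W)) + (\<Sum>K\<in>N (k - 1). c (K \<union> insert n W))"
   proof -
    have "(\<Sum>K\<in>insert n ` N (k - 1). c (K \<union> W)) = (\<Sum>K\<in>N (k - 1). c (K \<union> insert n W))"
     by (subst sum.reindex [OF inj]) simp
    then show ?thesis by (subst sum.union_disjoint [OF finN finite_imageI [OF finN] dis]) simp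
   qed
   then show ?thesis unfolding split using False by (simp only: sumN if_False)
  qed
  moreover have "T - insert n F = W" using W by simp
  ultimately have "symm (insert n F) c T
    = (real (m choose k) * \<beta> k W + (if k = 0 then 0 else real (m choose (k - 1)) * \<beta> (k - 1) (insert n W)))
     / real (m + 1 choose k)"
   using insert.hyps by (simp add: symm_def k m_def)
  also have "\<dots> = ((real m + 1 - real k) * \<beta> k W + real k * \<beta> (k - 1) (insert n W)) / (real m + 1)"
  proof -
   define X where "X = (if k = 0 then 0 else real (m choose (k - 1)) * \<beta> (k - 1) (insert n W))"
   have "(real m + 1) * X = real (m + 1 choose k) * (real k * \<beta> (k - 1) (insert n W))"
   proof (cases "k = 0")
    case False
    then have "(real m + 1) * X = ((real m + 1) * real (m choose (k - 1))) * \<beta> (k - 1) (insert n W)"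
     by (simp add: X_def)
    then show ?thesis unfolding b2 [OF False] by (simp only: mult_ac)
   qed (simp add: X_def)
   moreover have "(real m + 1) * (real (m choose k) * \<beta> k W)
     = real (m + 1 choose k) * ((real m + 1 - real k) * \<beta> k W)"
    unfolding mult.assoc [symmetric] b1 by (simp only: mult_ac)
   ultimately have "(real m + 1) * (real (m choose k) * \<beta> k W + X)
     = real (m + 1 choose k) * ((real m + 1 - real k) * \<beta> k W + real k * \<beta> (k - 1) (insert n W))"
    by (simp only: distrib_left)
   moreover have "real m + 1 ~= 0" "real (m + 1 choose k) ~= 0" using pos by linarith+
   ultimately show ?thesis unfolding X_def [symmetric] by (metis frac_eq_eq mult.commute)
  qed
  finally show ?thesis .
 qed
 show ?case
 proof (cases "F = {}")
  case True
  have "symm (insert n F) c T = c T" for T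
  proof (cases "n \<in> T")
   case True
   have "{K. K \<subseteq> {n} & card K = Suc 0} = {{n}}" unfolding subset_singleton_iff by auto
   moreover have "insert n (T - {n}) = T" using True by auto
   ultimately show ?thesis using True by (simp add: symm_def \<open>F = {}\<close>)
  next
   case False
   have "{K. K \<subseteq> {n} & card K = 0} = {{}}" unfolding subset_singleton_iff by auto
   then show ?thesis using False by (simp add: symm_def \<open>F = {}\<close>)
  qed
  then show ?thesis using insert.prems by (simp add: gard_cong [of E "symm (insert n F) c" c])
 next
  case False
  then obtain l where l: "l \<in> F" by auto
  define \<theta> where "\<theta> = 1 / (real m + 1)"
  define d where "d = swap_avg \<theta> l n (symm F c)"
  have m0: "0 < m" using False insert.hyps by (simp add: m_def card_gt_0_iff)
  then have m0': "real m ~= 0" by simp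
  have ln: "l ~= n" using l insert.hyps by auto
  have "gard E (symm F c)" using insert by auto
  then have "gard E d" unfolding d_def using l ln insert.prems by (intro gard_swap_avg) (auto simp: \<theta>_def)
  then have gd: "gard E (symm F d)" using insert by auto
  have counts: "real (card {K \<in> N k. l \<in> K}) * real m = real k * real (m choose k)"
   "real (card {K \<in> N k. l \<notin> K}) * real m = (real m - real k) * real (m choose k)" for k
  proof -
   have "{K \<in> N k. l \<in> K} = {K. K \<subseteq> F & card K = k & l \<in> K}" by (auto simp: N_def)
   then show 1: "real (card {K \<in> N k. l \<in> K}) * real m = real k * real (m choose k)"
    using card_subsets_containing [OF insert.hyps(1) l] by (simp add: m_def)
   have "card ({K \<in> N k. l \<in> K} \<union> {K \<in> N k. l \<notin> K}) = card {K \<in> N k. l \<in> K} + card {K \<in> N k. l \<notin> K}"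
    by (rule card_Un_disjoint) (use finN [of k] in auto)
   moreover have "{K \<in> N k. l \<in> K} \<union> {K \<in> N k. l \<notin> K} = N k" by blast
   ultimately have "card {K \<in> N k. l \<in> K} + card {K \<in> N k. l \<notin> K} = card (N k)" by (simp only:)
   then have "real (card {K \<in> N k. l \<in> K}) + real (card {K \<in> N k. l \<notin> K}) = real (m choose k)"
    unfolding cardN by (simp only: of_nat_add [symmetric])
   then have eq_diff: "real (card {K \<in> N k. l \<notin> K}) = real (m choose k) - real (card {K \<in> N k. l \<in> K})"
    by (simp only: eq_diff_eq add.commute)
   show "real (card {K \<in> N k. l \<notin> K}) * real m = (real m - real k) * real (m choose k)"
   proof -
    have "real (card {K \<in> N k. l \<notin> K}) * real m
      = real (m choose k) * real m - real (card {K \<in> N k. l \<in> K}) * real m"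
     by (simp only: eq_diff left_diff_distrib)
    then show ?thesis unfolding 1 by (simp add: algebra_simps)
   qed
  qed
  have distrib: "(a * X + b * Y) * r = C * (u * X + v * Y)" if "a * r = u * C" "b * r = v * C"
   for a b r u v C X Y :: real
  proof -
   have "(a * X + b * Y) * r = (a * r) * X + (b * r) * Y" by (simp add: algebra_simps)
   then show ?thesis unfolding that by (simp add: algebra_simps)
  qed
  have split: "(\<Sum>K\<in>N k. f K) = (\<Sum>K\<in>{K \<in> N k. l \<in> K}. f K) + (\<Sum>K\<in>{K \<in> N k. l \<notin> K}. f K)" for f :: "'a set => real" and k
  proof -
   have "sum f ({K \<in> N k. l \<in> K} \<union> {K \<in> N k. l \<notin> K})
     = (\<Sum>K\<in>{K \<in> N k. l \<in> K}. f K) + (\<Sum>K\<in>{K \<in> N k. l \<notin> K}. f K)"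
    by (rule sum.union_disjoint) (use finN [of k] in auto)
   moreover have "{K \<in> N k. l \<in> K} \<union> {K \<in> N k. l \<notin> K} = N k" by blast
   ultimately show ?thesis by (simp only:)
  qed
  have "symm F d T = symm (insert n F) c T" for T
  proof -
   define k where "k = card (T \<inter> F)"
   define W where "W = T - insert n F"
   have kF: "k <= m" unfolding k_def m_def using insert.hyps(1) by (intro card_mono) auto
   then have bpos: "0 < real (m choose k)" by simp
   have WF: "W \<inter> F = {}" "n \<notin> W" "insert n W \<inter> F = {}" using insert.hyps by (auto simp: W_def)
   have l1: "l \<notin> K ==> l \<notin> K \<union> W" for K using l by (auto simp: W_def)
   have nK: "n \<notin> K" if "K \<in> N j" for K j using that insert.hyps by (auto simp: N_def)
   show ?thesis
   proof (cases "n \<in> T")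
    case False
    then have TW: "T - F = W" "T \<inter> insert n F = T \<inter> F" by (auto simp: W_def)
    have v1: "d (K \<union> W) = \<beta> k W" if "K \<in> N k" "l \<notin> K" for K
     using that nK WF l1 symm_c [of K W] unfolding d_def by (subst swap_avg_neither) (auto simp: N_def)
    have v2: "d (K \<union> W) = \<theta> * \<beta> k W + (1 - \<theta>) * \<beta> (k - 1) (insert n W)" if K: "K \<in> N k" "l \<in> K" for K
    proof -
     define J where "J = K - {l}"
     have J: "J \<subseteq> F" "l \<notin> J" "card J = k - 1" "K \<union> W = insert l (J \<union> W)"
      using K finite_subset [of K F] insert.hyps(1) by (auto simp: J_def N_def)
     have "d (K \<union> W) = \<theta> * symm F c (K \<union> W) + (1 - \<theta>) * symm F c (insert n (J \<union> W))"
      unfolding d_def J(4) using J(2) nK [OF K(1)] WF l1 by (intro swap_avg_insert(1)) (auto simp: J_def)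
     moreover have "insert n (J \<union> W) = J \<union> insert n W" by auto
     moreover have "symm F c (K \<union> W) = \<beta> k W" using symm_c [of K W] K(1) WF(1) by (simp add: N_def)
     moreover have "symm F c (J \<union> insert n W) = \<beta> (k - 1) (insert n W)"
      using symm_c [of J "insert n W"] J(1,3) WF(3) by simp
     ultimately show ?thesis by (simp only:)
    qed
    have "(\<Sum>K\<in>N k. d (K \<union> W)) = real (card {K \<in> N k. l \<in> K}) * (\<theta> * \<beta> k W + (1 - \<theta>) * \<beta> (k - 1) (insert n W))
      + real (card {K \<in> N k. l \<notin> K}) * \<beta> k W"
     unfolding split [of _ k] by (simp add: v1 v2)
    then have "(\<Sum>K\<in>N k. d (K \<union> W)) * real m = real (m choose k) *
      (real k * (\<theta> * \<beta> k W + (1 - \<theta>) * \<beta> (k - 1) (insert n W)) + (real m - real k) * \<beta> k W)"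
     by (simp only: distrib [OF counts])
    then have "symm F d T * real m = real k * (\<theta> * \<beta> k W + (1 - \<theta>) * \<beta> (k - 1) (insert n W)) + (real m - real k) * \<beta> k W"
     using bpos by (simp add: symm_F k_def [symmetric] TW)
    also have "\<dots> = real m * (((real m + 1 - real k) * \<beta> k W + real k * \<beta> (k - 1) (insert n W)) / (real m + 1))"
     unfolding \<theta>_def by (rule lazy_swap_mean) simp
    finally have "symm F d T = ((real m + 1 - real k) * \<beta> k W + real k * \<beta> (k - 1) (insert n W)) / (real m + 1)"
     using m0' by (metis mult.commute mult_left_cancel)
    then show ?thesis using new [of k T W] TW by (simp add: k_def W_def)
   next
    case True
    then have TW: "T - F = insert n W" "T \<inter> insert n F = insert n (T \<inter> F)" using insert.hyps by (auto simp: W_def)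
    have k1: "card (T \<inter> insert n F) = k + 1" unfolding TW k_def using insert.hyps by simp
    have v1: "d (K \<union> insert n W) = \<beta> k (insert n W)" if "K \<in> N k" "l \<in> K" for K
     using that WF symm_c [of K "insert n W"] unfolding d_def by (subst swap_avg_both) (auto simp: N_def)
    have v2: "d (K \<union> insert n W) = \<theta> * \<beta> k (insert n W) + (1 - \<theta>) * \<beta> (k + 1) W" if K: "K \<in> N k" "l \<notin> K" for K
    proof -
     have J: "insert l K \<subseteq> F" "card (insert l K) = k + 1" "K \<union> insert n W = insert n (K \<union> W)"
      using K finite_subset [of K F] insert.hyps(1) l by (auto simp: N_def)
     have "d (K \<union> insert n W) = \<theta> * symm F c (K \<union> insert n W) + (1 - \<theta>) * symm F c (insert l (K \<union> W))"
      unfolding d_def J(3) using K(2) nK [OF K(1)] WF l1 by (intro swap_avg_insert(2)) auto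
     moreover have "insert l (K \<union> W) = insert l K \<union> W" by auto
     moreover have "symm F c (K \<union> insert n W) = \<beta> k (insert n W)"
      using symm_c [of K "insert n W"] K(1) WF(3) by (simp add: N_def)
     moreover have "symm F c (insert l K \<union> W) = \<beta> (k + 1) W"
      using symm_c [of "insert l K" W] J(1,2) WF(1) by simp
     ultimately show ?thesis by (simp only:)
    qed
    have "(\<Sum>K\<in>N k. d (K \<union> insert n W)) = real (card {K \<in> N k. l \<in> K}) * \<beta> k (insert n W)
      + real (card {K \<in> N k. l \<notin> K}) * (\<theta> * \<beta> k (insert n W) + (1 - \<theta>) * \<beta> (k + 1) W)"
    proof -
     have 1: "(\<Sum>K\<in>{K \<in> N k. l \<in> K}. d (K \<union> insert n W)) = (\<Sum>K\<in>{K \<in> N k. l \<in> K}. \<beta> k (insert n W))"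
      by (rule sum.cong [OF refl], rule v1) auto
     have 2: "(\<Sum>K\<in>{K \<in> N k. l \<notin> K}. d (K \<union> insert n W))
       = (\<Sum>K\<in>{K \<in> N k. l \<notin> K}. \<theta> * \<beta> k (insert n W) + (1 - \<theta>) * \<beta> (k + 1) W)"
      by (rule sum.cong [OF refl], rule v2) auto
     show ?thesis unfolding split [of _ k] 1 2 by (simp only: sum_constant)
    qed
    then have "(\<Sum>K\<in>N k. d (K \<union> insert n W)) * real m = real (m choose k) *
      (real k * \<beta> k (insert n W) + (real m - real k) * (\<theta> * \<beta> k (insert n W) + (1 - \<theta>) * \<beta> (k + 1) W))"
     by (simp only: distrib [OF counts])
    then have "symm F d T * real m = real k * \<beta> k (insert n W) + (real m - real k) * (\<theta> * \<beta> k (insert n W) + (1 - \<theta>) * \<beta> (k + 1) W)"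
     using bpos by (simp add: symm_F k_def [symmetric] TW)
    also have "\<dots> = real m * (((real m - real k) * \<beta> (k + 1) W + (real k + 1) * \<beta> k (insert n W)) / (real m + 1))"
     unfolding \<theta>_def by (rule lazy_swap_mean) simp
    finally have "symm F d T = ((real m - real k) * \<beta> (k + 1) W + (real k + 1) * \<beta> k (insert n W)) / (real m + 1)"
     using m0' by (metis mult.commute mult_left_cancel)
    then show ?thesis using new [of "k + 1" T W] k1 by (simp add: W_def)
   qed
  qed
  then show ?thesis using gd by (simp add: gard_cong [of E "symm F d" "symm (insert n F) c"])
 qed
qed

text \<open>
 In the symmetrized polynomial a derivative in \<open>k - 1\<close> variables, evaluated at the origin of the
 others, has the values \<open>\<mu> (k - 1)\<close>, \<open>\<mu> k\<close> and \<open>\<mu> (k + 1)\<close>; they satisfy the Rayleigh inequality.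
\<close>

lemma newton_gard:
 assumes g: "gard E c" and k: "1 <= k" "k < card E"
 defines "\<mu> \<equiv> \<lambda>j. (\<Sum>T | T \<subseteq> E & card T = j. c T) / real (card E choose j)"
 shows "\<mu> (k - 1) * \<mu> (k + 1) <= (\<mu> k)\<^sup>2"
proof -
 have fin: "finite E" using g by (rule gardD)
 define d where "d = symm E c"
 have gd: "gard E d" unfolding d_def using fin g by (intro gard_symm) auto
 have dT: "d T = \<mu> (card T)" if "T \<subseteq> E" for T
 proof -
  have "T \<inter> E = T" "T - E = {}" using that by auto
  then have "d T = (\<Sum>K | K \<subseteq> E & card K = card T. c (K \<union> {})) / real (card E choose card T)"
   unfolding d_def symm_def by (simp only:)
  then show ?thesis by (simp add: \<mu>_def)
 qed
 have "k + 1 <= card E" using k by simp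
 then obtain U where U: "U \<subseteq> E" "card U = k + 1" by (rule obtain_subset_with_card_n)
 then have fU: "finite U" using fin finite_subset by auto
 obtain i where i: "i \<in> U" using U k by fastforce
 have "card (U - {i}) = k" using U i fU by simp
 then have "U - {i} ~= {}" using k by force
 then obtain j where j: "j \<in> U - {i}" by blast
 define T where "T = U - {i,j}"
 define G where "G = E - T"
 have fT: "finite T" using fU by (simp add: T_def)
 have Ueq: "U = insert i (insert j T)" "i \<notin> T" "j \<notin> T" "i ~= j" using i j by (auto simp: T_def)
 have cT: "card T = k - 1" "card (insert i T) = k" "card (insert j T) = k" using U Ueq fT k by auto
 have sub: "T \<subseteq> E" "insert i T \<subseteq> E" "insert j T \<subseteq> E" using U Ueq by auto
 have ijG: "i \<in> G" "j \<in> G" using Ueq U by (auto simp: G_def)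
 have gG: "gard G (link d T)" unfolding G_def using gd sub(1) by (rule gard_link)
 have ray: "ma (G - {i,j}) (link d T) (\<lambda>_. t) * pd G (link d T) {i,j} (\<lambda>_. t)
   <= pd (G - {j}) (link d T) {i} (\<lambda>_. t) * pd (G - {i}) (link d T) {j} (\<lambda>_. t)" if t: "0 < t" for t
 proof (rule gard_rayleigh [OF gG ijG Ueq(4)])
  have g': "gard (G - {i,j}) (link (link d T) {i,j})" using gG ijG by (intro gard_link) auto
  show "(\<lambda>_. t) \<in> posR (G - {i,j}) (link (link d T) {i,j})"
   using t by (rule gard_orthant [OF g'])
 qed
 have at0: "ma F f (\<lambda>_. 0) = f {}" if "finite F" for F :: "'a set" and f
  using that
 proof (induction F arbitrary: f rule: finite_induct)
  case (insert e F) then show ?case by (simp add: ma_insert)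
 qed simp
 have ev: "\<forall>\<^sub>F t in at_right (0::real). ma (G - {i,j}) (link d T) (\<lambda>_. t) * pd G (link d T) {i,j} (\<lambda>_. t)
   <= pd (G - {j}) (link d T) {i} (\<lambda>_. t) * pd (G - {i}) (link d T) {j} (\<lambda>_. t)"
  using eventually_at_right_less [of 0] by eventually_elim (rule ray)
 have id: "((\<lambda>t::real. t) \<longlongrightarrow> 0) (at_right 0)" by (rule tendsto_ident_at)
 have "ma (G - {i,j}) (link d T) (\<lambda>_. 0) * pd G (link d T) {i,j} (\<lambda>_. 0)
   <= pd (G - {j}) (link d T) {i} (\<lambda>_. 0) * pd (G - {i}) (link d T) {j} (\<lambda>_. 0)"
  by (rule tendsto_le [OF _ _ _ ev]) (auto intro!: tendsto_intros id)
 moreover have "finite G" using fin by (simp add: G_def)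
 ultimately have "d T * d (insert i (insert j T)) <= d (insert i T) * d (insert j T)"
  by (simp add: at0 pd_def link_def)
 then have "\<mu> (card T) * \<mu> (card U) <= \<mu> (card (insert i T)) * \<mu> (card (insert j T))"
  using dT [OF sub(1)] dT [OF U(1)] dT [OF sub(2)] dT [OF sub(3)] Ueq(1) by simp
 then show ?thesis using cT U by (simp add: power2_eq_square)
qed

section \<open>Limits\<close>

text \<open>
 The form of \<open>gard\<close> for polynomials without the monomial of the whole set: only the derivatives that are
 not identically zero can be asked to be positive.
\<close>

definition wgard :: "'a set => ('a set => real) => bool" where
 "wgard E c \<longleftrightarrow> finite E & (\<forall>T\<subseteq>E. 0 <= c T) \<and>
   (\<forall>x\<in>nnR E c. 0 < ma E c x -->
    (\<forall>T U. T \<subseteq> U --> U \<subseteq> E --> 0 < c U --> 0 < pd E c T x))"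

lemma gard_imp_wgard: "gard E c ==> wgard E c"
 unfolding gard_def wgard_def by (meson posR_D subset_trans)

lemma pd_orthant_ge:
 assumes "finite E" "\<And>T. T \<subseteq> E ==> 0 <= c T" "\<And>e. e \<in> E ==> 0 <= x e" "T \<subseteq> U" "U \<subseteq> E"
 shows "c U * prod x (U - T) <= pd E c T x"
proof -
 have "link c T (U - T) * prod x (U - T) <= (\<Sum>V\<in>Pow (E - T). link c T V * prod x V)"
 proof (rule member_le_sum)
  fix V assume V: "V \<in> Pow (E - T) - {U - T}"
  then have "V \<union> T \<subseteq> E" using assms(4,5) by auto
  moreover have "0 <= prod x V" using assms(3) V by (intro prod_nonneg) auto
  ultimately show "0 <= link c T V * prod x V" using assms(2) by (simp add: link_def)
 qed (use assms in auto)
 moreover have "U - T \<union> T = U" using assms(4) by auto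
 ultimately show ?thesis by (simp add: pd_def ma_def link_def)
qed

lemma nnR_shift_pos:
 assumes fin: "finite E" and nn: "\<And>T. T \<subseteq> E ==> 0 <= c T" and x: "x \<in> nnR E c"
  and TU: "T \<subseteq> U" "U \<subseteq> E" "0 < c U" and t: "0 < t"
 shows "0 < pd E c T (\<lambda>e. x e + t)"
proof -
 have TE: "T \<subseteq> E" using TU by auto
 have ex: "\<exists>V\<subseteq>E - T. 0 < pd E c (T \<union> V) x"
 proof (rule ccontr)
  assume "\<not> ?thesis"
  then have z: "pd E c (T \<union> V) x = 0" if "V \<subseteq> E - T" for V
  proof -
   have "T \<union> V \<subseteq> E" using that TE by auto
   then have "0 <= pd E c (T \<union> V) x" by (rule nnR_D [OF x])
   moreover have "\<not> 0 < pd E c (T \<union> V) x" using \<open>\<not> (\<exists>V\<subseteq>E - T. 0 < pd E c (T \<union> V) x)\<close> that by blast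
   ultimately show ?thesis by linarith
  qed
  define s where "s = 1 + (\<Sum>e\<in>E. \<bar>x e\<bar>)"
  have "\<bar>x e\<bar> <= (\<Sum>e\<in>E. \<bar>x e\<bar>)" if "e \<in> E" for e using that fin by (intro member_le_sum) auto
  then have pos: "0 < x e + s" if "e \<in> E" for e using that by (force simp: s_def)
  have "pd E c T (\<lambda>e. x e + s) = (\<Sum>V\<in>Pow (E - T). pd E c (T \<union> V) x * (\<Prod>e\<in>V. s))"
   by (rule taylor_pd [OF fin])
  also have "\<dots> = 0" using z by (intro sum.neutral) auto
  finally have "pd E c T (\<lambda>e. x e + s) = 0" .
  moreover have "c U * (\<Prod>e\<in>U - T. x e + s) <= pd E c T (\<lambda>e. x e + s)"
   using fin nn TU pos by (intro pd_orthant_ge) (auto simp: less_imp_le)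
  moreover have "0 < (\<Prod>e\<in>U - T. x e + s)" using TU pos by (intro prod_pos) auto
  ultimately show False using TU(3) by (smt (verit) mult_pos_pos)
 qed
 then obtain V where V: "V \<subseteq> E - T" "0 < pd E c (T \<union> V) x" by auto
 have "pd E c (T \<union> V) x * (\<Prod>e\<in>V. t) <= pd E c T (\<lambda>e. x e + t)"
  using fin x t TE V by (intro pd_add_ge) auto
 moreover have "0 < (\<Prod>e\<in>V. t)" using t by (intro prod_pos) auto
 ultimately show ?thesis using V(2) by (smt (verit) mult_pos_pos)
qed

lemma ma_le_add:
 assumes "finite E" "x \<in> nnR E c" "\<And>e. e \<in> E ==> 0 <= v e"
 shows "ma E c x <= ma E c (\<lambda>e. x e + v e)"
 using pd_add_ge [OF assms(1,2), of v "{}" "{}"] assms(3) by simp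

lemma prod_abs_le_power:
 assumes "finite E" "T \<subseteq> E" "\<And>e. e \<in> E ==> \<bar>z e\<bar> <= K" "1 <= (K :: real)"
 shows "\<bar>prod z T\<bar> <= K ^ card E"
proof -
 have "\<bar>prod z T\<bar> = (\<Prod>e\<in>T. \<bar>z e\<bar>)" by (rule abs_prod)
 also have "\<dots> <= (\<Prod>e\<in>T. K)" using assms by (intro prod_mono) auto
 also have "\<dots> = K ^ card T" by simp
 also have "\<dots> <= K ^ card E" using assms by (intro power_increasing card_mono) auto
 finally show ?thesis .
qed

text \<open>
 If the derivative vanished at \<open>x\<close>, the value of \<open>f\<close> would be unchanged when \<open>x\<close> is moved down in
 direction \<open>e\<close>, while nearby \<open>gard\<close> polynomials force a root there.
\<close>

lemma wgard_limit_step: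
 fixes c :: "nat => 'a set => real"
 assumes g: "\<And>n. gard E (c n)" and lim: "\<And>T. T \<subseteq> E ==> (\<lambda>n. c n T) \<longlonglongrightarrow> b T"
  and x: "x \<in> nnR E b" and pos: "0 < ma E b x" and e: "e \<in> U" "U \<subseteq> E" "0 < b U"
 shows "0 < pd E b {e} x"
proof -
 have fin: "finite E" using g [of 0] by (rule gardD)
 have eE: "e \<in> E" using e by auto
 have nn: "0 <= b T" if "T \<subseteq> E" for T
  using lim [OF that] gardD(2) [OF g that] by (intro LIMSEQ_le_const) auto
 have limp: "(\<lambda>n. pd E (c n) T z) \<longlonglongrightarrow> pd E b T z" if "T \<subseteq> E" for T z
  unfolding pd_def ma_def link_def using that by (intro tendsto_intros lim) auto
 have limm: "(\<lambda>n. ma E (c n) z) \<longlonglongrightarrow> ma E b z" for z using limp [of "{}" z] by simp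
 have key: "ma E b (\<lambda>k. x k + t) * pd E b {e} (\<lambda>k. x k + t + 1)
   <= ma E b (\<lambda>k. x k + t + 1) * pd E b {e} (\<lambda>k. x k + t)" if t: "0 < t" for t
 proof -
  define y where "y = (\<lambda>k. x k + t)"
  define \<beta> where "\<beta> = ma E b y"
  have ynn: "y \<in> nnR E b" unfolding y_def using fin x t by (intro nnR_add) auto
  have "ma E b x <= ma E b y"
   unfolding y_def using fin x t by (intro ma_le_add) auto
  then have \<beta>: "0 < \<beta>" using pos by (simp add: \<beta>_def y_def)
  define s0 where "s0 = (\<Sum>k\<in>E. \<bar>y k\<bar>)"
  have yk: "\<bar>y k\<bar> <= s0" if "k \<in> E" for k unfolding s0_def using that fin by (intro member_le_sum) auto
  have s0: "0 <= s0" by (simp add: s0_def sum_nonneg)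
  define K where "K = 1 + 2 * s0"
  have "(\<lambda>n. (\<Sum>T\<in>Pow E. \<bar>c n T - b T\<bar> * K ^ card E)) \<longlonglongrightarrow> (\<Sum>T\<in>Pow E. \<bar>b T - b T\<bar> * K ^ card E)"
   by (intro tendsto_intros lim) auto
  then have "(\<lambda>n. (\<Sum>T\<in>Pow E. \<bar>c n T - b T\<bar> * K ^ card E)) \<longlonglongrightarrow> 0" by simp
  then have "\<forall>\<^sub>F n in sequentially. (\<Sum>T\<in>Pow E. \<bar>c n T - b T\<bar> * K ^ card E) < \<beta>"
   using \<beta> by (rule order_tendstoD)
  then have "\<forall>\<^sub>F n in sequentially. y \<in> posR E (c n)"
  proof eventually_elim
   case (elim n)
   show ?case
   proof (rule path_into_posR [OF g s0, where u = "\<lambda>_. 1"])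
    show "(\<lambda>k. y k + s0 * 1) \<in> nnR E (c n)"
    proof (rule orthant_nnR)
     show "0 <= y k + s0 * 1" if "k \<in> E" for k using yk [OF that] by linarith
    qed (rule gardD(2) [OF g])
    fix s assume s: "0 <= s" "s <= s0"
    define z where "z = (\<lambda>k. y k + s * 1)"
    have zK: "\<bar>z k\<bar> <= K" if "k \<in> E" for k using yk [OF that] s by (simp add: z_def K_def)
    have "\<beta> <= ma E b z"
     unfolding \<beta>_def z_def using fin ynn s by (intro ma_le_add) auto
    moreover have "\<bar>ma E (c n) z - ma E b z\<bar> <= (\<Sum>T\<in>Pow E. \<bar>c n T - b T\<bar> * K ^ card E)"
    proof -
     have "ma E (c n) z - ma E b z = (\<Sum>T\<in>Pow E. (c n T - b T) * prod z T)"
      by (simp add: ma_def sum_subtractf left_diff_distrib)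
     also have "\<bar>\<dots>\<bar> <= (\<Sum>T\<in>Pow E. \<bar>(c n T - b T) * prod z T\<bar>)" by (rule sum_abs)
     also have "\<dots> <= (\<Sum>T\<in>Pow E. \<bar>c n T - b T\<bar> * K ^ card E)"
     proof (rule sum_mono)
      fix T assume "T \<in> Pow E"
      then have "\<bar>prod z T\<bar> <= K ^ card E" using fin zK s0 by (intro prod_abs_le_power) (auto simp: K_def)
      then show "\<bar>(c n T - b T) * prod z T\<bar> <= \<bar>c n T - b T\<bar> * K ^ card E"
       unfolding abs_mult by (intro mult_left_mono) auto
     qed
     finally show ?thesis .
    qed
    ultimately show "0 < ma E (c n) (\<lambda>k. y k + s * 1)" using elim by (simp add: z_def)
   qed
  qed
  then have "\<forall>\<^sub>F n in sequentially. ma E (c n) y * pd E (c n) {e} (\<lambda>k. y k + 1)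
    <= ma E (c n) (\<lambda>k. y k + 1) * pd E (c n) {e} y"
  proof eventually_elim
   case (elim n)
   define A where "A = ma (E - {e}) (c n)"
   define B where "B = pd E (c n) {e}"
   have fAB: "ma E (c n) z = A z + z e * B z" for z
    using ma_split [OF fin eE] by (simp add: A_def B_def)
   have yl: "y \<in> nnR (E - {e}) (link (c n) {e})"
    using elim eE by (intro nnR_link posR_subset_nnR) auto
   have "(\<lambda>k. y k + 1) \<in> posR E (c n)" using elim fin by (intro posR_add) auto
   then have "0 < B (\<lambda>k. y k + 1)" "0 < B y" using elim eE posR_D [of _ E "c n" "{e}"] by (auto simp: B_def)
   then have "0 <= B (\<lambda>k. y k + 1) * B y" by simp
   moreover have "A y * B (\<lambda>k. y k + 1) <= A (\<lambda>k. y k + 1) * B y"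
    unfolding A_def B_def by (intro ratio_mono [OF g eE yl]) auto
   ultimately show ?case unfolding fAB B_def [symmetric] by (simp add: algebra_simps)
  qed
  then have "ma E b y * pd E b {e} (\<lambda>k. y k + 1) <= ma E b (\<lambda>k. y k + 1) * pd E b {e} y"
   using eE by (intro tendsto_le [OF _ tendsto_mult [OF limm limp] tendsto_mult [OF limm limp]]) auto
  then show ?thesis by (simp add: y_def)
 qed
 have ev: "\<forall>\<^sub>F t in at_right (0::real). ma E b (\<lambda>k. x k + t) * pd E b {e} (\<lambda>k. x k + t + 1)
   <= ma E b (\<lambda>k. x k + t + 1) * pd E b {e} (\<lambda>k. x k + t)"
  using eventually_at_right_less [of 0] by eventually_elim (rule key)
 have "ma E b x * pd E b {e} (\<lambda>k. x k + 1) <= ma E b (\<lambda>k. x k + 1) * pd E b {e} x"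
  by (rule tendsto_le [OF _ _ _ ev]) (auto intro!: tendsto_intros)
 moreover have "0 < pd E b {e} (\<lambda>k. x k + 1)"
  using fin nn x e by (intro nnR_shift_pos [of E b x "{e}" U]) auto
 ultimately have "pd E b {e} x ~= 0" using pos by (auto simp: mult_le_0_iff)
 then show ?thesis using nnR_D [OF x, of "{e}"] eE by auto
qed

lemma wgard_limit_pd:
 fixes c :: "nat => 'a set => real"
 assumes "finite T" "\<forall>n. gard E (c n)" "\<forall>T. T \<subseteq> E --> (\<lambda>n. c n T) \<longlonglongrightarrow> b T"
  "x \<in> nnR E b" "0 < ma E b x" "T \<subseteq> U" "U \<subseteq> E" "0 < b U"
 shows "0 < pd E b T x"
 using assms
proof (induction T arbitrary: E b c U rule: finite_induct)
 case (insert e T)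
 have e1: "0 < pd E b {e} x" using insert.prems by (intro wgard_limit_step [of E c b x e U]) auto
 have eE: "e \<in> E" using insert.prems by auto
 have "0 < pd (E - {e}) (link b {e}) T x"
 proof (rule insert.IH)
  show "x \<in> nnR (E - {e}) (link b {e})" using insert.prems(3) eE by (intro nnR_link) auto
  show "0 < ma (E - {e}) (link b {e}) x" using e1 by (simp add: ma_link)
  show "T \<subseteq> U - {e}" "U - {e} \<subseteq> E - {e}" using insert by auto
  have "U - {e} \<union> {e} = U" using insert.prems(5) by auto
  then show "0 < link b {e} (U - {e})" using insert.prems(7) by (simp only: link_apply)
  show "\<forall>n. gard (E - {e}) (link (c n) {e})" using insert.prems(1) eE by (intro allI gard_link1) auto
  show "\<forall>S. S \<subseteq> E - {e} --> (\<lambda>n. link (c n) {e} S) \<longlonglongrightarrow> link b {e} S"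
  proof (intro allI impI)
   fix S assume "S \<subseteq> E - {e}"
   then have "S \<union> {e} \<subseteq> E" using eE by auto
   then show "(\<lambda>n. link (c n) {e} S) \<longlonglongrightarrow> link b {e} S" unfolding link_def using insert.prems(2) by blast
  qed
 qed
 then show ?case by (simp add: pd_link)
qed simp

lemma wgard_limit:
 fixes c :: "nat => 'a set => real"
 assumes g: "\<And>n. gard E (c n)" and lim: "\<And>T. T \<subseteq> E ==> (\<lambda>n. c n T) \<longlonglongrightarrow> b T"
 shows "wgard E b"
 unfolding wgard_def
proof (intro conjI allI impI ballI)
 show fin: "finite E" using g [of 0] by (rule gardD)
 show "0 <= b T" if "T \<subseteq> E" for T
  using lim [OF that] gardD(2) [OF g that] by (intro LIMSEQ_le_const) auto
 fix x T U assume *: "x \<in> nnR E b" "0 < ma E b x" "T \<subseteq> U" "U \<subseteq> E" "0 < b U"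
 have "finite T" using *(3,4) fin by (meson finite_subset)
 then show "0 < pd E b T x" by (rule wgard_limit_pd) (use g lim * in auto)
qed

section \<open>Comparison with the topological definition\<close>

lemma closure_pos_orthant_nonneg:
 assumes "v \<in> closure (pos_orthant E)" "e \<in> E"
 shows "0 <= v e"
proof -
 have "closed {v :: 'a => real. 0 <= v e}"
  by (intro closed_Collect_le continuous_on_product_coordinates continuous_on_const)
 moreover have "pos_orthant E \<subseteq> {v. 0 <= v e}" using assms(2) by (force simp: pos_orthant_def PiE_iff)
 ultimately show ?thesis using assms(1) closure_minimal [of "pos_orthant E" "{v. 0 <= v e}"] by auto
qed

lemma continuous_on_affine_path:
 fixes x w :: "'a => real"
 shows "continuous_on S (\<lambda>t::real. \<lambda>e\<in>E. x e + t * w e)"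
proof (rule continuous_on_coordinatewise_then_product)
 show "continuous_on S (\<lambda>t. (\<lambda>e\<in>E. x e + t * w e) e)" for e
  by (cases "e \<in> E") (auto intro!: continuous_intros)
qed

text \<open>
 A vector with vanishing entries is the limit of the vectors shifted by a small positive constant.
\<close>

lemma in_closure_pos_orthant:
 assumes "v \<in> E \<rightarrow>\<^sub>E {0..}"
 shows "v \<in> closure (pos_orthant E)"
proof -
 define f where "f = (\<lambda>t::real. \<lambda>e\<in>E. v e + t * 1)"
 have "f ` {0<..} \<subseteq> closure (pos_orthant E)"
 proof -
  have "f t \<in> pos_orthant E" if "0 < t" for t
   unfolding pos_orthant_def f_def
  proof (rule restrict_PiE_iff [THEN iffD2], intro ballI)
   fix e assume "e \<in> E"
   then have "0 <= v e" using assms by auto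
   then show "v e + t * 1 \<in> {0<..}" using that by simp
  qed
  then show ?thesis using closure_subset by blast
 qed
 then have "f ` closure {0<..} \<subseteq> closure (pos_orthant E)"
  unfolding f_def by (intro image_closure_subset continuous_on_affine_path closed_closure)
 moreover have "f 0 = v" using assms by (auto simp: f_def fun_eq_iff restrict_def PiE_def extensional_def)
 moreover have "(0::real) \<in> closure {0<..}" by simp
 ultimately show ?thesis by blast
qed

lemma segment_connected_component:
 assumes "\<And>t. 0 <= t ==> t <= 1 ==> (\<lambda>e\<in>E. x e + t * w e) \<in> S"
 shows "connected_component S (\<lambda>e\<in>E. x e) (\<lambda>e\<in>E. x e + w e :: real)"
proof -
 define p where "p = (\<lambda>t::real. \<lambda>e\<in>E. x e + t * w e)"
 have "connected (p ` {0..1})" unfolding p_def by (intro connected_continuous_image continuous_on_affine_path) simp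
 moreover have "p ` {0..1} \<subseteq> S" using assms by (auto simp: p_def)
 moreover have "p 0 \<in> p ` {0..1}" "p 1 \<in> p ` {0..1}" by auto
 ultimately have "connected_component S (p 0) (p 1)" by (auto simp: connected_component_def)
 then show ?thesis by (simp add: p_def)
qed

lemma nnR_restrict_add:
 assumes "finite E" "x \<in> nnR E c" "\<And>e. e \<in> E ==> 0 <= w e"
 shows "(\<lambda>e\<in>E. x e + w e) \<in> nnR E c" "ma E c x <= ma E c (\<lambda>e\<in>E. x e + w e)"
proof -
 have "(\<lambda>e. x e + w e) \<in> nnR E c" using assms by (intro nnR_add) auto
 then show "(\<lambda>e\<in>E. x e + w e) \<in> nnR E c" by (subst nnR_cong [where y = "\<lambda>e. x e + w e" and d = c]) auto
 have "ma E c x <= ma E c (\<lambda>e. x e + w e)" using assms by (intro ma_le_add) auto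
 also have "\<dots> = ma E c (\<lambda>e\<in>E. x e + w e)" by (intro ma_cong) auto
 finally show "ma E c x <= ma E c (\<lambda>e\<in>E. x e + w e)" .
qed

lemma continuous_on_pd_fun: "continuous_on UNIV (pd E c T :: ('a => real) => real)"
 by (rule continuous_on_pd) (rule continuous_on_product_coordinates)

text \<open>
 The set of points of \<open>nnR\<close> with positive value is closed in \<open>{f > 0}\<close>, open by the positivity of the relevant
 derivatives, and connected through the orthant, so it is a component; it passes the ray test by Taylor expansion.
\<close>

lemma garding_of_wgard:
 assumes g: "wgard E c" and U: "U \<subseteq> E" "0 < c U" and f: "\<And>x. x \<in> real_space E ==> f x = ma E c x"
 shows "garding E f"
proof -
 have fin: "finite E" and nn: "\<And>T. T \<subseteq> E ==> 0 <= c T"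
  and wg: "\<And>x T U. x \<in> nnR E c ==> 0 < ma E c x ==> T \<subseteq> U ==> U \<subseteq> E ==> 0 < c U ==> 0 < pd E c T x"
  using g by (auto simp: wgard_def)
 define S where "S = {x \<in> real_space E. 0 < f x}"
 define Q where "Q = S \<inter> nnR E c"
 define D where "D = {T. T \<subseteq> E & (\<exists>U. T \<subseteq> U & U \<subseteq> E & 0 < c U)}"
 have finD: "finite D" unfolding D_def using fin by auto
 have S: "x \<in> S \<longleftrightarrow> x \<in> real_space E & 0 < ma E c x" for x using f by (auto simp: S_def)
 have notD: "pd E c T x = 0" if "T \<subseteq> E" "T \<notin> D" for T x
  unfolding pd_def ma_def
 proof (intro sum.neutral ballI)
  fix V assume "V \<in> Pow (E - T)"
  then have V: "T \<subseteq> V \<union> T" "V \<union> T \<subseteq> E" using that by auto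
  then have "\<not> 0 < c (V \<union> T)" using that by (auto simp: D_def)
  then have "c (V \<union> T) = 0" using nn [OF V(2)] by simp
  then show "link c T V * prod x V = 0" by (simp add: link_def)
 qed
 have nnR_D_eq: "nnR E c = {x. \<forall>T\<in>D. 0 <= pd E c T x}"
 proof (intro set_eqI iffI)
  fix x assume "x \<in> {x. \<forall>T\<in>D. 0 <= pd E c T x}"
  then have "0 <= pd E c T x" if "T \<subseteq> E" for T using notD [OF that] by (cases "T \<in> D") auto
  then show "x \<in> nnR E c" by (simp add: nnR_def)
 qed (auto simp: nnR_def D_def)
 have QD: "x \<in> Q \<longleftrightarrow> x \<in> S & (\<forall>T\<in>D. 0 < pd E c T x)" for x
  using wg [of x] by (auto simp: Q_def S nnR_D_eq D_def less_imp_le)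
 have closed: "closed (nnR E c)"
 proof -
  have "nnR E c = (\<Inter>T\<in>D. {x. 0 <= pd E c T x})" by (auto simp: nnR_D_eq)
  then show ?thesis
   by (auto intro!: closed_INT closed_Collect_le continuous_on_pd_fun continuous_on_const)
 qed
 have opn: "open {x. \<forall>T\<in>D. 0 < pd E c T x}"
 proof -
  have "{x. \<forall>T\<in>D. 0 < pd E c T x} = (\<Inter>T\<in>D. {x. 0 < pd E c T x})" by auto
  then show ?thesis using finD
   by (auto intro!: open_INT open_Collect_less continuous_on_pd_fun continuous_on_const)
 qed
 have up: "(\<lambda>e\<in>E. x e + w e) \<in> Q" if "x \<in> Q" "\<And>e. e \<in> E ==> 0 <= w e" for x w
  using that nnR_restrict_add [OF fin, of x c w] by (auto simp: Q_def S real_space_def)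
 have Q_path: "connected_component Q x (\<lambda>e\<in>E. x e + w e)" if "x \<in> Q" "\<And>e. e \<in> E ==> 0 <= w e" for x w
 proof -
  have "(\<lambda>e\<in>E. x e) = x" using that(1) by (auto simp: Q_def S real_space_def)
  moreover have "connected_component Q (\<lambda>e\<in>E. x e) (\<lambda>e\<in>E. x e + w e)"
   using that by (intro segment_connected_component up) auto
  ultimately show ?thesis by simp
 qed
 have conn: "connected Q"
  unfolding connected_iff_connected_component
 proof (intro ballI)
  fix x y assume xy: "x \<in> Q" "y \<in> Q"
  have eq: "(\<lambda>e\<in>E. x e + (max (x e) (y e) - x e)) = (\<lambda>e\<in>E. y e + (max (x e) (y e) - y e))"
   by (auto simp: restrict_def)
  have "connected_component Q x (\<lambda>e\<in>E. x e + (max (x e) (y e) - x e))"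
   by (rule Q_path [OF xy(1)]) simp
  moreover have "connected_component Q y (\<lambda>e\<in>E. y e + (max (x e) (y e) - y e))"
   by (rule Q_path [OF xy(2)]) simp
  ultimately show "connected_component Q x y" unfolding eq
   by (meson connected_component_sym connected_component_trans)
 qed
 define one where "one = (\<lambda>e\<in>E. 1 :: real)"
 have "c U * prod one (U - {}) <= pd E c {} one"
  using fin nn U by (intro pd_orthant_ge) (auto simp: one_def)
 moreover have "prod one U = (\<Prod>e\<in>U. 1)" using U by (intro prod.cong) (auto simp: one_def)
 ultimately have "0 < ma E c one" using U by simp
 moreover have "one \<in> nnR E c" using nn by (intro orthant_nnR) (auto simp: one_def)
 moreover have one_rs: "one \<in> real_space E" by (simp add: one_def real_space_def)
 ultimately have one: "one \<in> Q" by (simp add: Q_def S)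
 have comp: "Q \<in> components S"
  unfolding in_components_maximal
 proof (intro conjI allI impI)
  show "Q ~= {}" "Q \<subseteq> S" using one by (auto simp: Q_def)
  show "connected Q" by (rule conn)
  fix d assume d: "d ~= {} & Q \<subseteq> d & d \<subseteq> S & connected d"
  have "Q = d \<inter> nnR E c" using d by (auto simp: Q_def)
  then have "closedin (top_of_set d) Q" using closed by (auto simp: closedin_closed)
  moreover have "Q = d \<inter> {x. \<forall>T\<in>D. 0 < pd E c T x}" using d QD by auto
  then have "openin (top_of_set d) Q" using opn by (auto simp: openin_open)
  ultimately have "Q = {} \<or> Q = d" using d by (auto simp: connected_clopen)
  then show "d = Q" using one by auto
 qed
 have prt: "passes_PRT E Q"
  unfolding passes_PRT_def using closure_pos_orthant_nonneg by (intro ballI up) auto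
 show ?thesis unfolding garding_def
 proof (intro conjI)
  show "multi_affine E f"
   unfolding multi_affine_def multi_affine_with_def using fin f by (intro exI [of _ c]) (auto simp: ma_def)
  show "\<exists>x\<in>real_space E. f x ~= 0" using one one_rs by (intro bexI [of _ one]) (auto simp: Q_def S_def)
  show "\<exists>R\<in>components {x \<in> real_space E. 0 < f x}. R ~= {} & passes_PRT E R"
   using comp prt one unfolding S_def by blast
 qed
qed

text \<open>
 On the given component all derivatives are non-negative by \<open>leading_coeff_nonneg\<close>. A point of
 \<open>nnR\<close> with positive value is joined to the component by a ray of the orthant, and the component is
 open, which makes the derivatives positive.
\<close>

lemma gard_of_garding:
 assumes g: "garding E f" and fin: "finite E" and nn: "\<And>T. T \<subseteq> E ==> 0 <= c T" and top: "0 < c E"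
  and f: "\<And>x. x \<in> real_space E ==> f x = ma E c x"
 shows "gard E c"
proof -
 define S where "S = {x \<in> real_space E. 0 < f x}"
 have S: "x \<in> S \<longleftrightarrow> x \<in> real_space E & 0 < ma E c x" for x using f by (auto simp: S_def)
 obtain R where R: "R \<in> components S" "R ~= {}" "passes_PRT E R"
  using g by (auto simp: garding_def S_def)
 have RS: "R \<subseteq> S" using R(1) by (rule in_components_subset)
 have prt: "(\<lambda>e\<in>E. r e + v e) \<in> R" if "r \<in> R" "\<And>e. e \<in> E ==> 0 <= v e" for r v
 proof -
  have "(\<lambda>e\<in>E. v e) \<in> closure (pos_orthant E)" using that(2) by (intro in_closure_pos_orthant) auto
  then have "(\<lambda>e\<in>E. r e + (\<lambda>e\<in>E. v e) e) \<in> R" using R(3) that(1) unfolding passes_PRT_def by blast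
  moreover have "(\<lambda>e\<in>E. r e + (\<lambda>e\<in>E. v e) e) = (\<lambda>e\<in>E. r e + v e)" by (auto simp: restrict_def)
  ultimately show ?thesis by simp
 qed
 have conn_R: "y \<in> R" if r: "r \<in> R" and cc: "connected_component S r y" for r y
 proof -
  obtain t where "connected t" "t \<subseteq> S" "r \<in> t" "y \<in> t"
   using cc unfolding connected_component_def by blast
  then show ?thesis using components_maximal [OF R(1), of t] r by blast
 qed
 have pdR: "0 <= pd E c T r" if r: "r \<in> R" and T: "T \<subseteq> E" for r T
 proof (rule leading_coeff_nonneg [where d = "\<lambda>V. pd E c V r"])
  show "finite T" using T fin finite_subset by auto
  fix t :: real assume t: "0 <= t"
  have "(\<lambda>e\<in>E. r e + (if e \<in> T then t else 0)) \<in> R" using t by (intro prt r) auto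
  then have "0 < ma E c (\<lambda>e\<in>E. r e + (if e \<in> T then t else 0))" using RS S by auto
  also have "\<dots> = ma E c (\<lambda>e. r e + (if e \<in> T then t else 0))" by (intro ma_cong) auto
  also have "\<dots> = (\<Sum>V\<in>Pow T. pd E c V r * t ^ card V)"
   using taylor_dir [OF fin, of T "{}" c r t] T by simp
  finally show "0 <= (\<Sum>V\<in>Pow T. pd E c V r * t ^ card V)" by simp
 qed
 have S_path: "connected_component S (\<lambda>e\<in>E. x e) (\<lambda>e\<in>E. x e + w e)"
  if x: "x \<in> nnR E c" "0 < ma E c x" and w: "\<And>e. e \<in> E ==> 0 <= w e" for x w
 proof (rule segment_connected_component)
  fix t :: real assume t: "0 <= t"
  have "ma E c x <= ma E c (\<lambda>e\<in>E. x e + t * w e)"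
   using w t by (intro nnR_restrict_add(2) [OF fin x(1)]) auto
  then show "(\<lambda>e\<in>E. x e + t * w e) \<in> S" using x(2) by (auto simp: S real_space_def)
 qed
 have in_R: "(\<lambda>e\<in>E. x e) \<in> R" if x: "x \<in> nnR E c" "0 < ma E c x" for x
 proof -
  obtain r where r: "r \<in> R" using R(2) by auto
  define q where "q = (\<lambda>e\<in>E. r e + (\<bar>r e\<bar> + 1))"
  have qR: "q \<in> R" unfolding q_def by (intro prt r) auto
  have qpos: "0 < q e" if "e \<in> E" for e using that by (simp add: q_def)
  have qnn: "q \<in> nnR E c" using qpos nn by (intro orthant_nnR) (auto simp: less_imp_le)
  have qma: "0 < ma E c q" using qR RS S by auto
  have q_eq: "(\<lambda>e\<in>E. q e) = q" by (auto simp: q_def)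
  have eq: "(\<lambda>e\<in>E. x e + (max (x e) (q e) - x e)) = (\<lambda>e\<in>E. q e + (max (x e) (q e) - q e))"
   by (auto simp: restrict_def)
  have "connected_component S (\<lambda>e\<in>E. x e) (\<lambda>e\<in>E. x e + (max (x e) (q e) - x e))"
   using x by (intro S_path) auto
  moreover have "connected_component S (\<lambda>e\<in>E. q e) (\<lambda>e\<in>E. q e + (max (x e) (q e) - q e))"
   using qnn qma by (intro S_path) auto
  ultimately have "connected_component S q (\<lambda>e\<in>E. x e)" unfolding eq q_eq
   by (meson connected_component_sym connected_component_trans)
  then show ?thesis using conn_R [OF qR] by simp
 qed
 show ?thesis unfolding gard_def
 proof (intro conjI ballI impI)
  fix x assume x: "x \<in> nnR E c" and pos: "0 < ma E c x"
  show "x \<in> posR E c" unfolding posR_def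
  proof (intro CollectI allI impI)
   fix T assume T: "T \<subseteq> E"
   show "0 < pd E c T x"
   proof (rule ccontr)
    assume "\<not> 0 < pd E c T x"
    define P where "P n \<longleftrightarrow> (\<exists>W\<subseteq>E - T. card W = n & 0 < pd E c (T \<union> W) x)" for n
    have "T \<union> (E - T) = E" using T by auto
    then have "P (card (E - T))" unfolding P_def using top by (intro exI [of _ "E - T"]) (auto simp: pd_top)
    then have P: "P (LEAST n. P n)" by (rule LeastI)
    then obtain W where W: "W \<subseteq> E - T" "card W = (LEAST n. P n)" "0 < pd E c (T \<union> W) x"
     unfolding P_def by blast
    have finW: "finite W" using W(1) fin finite_subset by auto
    have zero: "pd E c (T \<union> V) x = 0" if V: "V \<subset> W" for V
    proof -
     have "card V < (LEAST n. P n)" using psubset_card_mono [OF finW V] W(2) by simp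
     then have "\<not> P (card V)" by (rule not_less_Least)
     moreover have "V \<subseteq> E - T" using V W(1) by auto
     ultimately have "\<not> 0 < pd E c (T \<union> V) x" unfolding P_def by blast
     moreover have "T \<union> V \<subseteq> E" using V W(1) T by auto
     then have "0 <= pd E c (T \<union> V) x" by (rule nnR_D [OF x])
     ultimately show ?thesis by linarith
    qed
    have "W ~= {}" using W(3) \<open>\<not> 0 < pd E c T x\<close> by auto
    then obtain k where k: "k \<in> W" by auto
    define v where "v e = (if e = k then -1 else if e \<in> W then 1 else 0 :: real)" for e
    define y where "y t = (\<lambda>e. x e + t * v e)" for t :: real
    have neg: "pd E c T (y t) < 0" if t: "0 < t" for t
    proof -
     have "pd E c T (y t) = (\<Sum>V\<in>Pow (E - T). pd E c (T \<union> V) x * (\<Prod>e\<in>V. t * v e))"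
      unfolding y_def by (rule taylor_pd [OF fin])
     also have "\<dots> = (\<Sum>V\<in>{W}. pd E c (T \<union> V) x * (\<Prod>e\<in>V. t * v e))"
     proof (rule sum.mono_neutral_right)
      show "\<forall>V\<in>Pow (E - T) - {W}. pd E c (T \<union> V) x * (\<Prod>e\<in>V. t * v e) = 0"
      proof
       fix V assume V: "V \<in> Pow (E - T) - {W}"
       show "pd E c (T \<union> V) x * (\<Prod>e\<in>V. t * v e) = 0"
       proof (cases "V \<subseteq> W")
        case True
        then have "V \<subset> W" using V by auto
        then show ?thesis using zero by simp
       next
        case False
        then obtain e where "e \<in> V" "e \<notin> W" by auto
        moreover have "finite V" using V fin finite_subset [of V E] by auto
        ultimately have "(\<Prod>e\<in>V. t * v e) = 0" using k by (intro prod_zero) (auto simp: v_def)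
        then show ?thesis by simp
       qed
      qed
     qed (use fin W in auto)
     also have "\<dots> = pd E c (T \<union> W) x * ((t * v k) * (\<Prod>e\<in>W - {k}. t * v e))"
      using finW k by (simp add: prod.remove)
     also have "(\<Prod>e\<in>W - {k}. t * v e) = (\<Prod>e\<in>W - {k}. t)" by (intro prod.cong) (auto simp: v_def)
     finally have "pd E c T (y t) = - (pd E c (T \<union> W) x * (t * t ^ card (W - {k})))"
      by (simp add: v_def)
     then show ?thesis using W(3) t by simp
    qed
    have "((\<lambda>t. ma E c (y t)) \<longlongrightarrow> ma E c (y 0)) (at 0)"
     unfolding y_def by (intro tendsto_intros)
    moreover have y0: "y 0 = x" by (simp add: y_def)
    ultimately have "\<forall>\<^sub>F t in at 0. 0 < ma E c (y t)" using pos by (intro order_tendstoD) auto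
    then obtain \<delta> where \<delta>: "0 < \<delta>" "\<And>t. t ~= 0 ==> \<bar>t\<bar> < \<delta> ==> 0 < ma E c (y t)"
     unfolding eventually_at by (auto simp: dist_real_def)
    define s where "s = \<delta> / 2"
    have s: "0 < s" "s < \<delta>" using \<delta>(1) by (auto simp: s_def)
    have ypos: "0 < ma E c (y t)" if "0 <= t" "t <= s" for t
     using \<delta>(2) [of t] that s pos y0 by (cases "t = 0") auto
    have "connected_component S (\<lambda>e\<in>E. x e) (\<lambda>e\<in>E. x e + s * v e)"
    proof (rule segment_connected_component)
     fix t :: real assume t: "0 <= t" "t <= 1"
     have "0 < ma E c (y (t * s))" using t s by (intro ypos) (auto simp: mult_left_le_one_le)
     also have "\<dots> = ma E c (\<lambda>e\<in>E. x e + t * (s * v e))" by (intro ma_cong) (auto simp: y_def)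
     finally show "(\<lambda>e\<in>E. x e + t * (s * v e)) \<in> S" by (auto simp: S real_space_def)
    qed
    then have "(\<lambda>e\<in>E. x e + s * v e) \<in> R" using conn_R [OF in_R [OF x pos]] by simp
    then have "0 <= pd E c T (\<lambda>e\<in>E. x e + s * v e)" using pdR T by simp
    also have "\<dots> = pd E c T (y s)" using T by (intro pd_cong) (auto simp: y_def)
    finally show False using neg [OF s(1)] by simp
   qed
  qed
 qed (use fin nn top in auto)
qed

lemma garding_iff_gard:
 assumes "finite E" "\<And>T. T \<subseteq> E ==> 0 <= c T" "0 < c E" "\<And>x. x \<in> real_space E ==> f x = ma E c x"
 shows "garding E f \<longleftrightarrow> gard E c"
 using gard_of_garding [of E f c] garding_of_wgard [OF gard_imp_wgard, of E c E f] assms by auto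

section \<open>Uniform matroids\<close>

text \<open>
 Spanning sets of the uniform matroid of rank \<open>k\<close>.
\<close>

definition uc :: "nat => 'a set => real" where
 "uc k T = (if k <= card T then 1 else 0)"

definition us :: "nat => 'a set => ('a => real) => real" where
 "us k F x = ma F (uc k) x"

definition negsum :: "'a set => ('a => real) => nat => real" where
 "negsum F x n = (\<Sum>h | h \<in> F & x h < 0. (- x h) ^ n)"

text \<open>
 A strengthening of the criterion on the zero set: not only is the polynomial of the next rank non-positive
 there, but by an amount controlled by the negative coordinates. The surplus is what lets the smoothing induction close.
\<close>

definition neg_bound :: "'a set => nat => bool" where
 "neg_bound F s \<longleftrightarrow> (\<forall>x. finite F --> s <= card F --> x \<in> nnR F (uc s) --> us s F x = 0 -->
   (real s + 1) * us (s + 1) F x + negsum F x (s + 1) <= 0)"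

lemma negsum_nonneg: "0 <= negsum F x n"
 unfolding negsum_def by (intro sum_nonneg zero_le_power) auto

lemma uc_bounds [simp]: "0 <= uc k T" "uc k T <= 1"
 by (simp_all add: uc_def)

lemma link_uc: "finite T ==> finite S ==> S \<inter> T = {} ==> link (uc k) S T = uc (k - card S) T"
 by (auto simp: link_def uc_def card_Un_disjoint Int_commute)

lemma pd_uc:
 assumes "finite F" "T \<subseteq> F"
 shows "pd F (uc k) T x = us (k - card T) (F - T) x"
 unfolding pd_def us_def
proof (rule ma_cong [OF _ refl])
 fix U assume "U \<subseteq> F - T"
 then show "link (uc k) T U = uc (k - card T) U"
  using assms by (intro link_uc) (auto intro: finite_subset)
qed

lemma link_uc_cong:
 assumes "finite F" "S \<subseteq> F"
 shows "gard (F - S) (link (uc k) S) \<longleftrightarrow> gard (F - S) (uc (k - card S))"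
  "x \<in> posR (F - S) (link (uc k) S) \<longleftrightarrow> x \<in> posR (F - S) (uc (k - card S))"
  "x \<in> nnR (F - S) (link (uc k) S) \<longleftrightarrow> x \<in> nnR (F - S) (uc (k - card S))"
proof -
 have "link (uc k) S T = uc (k - card S) T" if "T \<subseteq> F - S" for T
  using assms that by (intro link_uc) (auto intro: finite_subset)
 note l = this
 show "gard (F - S) (link (uc k) S) \<longleftrightarrow> gard (F - S) (uc (k - card S))" by (rule gard_cong) (rule l)
 show "x \<in> posR (F - S) (link (uc k) S) \<longleftrightarrow> x \<in> posR (F - S) (uc (k - card S))"
  by (rule posR_coeff_cong) (rule l)
 show "x \<in> nnR (F - S) (link (uc k) S) \<longleftrightarrow> x \<in> nnR (F - S) (uc (k - card S))"
  by (rule nnR_coeff_cong) (rule l)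
qed

lemma us_insert:
 assumes "finite F" "e \<notin> F"
 shows "us k (insert e F) x = us k F x + x e * us (k - 1) F x"
 using ma_insert [OF assms, of "uc k" x] pd_uc [of "insert e F" "{e}" k x] assms
 by (simp add: us_def pd_def)

lemma us_split:
 assumes "finite F" "e \<in> F"
 shows "us k F x = us k (F - {e}) x + x e * us (k - 1) (F - {e}) x"
 using us_insert [of "F - {e}" e k x] assms by (simp add: insert_absorb)

lemma us_cong: "(\<And>e. e \<in> F ==> x e = y e) ==> us k F x = us k F y"
 unfolding us_def by (rule ma_cong) auto

lemma us_upd: "h \<notin> F ==> us k F (x(h := t)) = us k F x"
 by (rule us_cong) auto

lemma us_0: "finite F ==> us 0 F x = (\<Prod>e\<in>F. 1 + x e)"
proof (induction F rule: finite_induct)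
 case (insert e F)
 then show ?case by (simp add: us_insert algebra_simps)
qed (simp add: us_def uc_def)

lemma us_1: "finite F ==> us (Suc 0) F x = us 0 F x - 1"
proof (induction F rule: finite_induct)
 case (insert e F)
 then show ?case by (simp add: us_insert algebra_simps)
qed (simp add: us_def uc_def)

lemma us_mono:
 assumes "\<And>e. e \<in> F ==> 0 <= x e" shows "us (Suc k) F x <= us k F x"
 unfolding us_def ma_def
 using assms by (intro sum_mono mult_right_mono prod_nonneg) (auto simp: uc_def)

lemma nnR_uc_D:
 assumes "finite F" "x \<in> nnR F (uc s)" "T \<subseteq> F"
 shows "0 <= us (s - card T) (F - T) x"
 using nnR_D [OF assms(2,3)] pd_uc [OF assms(1,3), of s x] by simp

lemma nnR_delete_nonpos:
 assumes fin: "finite F" and h: "h \<in> F" "x h <= 0" and x: "x \<in> nnR F c"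
 shows "x \<in> nnR (F - {h}) c"
 unfolding nnR_def
proof (intro CollectI allI impI)
 fix T assume T: "T \<subseteq> F - {h}"
 have "pd F c T x = pd (F - {h}) c T x + x h * pd F c (insert h T) x"
  using fin h T by (intro pd_split) auto
 moreover have "0 <= pd F c T x" "0 <= pd F c (insert h T) x" using T h by (auto intro!: nnR_D [OF x])
 moreover have "x h * pd F c (insert h T) x <= 0" using calculation h by (simp add: mult_nonpos_nonneg)
 ultimately show "0 <= pd (F - {h}) c T x" by linarith
qed

lemma gard_uc_0: "finite F ==> gard F (uc 0)"
 unfolding gard_def
proof (intro conjI ballI impI allI)
 fix x assume F: "finite F" and x: "x \<in> nnR F (uc 0)" and p: "0 < ma F (uc 0) x"
 have 1: "0 <= 1 + x e" if "e \<in> F" for e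
 proof -
  have "F - (F - {e}) = {e}" using that by auto
  then show ?thesis using nnR_uc_D [OF F x, of "F - {e}"] that by (simp add: us_0)
 qed
 have "0 < (\<Prod>e\<in>F. 1 + x e)" using p us_0 [OF F, of x] by (simp add: us_def)
 then have ne: "1 + x e ~= 0" if "e \<in> F" for e using that F by (metis less_irrefl prod_zero_iff)
 have "0 < 1 + x e" if "e \<in> F" for e using 1 [OF that] ne [OF that] by linarith
 then show "x \<in> posR F (uc 0)"
  unfolding posR_def using F by (auto simp: pd_uc us_0 intro!: prod_pos)
qed (auto simp: uc_def)

text \<open>
 Adding one variable at a time, \<open>gard_criterion\<close> asks exactly for the sign in \<open>neg_bound\<close>.
\<close>

lemma gard_uc_if:
 fixes F :: "'a set"
 assumes "\<And>k G. 1 <= k ==> k < s ==> neg_bound (G :: 'a set) k" "finite F" "s <= card F"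
 shows "gard F (uc s)"
 using assms
proof (induction s arbitrary: F)
 case 0 then show ?case by (simp add: gard_uc_0)
next
 case (Suc s)
 then obtain e where e: "e \<in> F" by fastforce
 have F: "finite F" using Suc by simp
 have c: "s <= card (F - {e})" using Suc.prems e by simp
 show ?case
 proof (rule gard_criterion [OF F e])
  have "gard (F - {e}) (uc s)" using Suc.prems c by (intro Suc.IH) auto
  then show "gard (F - {e}) (link (uc (Suc s)) {e})" using link_uc_cong(1) [of F "{e}" "Suc s"] F e by simp
  fix x assume "x \<in> nnR (F - {e}) (link (uc (Suc s)) {e})" "pd F (uc (Suc s)) {e} x = 0"
  then have x: "x \<in> nnR (F - {e}) (uc s)" and z: "us s (F - {e}) x = 0"
   using link_uc_cong(3) [of F "{e}" x "Suc s"] pd_uc [of F "{e}" "Suc s" x] F e by auto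
  show "ma (F - {e}) (uc (Suc s)) x <= 0"
  proof (cases "s = 0")
   case True
   then show ?thesis using us_1 [of "F - {e}" x] z F by (simp add: us_def)
  next
   case False
   then have "neg_bound (F - {e}) s" using Suc.prems(1) [of s "F - {e}"] by simp
   then have "(real s + 1) * us (s + 1) (F - {e}) x + negsum (F - {e}) x (s + 1) <= 0"
    using F c x z by (simp add: neg_bound_def)
   moreover have "0 <= negsum (F - {e}) x (s + 1)" by (rule negsum_nonneg)
   ultimately have "(real s + 1) * us (s + 1) (F - {e}) x <= 0" by linarith
   then show ?thesis by (simp add: us_def mult_le_0_iff)
  qed
 qed simp
qed

lemma neg_bound_D:
 assumes "neg_bound F s" "finite F" "s <= card F" "x \<in> nnR F (uc s)" "us s F x = 0"
 shows "us (s + 1) F x <= 0" "(real s + 1) * us (s + 1) F x + negsum F x (s + 1) <= 0"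
proof -
 show 1: "(real s + 1) * us (s + 1) F x + negsum F x (s + 1) <= 0"
  using assms by (simp add: neg_bound_def)
 then have "(real s + 1) * us (s + 1) F x <= 0" using negsum_nonneg [of F x "s + 1"] by linarith
 then show "us (s + 1) F x <= 0" by (simp add: mult_le_0_iff)
qed

lemma posR_uc_down:
 fixes F :: "'a set"
 assumes nb: "\<And>k G. 1 <= k ==> k < s ==> neg_bound (G :: 'a set) k"
  and F: "finite F" "h \<in> F" "s <= card (F - {h})" and z: "z \<in> posR (F - {h}) (uc s)" and j: "j <= s"
 shows "z \<in> posR (F - {h}) (uc j)"
 using j
proof (induction "s - j" arbitrary: j)
 case 0 then show ?case using z by simp
next
 case (Suc d)
 then have "z \<in> posR (F - {h}) (uc (Suc j))" by (intro Suc.hyps(1)) auto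
 moreover have "gard F (uc (Suc j))" by (intro gard_uc_if nb) (use F Suc in auto)
 moreover have "0 < uc (Suc j) (F - {h})" using F Suc by (simp add: uc_def)
 ultimately have "z \<in> posR (F - {h}) (link (uc (Suc j)) {h})" using F by (intro posR_slice) auto
 then show ?case using link_uc_cong(2) [of F "{h}" z "Suc j"] F by simp
qed

lemma newton_uc:
 fixes F :: "'a set"
 assumes nb: "\<And>k G. 1 <= k ==> k < s ==> neg_bound (G :: 'a set) k"
  and F: "finite F" "h \<in> F" "s <= card (F - {h})" and z: "z \<in> posR (F - {h}) (uc s)" and k: "1 <= k" "k < s"
 shows "us (k + 1) (F - {h}) z * us (k - 1) (F - {h}) z <= (us k (F - {h}) z)\<^sup>2"
proof -
 have zk: "z \<in> posR (F - {h}) (uc (k - 1))" using posR_uc_down [OF nb F z] k by auto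
 then have pos: "0 < us (k - 1) (F - {h}) z" by (simp add: us_def posR_D0)
 define q where "q = us k (F - {h}) z / us (k - 1) (F - {h}) z"
 define y where "y = z(h := - q)"
 have hF: "h \<notin> F - {h}" by simp
 have y0: "us k F y = 0"
  unfolding us_split [OF F(1,2)] using pos by (simp add: y_def us_upd q_def)
 have "z \<in> posR (F - {h}) (link (uc k) {h})" using zk link_uc_cong(2) [of F "{h}" z k] F by simp
 then have "y \<in> posR (F - {h}) (link (uc k) {h})"
  by (subst posR_cong [where y = z and d = "link (uc k) {h}"]) (auto simp: y_def)
 moreover have "gard F (uc k)" by (intro gard_uc_if nb) (use k F in auto)
 ultimately have "y \<in> nnR F (uc k)" using F y0 by (intro nnR_fiber) (auto simp: us_def)
 moreover have "k <= card F" using k F by simp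
 ultimately have "us (k + 1) F y <= 0" using neg_bound_D [OF nb [OF k]] F y0 by blast
 then have "us (k + 1) (F - {h}) z - q * us k (F - {h}) z <= 0"
  unfolding us_split [OF F(1,2), of "k + 1"] by (simp add: y_def us_upd)
 then have "(us (k + 1) (F - {h}) z - q * us k (F - {h}) z) * us (k - 1) (F - {h}) z <= 0"
  using pos by (simp add: mult_le_0_iff)
 then show ?thesis using pos by (simp add: q_def power2_eq_square algebra_simps)
qed

text \<open>
 The Newton inequalities of \<open>newton_uc\<close> multiplied together, starting from \<open>us 0\<close>.
\<close>

lemma power_chain_uc:
 fixes F :: "'a set"
 assumes nb: "\<And>k G. 1 <= k ==> k < s ==> neg_bound (G :: 'a set) k"
  and F: "finite F" "h \<in> F" "s <= card (F - {h})" and z: "z \<in> nnR (F - {h}) (uc s)" and s: "1 <= s"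
 shows "us s (F - {h}) z ^ (s - 1) <= us (s - 1) (F - {h}) z ^ s"
proof -
 have strict: "us j (F - {h}) z ^ (j - 1) <= us (j - 1) (F - {h}) z ^ j"
  if z: "z \<in> posR (F - {h}) (uc s)" and j: "1 <= j" "j <= s" for z j
  using j
 proof (induction j rule: nat_induct_at_least)
  case base
  have "z \<in> posR (F - {h}) (uc 1)" using posR_uc_down [OF nb F z] s by auto
  then have "0 < us (Suc 0) (F - {h}) z" by (simp add: us_def posR_D0)
  then show ?case using us_1 [of "F - {h}" z] F by simp
 next
  case (Suc j)
  let ?u = "\<lambda>j. us j (F - {h}) z"
  have pos: "0 < ?u i" if "i <= s" for i
   using posR_uc_down [OF nb F z that] by (simp add: us_def posR_D0)
  have IH: "?u j ^ (j - 1) <= ?u (j - 1) ^ j" using Suc by simp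
  have "?u (j + 1) * ?u (j - 1) <= (?u j)\<^sup>2" using Suc by (intro newton_uc [OF nb F z]) auto
  then have "(?u (j + 1) * ?u (j - 1)) ^ j <= ((?u j)\<^sup>2) ^ j"
   using pos Suc by (intro power_mono) (auto simp: less_imp_le)
  moreover have "2 * j = j - 1 + Suc j" using Suc.hyps by simp
  then have "((?u j)\<^sup>2) ^ j = ?u j ^ (j - 1) * ?u j ^ Suc j"
   by (simp only: power_mult [symmetric] power_add [symmetric])
  ultimately have "?u (j + 1) ^ j * ?u (j - 1) ^ j <= ?u j ^ (j - 1) * ?u j ^ Suc j"
   by (simp only: power_mult_distrib)
  moreover have "?u (j + 1) ^ j * ?u j ^ (j - 1) <= ?u (j + 1) ^ j * ?u (j - 1) ^ j"
   using IH pos [of "j + 1"] Suc by (intro mult_left_mono) (auto simp: less_imp_le)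
  ultimately have "?u (j + 1) ^ j * ?u j ^ (j - 1) <= ?u j ^ Suc j * ?u j ^ (j - 1)"
   by (simp only: mult.commute)
  moreover have "0 < ?u j ^ (j - 1)" using pos [of j] Suc by simp
  ultimately have "?u (j + 1) ^ j <= ?u j ^ Suc j" by (rule mult_right_le_imp_le)
  then show ?case by simp
 qed
 have top: "0 < uc s (F - {h})" using F by (simp add: uc_def)
 have ev: "\<forall>\<^sub>F t in at_right (0::real). us s (F - {h}) (\<lambda>e. z e + t) ^ (s - 1) <= us (s - 1) (F - {h}) (\<lambda>e. z e + t) ^ s"
  using eventually_at_right_less [of 0]
 proof eventually_elim
  case (elim t)
  have "(\<lambda>e. z e + t) \<in> posR (F - {h}) (uc s)" using elim F top z by (intro nnR_add_pos) auto
  then show ?case using s by (intro strict) auto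
 qed
 show ?thesis
  unfolding us_def by (rule tendsto_le [OF _ _ _ ev [unfolded us_def]]) (auto intro!: tendsto_intros)
qed

lemma power_diff_le:
 fixes a b :: real
 assumes "0 <= b" "b <= a"
 shows "a ^ (n + 1) - b ^ (n + 1) <= (real n + 1) * a ^ n * (a - b)"
proof (induction n)
 case (Suc n)
 have "a ^ (Suc n + 1) - b ^ (Suc n + 1) = a * (a ^ (n + 1) - b ^ (n + 1)) + b ^ (n + 1) * (a - b)"
  by (simp add: algebra_simps)
 also have "\<dots> <= a * ((real n + 1) * a ^ n * (a - b)) + a ^ (n + 1) * (a - b)"
  using assms Suc by (intro add_mono mult_left_mono mult_right_mono power_mono) auto
 also have "\<dots> = (real (Suc n) + 1) * a ^ Suc n * (a - b)" by (simp add: algebra_simps)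
 finally show ?case .
qed simp

lemma nonpos_contradiction:
 assumes F: "finite F" "s <= card F" "1 <= s" and x: "x \<in> nnR F (uc s)"
  and T: "T \<subseteq> F" "card T = s - 1" and np: "\<And>e. e \<in> F - T ==> x e <= 0" and h: "h \<in> F - T" "x h < 0"
 shows False
proof -
 have 1: "0 <= us 1 (F - T) x" using nnR_uc_D [OF F(1) x T(1)] T(2) F(3) by simp
 have le0: "0 <= us (s - card (F - {h})) {h} x"
 proof -
  have "F - (F - {h}) = {h}" using h by auto
  then show ?thesis using nnR_uc_D [OF F(1) x, of "F - {h}"] by simp
 qed
 have "s <= card (F - {h})"
 proof (rule ccontr)
  assume "\<not> s <= card (F - {h})"
  then have "s - card (F - {h}) = Suc 0" using F h by auto
  then show False using le0 h us_1 [of "{h}" x] us_0 [of "{h}" x] by simp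
 qed
 have ge: "0 <= 1 + x e" if e: "e \<in> F" for e
 proof -
  have "s <= card (F - {e})" using \<open>s <= card (F - {h})\<close> F(1) h e by simp
  moreover have "F - (F - {e}) = {e}" using e by auto
  ultimately show ?thesis using nnR_uc_D [OF F(1) x, of "F - {e}"] by (simp add: us_0)
 qed
 have "(\<Prod>e\<in>F - T. 1 + x e) = (1 + x h) * (\<Prod>e\<in>F - T - {h}. 1 + x e)"
  using F h by (intro prod.remove) auto
 also have "\<dots> <= (1 + x h) * 1"
  using ge np h by (intro mult_left_mono prod_le_1) force+
 finally have "us 0 (F - T) x < 1" using F h us_0 [of "F - T" x] by simp
 then show False using 1 F us_1 [of "F - T" x] by simp
qed

text \<open>
 At a zero with a negative coordinate there must be a positive one as well: otherwise all
 derivatives of top order could not be non-negative.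
\<close>

lemma link_pos_at_negative:
 fixes F :: "'a set"
 assumes nb: "\<And>k G. 1 <= k ==> k < s ==> neg_bound (G :: 'a set) k"
  and F: "finite F" "s <= card F" "1 <= s" and x: "x \<in> nnR F (uc s)" and z: "us s F x = 0"
  and h: "h \<in> F" "x h < 0"
 shows "s <= card (F - {h})" "(- x h) ^ (s - 1) <= us (s - 1) (F - {h}) x"
  "\<exists>p\<in>F. 0 < x p"
proof -
 have le0: "0 <= us (s - card (F - {h})) {h} x"
 proof -
  have "F - (F - {h}) = {h}" using h by auto
  then show ?thesis using nnR_uc_D [OF F(1) x, of "F - {h}"] by simp
 qed
 show c: "s <= card (F - {h})"
 proof (rule ccontr)
  assume "\<not> s <= card (F - {h})"
  then have "s - card (F - {h}) = Suc 0" using F h by auto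
  then show False using le0 h us_1 [of "{h}" x] us_0 [of "{h}" x] by simp
 qed
 define w where "w = us (s - 1) (F - {h}) x"
 define a where "a = - x h"
 have a: "0 < a" using h by (simp add: a_def)
 have w0: "0 <= w" using nnR_uc_D [OF F(1) x, of "{h}"] h by (simp add: w_def)
 have us': "us s (F - {h}) x = a * w" using z us_split [OF F(1) h(1), of s x] by (simp add: a_def w_def)
 have x': "x \<in> nnR (F - {h}) (uc s)" using F h x by (intro nnR_delete_nonpos) auto
 have chain: "(a * w) ^ (s - 1) <= w ^ s"
  using power_chain_uc [OF nb F(1) h(1) c x' F(3)] by (simp add: us' w_def)
 have "w ~= 0"
 proof
  assume w: "w = 0"
  show False
  proof (cases "s = 1")
   case True
   then show False using z w us_1 [OF F(1), of x] us_split [OF F(1) h(1), of 0 x] by (simp add: w_def)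
  next
   case False
   then have s1: "1 <= s - 1" "s - 1 < s" using F by auto
   have xl: "x \<in> nnR (F - {h}) (uc (s - 1))"
    using nnR_link [OF x, of "{h}"] link_uc_cong(3) [of F "{h}" x s] F h by simp
   have "real (s - 1) + 1 = s" "s - 1 + 1 = s" using F by auto
   then have "real s * us s (F - {h}) x + negsum (F - {h}) x s <= 0"
    using neg_bound_D(2) [OF nb [OF s1], of "F - {h}" x] F c xl w by (simp add: w_def)
   then have ns: "negsum (F - {h}) x s <= 0" using us' w by simp
   have nneg: "0 <= x e" if e: "e \<in> F - {h}" for e
   proof (rule ccontr)
    assume "\<not> 0 <= x e"
    then have "(- x e) ^ s <= negsum (F - {h}) x s"
     unfolding negsum_def using e F by (intro member_le_sum) auto
    moreover have "0 < (- x e) ^ s" using \<open>\<not> 0 <= x e\<close> by simp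
    ultimately show False using ns by linarith
   qed
   define P where "P = {e \<in> F - {h}. 0 < x e}"
   have "card P < s - 1"
   proof (rule ccontr)
    assume "\<not> card P < s - 1"
    then have "uc (s - 1) P = 1" by (simp add: uc_def)
    moreover have "uc (s - 1) P * prod x (P - {}) <= pd (F - {h}) (uc (s - 1)) {} x"
     using F nneg by (intro pd_orthant_ge) (auto simp: P_def)
    moreover have "0 < prod x P" by (intro prod_pos) (auto simp: P_def)
    ultimately show False using w by (simp add: w_def us_def)
   qed
   moreover have "s - 1 <= card (F - {h})" using c by simp
   ultimately obtain T where T: "P \<subseteq> T" "T \<subseteq> F - {h}" "card T = s - 1"
    using exists_subset_between [of P "s - 1" "F - {h}"] F by (auto simp: P_def)
   show False
   proof (rule nonpos_contradiction [OF F(1,2,3) x _ T(3)])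
    show "x e <= 0" if "e \<in> F - T" for e using that T h by (cases "e = h") (auto simp: P_def not_less)
   qed (use T h in auto)
  qed
 qed
 then have wpos: "0 < w" using w0 by simp
 have "w ^ s = w * w ^ (s - 1)" using F(3) by (simp add: power_eq_if)
 then have "a ^ (s - 1) * w ^ (s - 1) <= w * w ^ (s - 1)" using chain by (simp add: power_mult_distrib)
 then have "a ^ (s - 1) <= w" using wpos by simp
 then show "(- x h) ^ (s - 1) <= us (s - 1) (F - {h}) x" by (simp add: a_def w_def)
 show "\<exists>p\<in>F. 0 < x p"
 proof (rule ccontr)
  assume np: "\<not> (\<exists>p\<in>F. 0 < x p)"
  have "s - 1 <= card (F - {h})" using c by simp
  then obtain T where T: "T \<subseteq> F - {h}" "card T = s - 1" by (metis obtain_subset_with_card_n)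
  then show False
   by (intro nonpos_contradiction [OF F(1,2,3) x, of T h]) (use np h in \<open>auto simp: not_less\<close>)
 qed
qed

lemma smoothing_arith:
 fixes a p \<alpha> \<beta> \<gamma> \<epsilon> :: real
 assumes zero: "\<alpha> + \<beta> * (p - a) - \<gamma> * a * p = 0" and pos: "0 < a" "0 < p" "0 < \<beta>"
  and v: "0 <= \<beta> - \<gamma> * a" and w: "a ^ n <= \<beta> + \<gamma> * p"
 defines "G \<equiv> a * p * ((\<beta> - \<gamma> * a) * (\<beta> + \<gamma> * p)) / \<beta>"
 shows "\<epsilon> + \<alpha> * (p - a) - \<beta> * a * p = \<epsilon> - \<alpha>\<^sup>2 / \<beta> - G"
  and "\<alpha> <= 0 ==> a ^ (n + 2) <= (real n + 2) * G"
  and "0 < \<alpha> ==> a ^ (n + 2) - (\<alpha> / \<beta>) ^ (n + 2) <= (real n + 2) * G"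
proof -
 have ba: "\<beta> * a = \<alpha> + p * (\<beta> - \<gamma> * a)" using zero by (simp add: algebra_simps)
 define q where "q = p * (\<beta> - \<gamma> * a) / \<beta>"
 have q: "q = a - \<alpha> / \<beta>" using ba pos by (simp add: q_def field_simps)
 have G: "G = a * q * (\<beta> + \<gamma> * p)" by (simp add: G_def q_def)
 have q0: "0 <= q" using v pos by (simp add: q_def)
 have K: "(\<beta> - \<gamma> * a) * (\<beta> + \<gamma> * p) = \<beta>\<^sup>2 - \<alpha> * \<gamma>"
 proof -
  have "(\<beta> - \<gamma> * a) * (\<beta> + \<gamma> * p) - (\<beta>\<^sup>2 - \<alpha> * \<gamma>) = \<gamma> * (\<alpha> + \<beta> * (p - a) - \<gamma> * a * p)"
   by (simp add: power2_eq_square algebra_simps)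
  then show ?thesis using zero by simp
 qed
 have "\<beta> * (\<alpha> * (p - a) - \<beta> * a * p) = \<beta> * (- \<alpha>\<^sup>2 / \<beta> - G)"
 proof -
  have "\<beta> * (\<alpha> * (p - a) - \<beta> * a * p) - (- \<alpha>\<^sup>2 - a * p * (\<beta>\<^sup>2 - \<alpha> * \<gamma>))
    = \<alpha> * (\<alpha> + \<beta> * (p - a) - \<gamma> * a * p)"
   by (simp add: power2_eq_square algebra_simps)
  then have "\<beta> * (\<alpha> * (p - a) - \<beta> * a * p) = - \<alpha>\<^sup>2 - a * p * (\<beta>\<^sup>2 - \<alpha> * \<gamma>)" using zero by simp
  also have "\<dots> = \<beta> * (- \<alpha>\<^sup>2 / \<beta> - G)" 
  proof -
   have "\<beta> * G = a * p * (\<beta>\<^sup>2 - \<alpha> * \<gamma>)" "\<beta> * (- \<alpha>\<^sup>2 / \<beta>) = - \<alpha>\<^sup>2"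
    using pos unfolding G_def K by simp_all
   then show ?thesis by (simp only: right_diff_distrib)
  qed
  finally show ?thesis .
 qed
 then have "\<alpha> * (p - a) - \<beta> * a * p = - \<alpha>\<^sup>2 / \<beta> - G" using pos by (simp only: mult_left_cancel) 
 then show "\<epsilon> + \<alpha> * (p - a) - \<beta> * a * p = \<epsilon> - \<alpha>\<^sup>2 / \<beta> - G" by simp
 have Ge: "a * q * a ^ n <= G" unfolding G using w q0 pos by (intro mult_left_mono) auto
 { assume "\<alpha> <= 0"
  then have "a <= q" using q pos by (simp add: divide_nonpos_pos)
  then have "a * a * a ^ n <= a * q * a ^ n" using pos by (intro mult_right_mono mult_left_mono) auto
  then have 1: "a ^ (n + 2) <= G" using Ge by (simp add: power_add power2_eq_square mult_ac)
  moreover have "0 <= a ^ (n + 2)" using pos by simp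
  ultimately have "0 <= G" by linarith
  then have "1 * G <= (real n + 2) * G" by (intro mult_right_mono) auto
  then show "a ^ (n + 2) <= (real n + 2) * G" using 1 by linarith }
 { assume "0 < \<alpha>"
  then have "0 <= \<alpha> / \<beta>" "\<alpha> / \<beta> <= a" using q q0 pos by auto
  then have "a ^ (n + 1 + 1) - (\<alpha> / \<beta>) ^ (n + 1 + 1) <= (real (n + 1) + 1) * a ^ (n + 1) * (a - \<alpha> / \<beta>)"
   by (rule power_diff_le)
  also have "\<dots> = (real n + 2) * (a * q * a ^ n)" by (simp add: q)
  also have "\<dots> <= (real n + 2) * G" using Ge by (intro mult_left_mono) auto
  finally show "a ^ (n + 2) - (\<alpha> / \<beta>) ^ (n + 2) <= (real n + 2) * G" by simp }
qed

text \<open>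
 Replacing the pair of coordinates \<open>h\<close>, \<open>p\<close> by a single one that keeps the polynomial
 zero reduces the number of variables and changes the bound in the right direction.
\<close>

lemma smoothing:
 fixes F :: "'a set"
 assumes nb: "\<And>k G. 1 <= k ==> k < s ==> neg_bound (G :: 'a set) k"
  and F: "finite F" "s <= card F" "1 <= s" and x: "x \<in> nnR F (uc s)" and z: "us s F x = 0"
  and h: "h \<in> F" "x h < 0" and p: "p \<in> F" "0 < x p"
 defines "\<beta> \<equiv> us (s - 1) (F - {h,p}) x" and "v \<equiv> us (s - 1) (F - {p}) x" and "w \<equiv> us (s - 1) (F - {h}) x"
 shows "0 < \<beta>" "0 <= v"
  and "x \<in> nnR (F - {h,p}) (uc (s - 1))"
  and "\<exists>G y. G \<subset> F & s <= card G & y \<in> nnR G (uc s) & us s G y = 0 \<and>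
    us (s + 1) F x = us (s + 1) G y - (- x h) * x p * (v * w) / \<beta> \<and>
    negsum F x (s + 1) <= negsum G y (s + 1) + (real s + 1) * ((- x h) * x p * (v * w) / \<beta>)"
proof -
 define a where "a = - x h"
 define q where "q = x p"
 define \<alpha> where "\<alpha> = us s (F - {h,p}) x"
 define \<gamma> where "\<gamma> = us (s - 2) (F - {h,p}) x"
 define \<epsilon> where "\<epsilon> = us (s + 1) (F - {h,p}) x"
 have hp: "h ~= p" using h p by auto
 have a: "0 < a" "0 < q" using h p by (auto simp: a_def q_def)
 have sets: "F - {h} - {p} = F - {h,p}" "F - {p} - {h} = F - {h,p}" by auto
 have c: "s <= card (F - {h})" and wge: "a ^ (s - 1) <= w"
  using link_pos_at_negative(1,2) [OF nb F x z h] by (simp_all add: a_def w_def)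
 have cp: "card (F - {p}) = card (F - {h})" using F h p by simp
 have c2: "s - 1 <= card (F - {h,p})" using c hp p F h by (simp add: sets [symmetric])
 have s2: "s - 1 - 1 = s - 2" and s11: "s + 1 - 1 = s" by simp_all
 have sph: "us k (F - {h}) y = us k (F - {h,p}) y + y p * us (k - 1) (F - {h,p}) y" for k y
  using us_split [of "F - {h}" p k y] F p hp by (simp add: sets)
 have spp: "us k (F - {p}) y = us k (F - {h,p}) y + y h * us (k - 1) (F - {h,p}) y" for k y
  using us_split [of "F - {p}" h k y] F h hp by (simp add: sets)
 have w: "w = \<beta> + \<gamma> * q" unfolding w_def sph s2 by (simp add: \<beta>_def \<gamma>_def q_def)
 have v: "v = \<beta> - \<gamma> * a" unfolding v_def spp s2 by (simp add: \<beta>_def \<gamma>_def a_def)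
 have fp: "us s (F - {h}) x = \<alpha> + \<beta> * q" unfolding sph by (simp add: \<alpha>_def \<beta>_def q_def)
 have fe: "us (s + 1) (F - {h}) x = \<epsilon> + \<alpha> * q" unfolding sph by (simp add: \<alpha>_def \<epsilon>_def q_def)
 have zero: "\<alpha> + \<beta> * (q - a) - \<gamma> * a * q = 0"
 proof -
  have "us s F x = us s (F - {h}) x + x h * w" using us_split [OF F(1) h(1), of s x] by (simp add: w_def)
  then show ?thesis using z fp w by (simp add: a_def algebra_simps)
 qed
 have top: "us (s + 1) F x = \<epsilon> + \<alpha> * (q - a) - \<beta> * a * q"
  using us_split [OF F(1) h(1), of "s + 1" x] fe fp by (simp add: a_def algebra_simps)
 show v0: "0 <= v" using nnR_uc_D [OF F(1) x, of "{p}"] p by (simp add: v_def)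
 have x1: "x \<in> nnR (F - {p}) (uc (s - 1))"
  using nnR_link [OF x, of "{p}"] link_uc_cong(3) [of F "{p}" x s] F p by simp
 then show xb: "x \<in> nnR (F - {h,p}) (uc (s - 1))"
  using nnR_delete_nonpos [of "F - {p}" h x] F h hp by (simp add: sets)
 have \<gamma>0: "0 <= \<gamma>" using nnR_uc_D [OF F(1) x, of "{h,p}"] h p hp by (simp add: \<gamma>_def numeral_2_eq_2)
 have \<beta>0: "0 <= \<beta>" using nnR_D0 [OF xb] by (simp add: \<beta>_def us_def)
 show \<beta>: "0 < \<beta>"
 proof (rule ccontr)
  assume "\<not> 0 < \<beta>"
  then have "\<beta> = 0" using \<beta>0 by simp
  then have "\<gamma> * a <= 0" using v0 v by simp
  then have "\<gamma> = 0" using \<gamma>0 a by (simp add: mult_le_0_iff)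
  then have "w = 0" using w \<open>\<beta> = 0\<close> by simp
  moreover have "0 < a ^ (s - 1)" using a by simp
  ultimately show False using wge by simp
 qed
 have sn: "s - 1 + 2 = s + 1" "real (s - 1) + 2 = real s + 1" using F(3) by auto
 note arith = smoothing_arith [OF zero a \<beta> v0 [unfolded v] wge [unfolded w], folded v w, unfolded sn]
 have xpos: "x \<in> posR (F - {h,p}) (uc (s - 1))"
 proof (rule gardD(4) [OF gard_uc_if xb])
  show "neg_bound G k" if "1 <= k" "k < s - 1" for k and G :: "'a set" using nb that by simp
 qed (use F c2 \<beta> in \<open>auto simp: \<beta>_def us_def\<close>)
 have new: "y \<in> nnR G (uc s)"
  if G: "G - {g} = F - {h,p}" "g \<in> G" "finite G" "s <= card G" and y: "\<And>e. e \<in> F - {h,p} ==> y e = x e"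
   and y0: "us s G y = 0" for G g y
 proof (rule nnR_fiber)
  show "gard G (uc s)" using G by (intro gard_uc_if nb) auto
  have "y \<in> posR (F - {h,p}) (uc (s - 1))" using xpos posR_cong [of "F - {h,p}" y x "uc (s - 1)" "uc (s - 1)"] y by simp
  then show "y \<in> posR (G - {g}) (link (uc s) {g})" using link_uc_cong(2) [of G "{g}" y s] G by simp
 qed (use G y0 in \<open>auto simp: us_def\<close>)
 show "\<exists>G y. G \<subset> F & s <= card G & y \<in> nnR G (uc s) & us s G y = 0 \<and>
    us (s + 1) F x = us (s + 1) G y - (- x h) * x p * (v * w) / \<beta> \<and>
    negsum F x (s + 1) <= negsum G y (s + 1) + (real s + 1) * ((- x h) * x p * (v * w) / \<beta>)"
 proof (cases "\<alpha> <= 0")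
  case True
  define y where "y = x(p := - \<alpha> / \<beta>)"
  have yF: "us k (F - {h,p}) y = us k (F - {h,p}) x" for k by (rule us_cong) (auto simp: y_def)
  have yp: "y p = - \<alpha> / \<beta>" by (simp add: y_def)
  have y0: "us s (F - {h}) y = 0" unfolding sph yF yp \<alpha>_def [symmetric] \<beta>_def [symmetric] using \<beta> by simp
  have y1: "us (s + 1) (F - {h}) y = \<epsilon> - \<alpha>\<^sup>2 / \<beta>"
   unfolding sph yF yp s11 \<alpha>_def [symmetric] \<epsilon>_def [symmetric] by (simp add: power2_eq_square)
  have yp0: "0 <= - \<alpha> / \<beta>" using True \<beta> by (simp add: divide_nonpos_pos)
  have negs: "{k \<in> F. x k < 0} = insert h {k \<in> F - {h}. y k < 0}"
   using h p hp yp0 by (auto simp: y_def split: if_splits)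
  have "negsum F x (s + 1) = a ^ (s + 1) + (\<Sum>k | k \<in> F - {h} & y k < 0. (- x k) ^ (s + 1))"
   unfolding negsum_def negs using F by (subst sum.insert) (auto simp: a_def)
  also have "(\<Sum>k | k \<in> F - {h} & y k < 0. (- x k) ^ (s + 1)) = negsum (F - {h}) y (s + 1)"
   unfolding negsum_def
  proof (rule sum.cong [OF refl])
   fix k assume "k \<in> {k. k \<in> F - {h} & y k < 0}"
   then have "k ~= p" using yp0 by (auto simp: y_def)
   then show "(- x k) ^ (s + 1) = (- y k) ^ (s + 1)" by (simp add: y_def)
  qed
  finally have ns: "negsum F x (s + 1) = a ^ (s + 1) + negsum (F - {h}) y (s + 1)" .
  show ?thesis
  proof (intro exI conjI)
   show "F - {h} \<subset> F" using h by auto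
   show "y \<in> nnR (F - {h}) (uc s)"
    using y0 F p hp c by (intro new [where g = p]) (auto simp: y_def sets)
   show "us (s + 1) F x = us (s + 1) (F - {h}) y - (- x h) * x p * (v * w) / \<beta>"
    unfolding top y1 using arith(1) [of \<epsilon>] by (simp add: a_def q_def)
   show "negsum F x (s + 1) <= negsum (F - {h}) y (s + 1) + (real s + 1) * ((- x h) * x p * (v * w) / \<beta>)"
    unfolding ns using arith(2) [OF True] by (simp add: a_def q_def)
  qed (use c y0 in auto)
 next
  case False
  define y where "y = x(h := - \<alpha> / \<beta>)"
  have yF: "us k (F - {h,p}) y = us k (F - {h,p}) x" for k by (rule us_cong) (auto simp: y_def)
  have yh: "y h = - \<alpha> / \<beta>" by (simp add: y_def)
  have yneg: "y h < 0" using False \<beta> by (simp add: yh divide_neg_pos)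
  have y0: "us s (F - {p}) y = 0" unfolding spp yF yh \<alpha>_def [symmetric] \<beta>_def [symmetric] using \<beta> by simp
  have y1: "us (s + 1) (F - {p}) y = \<epsilon> - \<alpha>\<^sup>2 / \<beta>"
   unfolding spp yF yh s11 \<alpha>_def [symmetric] \<epsilon>_def [symmetric] by (simp add: power2_eq_square)
  define N where "N = {k \<in> F - {h}. x k < 0}"
  have N: "finite N" "h \<notin> N" using F by (auto simp: N_def)
  have "{k \<in> F. x k < 0} = insert h N" using h by (auto simp: N_def)
  then have n1: "negsum F x (s + 1) = a ^ (s + 1) + (\<Sum>k\<in>N. (- x k) ^ (s + 1))"
   unfolding negsum_def using N by (simp add: a_def)
  have "{k \<in> F - {p}. y k < 0} = insert h N"
   using h p hp yneg by (auto simp: N_def y_def)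
  then have "negsum (F - {p}) y (s + 1) = (- y h) ^ (s + 1) + (\<Sum>k\<in>N. (- y k) ^ (s + 1))"
   unfolding negsum_def using N by simp
  also have "(\<Sum>k\<in>N. (- y k) ^ (s + 1)) = (\<Sum>k\<in>N. (- x k) ^ (s + 1))"
   using N by (intro sum.cong) (auto simp: y_def)
  finally have n2: "negsum (F - {p}) y (s + 1) = (\<alpha> / \<beta>) ^ (s + 1) + (\<Sum>k\<in>N. (- x k) ^ (s + 1))"
   by (simp add: yh)
  show ?thesis
  proof (intro exI conjI)
   show "F - {p} \<subset> F" using p by auto
   show "y \<in> nnR (F - {p}) (uc s)"
    using y0 F h hp c cp by (intro new [where g = h]) (auto simp: y_def sets)
   show "us (s + 1) F x = us (s + 1) (F - {p}) y - (- x h) * x p * (v * w) / \<beta>"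
    unfolding top y1 using arith(1) [of \<epsilon>] by (simp add: a_def q_def)
   show "negsum F x (s + 1) <= negsum (F - {p}) y (s + 1) + (real s + 1) * ((- x h) * x p * (v * w) / \<beta>)"
    unfolding n1 n2 using arith(3) False by (simp add: a_def q_def)
  qed (use c cp y0 in auto)
 qed
qed

lemma neg_bound_all:
 fixes F :: "'a set"
 assumes "1 <= s"
 shows "neg_bound F s"
 using assms
proof (induction s arbitrary: F rule: less_induct)
 case (less s)
 have nb: "neg_bound (G :: 'a set) k" if "1 <= k" "k < s" for k G using less.IH that by simp
 show ?case
 proof (cases "finite F")
  case True
  then show ?thesis
  proof (induction F rule: finite_psubset_induct)
   case (psubset F)
   show ?case unfolding neg_bound_def
   proof (intro allI impI)
    fix x assume F: "finite F" "s <= card F" and x: "x \<in> nnR F (uc s)" and z: "us s F x = 0"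
    show "(real s + 1) * us (s + 1) F x + negsum F x (s + 1) <= 0"
    proof (cases "\<exists>h\<in>F. x h < 0")
     case False
     then have nn: "0 <= x e" if "e \<in> F" for e using that by (auto simp: not_less)
     have "{h \<in> F. x h < 0} = {}" using False by auto
     then have "negsum F x (s + 1) = 0" by (simp only: negsum_def sum.empty)
     moreover have "us (s + 1) F x <= 0" using us_mono [of F x s] nn z by simp
     ultimately show ?thesis by (simp add: mult_le_0_iff)
    next
     case True
     then obtain h where h: "h \<in> F" "x h < 0" by auto
     obtain p where p: "p \<in> F" "0 < x p"
      using link_pos_at_negative(3) [OF nb F less.prems x z h] by auto
     obtain G y D where G: "G \<subset> F" "s <= card G" "y \<in> nnR G (uc s)" "us s G y = 0"
      and D: "us (s + 1) F x = us (s + 1) G y - D" "negsum F x (s + 1) <= negsum G y (s + 1) + (real s + 1) * D"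
      using smoothing(4) [OF nb F less.prems x z h p] by blast
     have "finite G" using G(1) F(1) finite_subset by auto
     then have "(real s + 1) * us (s + 1) G y + negsum G y (s + 1) <= 0"
      using psubset.IH [OF G(1)] G by (simp add: neg_bound_def)
     moreover have "(real s + 1) * us (s + 1) F x = (real s + 1) * us (s + 1) G y - (real s + 1) * D"
      unfolding D(1) by (rule right_diff_distrib)
     ultimately show ?thesis using D(2) by linarith
    qed
   qed
  qed
 qed (simp add: neg_bound_def)
qed

lemma gard_uniform: "finite F ==> s <= card F ==> gard F (uc s)"
 using neg_bound_all by (intro gard_uc_if) auto

lemma card_times_prod_le_sum_power:
 fixes a :: "'a => real"
 assumes "finite H" "\<And>h. h \<in> H ==> 0 < a h"
 shows "real (card H) * prod a H <= (\<Sum>h\<in>H. a h ^ card H)"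
proof -
 define P where "P = prod a H"
 have P: "0 < P" unfolding P_def using assms by (intro prod_pos) auto
 have ln: "ln P = (\<Sum>h\<in>H. ln (a h))" unfolding P_def using assms by (intro ln_prod) force+
 have 1: "card H * ln (a h) - ln P + 1 <= a h ^ card H / P" if "h \<in> H" for h
 proof -
  have "0 < a h ^ card H / P" using assms(2) [OF that] P by simp
  then have "ln (a h ^ card H / P) <= a h ^ card H / P - 1" by (rule ln_le_minus_one)
  moreover have "ln (a h ^ card H / P) = card H * ln (a h) - ln P"
   using assms(2) [OF that] P by (simp add: ln_div ln_realpow)
  ultimately show ?thesis by simp
 qed
 have "(\<Sum>h\<in>H. card H * ln (a h) - ln P + 1) = real (card H) * (\<Sum>h\<in>H. ln (a h)) - real (card H) * ln P + real (card H)"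
  by (simp add: sum.distrib sum_subtractf sum_distrib_left)
 then have "real (card H) = (\<Sum>h\<in>H. card H * ln (a h) - ln P + 1)" by (simp add: ln)
 also have "\<dots> <= (\<Sum>h\<in>H. a h ^ card H / P)" using 1 by (rule sum_mono)
 also have "\<dots> = (\<Sum>h\<in>H. a h ^ card H) / P" by (simp add: sum_divide_distrib)
 finally show ?thesis using P by (simp add: P_def field_simps)
qed

text \<open>
 The sharper bound by the monomial of a set of size \<open>s + 1\<close>; for sets with negative coordinates the
 sum of powers in \<open>neg_bound\<close> is compared with the product by the inequality of arithmetic and geometric means.
\<close>

lemma uniform_circuit_bound:
 fixes F H :: "'a set"
 assumes "finite F" "s <= card F" "x \<in> nnR F (uc s)" "us s F x = 0" "H \<subseteq> F" "card H = s + 1"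
 shows "us (s + 1) F x <= prod x H"
 using assms
proof (induction s arbitrary: F H x)
 case 0
 then obtain h where h: "H = {h}" "h \<in> F" by (auto simp: card_1_singleton_iff)
 have "F - (F - {h}) = {h}" using h by auto
 then have "0 <= us 0 {h} x" using nnR_uc_D [OF 0(1,3), of "F - {h}"] by simp
 then have "0 <= 1 + x h" by (simp add: us_0)
 moreover have "us 1 F x = - 1" using 0(4) us_1 [OF 0(1), of x] by simp
 ultimately show ?case using h by simp
next
 case (Suc s)
 define r where "r = Suc s"
 have r: "1 <= r" by (simp add: r_def)
 note prems = Suc.prems [folded r_def]
 have nb: "neg_bound (G :: 'a set) k" if "1 <= k" for G k using that by (rule neg_bound_all)
 have finH: "finite H" using prems finite_subset by auto
 show ?case unfolding r_def [symmetric]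
 proof (cases "0 <= prod x H")
  case True
  then show "us (r + 1) F x <= prod x H" using neg_bound_D(1) [OF nb [OF r] prems(1-4)] by linarith
 next
  case False
  have nz: "x e ~= 0" if "e \<in> H" for e 
 proof
  assume "x e = 0"
  then have "prod x H = 0" using that finH by (intro prod_zero) auto
  then show False using False by simp
 qed
  show "us (r + 1) F x <= prod x H"
  proof (cases "\<exists>p\<in>H. 0 < x p")
   case True
   then obtain p where p: "p \<in> H" "0 < x p" by auto
   have "\<exists>h\<in>H. x h < 0" using False prod_nonneg [of H x] by force
   then obtain h where h: "h \<in> H" "x h < 0" by auto
   have hp: "h ~= p" using h p by auto
   have F: "h \<in> F" "p \<in> F" using h p prems by auto
   define Y where "Y = prod x (H - {h,p})"
   have "prod x H = x h * prod x (H - {h})" using finH h by (intro prod.remove)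
   also have "prod x (H - {h}) = x p * prod x (H - {h} - {p})" using finH p hp by (intro prod.remove) auto
   also have "H - {h} - {p} = H - {h,p}" by auto
   finally have pH: "prod x H = x h * x p * Y" by (simp add: Y_def)
   define \<beta> where "\<beta> = us (r - 1) (F - {h,p}) x"
   define v where "v = us (r - 1) (F - {p}) x"
   define w where "w = us (r - 1) (F - {h}) x"
   note sm = smoothing [OF nb prems(1,2) r prems(3,4) F(1) h(2) F(2) p(2), folded \<beta>_def v_def w_def]
   obtain G y where G: "G \<subset> F" "r <= card G" "y \<in> nnR G (uc r)" "us r G y = 0"
    "us (r + 1) F x = us (r + 1) G y - (- x h) * x p * (v * w) / \<beta>"
    using sm(4) by blast
   have "finite G" using G(1) prems(1) finite_subset by auto
   then have "us (r + 1) G y <= 0" using neg_bound_D(1) [OF nb [OF r]] G by blast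
   then have le: "us (r + 1) F x <= x h * x p * (v * w / \<beta>)" using G(5) by simp
   have sets: "F - {h} - {p} = F - {h,p}" "F - {p} - {h} = F - {h,p}" by auto
   define \<gamma> where "\<gamma> = us (r - 2) (F - {h,p}) x"
   define \<alpha> where "\<alpha> = us r (F - {h,p}) x"
   have r2: "r - 1 - 1 = r - 2" by simp
   have sph: "us k (F - {h}) y = us k (F - {h,p}) y + y p * us (k - 1) (F - {h,p}) y" for k y
    using us_split [of "F - {h}" p k y] prems F hp by (simp add: sets)
   have spp: "us k (F - {p}) y = us k (F - {h,p}) y + y h * us (k - 1) (F - {h,p}) y" for k y
    using us_split [of "F - {p}" h k y] prems F hp by (simp add: sets)
   have w: "w = \<beta> + \<gamma> * x p" unfolding w_def sph r2 by (simp add: \<beta>_def \<gamma>_def)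
   have v: "v = \<beta> + \<gamma> * x h" unfolding v_def spp r2 by (simp add: \<beta>_def \<gamma>_def)
   have zero: "\<alpha> + \<beta> * (x p + x h) + \<gamma> * x h * x p = 0"
   proof -
    have "us r F x = us r (F - {h}) x + x h * w" using us_split [OF prems(1) F(1), of r x] by (simp add: w_def)
    moreover have "us r (F - {h}) x = \<alpha> + x p * \<beta>" unfolding sph by (simp add: \<alpha>_def \<beta>_def)
    ultimately show ?thesis using prems(4) w by (simp add: algebra_simps)
   qed
   have vw: "v * w = \<beta>\<^sup>2 - \<alpha> * \<gamma>"
   proof -
    have "v * w - (\<beta>\<^sup>2 - \<alpha> * \<gamma>) = \<gamma> * (\<alpha> + \<beta> * (x p + x h) + \<gamma> * x h * x p)"
     unfolding v w by (simp add: power2_eq_square algebra_simps)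
    then show ?thesis using zero by simp
   qed
   have cardF: "r - 1 <= card (F - {h,p})"
   proof -
    have "H - {h,p} \<subseteq> F - {h,p}" "card (H - {h,p}) = r - 1" using prems finH h p hp by auto
    then show ?thesis using prems(1) card_mono [of "F - {h,p}" "H - {h,p}"] by simp
   qed
   have x2: "x \<in> nnR (F - {h,p}) (uc (r - 2))"
    using nnR_link [OF prems(3), of "{h,p}"] link_uc_cong(3) [of F "{h,p}" x r] prems F hp
    by (simp add: numeral_2_eq_2)
   have "\<gamma> ~= 0"
   proof
    assume \<gamma>: "\<gamma> = 0"
    consider "r = 1" | "r = 2" | "3 <= r" using r by linarith
    then show False
    proof cases
     case 1
     then show False using \<gamma> sm(1) by (simp add: \<gamma>_def \<beta>_def)
    next
     case 2
     then show False using \<gamma> sm(1) us_1 [of "F - {h,p}" x] prems(1) by (simp add: \<gamma>_def \<beta>_def)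
    next
     case 3
     then have "us (r - 2 + 1) (F - {h,p}) x <= 0"
      using x2 prems(1) cardF \<gamma> by (intro neg_bound_D(1) [OF nb]) (auto simp: \<gamma>_def)
     moreover have "r - 2 + 1 = r - 1" using 3 by simp
     ultimately show False using sm(1) by (simp add: \<beta>_def)
    qed
   qed
   then have \<gamma>: "0 < \<gamma>" using nnR_D0 [OF x2] by (simp add: \<gamma>_def us_def)
   define y' where "y' = x(h := - \<beta> / \<gamma>)"
   have yF: "us k (F - {h,p}) y' = us k (F - {h,p}) x" for k by (rule us_cong) (auto simp: y'_def)
   have yh: "y' h = - \<beta> / \<gamma>" by (simp add: y'_def)
   have "gard (F - {h,p}) (uc (r - 2))" using prems(1) cardF by (intro gard_uniform) auto
   then have "x \<in> posR (F - {h,p}) (uc (r - 2))" using x2 \<gamma> by (auto simp: \<gamma>_def us_def gard_def)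
   then have "y' \<in> posR (F - {h,p}) (uc (r - 2))"
    using posR_cong [of "F - {h,p}" y' x "uc (r - 2)" "uc (r - 2)"] by (auto simp: y'_def)
   then have yl: "y' \<in> posR (F - {p} - {h}) (link (uc (r - 1)) {h})"
    using link_uc_cong(2) [of "F - {p}" "{h}" y' "r - 1"] prems(1) F hp r2 by (simp add: sets)
   have y0: "us (r - 1) (F - {p}) y' = 0"
    unfolding spp yF yh r2 \<beta>_def [symmetric] \<gamma>_def [symmetric] using \<gamma> by simp
   have cFp: "s <= card (F - {p})" using prems F by (simp add: r_def)
   have rs: "r - 1 = s" by (simp add: r_def)
   have "y' \<in> nnR (F - {p}) (uc (r - 1))"
   proof (rule nnR_fiber [OF _ _ yl])
    show "gard (F - {p}) (uc (r - 1))" using prems(1) cFp rs by (intro gard_uniform) auto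
   qed (use F hp y0 in \<open>auto simp: us_def\<close>)
   then have "us (s + 1) (F - {p}) y' <= prod y' (H - {p})"
    using prems F p cFp y0 finH rs by (intro Suc.IH) (auto simp: r_def)
   also have "prod y' (H - {p}) = y' h * prod y' (H - {p} - {h})" using finH h hp by (intro prod.remove) auto
   also have "prod y' (H - {p} - {h}) = Y" unfolding Y_def by (intro prod.cong) (auto simp: y'_def)
   finally have "\<alpha> + (- \<beta> / \<gamma>) * \<beta> <= (- \<beta> / \<gamma>) * Y"
    using spp [of r y'] by (simp add: yF yh r_def \<alpha>_def \<beta>_def)
   then have "\<gamma> * (\<alpha> + (- \<beta> / \<gamma>) * \<beta>) <= \<gamma> * ((- \<beta> / \<gamma>) * Y)" using \<gamma> by (intro mult_left_mono) auto
   then have "\<beta> * Y <= v * w" unfolding vw using \<gamma> by (simp add: power2_eq_square algebra_simps)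
   then have "Y <= v * w / \<beta>" using sm(1) by (simp add: field_simps)
   moreover have "x h * x p <= 0" using h p by (simp add: mult_nonpos_nonneg)
   ultimately have "x h * x p * (v * w / \<beta>) <= x h * x p * Y" by (rule mult_left_mono_neg)
   then show ?thesis using le pH by simp
  next
   case no: False
   then have neg: "x e < 0" if "e \<in> H" for e using that nz [OF that] by (auto simp: not_less)
   have "real (card H) * (\<Prod>h\<in>H. - x h) <= (\<Sum>h\<in>H. (- x h) ^ card H)"
    using finH neg by (intro card_times_prod_le_sum_power) auto
   also have "\<dots> <= negsum F x (r + 1)"
    unfolding negsum_def prems(6)
   proof (rule sum_mono2)
    show "finite {h. h \<in> F & x h < 0}" using prems(1) by simp
    show "H \<subseteq> {h. h \<in> F & x h < 0}" using neg prems(5) by auto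
    show "0 <= (- x b) ^ (r + 1)" if "b \<in> {h. h \<in> F & x h < 0} - H" for b
     using that by (intro zero_le_power) auto
   qed
   finally have "(real r + 1) * (\<Prod>h\<in>H. - x h) <= negsum F x (r + 1)" by (simp add: prems(6) add.commute)
   moreover have "(real r + 1) * us (r + 1) F x + negsum F x (r + 1) <= 0"
    by (rule neg_bound_D(2) [OF nb [OF r] prems(1-4)])
   ultimately have "(real r + 1) * us (r + 1) F x <= (real r + 1) * (- (\<Prod>h\<in>H. - x h))"
    by (simp add: algebra_simps)
   then have "us (r + 1) F x <= - (\<Prod>h\<in>H. - x h)" by (rule mult_left_le_imp_le) simp
   moreover have "(\<Prod>h\<in>H. - x h) = \<bar>prod x H\<bar>"
    unfolding abs_prod by (rule prod.cong [OF refl]) (simp add: neg less_imp_le)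
   ultimately show ?thesis using False by simp
  qed
 qed
qed

text \<open>
 Expand at a point outside \<open>H\<close>: the link is uniform, and where it vanishes \<open>uniform_circuit_bound\<close>
 says that the remaining part, diminished by the monomial of \<open>H\<close>, is non-positive.
\<close>

lemma gard_uniform_minus:
 assumes E: "finite E" "H \<subseteq> E" "card H = r" and r: "1 <= r" "r < card E"
 shows "gard E (\<lambda>T. if T = H then 0 else uc r T)"
proof -
 have "H ~= E" using E r by auto
 then obtain e where e: "e \<in> E" "e \<notin> H" using E by auto
 have l: "link (\<lambda>T. if T = H then 0 else uc r T) {e} T = uc (r - 1) T" if "T \<subseteq> E - {e}" for T
 proof -
  have "finite T" "e \<notin> T" using that E finite_subset [of T E] by auto
  then show ?thesis using e link_uc [of T "{e}" r] by (auto simp: link_def)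
 qed
 show ?thesis
 proof (rule gard_criterion [OF E(1) e(1)])
  have "gard (E - {e}) (uc (r - 1))" using E e r by (intro gard_uniform) auto
  then show "gard (E - {e}) (link (\<lambda>T. if T = H then 0 else uc r T) {e})"
   using gard_cong [of "E - {e}" "link (\<lambda>T. if T = H then 0 else uc r T) {e}", OF l] by simp
  fix x assume "x \<in> nnR (E - {e}) (link (\<lambda>T. if T = H then 0 else uc r T) {e})"
   and "pd E (\<lambda>T. if T = H then 0 else uc r T) {e} x = 0"
  then have x: "x \<in> nnR (E - {e}) (uc (r - 1))" and z: "us (r - 1) (E - {e}) x = 0"
   using nnR_coeff_cong [of "E - {e}" "link (\<lambda>T. if T = H then 0 else uc r T) {e}", OF l]
    ma_cong [of "E - {e}" "link (\<lambda>T. if T = H then 0 else uc r T) {e}" "uc (r - 1)" x x] l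
   by (auto simp: pd_def us_def)
  have "us (r - 1 + 1) (E - {e}) x <= prod x H"
   using E e r x z by (intro uniform_circuit_bound) auto
  moreover have "ma (E - {e}) (\<lambda>T. if T = H then 0 else uc r T) x = us r (E - {e}) x - prod x H"
  proof -
   have "ma (E - {e}) (\<lambda>T. if T = H then 0 else uc r T) x
     = ma (E - {e}) (\<lambda>T. uc r T - (if T = H then 1 else 0)) x"
    by (intro ma_cong) (auto simp: uc_def E)
   also have "\<dots> = us r (E - {e}) x - ma (E - {e}) (\<lambda>T. if T = H then 1 else 0) x"
    by (simp only: ma_diff us_def)
   also have "ma (E - {e}) (\<lambda>T. if T = H then 1 else 0) x = (\<Sum>T\<in>Pow (E - {e}). if T = H then prod x T else 0)"
    unfolding ma_def by (intro sum.cong) auto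
   also have "\<dots> = prod x H" using E e by (subst sum.delta) auto
   finally show ?thesis .
  qed
  ultimately show "ma (E - {e}) (\<lambda>T. if T = H then 0 else uc r T) x <= 0" using r by simp
 qed auto
qed

section \<open>Rank three on six elements\<close>

text \<open>
 Spanning sets of a matroid of rank \<open>r\<close> whose non-bases \<open>\<H>\<close> are so sparse that all larger
 sets are spanning.
\<close>

definition minus_coeff :: "nat => 'a set set => 'a set => real" where
 "minus_coeff r \<H> T = (if T \<in> \<H> then 0 else uc r T)"

lemma pd_minus_coeff:
 assumes E: "finite E" "T \<subseteq> E" and H: "\<And>H. H \<in> \<H> ==> card H = r"
 shows "pd E (minus_coeff r \<H>) T x = us (r - card T) (E - T) x - (\<Sum>H | H \<in> \<H> & T \<subseteq> H & H \<subseteq> E. prod x (H - T))"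
proof -
 have "pd E (minus_coeff r \<H>) T x = ma (E - T) (\<lambda>U. link (uc r) T U - (if U \<union> T \<in> \<H> then 1 else 0)) x"
  unfolding pd_def by (rule ma_cong [OF _ refl]) (auto simp: minus_coeff_def link_def uc_def H)
 also have "\<dots> = pd E (uc r) T x - ma (E - T) (\<lambda>U. if U \<union> T \<in> \<H> then 1 else 0) x"
  by (simp only: ma_diff pd_def)
 also have "ma (E - T) (\<lambda>U. if U \<union> T \<in> \<H> then 1 else 0) x = (\<Sum>U | U \<in> Pow (E - T) & U \<union> T \<in> \<H>. prod x U)"
 proof -
  have "ma (E - T) (\<lambda>U. if U \<union> T \<in> \<H> then 1 else 0) x = (\<Sum>U\<in>Pow (E - T). if U \<union> T \<in> \<H> then prod x U else 0)"
   unfolding ma_def by (intro sum.cong) auto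
  then show ?thesis using sum.inter_filter [of "Pow (E - T)" "prod x" "\<lambda>U. U \<union> T \<in> \<H>"] E by simp
 qed
 also have "\<dots> = (\<Sum>H | H \<in> \<H> & T \<subseteq> H & H \<subseteq> E. prod x (H - T))"
 proof (rule sum.reindex_bij_witness [where i = "\<lambda>H. H - T" and j = "\<lambda>U. U \<union> T"])
  fix U assume U: "U \<in> {U \<in> Pow (E - T). U \<union> T \<in> \<H>}"
  then have "U \<union> T - T = U" by auto
  then show "U \<union> T - T = U" "prod x (U \<union> T - T) = prod x U" by simp_all
  show "U \<union> T \<in> {H \<in> \<H>. T \<subseteq> H & H \<subseteq> E}" using U E by auto
 next
  fix H assume H: "H \<in> {H \<in> \<H>. T \<subseteq> H & H \<subseteq> E}"
  then have "H - T \<union> T = H" by auto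
  then show "H - T \<union> T = H" "H - T \<in> {U \<in> Pow (E - T). U \<union> T \<in> \<H>}" using H by auto
 qed
 finally show ?thesis using pd_uc [OF E, of r x] by simp
qed

lemma us_empty: "us k {} x = (if k = 0 then 1 else 0)"
 by (simp add: us_def uc_def)

lemma sum_pos_of_prod_gt_1:
 fixes x y t :: real
 assumes "0 < 1 + x" "0 < 1 + y" "0 < 1 + t" "1 < (1 + x) * (1 + y) * (1 + t)"
 shows "0 < x + y + t"
proof -
 have "0 < ln ((1 + x) * (1 + y) * (1 + t))" using assms by simp
 also have "\<dots> = ln (1 + x) + ln (1 + y) + ln (1 + t)" using assms by (simp add: ln_mult)
 also have "\<dots> <= x + y + t"
  using ln_le_minus_one [of "1 + x"] ln_le_minus_one [of "1 + y"] ln_le_minus_one [of "1 + t"] assms by simp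
 finally show ?thesis .
qed

lemma K4_inequality:
 fixes a b d f :: real
 assumes pos: "0 < 1 + a" "0 < 1 + b" "0 < 1 + d" "0 < 1 + f" and W: "1 < (1 + a) * (1 + b) * (1 + d) * (1 + f)"
 shows "0 <= (1 + b) * (1 + d) * (a * f)\<^sup>2 - 2 * (a * f) * (b * d) + (1 + a) * (1 + f) * (b * d)\<^sup>2"
proof -
 define p where "p = (1 + a) * (1 + f)"
 define q where "q = (1 + b) * (1 + d)"
 define u where "u = a * f"
 define v where "v = b * d"
 have q: "0 < q" using pos by (simp add: q_def)
 have pq: "1 < p * q" using W by (simp add: p_def q_def mult_ac)
 have "q * (q * u\<^sup>2 - 2 * u * v + p * v\<^sup>2) = (q * u - v)\<^sup>2 + (p * q - 1) * v\<^sup>2"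
  by (simp add: power2_eq_square algebra_simps)
 also have "0 <= \<dots>" using pq by simp
 finally have "0 <= q * u\<^sup>2 - 2 * u * v + p * v\<^sup>2" using q by (simp add: zero_le_mult_iff)
 then show ?thesis by (simp add: p_def q_def u_def v_def)
qed

lemma pair_bound_nonneg:
 fixes a b :: real
 assumes "0 < 1 + a" "0 < 1 + b" "0 <= a * b"
 shows "a * b <= (a + b + a * b)\<^sup>2 - a * b * (1 + (a + b + a * b))"
proof -
 define \<sigma> where "\<sigma> = a + b"
 define g where "g = a * b"
 have g: "0 <= g" "4 * g <= \<sigma>\<^sup>2"
  using assms(3) zero_le_power2 [of "a - b"] by (auto simp: g_def \<sigma>_def power2_eq_square algebra_simps)
 have \<sigma>: "-2 < \<sigma>" using assms by (simp add: \<sigma>_def)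
 have "0 <= \<sigma>\<^sup>2 + \<sigma> * g - 2 * g"
 proof (cases "0 <= \<sigma>")
  case True
  then have "0 <= \<sigma> * g" using g by simp
  then show ?thesis using g by linarith
 next
  case False
  have "0 <= (2 - \<sigma>) * (\<sigma>\<^sup>2 - 4 * g)" using False g by simp
  moreover have "0 <= \<sigma>\<^sup>2 * (2 + \<sigma>)" using \<sigma> by simp
  moreover have "4 * (\<sigma>\<^sup>2 + \<sigma> * g - 2 * g) = (2 - \<sigma>) * (\<sigma>\<^sup>2 - 4 * g) + \<sigma>\<^sup>2 * (2 + \<sigma>)"
   by (simp add: power2_eq_square algebra_simps)
  ultimately have "0 <= 4 * (\<sigma>\<^sup>2 + \<sigma> * g - 2 * g)" by (simp only: add_nonneg_nonneg)
  then show ?thesis by simp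
 qed
 moreover have "(a + b + a * b)\<^sup>2 - a * b * (1 + (a + b + a * b)) - a * b = \<sigma>\<^sup>2 + \<sigma> * g - 2 * g"
  by (simp add: \<sigma>_def g_def power2_eq_square algebra_simps)
 ultimately show ?thesis by linarith
qed

lemma two_pairs_inequality:
 fixes a b d f :: real
 assumes pos: "0 < 1 + a" "0 < 1 + b" "0 < 1 + d" "0 < 1 + f" and W: "1 < (1 + a) * (1 + b) * (1 + d) * (1 + f)"
 defines "U \<equiv> a + b + a * b" and "V \<equiv> d + f + d * f"
 shows "a * b * (d * f) <= (U\<^sup>2 - a * b * (1 + U)) * (V\<^sup>2 - d * f * (1 + V))"
proof -
 have UV: "0 < 1 + U" "0 < 1 + V" "1 < (1 + U) * (1 + V)"
 proof -
  have 1: "1 + U = (1 + a) * (1 + b)" "1 + V = (1 + d) * (1 + f)" by (simp_all add: U_def V_def algebra_simps)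
  show "0 < 1 + U" "0 < 1 + V" "1 < (1 + U) * (1 + V)" using pos W unfolding 1 by (simp_all add: mult.assoc)
 qed
 define g where "g = a * b"
 define h where "h = d * f"
 define \<alpha> where "\<alpha> = U\<^sup>2 - g * (1 + U)"
 define \<beta> where "\<beta> = V\<^sup>2 - h * (1 + V)"
 have a0: "g <= \<alpha>" if "0 <= g" using pair_bound_nonneg [OF pos(1,2)] that by (simp add: g_def \<alpha>_def U_def)
 have b0: "h <= \<beta>" if "0 <= h" using pair_bound_nonneg [OF pos(3,4)] that by (simp add: h_def \<beta>_def V_def)
 have a1: "- g * (1 + U) <= \<alpha>" and b1: "- h * (1 + V) <= \<beta>" by (simp_all add: \<alpha>_def \<beta>_def)
 have "g * h <= \<alpha> * \<beta>"
 proof (cases "0 <= g"; cases "0 <= h")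
  assume "0 <= g" "0 <= h"
  then show ?thesis using a0 b0 by (intro mult_mono) auto
 next
  assume gh: "0 <= g" "\<not> 0 <= h"
  have "0 <= - h * (1 + V)" using gh UV by (simp add: mult_nonpos_nonneg)
  then have "0 <= \<alpha> * \<beta>" using a0 [OF gh(1)] b1 gh by (intro mult_nonneg_nonneg) linarith+
  moreover have "g * h <= 0" using gh by (simp add: mult_nonneg_nonpos)
  ultimately show ?thesis by linarith
 next
  assume gh: "\<not> 0 <= g" "0 <= h"
  have "0 <= - g * (1 + U)" using gh UV by (simp add: mult_nonpos_nonneg)
  then have "0 <= \<alpha> * \<beta>" using b0 [OF gh(2)] a1 gh by (intro mult_nonneg_nonneg) linarith+
  moreover have "g * h <= 0" using gh by (simp add: mult_nonpos_nonneg)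
  ultimately show ?thesis by linarith
 next
  assume gh: "\<not> 0 <= g" "\<not> 0 <= h"
  have n: "0 <= - g * (1 + U)" "0 <= - h * (1 + V)" using gh UV by (simp_all add: mult_nonpos_nonneg)
  have "g * h * 1 <= g * h * ((1 + U) * (1 + V))"
   using gh UV by (intro mult_left_mono) (auto simp: mult_nonpos_nonpos)
  also have "\<dots> = (- g * (1 + U)) * (- h * (1 + V))" by (simp add: algebra_simps)
  also have "\<dots> <= \<alpha> * \<beta>" using a1 b1 n by (intro mult_mono) auto
  finally show ?thesis by simp
 qed
 then show ?thesis by (simp add: g_def h_def \<alpha>_def \<beta>_def)
qed

lemma disjoint_lines_inequality:
 fixes k x y t :: real
 assumes pos: "0 < 1 + k" "0 < 1 + x" "0 < 1 + y" "0 < 1 + t" and W: "1 < (1 + x) * (1 + y) * (1 + t)"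
 defines "F \<equiv> (1 + x) * (1 + y) * (1 + t) - 1" and "e \<equiv> x + y + t"
 shows "0 <= F * e * k\<^sup>2 + F * (F - e) * k + (F - e)\<^sup>2"
proof -
 have F: "0 < F" using W by (simp add: F_def)
 have e: "0 < e" unfolding e_def using pos W by (intro sum_pos_of_prod_gt_1) auto
 show ?thesis
 proof (cases "2 * e <= F - e")
  case True
  have "F * e * k\<^sup>2 + F * (F - e) * k + (F - e)\<^sup>2
    = F * e * (1 + k)\<^sup>2 + (1 + k) * F * (F - e - 2 * e) + e\<^sup>2"
   by (simp add: power2_eq_square algebra_simps)
  also have "0 <= \<dots>" using F e pos True by simp
  finally show ?thesis .
 next
  case False
  have "4 * F * e * (F * e * k\<^sup>2 + F * (F - e) * k + (F - e)\<^sup>2)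
    = (2 * F * e * k + F * (F - e))\<^sup>2 + (F - e)\<^sup>2 * F * (4 * e - F)"
   by (simp add: power2_eq_square algebra_simps)
  also have "0 <= \<dots>" using F False by simp
  finally have "0 <= 4 * F * e * (F * e * k\<^sup>2 + F * (F - e) * k + (F - e)\<^sup>2)" .
  moreover have "0 < 4 * F * e" using F e by simp
  ultimately show ?thesis by (metis mult_pos_neg not_le)
 qed
qed

lemma whirl_inequality:
 fixes k x y t :: real
 assumes pos: "0 < 1 + k" "0 < 1 + x" "0 < 1 + y" "0 < 1 + t" and W: "1 < (1 + x) * (1 + y) * (1 + t)"
 defines "F \<equiv> (1 + x) * (1 + y) * (1 + t) - 1" and "e \<equiv> x + y + t"
 shows "0 <= F * e * k\<^sup>2 + F * (y * t) * k + (1 + x) * (y * t)\<^sup>2"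
proof -
 have F: "0 < F" using W by (simp add: F_def)
 have e: "0 < e" unfolding e_def using pos W by (intro sum_pos_of_prod_gt_1) auto
 define X where "X = 1 + x"
 define s where "s = y + t"
 define g where "g = y * t"
 have Feq: "F = x + X * s + X * g" by (simp add: F_def X_def s_def g_def algebra_simps)
 have eeq: "e = x + s" by (simp add: e_def s_def)
 have X: "0 < X" using pos by (simp add: X_def)
 have key: "0 <= 2 * x\<^sup>2 + x + X * s"
 proof -
  define m where "m = 1 + s / 2"
  have "m = ((1 + y) + (1 + t)) / 2" by (simp add: m_def s_def)
  moreover have "0 < (1 + y) + (1 + t)" by (rule add_pos_pos [OF pos(3,4)])
  ultimately have m: "0 < m" by simp
  have "m\<^sup>2 - (1 + y) * (1 + t) = ((y - t) / 2)\<^sup>2" by (simp add: m_def s_def power2_eq_square field_simps)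
  then have "(1 + y) * (1 + t) <= m\<^sup>2" by (metis diff_ge_0_iff_ge zero_le_power2)
  then have "X * ((1 + y) * (1 + t)) <= X * m\<^sup>2" using X by (intro mult_left_mono) auto
  then have "1 <= X * m\<^sup>2" using W by (simp add: X_def mult.assoc)
  then have "X * 1 <= X * (X * m\<^sup>2)" using X by (intro mult_left_mono) auto
  then have "X <= (X * m)\<^sup>2" by (simp add: power2_eq_square mult_ac)
  then have "sqrt X <= X * m" using X m by (intro real_le_lsqrt) auto
  moreover have "2 * x\<^sup>2 + x + X * s = 2 * X\<^sup>2 - 5 * X + 1 + 2 * (X * m)"
   by (simp add: X_def m_def power2_eq_square algebra_simps)
  moreover have "2 * X\<^sup>2 - 5 * X + 1 + 2 * sqrt X = (sqrt X - 1)\<^sup>2 * (2 * (sqrt X)\<^sup>2 + 4 * sqrt X + 1)"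
  proof -
   define q where "q = sqrt X"
   have "X = q\<^sup>2" using X by (simp add: q_def)
   then show ?thesis unfolding q_def [symmetric] by (simp add: power2_eq_square algebra_simps)
  qed
  moreover have "0 <= (sqrt X - 1)\<^sup>2 * (2 * (sqrt X)\<^sup>2 + 4 * sqrt X + 1)" using X by simp
  ultimately show ?thesis by linarith
 qed
 have disc: "4 * F * e * (F * e * k\<^sup>2 + F * g * k + X * g\<^sup>2) = (2 * F * e * k + F * g)\<^sup>2 + g\<^sup>2 * F * (4 * e * X - F)"
  by (simp add: power2_eq_square algebra_simps)
 have eX: "4 * e * X - F = 3 * (x + X * s) + 4 * x\<^sup>2 - X * g"
  by (simp add: Feq eeq X_def power2_eq_square algebra_simps)
 have small: "0 <= F * e * k\<^sup>2 + F * g * k + X * g\<^sup>2" if "0 <= 4 * e * X - F"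
 proof -
  have "0 <= 4 * F * e * (F * e * k\<^sup>2 + F * g * k + X * g\<^sup>2)" unfolding disc using that F by simp
  moreover have "0 < 4 * F * e" using F e by simp
  ultimately show ?thesis by (metis mult_pos_neg not_le)
 qed
 consider "g < 0" | "0 <= g" "g <= 2 * e" | "2 * e < g" by linarith
 then have "0 <= F * e * k\<^sup>2 + F * g * k + X * g\<^sup>2"
 proof cases
  case 1
  then have "X * g < 0" using X by (simp add: mult_pos_neg)
  moreover have "0 < x + X * s" using calculation F Feq by linarith
  ultimately have "0 <= (3 * (x + X * s) + 4 * x\<^sup>2) + (- (X * g))"
   by (intro add_nonneg_nonneg) simp_all
  then have "0 <= 3 * (x + X * s) + 4 * x\<^sup>2 - X * g" by (simp only: diff_conv_add_uminus)
  then show ?thesis by (intro small) (simp only: eX)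
 next
  case 2
  have "X * g <= X * (2 * e)" using 2 X by (intro mult_left_mono) auto
  then have "3 * (x + X * s) + 4 * x\<^sup>2 - X * (2 * e) <= 3 * (x + X * s) + 4 * x\<^sup>2 - X * g"
   by (rule diff_left_mono)
  moreover have "3 * (x + X * s) + 4 * x\<^sup>2 - X * (2 * e) = 2 * x\<^sup>2 + x + X * s"
   by (simp add: eeq X_def power2_eq_square algebra_simps)
  ultimately have "0 <= 3 * (x + X * s) + 4 * x\<^sup>2 - X * g" using key by simp
  then show ?thesis by (intro small) (simp only: eX)
 next
  case 3
  have "(x + X * s) * e + g * x\<^sup>2 \<ge> e * (2 * x\<^sup>2 + x + X * s)"
  proof -
   have "2 * e * x\<^sup>2 <= g * x\<^sup>2" using 3 by (intro mult_right_mono) auto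
   then show ?thesis by (simp add: algebra_simps)
  qed
  moreover have "0 <= e * (2 * x\<^sup>2 + x + X * s)" using e key by simp
  ultimately have V: "0 <= (x + X * s) * e + g * x\<^sup>2" by linarith
  have "F * e * k\<^sup>2 + F * g * k + X * g\<^sup>2
    = F * e * (1 + k)\<^sup>2 + (1 + k) * F * (g - 2 * e) + (F * (e - g) + X * g\<^sup>2)"
   by (simp add: power2_eq_square algebra_simps)
  also have "F * (e - g) + X * g\<^sup>2 = (x + X * s) * e + g * x\<^sup>2"
   unfolding Feq eeq X_def by (simp add: power2_eq_square algebra_simps)
  finally have "F * e * k\<^sup>2 + F * g * k + X * g\<^sup>2
    = F * e * (1 + k)\<^sup>2 + (1 + k) * F * (g - 2 * e) + ((x + X * s) * e + g * x\<^sup>2)" .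
  then show ?thesis using V F e pos 3 by simp
 qed
 then show ?thesis by (simp add: X_def g_def)
qed


text \<open>
 A derivative of order one less than the size of the ground set is \<open>1 + x e\<close>.
\<close>

lemma one_plus_pos:
 assumes E: "finite E" "S \<subseteq> E" "r < card E - 1" and H: "\<And>H. H \<in> \<H> ==> card H = r"
  and x: "x \<in> posR (E - S) (link (minus_coeff r \<H>) S)" and e: "e \<in> E - S"
 shows "0 < 1 + x e"
proof -
 have "0 < pd (E - S) (link (minus_coeff r \<H>) S) (E - S - {e}) x" by (rule posR_D [OF x]) auto
 moreover have "S \<union> (E - S - {e}) = E - {e}" using E e by auto
 ultimately have "0 < pd E (minus_coeff r \<H>) (E - {e}) x" by (simp add: pd_link)
 moreover have "{H. H \<in> \<H> & E - {e} \<subseteq> H & H \<subseteq> E} = {}"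
 proof -
  have "\<not> (H \<in> \<H> & E - {e} \<subseteq> H & H \<subseteq> E)" for H
  proof
   assume h: "H \<in> \<H> & E - {e} \<subseteq> H & H \<subseteq> E"
   then have "card (E - {e}) <= card H" using E(1) by (intro card_mono) (auto intro: finite_subset)
   then show False using H [of H] h E e by auto
  qed
  then show ?thesis by blast
 qed
 moreover have "r - card (E - {e}) = 0" "E - (E - {e}) = {e}" using E e by auto
 moreover have "pd E (minus_coeff r \<H>) (E - {e}) x = us (r - card (E - {e})) (E - (E - {e})) x
   - (\<Sum>H | H \<in> \<H> & E - {e} \<subseteq> H & H \<subseteq> E. prod x (H - (E - {e})))"
  by (rule pd_minus_coeff) (use E H in auto)
 ultimately show ?thesis by (simp add: us_0)
qed

text \<open>
 The single Rayleigh inequality needed, in which the four parts are elementary symmetric-like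
 sums corrected by the monomials of the lines in each class.
\<close>

lemma gard_minus_single_pair:
 assumes E: "finite E" "3 < card E - 1" and H: "\<And>H. H \<in> \<H> ==> card H = 3"
  and ij: "i \<in> E" "j \<in> E" "i ~= j"
  and gi: "gard (E - {i}) (link (minus_coeff 3 \<H>) {i})" and gj: "gard (E - {j}) (link (minus_coeff 3 \<H>) {j})"
  and D: "E - {i,j} = D"
  and SP: "{H. H \<in> \<H> & H \<subseteq> D} = \<H>P" and S1: "{H. H \<in> \<H> & i \<in> H & j \<notin> H & H \<subseteq> E} = \<H>1"
  and S2: "{H. H \<in> \<H> & j \<in> H & i \<notin> H & H \<subseteq> E} = \<H>2" and SR: "{H. H \<in> \<H> & i \<in> H & j \<in> H & H \<subseteq> E} = \<H>R"
  and ineq: "\<And>x. (\<And>e. e \<in> D ==> 0 < 1 + x e) ==> 0 < us 1 D x - (\<Sum>H\<in>\<H>R. prod x (H - {i,j})) ==>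
    (us 3 D x - (\<Sum>H\<in>\<H>P. prod x H)) * (us 1 D x - (\<Sum>H\<in>\<H>R. prod x (H - {i,j})))
     <= (us 2 D x - (\<Sum>H\<in>\<H>1. prod x (H - {i}))) * (us 2 D x - (\<Sum>H\<in>\<H>2. prod x (H - {j})))"
 shows "gard E (minus_coeff 3 \<H>)"
proof (rule gard_single_pair [OF E(1) ij _ gi gj])
 show "0 <= minus_coeff 3 \<H> T" for T by (simp add: minus_coeff_def)
 fix x assume x: "x \<in> posR (E - {i,j}) (link (minus_coeff 3 \<H>) {i,j})"
 have s: "E - {j} - {i} = D" "E - {i} - {j} = D" using D by auto
 have P: "ma D (minus_coeff 3 \<H>) x = us 3 D x - (\<Sum>H\<in>\<H>P. prod x H)"
 proof -
  have "{H. H \<in> \<H> & {} \<subseteq> H & H \<subseteq> D} = \<H>P" using SP by simp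
  moreover have "finite D" using D E(1) by auto
  ultimately show ?thesis using pd_minus_coeff [of D "{}" \<H> 3 x] H by simp
 qed
 have R: "pd E (minus_coeff 3 \<H>) {i,j} x = us 1 D x - (\<Sum>H\<in>\<H>R. prod x (H - {i,j}))"
 proof -
  have "{H. H \<in> \<H> & {i,j} \<subseteq> H & H \<subseteq> E} = \<H>R" using SR by auto
  then show ?thesis using pd_minus_coeff [of E "{i,j}" \<H> 3 x] H E ij D by simp
 qed
 have Q1: "pd (E - {j}) (minus_coeff 3 \<H>) {i} x = us 2 D x - (\<Sum>H\<in>\<H>1. prod x (H - {i}))"
 proof -
  have "{H. H \<in> \<H> & {i} \<subseteq> H & H \<subseteq> E - {j}} = \<H>1" using S1 by auto
  then show ?thesis using pd_minus_coeff [of "E - {j}" "{i}" \<H> 3 x] H E ij s by simp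
 qed
 have Q2: "pd (E - {i}) (minus_coeff 3 \<H>) {j} x = us 2 D x - (\<Sum>H\<in>\<H>2. prod x (H - {j}))"
 proof -
  have "{H. H \<in> \<H> & {j} \<subseteq> H & H \<subseteq> E - {i}} = \<H>2" using S2 by auto
  then show ?thesis using pd_minus_coeff [of "E - {i}" "{j}" \<H> 3 x] H E ij s by simp
 qed
 have "0 < 1 + x e" if "e \<in> D" for e
  by (rule one_plus_pos [OF E(1) _ E(2) H x]) (use that D ij in auto)
 moreover have "0 < pd E (minus_coeff 3 \<H>) {i,j} x" using posR_D0 [OF x] by (simp add: ma_link)
 ultimately show "ma (E - {i,j}) (minus_coeff 3 \<H>) x * pd E (minus_coeff 3 \<H>) {i,j} x
  <= pd (E - {j}) (minus_coeff 3 \<H>) {i} x * pd (E - {i}) (minus_coeff 3 \<H>) {j} x"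
  unfolding D P R Q1 Q2 by (rule ineq)
qed

context
 fixes a b c d f g :: 'a and E :: "'a set"
 assumes dist: "distinct [a,b,c,d,f,g]" and E: "E = {a,b,c,d,f,g}"
begin

lemma E_facts: "finite E" "3 < card E - 1"
 using dist by (auto simp: E)

lemmas us_expand = us_insert us_empty

text \<open>
 The four lines of the graph \<open>K4\<close>. For the opposite pair \<open>c\<close>, \<open>g\<close> the Rayleigh difference is the
 quadratic form of \<open>K4_inequality\<close>.
\<close>

lemma gard_K4:
 assumes "\<H> = {{c,a,b},{c,d,f},{a,d,g},{b,f,g}}"
  and "gard (E - {c}) (link (minus_coeff 3 \<H>) {c})" "gard (E - {g}) (link (minus_coeff 3 \<H>) {g})"
 shows "gard E (minus_coeff 3 \<H>)"
proof (rule gard_minus_single_pair [OF E_facts, where i = c and j = g and D = "{a,b,d,f}"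
   and \<H>P = "{}" and \<H>R = "{}" and ?\<H>1.0 = "{{c,a,b},{c,d,f}}" and ?\<H>2.0 = "{{a,d,g},{b,f,g}}"])
 fix x :: "'a => real"
 assume pos: "\<And>e. e \<in> {a,b,d,f} ==> 0 < 1 + x e"
  and R: "0 < us 1 {a,b,d,f} x - (\<Sum>H\<in>{}. prod x (H - {c,g}))"
 define A B D F where "A = x a" "B = x b" "D = x d" "F = x f"
 note defs = this
 have u1: "us 1 {a,b,d,f} x = (1 + A) * (1 + B) * (1 + D) * (1 + F) - 1"
  using dist by (simp add: us_expand defs algebra_simps)
 have u2: "us 2 {a,b,d,f} x = A*B + A*D + A*F + B*D + B*F + D*F + A*B*D + A*B*F + A*D*F + B*D*F + A*B*D*F"
  using dist by (simp add: us_expand defs algebra_simps)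
 have u3: "us 3 {a,b,d,f} x = A*B*D + A*B*F + A*D*F + B*D*F + A*B*D*F"
  using dist by (simp add: us_expand defs algebra_simps)
 have ne: "{c,a,b} ~= {c,d,f}" "{a,d,g} ~= {b,f,g}" using dist by auto
 have df: "{c,a,b} - {c} = {a,b}" "{c,d,f} - {c} = {d,f}" "{a,d,g} - {g} = {a,d}" "{b,f,g} - {g} = {b,f}"
  using dist by auto
 have s1: "(\<Sum>H\<in>{{c,a,b},{c,d,f}}. prod x (H - {c})) = A*B + D*F"
  using dist ne by (simp add: df defs)
 have s2: "(\<Sum>H\<in>{{a,d,g},{b,f,g}}. prod x (H - {g})) = A*D + B*F"
  using dist ne by (simp add: df defs)
 have "0 <= (1 + B) * (1 + D) * (A * F)\<^sup>2 - 2 * (A * F) * (B * D) + (1 + A) * (1 + F) * (B * D)\<^sup>2"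
  using pos R u1 by (intro K4_inequality) (auto simp: defs)
 also have "\<dots> = (us 2 {a,b,d,f} x - (A*B + D*F)) * (us 2 {a,b,d,f} x - (A*D + B*F)) - us 3 {a,b,d,f} x * us 1 {a,b,d,f} x"
  unfolding u1 u2 u3 by (simp add: power2_eq_square algebra_simps)
 finally show "(us 3 {a,b,d,f} x - (\<Sum>H\<in>{}. prod x H)) * (us 1 {a,b,d,f} x - (\<Sum>H\<in>{}. prod x (H - {c,g})))
   <= (us 2 {a,b,d,f} x - (\<Sum>H\<in>{{c,a,b},{c,d,f}}. prod x (H - {c}))) * (us 2 {a,b,d,f} x - (\<Sum>H\<in>{{a,d,g},{b,f,g}}. prod x (H - {g})))"
  unfolding s1 s2 by simp
qed (use assms dist in \<open>auto simp: E\<close>)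

lemma gard_two_meeting_lines:
 assumes "\<H> = {{c,a,b},{c,d,f}}"
  and "gard (E - {c}) (link (minus_coeff 3 \<H>) {c})" "gard (E - {g}) (link (minus_coeff 3 \<H>) {g})"
 shows "gard E (minus_coeff 3 \<H>)"
proof (rule gard_minus_single_pair [OF E_facts, where i = c and j = g and D = "{a,b,d,f}"
   and \<H>P = "{}" and \<H>R = "{}" and ?\<H>1.0 = "{{c,a,b},{c,d,f}}" and ?\<H>2.0 = "{}"])
 fix x :: "'a => real"
 assume pos: "\<And>e. e \<in> {a,b,d,f} ==> 0 < 1 + x e"
  and R: "0 < us 1 {a,b,d,f} x - (\<Sum>H\<in>{}. prod x (H - {c,g}))"
 define A B D F where "A = x a" "B = x b" "D = x d" "F = x f"
 note defs = this
 have u1: "us 1 {a,b,d,f} x = (1 + A) * (1 + B) * (1 + D) * (1 + F) - 1"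
  using dist by (simp add: us_expand defs algebra_simps)
 have u2: "us 2 {a,b,d,f} x = A*B + A*D + A*F + B*D + B*F + D*F + A*B*D + A*B*F + A*D*F + B*D*F + A*B*D*F"
  using dist by (simp add: us_expand defs algebra_simps)
 have u3: "us 3 {a,b,d,f} x = A*B*D + A*B*F + A*D*F + B*D*F + A*B*D*F"
  using dist by (simp add: us_expand defs algebra_simps)
 have ne: "{c,a,b} ~= {c,d,f}" using dist by auto
 have df: "{c,a,b} - {c} = {a,b}" "{c,d,f} - {c} = {d,f}" using dist by auto
 have s1: "(\<Sum>H\<in>{{c,a,b},{c,d,f}}. prod x (H - {c})) = A*B + D*F"
  using dist ne by (simp add: df defs)
 have "A * B * (D * F) <= ((A + B + A * B)\<^sup>2 - A * B * (1 + (A + B + A * B))) * ((D + F + D * F)\<^sup>2 - D * F * (1 + (D + F + D * F)))"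
  using pos R u1 by (intro two_pairs_inequality) (auto simp: defs)
 also have "\<dots> = (us 2 {a,b,d,f} x - (A*B + D*F)) * us 2 {a,b,d,f} x - us 3 {a,b,d,f} x * us 1 {a,b,d,f} x + A * B * (D * F)"
  unfolding u1 u2 u3 by (simp add: power2_eq_square algebra_simps)
 finally show "(us 3 {a,b,d,f} x - (\<Sum>H\<in>{}. prod x H)) * (us 1 {a,b,d,f} x - (\<Sum>H\<in>{}. prod x (H - {c,g})))
   <= (us 2 {a,b,d,f} x - (\<Sum>H\<in>{{c,a,b},{c,d,f}}. prod x (H - {c}))) * (us 2 {a,b,d,f} x - (\<Sum>H\<in>{}. prod x (H - {g})))"
  unfolding s1 by simp
qed (use assms dist in \<open>auto simp: E\<close>)

lemma gard_two_disjoint_lines: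
 assumes "\<H> = {{c,a,b},{d,f,g}}"
  and "gard (E - {c}) (link (minus_coeff 3 \<H>) {c})" "gard (E - {a}) (link (minus_coeff 3 \<H>) {a})"
 shows "gard E (minus_coeff 3 \<H>)"
proof (rule gard_minus_single_pair [OF E_facts, where i = c and j = a and D = "{b,d,f,g}"
   and \<H>P = "{{d,f,g}}" and \<H>R = "{{c,a,b}}" and ?\<H>1.0 = "{}" and ?\<H>2.0 = "{}"])
 fix x :: "'a => real"
 assume pos: "\<And>e. e \<in> {b,d,f,g} ==> 0 < 1 + x e"
  and R: "0 < us 1 {b,d,f,g} x - (\<Sum>H\<in>{{c,a,b}}. prod x (H - {c,a}))"
 define B D F G where "B = x b" "D = x d" "F = x f" "G = x g"
 note defs = this
 define P where "P = (1 + D) * (1 + F) * (1 + G) - 1"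
 have u1: "us 1 {b,d,f,g} x = (1 + B) * P + B"
  using dist by (simp add: us_expand defs P_def algebra_simps)
 have u2: "us 2 {b,d,f,g} x = P - (D + F + G) + B * P"
  using dist by (simp add: us_expand defs P_def algebra_simps)
 have u3: "us 3 {b,d,f,g} x = D*F*G + B * (P - (D + F + G))"
  using dist by (simp add: us_expand defs P_def algebra_simps)
 have "{c,a,b} - {c,a} = {b}" using dist by auto
 then have sR: "(\<Sum>H\<in>{{c,a,b}}. prod x (H - {c,a})) = B" by (simp add: defs)
 have sP: "(\<Sum>H\<in>{{d,f,g}}. prod x H) = D*F*G" using dist by (simp add: defs)
 have p1: "0 < 1 + B" "0 < 1 + D" "0 < 1 + F" "0 < 1 + G" using pos by (auto simp: defs)
 have "0 < (1 + B) * P" using R unfolding sR u1 by simp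
 then have "0 < P" using p1 by (simp add: zero_less_mult_iff)
 then have "0 <= P * (D + F + G) * B\<^sup>2 + P * (P - (D + F + G)) * B + (P - (D + F + G))\<^sup>2"
  using disjoint_lines_inequality [OF p1] by (simp add: P_def)
 also have "\<dots> = us 2 {b,d,f,g} x * us 2 {b,d,f,g} x - (us 3 {b,d,f,g} x - D*F*G) * (us 1 {b,d,f,g} x - B)"
  unfolding u1 u2 u3 by (simp add: power2_eq_square algebra_simps)
 finally show "(us 3 {b,d,f,g} x - (\<Sum>H\<in>{{d,f,g}}. prod x H)) * (us 1 {b,d,f,g} x - (\<Sum>H\<in>{{c,a,b}}. prod x (H - {c,a})))
   <= (us 2 {b,d,f,g} x - (\<Sum>H\<in>{}. prod x (H - {c}))) * (us 2 {b,d,f,g} x - (\<Sum>H\<in>{}. prod x (H - {a})))"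
  unfolding sR sP by simp
qed (use assms dist in \<open>auto simp: E\<close>)

text \<open>
 The three lines of the whirl; the point \<open>c\<close> lies on two of them and \<open>a\<close> on two.
\<close>

lemma gard_whirl:
 assumes "\<H> = {{c,a,b},{c,d,f},{a,d,g}}"
  and "gard (E - {c}) (link (minus_coeff 3 \<H>) {c})" "gard (E - {a}) (link (minus_coeff 3 \<H>) {a})"
 shows "gard E (minus_coeff 3 \<H>)"
proof (rule gard_minus_single_pair [OF E_facts, where i = c and j = a and D = "{b,d,f,g}"
   and \<H>P = "{}" and \<H>R = "{{c,a,b}}" and ?\<H>1.0 = "{{c,d,f}}" and ?\<H>2.0 = "{{a,d,g}}"])
 fix x :: "'a => real"
 assume pos: "\<And>e. e \<in> {b,d,f,g} ==> 0 < 1 + x e"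
  and R: "0 < us 1 {b,d,f,g} x - (\<Sum>H\<in>{{c,a,b}}. prod x (H - {c,a}))"
 define B D F G where "B = x b" "D = x d" "F = x f" "G = x g"
 note defs = this
 define P where "P = (1 + D) * (1 + F) * (1 + G) - 1"
 have u1: "us 1 {b,d,f,g} x = (1 + B) * P + B"
  using dist by (simp add: us_expand defs P_def algebra_simps)
 have u2: "us 2 {b,d,f,g} x = P - (D + F + G) + B * P"
  using dist by (simp add: us_expand defs P_def algebra_simps)
 have u3: "us 3 {b,d,f,g} x = D*F*G + B * (P - (D + F + G))"
  using dist by (simp add: us_expand defs P_def algebra_simps)
 have df: "{c,a,b} - {c,a} = {b}" "{c,d,f} - {c} = {d,f}" "{a,d,g} - {a} = {d,g}" using dist by auto
 have sR: "(\<Sum>H\<in>{{c,a,b}}. prod x (H - {c,a})) = B" by (simp add: df defs)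
 have s1: "(\<Sum>H\<in>{{c,d,f}}. prod x (H - {c})) = D*F" using dist by (simp add: df defs)
 have s2: "(\<Sum>H\<in>{{a,d,g}}. prod x (H - {a})) = D*G" using dist by (simp add: df defs)
 have p1: "0 < 1 + B" "0 < 1 + D" "0 < 1 + F" "0 < 1 + G" using pos by (auto simp: defs)
 have "0 < (1 + B) * P" using R unfolding sR u1 by simp
 then have "0 < P" using p1 by (simp add: zero_less_mult_iff)
 then have "0 <= P * (D + F + G) * B\<^sup>2 + P * (F * G) * B + (1 + D) * (F * G)\<^sup>2"
  using whirl_inequality [OF p1] by (simp add: P_def)
 also have "\<dots> = (us 2 {b,d,f,g} x - D*F) * (us 2 {b,d,f,g} x - D*G) - us 3 {b,d,f,g} x * (us 1 {b,d,f,g} x - B)"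
  unfolding u1 u2 u3 P_def by (simp add: power2_eq_square algebra_simps)
 finally show "(us 3 {b,d,f,g} x - (\<Sum>H\<in>{}. prod x H)) * (us 1 {b,d,f,g} x - (\<Sum>H\<in>{{c,a,b}}. prod x (H - {c,a})))
   <= (us 2 {b,d,f,g} x - (\<Sum>H\<in>{{c,d,f}}. prod x (H - {c}))) * (us 2 {b,d,f,g} x - (\<Sum>H\<in>{{a,d,g}}. prod x (H - {a})))"
  unfolding sR s1 s2 by simp
qed (use assms dist in \<open>auto simp: E\<close>)

end

section \<open>Matroids: minors and duality\<close>

context matroid
begin

lemma finite_indep: "I \<in> indeps M ==> finite I"
 using indeps_subset finite_ground finite_subset by blast

lemma finite_indeps: "finite (indeps M)"
 using indeps_subset finite_ground by (meson finite_Pow_iff finite_subset PowI subsetI)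

text \<open>
 Defined as a maximum over independent sets; by augmentation every independent set extends to this size.
\<close>

definition rank :: nat where "rank = Max (card ` indeps M)"

lemma card_indep_le: "I \<in> indeps M ==> card I <= rank"
 unfolding rank_def using finite_indeps by (intro Max_ge) auto

text \<open>
 Augmentation repeated inside \<open>J\<close>.
\<close>

lemma augment_to_card:
 assumes "I \<in> indeps M" "J \<in> indeps M" "card I <= card J"
 shows "\<exists>K\<in>indeps M. I \<subseteq> K & K \<subseteq> I \<union> J & card K = card J"
 using assms
proof (induction "card J - card I" arbitrary: I)
 case 0
 then show ?case by (intro bexI [of _ I]) auto
next
 case (Suc d)
 then have "card I < card J" by simp
 then obtain x where x: "x \<in> J - I" "insert x I \<in> indeps M" using augment Suc by blast
 have c: "card (insert x I) = Suc (card I)" using x finite_indep Suc by simp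
 have "\<exists>K\<in>indeps M. insert x I \<subseteq> K & K \<subseteq> insert x I \<union> J & card K = card J"
  by (rule Suc.hyps(1)) (use Suc.hyps(2) Suc.prems x c in auto)
 then obtain K where "K \<in> indeps M" "insert x I \<subseteq> K" "K \<subseteq> insert x I \<union> J" "card K = card J" by auto
 then show ?case using x by (intro bexI [of _ K]) auto
qed

lemma ex_card_rank: "\<exists>I\<in>indeps M. card I = rank"
proof -
 have "rank \<in> card ` indeps M" unfolding rank_def using finite_indeps empty_indep by (intro Max_in) auto
 then show ?thesis by auto
qed

lemma bases_iff: "B \<in> bases M \<longleftrightarrow> B \<in> indeps M & card B = rank"
proof
 assume B: "B \<in> bases M"
 obtain I where I: "I \<in> indeps M" "card I = rank" using ex_card_rank by auto
 have "card B <= card I" using B card_indep_le I by (auto simp: bases_def)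
 then obtain K where K: "K \<in> indeps M" "B \<subseteq> K" "card K = rank"
  using augment_to_card [of B I] B I by (auto simp: bases_def)
 then have "K = B" using B by (auto simp: bases_def)
 then show "B \<in> indeps M & card B = rank" using K by simp
next
 assume B: "B \<in> indeps M & card B = rank"
 show "B \<in> bases M" unfolding bases_def
 proof (intro CollectI conjI ballI impI)
  fix I assume "I \<in> indeps M" "B \<subseteq> I"
  moreover have "card I <= card B" using calculation card_indep_le B by simp
  ultimately show "I = B" using card_seteq [of I B] finite_indep by auto
 qed (use B in auto)
qed

lemma spanning_iff: "T \<in> spanning_sets M \<longleftrightarrow> T \<subseteq> ground M & (\<exists>I\<in>indeps M. I \<subseteq> T & card I = rank)"
 by (auto simp: spanning_sets_def bases_iff)

lemma ground_spanning: "ground M \<in> spanning_sets M"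
 using ex_card_rank indeps_subset by (auto simp: spanning_iff)

lemma spanning_mono: "T \<in> spanning_sets M ==> T \<subseteq> U ==> U \<subseteq> ground M ==> U \<in> spanning_sets M"
 unfolding spanning_iff by blast

lemma spanning_subset: "T \<in> spanning_sets M ==> T \<subseteq> ground M"
 by (simp add: spanning_iff)

lemma extend_in_spanning:
 assumes "I \<in> indeps M" "I \<subseteq> T" "T \<in> spanning_sets M"
 shows "\<exists>B\<in>indeps M. I \<subseteq> B & B \<subseteq> T & card B = rank"
proof -
 obtain J where J: "J \<in> indeps M" "J \<subseteq> T" "card J = rank" using assms by (auto simp: spanning_iff)
 then have "card I <= card J" using card_indep_le [OF assms(1)] by simp
 then obtain K where K: "K \<in> indeps M" "I \<subseteq> K" "K \<subseteq> I \<union> J" "card K = card J"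
  using augment_to_card [OF assms(1) J(1)] by blast
 then show ?thesis using assms J by (intro bexI [of _ K]) auto
qed

lemma indep_extends: "I \<in> indeps M ==> \<exists>B\<in>indeps M. I \<subseteq> B & card B = rank"
 using extend_in_spanning [OF _ _ ground_spanning] indeps_subset by blast

lemma matroid_delete: "matroid (delete M X)"
proof
 fix I J assume "I \<in> indeps (delete M X)" "J \<in> indeps (delete M X)" "card I < card J"
 then have "I \<in> indeps M" "J \<in> indeps M" "I \<inter> X = {}" "J \<inter> X = {}" by (auto simp: delete_def)
 then obtain x where "x \<in> J - I" "insert x I \<in> indeps M" using augment \<open>card I < card J\<close> by blast
 then show "\<exists>x\<in>J - I. insert x I \<in> indeps (delete M X)"
  using \<open>I \<inter> X = {}\<close> \<open>J \<inter> X = {}\<close> by (intro bexI [of _ x]) (auto simp: delete_def)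
qed (use finite_ground indeps_subset empty_indep indep_subset in \<open>auto simp: delete_def\<close>)

lemma bases_restrict:
 assumes "D \<subseteq> ground M"
 shows "J \<in> bases (delete M (ground M - D)) \<longleftrightarrow>
  J \<in> indeps M & J \<subseteq> D & (\<forall>I\<in>indeps M. I \<subseteq> D --> card I <= card J)"
proof -
 interpret d: matroid "delete M (ground M - D)" by (rule matroid_delete)
 have ind: "I \<in> indeps (delete M (ground M - D)) \<longleftrightarrow> I \<in> indeps M & I \<subseteq> D" for I
  using indeps_subset by (auto simp: delete_def)
 show ?thesis
 proof
  assume J: "J \<in> bases (delete M (ground M - D))"
  then have "J \<in> indeps M" "J \<subseteq> D" "card J = d.rank" by (auto simp: d.bases_iff ind)
  moreover have "card I <= card J" if "I \<in> indeps M" "I \<subseteq> D" for I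
   using d.card_indep_le [of I] that calculation by (simp add: ind)
  ultimately show "J \<in> indeps M & J \<subseteq> D & (\<forall>I\<in>indeps M. I \<subseteq> D --> card I <= card J)" by auto
 next
  assume J: "J \<in> indeps M & J \<subseteq> D & (\<forall>I\<in>indeps M. I \<subseteq> D --> card I <= card J)"
  obtain K where K: "K \<in> indeps (delete M (ground M - D))" "card K = d.rank" using d.ex_card_rank by auto
  then have "card K <= card J" using J by (auto simp: ind)
  moreover have "card J <= d.rank" using d.card_indep_le [of J] J by (simp add: ind)
  ultimately show "J \<in> bases (delete M (ground M - D))" using J K by (simp add: d.bases_iff ind)
 qed
qed

lemma ex_basis_restrict:
 assumes "D \<subseteq> ground M"
 shows "\<exists>J. J \<in> bases (delete M (ground M - D))"
proof -
 interpret d: matroid "delete M (ground M - D)" by (rule matroid_delete)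
 show ?thesis using d.ex_card_rank by (auto simp: d.bases_iff)
qed

text \<open>
 Two maximal independent subsets of \<open>D\<close> span the same, so the choice in the definition of contraction is immaterial.
\<close>

lemma basis_exchange_restrict:
 assumes D: "D \<subseteq> ground M" and J: "J \<in> bases (delete M (ground M - D))" "J' \<in> bases (delete M (ground M - D))"
  and I: "I \<inter> D = {}" "I \<union> J \<in> indeps M"
 shows "I \<union> J' \<in> indeps M"
proof -
 have J1: "J \<in> indeps M" "J \<subseteq> D" "J' \<in> indeps M" "J' \<subseteq> D" "card J = card J'"
  using J by (auto simp: bases_restrict [OF D] intro: le_antisym)
 have fin: "finite I" "finite J" "finite J'" using finite_indep J1 I finite_subset [of I "I \<union> J"] by auto
 have c: "card (I \<union> J) = card I + card J" using I J1 fin by (intro card_Un_disjoint) auto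
 then have "card J' <= card (I \<union> J)" using J1 by simp
 then obtain K where K: "K \<in> indeps M" "J' \<subseteq> K" "K \<subseteq> J' \<union> (I \<union> J)" "card K = card (I \<union> J)"
  using augment_to_card [OF J1(3) I(2)] by blast
 have "K \<inter> D \<in> indeps M" using K indep_subset by (meson inf_le1)
 then have "card (K \<inter> D) <= card J'" using J(2) by (auto simp: bases_restrict [OF D])
 moreover have "J' \<subseteq> K \<inter> D" using K J1 by auto
 ultimately have KD: "K \<inter> D = J'" using card_seteq [of "K \<inter> D" J'] finite_indep [OF K(1)] by auto
 have sub: "K - D \<subseteq> I" using K J1 by auto
 have "card K = card (K \<inter> D) + card (K - D)"
  using finite_indep [OF K(1)] by (subst card_Un_disjoint [symmetric]) (auto intro: arg_cong [where f = card])
 then have "card (K - D) = card I" using K(4) c KD J1(5) by simp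
 then have "K - D = I" using sub fin by (intro card_seteq) auto
 then have "I \<union> J' \<subseteq> K" using K by auto
 then show ?thesis using K indep_subset by blast
qed

lemma contract_indeps:
 assumes D: "D \<subseteq> ground M" and J: "J \<in> bases (delete M (ground M - D))"
 shows "I \<in> indeps (contract M D) \<longleftrightarrow> I \<subseteq> ground M - D & I \<union> J \<in> indeps M"
proof
 assume "I \<in> indeps (contract M D)"
 then obtain J' where I: "I \<subseteq> ground M - D" and J': "J' \<in> bases (delete M (ground M - D))" "I \<union> J' \<in> indeps M"
  by (auto simp: contract_def)
 then have "I \<inter> D = {}" by auto
 then show "I \<subseteq> ground M - D & I \<union> J \<in> indeps M" using basis_exchange_restrict [OF D J'(1) J] J' I by auto
qed (use J in \<open>auto simp: contract_def\<close>)

end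

lemma ground_minors [simp]: "ground (delete M D) = ground M - D" "ground (contract M D) = ground M - D"
 by (simp_all add: delete_def contract_def)

context matroid
begin

lemma matroid_contract:
 assumes D: "D \<subseteq> ground M"
 shows "matroid (contract M D)"
proof -
 obtain J where J: "J \<in> bases (delete M (ground M - D))" using ex_basis_restrict [OF D] by auto
 note ci = contract_indeps [OF D J]
 have JD: "J \<in> indeps M" "J \<subseteq> D" using J by (auto simp: bases_restrict [OF D])
 show ?thesis
 proof
  show "finite (ground (contract M D))" using finite_ground by simp
  show "I \<subseteq> ground (contract M D)" if "I \<in> indeps (contract M D)" for I using that by (simp add: ci)
  show "{} \<in> indeps (contract M D)" using JD by (simp add: ci)
  show "K \<in> indeps (contract M D)" if "I \<in> indeps (contract M D)" "K \<subseteq> I" for I K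
   using that indep_subset [of "I \<union> J" "K \<union> J"] by (auto simp: ci)
  fix I K assume I: "I \<in> indeps (contract M D)" and K: "K \<in> indeps (contract M D)" and c: "card I < card K"
  have fin: "finite I" "finite K" "finite J" using I K JD finite_indep finite_subset [of I "I \<union> J"] finite_subset [of K "K \<union> J"]
   by (auto simp: ci)
  have "I \<inter> J = {}" "K \<inter> J = {}" using I K JD by (auto simp: ci)
  then have "card (I \<union> J) < card (K \<union> J)" using fin c by (simp add: card_Un_disjoint)
  then obtain x where x: "x \<in> (K \<union> J) - (I \<union> J)" "insert x (I \<union> J) \<in> indeps M"
   using augment I K by (meson ci)
  then show "\<exists>x\<in>K - I. insert x I \<in> indeps (contract M D)"
   using I K by (intro bexI [of _ x]) (auto simp: ci)
 qed
qed

text \<open>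
 Contraction is the link on spanning sets.
\<close>

lemma contract_spanning:
 assumes D: "D \<subseteq> ground M" and T: "T \<subseteq> ground M - D"
 shows "T \<in> spanning_sets (contract M D) \<longleftrightarrow> T \<union> D \<in> spanning_sets M"
proof -
 interpret c: matroid "contract M D" by (rule matroid_contract [OF D])
 obtain J where J: "J \<in> bases (delete M (ground M - D))" using ex_basis_restrict [OF D] by auto
 note ci = contract_indeps [OF D J]
 have JD: "J \<in> indeps M" "J \<subseteq> D" using J by (auto simp: bases_restrict [OF D])
 have disj: "card (I \<union> J) = card I + card J" if "I \<in> indeps (contract M D)" for I
 proof (rule card_Un_disjoint)
  show "finite I" using c.finite_indep that .
  show "finite J" using finite_indep JD by simp
  show "I \<inter> J = {}" using that JD by (auto simp: ci)
 qed
 have split: "\<exists>I. I \<in> indeps (contract M D) & B = I \<union> J & I = B - D"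
  if B: "B \<in> indeps M" "J \<subseteq> B" for B
 proof -
  have "B \<inter> D \<in> indeps M" using B indep_subset by (meson inf_le1)
  then have "card (B \<inter> D) <= card J" using J by (auto simp: bases_restrict [OF D])
  moreover have "J \<subseteq> B \<inter> D" using B JD by auto
  ultimately have "B \<inter> D = J" using card_seteq [of "B \<inter> D" J] finite_indep [OF B(1)] by auto
  then have "B = (B - D) \<union> J" by auto
  moreover have "B - D \<subseteq> ground M - D" using B indeps_subset by auto
  ultimately show ?thesis using B by (intro exI [of _ "B - D"]) (simp add: ci)
 qed
 have rk: "rank = c.rank + card J"
 proof (rule le_antisym)
  obtain B where B: "B \<in> indeps M" "J \<subseteq> B" "card B = rank" using indep_extends [OF JD(1)] by auto
  then obtain I where I: "I \<in> indeps (contract M D)" "B = I \<union> J" using split by blast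
  then show "rank <= c.rank + card J" using B disj [OF I(1)] c.card_indep_le [OF I(1)] by simp
  obtain I where I: "I \<in> indeps (contract M D)" "card I = c.rank" using c.ex_card_rank by auto
  then have "I \<union> J \<in> indeps M" by (simp add: ci)
  then show "c.rank + card J <= rank" using card_indep_le disj I by metis
 qed
 show ?thesis
 proof
  assume "T \<in> spanning_sets (contract M D)"
  then obtain I where I: "I \<in> indeps (contract M D)" "I \<subseteq> T" "card I = c.rank" by (auto simp: c.spanning_iff)
  then have "I \<union> J \<in> indeps M" "card (I \<union> J) = rank" using disj rk by (simp_all add: ci)
  moreover have "I \<union> J \<subseteq> T \<union> D" "T \<union> D \<subseteq> ground M" using I JD T D by auto
  ultimately show "T \<union> D \<in> spanning_sets M" unfolding spanning_iff by blast
 next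
  assume TD: "T \<union> D \<in> spanning_sets M"
  obtain B where B: "B \<in> indeps M" "J \<subseteq> B" "B \<subseteq> T \<union> D" "card B = rank"
   using extend_in_spanning [OF JD(1) _ TD] JD by blast
  then obtain I where I: "I \<in> indeps (contract M D)" "B = I \<union> J" "I = B - D" using split by blast
  then have "card I = c.rank" using B(4) disj [OF I(1)] rk unfolding I(2) [symmetric] by linarith
  moreover have "I \<subseteq> T" using I(3) B(3) by blast
  ultimately show "T \<in> spanning_sets (contract M D)" unfolding c.spanning_iff using I(1) T by auto
 qed
qed

text \<open>
 Deletion is a link followed by a slice: \<open>K\<close> completes a basis of the complement of \<open>D\<close> to a basis of the matroid.
\<close>

lemma delete_spanning:
 assumes D: "D \<subseteq> ground M"
 shows "\<exists>K\<subseteq>D. (ground M - D) \<union> K \<in> spanning_sets M \<and>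
   (\<forall>T\<subseteq>ground M - D. T \<in> spanning_sets (delete M D) \<longleftrightarrow> T \<union> K \<in> spanning_sets M)"
proof -
 interpret d: matroid "delete M D" by (rule matroid_delete)
 have ind: "I \<in> indeps (delete M D) \<longleftrightarrow> I \<in> indeps M & I \<inter> D = {}" for I by (simp add: delete_def)
 obtain B0 where B0: "B0 \<in> indeps M" "B0 \<inter> D = {}" "card B0 = d.rank" using d.ex_card_rank by (auto simp: ind)
 obtain B where B: "B \<in> indeps M" "B0 \<subseteq> B" "card B = rank" using indep_extends [OF B0(1)] by auto
 define K where "K = B - B0"
 have finB: "finite B" using B finite_indep by auto
 have KD: "K \<subseteq> D"
 proof
  fix k assume k: "k \<in> K"
  show "k \<in> D"
  proof (rule ccontr)
   assume "k \<notin> D"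
   then have "insert k B0 \<in> indeps (delete M D)"
    using k B B0 indep_subset [of B "insert k B0"] by (auto simp: ind K_def)
   then have "card (insert k B0) <= d.rank" by (rule d.card_indep_le)
   then show False using k B0 finite_indep [OF B0(1)] by (simp add: K_def)
  qed
 qed
 have "card K = card B - card B0" unfolding K_def by (rule card_Diff_subset) (use B0 B finite_indep in auto)
 moreover have "card B0 <= card B" using B finB by (intro card_mono) auto
 ultimately have cK: "rank = d.rank + card K" using B B0 by simp
 have "B \<subseteq> (ground M - D) \<union> K" using B0 B indeps_subset [OF B0(1)] by (auto simp: K_def)
 then have sp: "(ground M - D) \<union> K \<in> spanning_sets M" using B KD D by (auto simp: spanning_iff)
 have "T \<in> spanning_sets (delete M D) \<longleftrightarrow> T \<union> K \<in> spanning_sets M" if T: "T \<subseteq> ground M - D" for T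
 proof
  assume "T \<in> spanning_sets (delete M D)"
  then obtain I where I: "I \<in> indeps M" "I \<inter> D = {}" "I \<subseteq> T" "card I = d.rank" by (auto simp: d.spanning_iff ind)
  then have "card I <= card B" using B cK by simp
  then obtain L where L: "L \<in> indeps M" "I \<subseteq> L" "L \<subseteq> I \<union> B" "card L = rank"
   using augment_to_card [OF I(1) B(1)] B by auto
  have "L - D \<in> indeps (delete M D)" using L indep_subset [of L "L - D"] by (auto simp: ind)
  then have "card (L - D) <= card I" using d.card_indep_le I by simp
  moreover have "I \<subseteq> L - D" using L I by auto
  ultimately have "L - D = I" using card_seteq [of "L - D" I] finite_indep [OF L(1)] by auto
  then have "L \<subseteq> T \<union> K" using L I B0 by (auto simp: K_def)
  then show "T \<union> K \<in> spanning_sets M" using L T KD D by (auto simp: spanning_iff)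
 next
  assume "T \<union> K \<in> spanning_sets M"
  then obtain I where I: "I \<in> indeps M" "I \<subseteq> T \<union> K" "card I = rank" by (auto simp: spanning_iff)
  have "I - D \<in> indeps (delete M D)" using I indep_subset [of I "I - D"] by (auto simp: ind)
  moreover have "card (I \<inter> D) <= card K" using I T KD finB by (intro card_mono) (auto simp: K_def)
  moreover have "card I = card (I \<inter> D) + card (I - D)"
  proof -
   have "card ((I \<inter> D) \<union> (I - D)) = card (I \<inter> D) + card (I - D)"
    by (rule card_Un_disjoint) (use finite_indep [OF I(1)] in auto)
   moreover have "(I \<inter> D) \<union> (I - D) = I" by auto
   ultimately show ?thesis by simp
  qed
  ultimately have "card (I - D) = d.rank" using d.card_indep_le [of "I - D"] I cK by linarith
  moreover have "I - D \<subseteq> T" using I T KD by auto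
  ultimately show "T \<in> spanning_sets (delete M D)" using \<open>I - D \<in> _\<close> T by (auto simp: d.spanning_iff)
 qed
 then show ?thesis using KD sp by blast
qed

end

definition dual :: "'a set_system => 'a set_system" where
 "dual M = \<lparr>ground = ground M, indeps = {I. I \<subseteq> ground M & ground M - I \<in> spanning_sets M}\<rparr>"

lemma ground_dual [simp]: "ground (dual M) = ground M"
 by (simp add: dual_def)

context matroid
begin

text \<open>
 Two complements of independent sets contain bases; extending what the first set leaves of the second
 basis avoids the first set, and counting shows that it cannot cover the difference.
\<close>

lemma matroid_dual: "matroid (dual M)"
proof
 show "finite (ground (dual M))" using finite_ground by simp
 show "{} \<in> indeps (dual M)" using ground_spanning by (simp add: dual_def)
 show "J \<in> indeps (dual M)" if "I \<in> indeps (dual M)" "J \<subseteq> I" for I J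
  using that spanning_mono [of "ground M - I" "ground M - J"] by (auto simp: dual_def)
 fix I J assume "I \<in> indeps (dual M)" "J \<in> indeps (dual M)" and c: "card I < card J"
 then have I: "I \<subseteq> ground M" "ground M - I \<in> spanning_sets M" and J: "J \<subseteq> ground M" "ground M - J \<in> spanning_sets M"
  by (auto simp: dual_def)
 have fin: "finite I" "finite J" using I J finite_ground finite_subset by auto
 obtain B where B: "B \<in> indeps M" "B \<subseteq> ground M - J" "card B = rank" using J by (auto simp: spanning_iff)
 have "B - I \<in> indeps M" using B indep_subset by blast
 then obtain C where C: "C \<in> indeps M" "B - I \<subseteq> C" "C \<subseteq> ground M - I" "card C = rank"
  using extend_in_spanning [of "B - I" "ground M - I"] I B indeps_subset [OF B(1)] by blast
 have "\<not> J - I \<subseteq> C"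
 proof
  assume "J - I \<subseteq> C"
  then have "(B - I) \<union> (J - I) \<subseteq> C" using C by auto
  then have "card ((B - I) \<union> (J - I)) <= card C" using finite_indep C by (intro card_mono) auto
  moreover have "card ((B - I) \<union> (J - I)) = card (B - I) + card (J - I)"
   by (rule card_Un_disjoint) (use finite_indep B fin in auto)
  moreover have "card B = card (B - I) + card (B \<inter> I)" "card J = card (J - I) + card (J \<inter> I)"
   using finite_indep [OF B(1)] fin by (simp_all add: card_Diff_subset_Int card_mono)
  moreover have "card (B \<inter> I) + card (J \<inter> I) <= card I"
  proof -
   have "card ((B \<inter> I) \<union> (J \<inter> I)) = card (B \<inter> I) + card (J \<inter> I)"
    by (rule card_Un_disjoint) (use fin B in auto)
   moreover have "card ((B \<inter> I) \<union> (J \<inter> I)) <= card I" using fin by (intro card_mono) auto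
   ultimately show ?thesis by simp
  qed
  ultimately show False using B C c by linarith
 qed
 then obtain x where x: "x \<in> J - I" "x \<notin> C" by auto
 then have "C \<subseteq> ground M - insert x I" using C by auto
 then have "insert x I \<in> indeps (dual M)" using C x J I by (auto simp: dual_def spanning_iff)
 then show "\<exists>x\<in>J - I. insert x I \<in> indeps (dual M)" using x by auto
qed (auto simp: dual_def)

lemma bases_dual: "B \<in> bases (dual M) \<longleftrightarrow> B \<subseteq> ground M & ground M - B \<in> bases M"
proof -
 interpret d: matroid "dual M" by (rule matroid_dual)
 have card: "card (ground M - C) = card (ground M) - card C" if "C \<subseteq> ground M" for C
  using that finite_ground by (intro card_Diff_subset) (auto intro: finite_subset)
 have small: "card C <= card (ground M)" if "C \<subseteq> ground M" for C using that finite_ground by (rule card_mono [rotated])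
 have comp: "ground M - C \<in> indeps (dual M)" if "C \<in> indeps M" "card C = rank" for C
 proof -
  have "ground M - (ground M - C) = C" using indeps_subset that by auto
  then show ?thesis using that indeps_subset by (auto simp: dual_def spanning_iff)
 qed
 have rk: "d.rank = card (ground M) - rank"
 proof (rule le_antisym)
  obtain I where I: "I \<in> indeps (dual M)" "card I = d.rank" using d.ex_card_rank by auto
  then obtain C where C: "C \<in> indeps M" "C \<subseteq> ground M - I" "card C = rank" "I \<subseteq> ground M"
   by (auto simp: dual_def spanning_iff)
  have "card C <= card (ground M - I)" using C finite_ground by (intro card_mono) auto
  then show "d.rank <= card (ground M) - rank" using C I card [of I] small [of I] by simp
  obtain C where C: "C \<in> indeps M" "card C = rank" using ex_card_rank by auto
  show "card (ground M) - rank <= d.rank"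
   using d.card_indep_le [OF comp [OF C]] card [of C] indeps_subset C by simp
 qed
 show ?thesis
 proof
  assume B: "B \<in> bases (dual M)"
  then have "B \<in> indeps (dual M)" "card B = card (ground M) - rank" unfolding d.bases_iff rk by auto
  then have B': "B \<subseteq> ground M" "ground M - B \<in> spanning_sets M" "card B = card (ground M) - rank"
   by (auto simp: dual_def)
  then obtain C where C: "C \<in> indeps M" "C \<subseteq> ground M - B" "card C = rank" by (auto simp: spanning_iff)
  have "rank <= card (ground M)" using C small indeps_subset by metis
  then have "card (ground M - B) = rank" using card [OF B'(1)] B'(3) by simp
  then have "C = ground M - B" using C finite_ground by (intro card_subset_eq) auto
  then show "B \<subseteq> ground M & ground M - B \<in> bases M" using C B' by (simp add: bases_iff)
 next
  assume B: "B \<subseteq> ground M & ground M - B \<in> bases M"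
  then have C: "ground M - B \<in> indeps M" "card (ground M - B) = rank" by (auto simp: bases_iff)
  have eq: "ground M - (ground M - B) = B" using B by auto
  have "B \<in> indeps (dual M)" using comp [OF C] eq by simp
  moreover have "card B = d.rank" using card [of "ground M - B"] eq rk C by simp
  ultimately show "B \<in> bases (dual M)" by (simp add: d.bases_iff)
 qed
qed

lemma spanning_dual: "T \<in> spanning_sets (dual M) \<longleftrightarrow> T \<subseteq> ground M & ground M - T \<in> indeps M"
proof
 assume "T \<in> spanning_sets (dual M)"
 then obtain B where B: "B \<in> bases (dual M)" "B \<subseteq> T" "T \<subseteq> ground M" by (auto simp: spanning_sets_def)
 then have "ground M - B \<in> indeps M" by (auto simp: bases_dual bases_iff)
 then show "T \<subseteq> ground M & ground M - T \<in> indeps M" using B indep_subset [of "ground M - B" "ground M - T"] by auto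
next
 assume T: "T \<subseteq> ground M & ground M - T \<in> indeps M"
 then obtain C where C: "C \<in> indeps M" "ground M - T \<subseteq> C" "card C = rank" using indep_extends by blast
 have "ground M - (ground M - C) = C" using indeps_subset C by auto
 then have "ground M - C \<in> bases (dual M)" using C by (simp add: bases_dual bases_iff)
 moreover have "ground M - C \<subseteq> T" using C by auto
 ultimately show "T \<in> spanning_sets (dual M)" using T by (auto simp: spanning_sets_def)
qed

lemma dual_dual: "dual (dual M) = M"
proof -
 have "I \<subseteq> ground M & ground M - I \<in> spanning_sets (dual M) \<longleftrightarrow> I \<in> indeps M" for I
 proof -
  have "I \<subseteq> ground M ==> ground M - (ground M - I) = I" by auto
  then show ?thesis using indeps_subset by (auto simp: spanning_dual)
 qed
 then show ?thesis by (simp add: dual_def [of "dual M"])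
qed

end

section \<open>Spanning and cospanning coefficients\<close>

definition S_coeff :: "'a set_system => 'a set => real" where
 "S_coeff M T = (if T \<in> spanning_sets M then 1 else 0)"

definition C_coeff :: "'a set_system => 'a set => real" where
 "C_coeff M T = (if T \<subseteq> ground M & ground M - T \<in> indeps M then 1 else 0)"

lemma coeff_nonneg: "0 <= S_coeff M T" "0 <= C_coeff M T"
 by (simp_all add: S_coeff_def C_coeff_def)

lemma gen_fun_eq_ma:
 assumes "finite E" "\<T> \<subseteq> Pow E"
 shows "gen_fun \<T> x = ma E (\<lambda>T. if T \<in> \<T> then 1 else 0) x"
proof -
 have "ma E (\<lambda>T. if T \<in> \<T> then 1 else 0) x = (\<Sum>T\<in>Pow E. if T \<in> \<T> then prod x T else 0)"
  unfolding ma_def by (intro sum.cong) auto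
 also have "\<dots> = (\<Sum>T\<in>\<T>. prod x T)"
  using assms by (subst sum.inter_restrict [symmetric]) (auto simp: Int_absorb1)
 finally show ?thesis by (simp add: gen_fun_def)
qed

context matroid
begin

lemma S_poly_eq: "S_poly M x = ma (ground M) (S_coeff M) x"
 unfolding S_poly_def S_coeff_def [abs_def]
 by (rule gen_fun_eq_ma) (use finite_ground spanning_subset in auto)

lemma C_poly_eq: "C_poly M x = ma (ground M) (C_coeff M) x"
 using gen_fun_eq_ma [OF finite_ground, of "{X. X \<subseteq> ground M & ground M - X \<in> indeps M}" x]
 by (auto simp: C_poly_def C_coeff_def [abs_def])

lemma S_coeff_dual: "S_coeff (dual M) = C_coeff M"
 by (rule ext) (simp add: S_coeff_def C_coeff_def spanning_dual)

lemma C_coeff_dual: "C_coeff (dual M) = S_coeff M"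
proof -
 interpret d: matroid "dual M" by (rule matroid_dual)
 show ?thesis using d.S_coeff_dual by (simp add: dual_dual)
qed

lemma coeff_ground: "S_coeff M (ground M) = 1" "C_coeff M (ground M) = 1"
 using ground_spanning empty_indep by (simp_all add: S_coeff_def C_coeff_def)

lemma coeff_mono:
 assumes "T \<subseteq> U" "U \<subseteq> ground M"
 shows "S_coeff M T <= S_coeff M U" "C_coeff M T <= C_coeff M U"
 using assms spanning_mono [of T U] indep_subset [of "ground M - T" "ground M - U"]
 by (auto simp: S_coeff_def C_coeff_def)

lemma garding_S: "garding (ground M) (S_poly M) \<longleftrightarrow> gard (ground M) (S_coeff M)"
 by (rule garding_iff_gard) (use finite_ground coeff_ground in \<open>auto simp: coeff_nonneg S_poly_eq\<close>)

lemma garding_C: "garding (ground M) (C_poly M) \<longleftrightarrow> gard (ground M) (C_coeff M)"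
 by (rule garding_iff_gard) (use finite_ground coeff_ground in \<open>auto simp: coeff_nonneg C_poly_eq\<close>)

end

lemma garding_matroid_iff:
 "garding_matroid S_poly M \<longleftrightarrow> matroid M & gard (ground M) (S_coeff M)"
 "garding_matroid C_poly M \<longleftrightarrow> matroid M & gard (ground M) (C_coeff M)"
 unfolding garding_matroid_def using matroid.garding_S [of M] matroid.garding_C [of M] by blast+

text \<open>
 The dual depends on the spanning sets only, and duality is an involution.
\<close>

lemma matroid_eqI:
 assumes M: "matroid M" and N: "matroid N" and g: "ground M = ground N" and s: "spanning_sets M = spanning_sets N"
 shows "M = N"
proof -
 have "dual M = dual N" using g s by (simp add: dual_def)
 then show ?thesis using matroid.dual_dual [OF M] matroid.dual_dual [OF N] by metis
qed

text \<open>
 Contract \<open>K\<close>, then delete the rest one element at a time; monotonicity keeps the top coefficient positive.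
\<close>

lemma gard_minor:
 assumes g: "gard E c" and D: "D \<subseteq> E" and K: "K \<subseteq> D" and pos: "0 < c (E - D \<union> K)"
  and mono: "\<And>T U. T \<subseteq> U ==> U \<subseteq> E ==> c T <= c U"
 shows "gard (E - D) (link c K)"
proof -
 have "finite E" using g by (rule gardD)
 have "gard (E - K - S) (link c K)" if "finite S" "S \<subseteq> D - K" for S
  using that
 proof induction
  case empty
  then show ?case using gard_link [OF g] K D by auto
 next
  case (insert e S)
  have "0 < link c K (E - K - S - {e})"
  proof -
   have "E - D \<union> K \<subseteq> (E - K - S - {e}) \<union> K" using insert by auto
   then have "c (E - D \<union> K) <= c ((E - K - S - {e}) \<union> K)" using K D by (intro mono) auto
   then show ?thesis using pos by (simp add: link_def)
  qed
  then have "gard (E - K - S - {e}) (link c K)" using insert D by (intro gard_slice(1)) auto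
  moreover have "E - K - S - {e} = E - K - insert e S" by auto
  ultimately show ?case by simp
 qed
 from this [of "D - K"] have "gard (E - K - (D - K)) (link c K)"
  using \<open>finite E\<close> D finite_subset by blast
 moreover have "E - K - (D - K) = E - D" using K by auto
 ultimately show ?thesis by simp
qed

context matroid
begin

lemma gard_S_minors:
 assumes g: "gard (ground M) (S_coeff M)" and D: "D \<subseteq> ground M"
 shows "gard (ground M - D) (S_coeff (delete M D))" "gard (ground M - D) (S_coeff (contract M D))"
proof -
 obtain K where K: "K \<subseteq> D" "(ground M - D) \<union> K \<in> spanning_sets M"
  "\<And>T. T \<subseteq> ground M - D ==> T \<in> spanning_sets (delete M D) \<longleftrightarrow> T \<union> K \<in> spanning_sets M"
  using delete_spanning [OF D] by blast
 have "gard (ground M - D) (link (S_coeff M) K)"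
  using K by (intro gard_minor [OF g D K(1)] coeff_mono) (auto simp: S_coeff_def)
 then show "gard (ground M - D) (S_coeff (delete M D))"
  by (rule gard_cong [THEN iffD1, rotated]) (simp add: link_def S_coeff_def K(3))
 have "gard (ground M - D) (link (S_coeff M) D)" using g D by (rule gard_link)
 then show "gard (ground M - D) (S_coeff (contract M D))"
  by (rule gard_cong [THEN iffD1, rotated]) (simp add: link_def S_coeff_def contract_spanning [OF D])
qed

lemma dual_delete:
 assumes D: "D \<subseteq> ground M"
 shows "dual (delete M D) = contract (dual M) D"
proof (rule matroid_eqI)
 interpret x: matroid "delete M D" by (rule matroid_delete)
 interpret d: matroid "dual M" by (rule matroid_dual)
 interpret cd: matroid "contract (dual M) D" using D by (intro d.matroid_contract) simp
 show "matroid (dual (delete M D))" by (rule x.matroid_dual)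
 show "matroid (contract (dual M) D)" by unfold_locales
 have "T \<in> spanning_sets (dual (delete M D)) \<longleftrightarrow> T \<in> spanning_sets (contract (dual M) D)" if "T \<subseteq> ground M - D" for T
 proof -
  have "ground M - D - T = ground M - (T \<union> D)" by auto
  moreover have "T \<in> spanning_sets (contract (dual M) D) \<longleftrightarrow> T \<union> D \<in> spanning_sets (dual M)"
   using that D by (intro d.contract_spanning) auto
  ultimately show ?thesis using that D by (auto simp: x.spanning_dual spanning_dual) (auto simp: delete_def)
 qed
 then show "spanning_sets (dual (delete M D)) = spanning_sets (contract (dual M) D)"
  using x.spanning_dual cd.spanning_subset by auto
qed simp

lemma dual_contract:
 assumes D: "D \<subseteq> ground M"
 shows "dual (contract M D) = delete (dual M) D"
proof -
 interpret d: matroid "dual M" by (rule matroid_dual)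
 have "dual (delete (dual M) D) = contract M D" using d.dual_delete [of D] D by (simp add: dual_dual)
 then show ?thesis using matroid.dual_dual [OF d.matroid_delete] by metis
qed

lemma gard_C_minors:
 assumes g: "gard (ground M) (C_coeff M)" and D: "D \<subseteq> ground M"
 shows "gard (ground M - D) (C_coeff (delete M D))" "gard (ground M - D) (C_coeff (contract M D))"
proof -
 interpret d: matroid "dual M" by (rule matroid_dual)
 have "C_coeff (delete M D) = S_coeff (contract (dual M) D)" "C_coeff (contract M D) = S_coeff (delete (dual M) D)"
  using matroid.S_coeff_dual [OF matroid_delete, of D] matroid.S_coeff_dual [OF matroid_contract [OF D]]
  by (simp_all add: dual_delete [OF D] dual_contract [OF D])
 then show "gard (ground M - D) (C_coeff (delete M D))" "gard (ground M - D) (C_coeff (contract M D))"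
  using d.gard_S_minors [of D] g D by (simp_all add: S_coeff_dual)
qed

end

text \<open>
 The matroid union, for ground sets with at most one common point: the direct sum if there is none,
 and the series connection otherwise.
\<close>

definition disjoint_union :: "'a set_system => 'a set_system => 'a set_system" where
 "disjoint_union M N = \<lparr>ground = ground M \<union> ground N,
   indeps = {I \<union> J | I J. I \<in> indeps M & J \<in> indeps N & I \<inter> J = {}}\<rparr>"

lemma ground_disjoint_union [simp]: "ground (disjoint_union M N) = ground M \<union> ground N"
 by (simp add: disjoint_union_def)

lemma disjoint_union_commute: "disjoint_union M N = disjoint_union N M"
proof -
 have "{I \<union> J | I J. I \<in> indeps M & J \<in> indeps N & I \<inter> J = {}} = {I \<union> J | I J. I \<in> indeps N & J \<in> indeps M & I \<inter> J = {}}"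
  by (blast intro: Un_commute)
 then show ?thesis by (simp add: disjoint_union_def Un_commute)
qed

locale two_matroids = M: matroid M + N: matroid N for M N :: "'a set_system" +
 fixes e :: 'a
 assumes inter: "ground M \<inter> ground N \<subseteq> {e}"
begin

lemma union_iff:
 "I \<in> indeps (disjoint_union M N) \<longleftrightarrow> (\<exists>A B. I = A \<union> B & A \<in> indeps M & B \<in> indeps N & A \<inter> B = {})"
 by (auto simp: disjoint_union_def)

lemma swap: "two_matroids N M e"
 by unfold_locales (use inter in auto)

text \<open>
 The only obstruction is the common point \<open>e\<close>, used by the other part. Moving it into the first part
 leaves the set unchanged and allows an augmentation by another element on one of the two sides.
\<close>

lemma augment_left:
 assumes A: "A \<in> indeps M" and B: "B \<in> indeps N" and AB: "A \<inter> B = {}"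
  and C: "C \<in> indeps M" and D: "D \<in> indeps N" and CD: "C \<inter> D = {}"
  and less: "card A < card C" and sum: "card A + card B < card C + card D"
 shows "\<exists>x\<in>(C \<union> D) - (A \<union> B). insert x (A \<union> B) \<in> indeps (disjoint_union M N)"
proof -
 obtain x where x: "x \<in> C - A" "insert x A \<in> indeps M" using M.augment [OF A C less] by auto
 have fin: "finite A" "finite B" using A B M.finite_indep N.finite_indep by auto
 show ?thesis
 proof (cases "x \<in> B")
  case False
  then have "insert x (A \<union> B) \<in> indeps (disjoint_union M N)"
   unfolding union_iff using x B AB by (intro exI [of _ "insert x A"] exI [of _ B]) auto
  then show ?thesis using x False by auto
 next
  case True
  then have xe: "x = e" using x(1) C B M.indeps_subset N.indeps_subset inter by blast
  have eD: "e \<notin> D" using x CD xe by auto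
  have B': "B - {e} \<in> indeps N" using B N.indep_subset by blast
  have cB: "card B = Suc (card (B - {e}))" using True xe fin by (metis card_Suc_Diff1)
  have only: "y = e" if "y \<in> ground M" "y \<in> ground N" for y using that inter by auto
  show ?thesis
  proof (cases "card (insert e A) < card C")
   case True
   then obtain y where y: "y \<in> C - insert e A" "insert y (insert e A) \<in> indeps M"
    using M.augment [OF _ C True] x xe by auto
   have "y \<notin> B" using y C B M.indeps_subset N.indeps_subset only by blast
   moreover have "insert y (A \<union> B) = insert y (insert e A) \<union> (B - {e})"
    using \<open>x \<in> B\<close> xe by auto
   moreover have "insert y (insert e A) \<inter> (B - {e}) = {}" using AB \<open>y \<notin> B\<close> by auto
   ultimately have "insert y (A \<union> B) \<in> indeps (disjoint_union M N)" unfolding union_iff using y B' by blast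
   then show ?thesis using y \<open>y \<notin> B\<close> by auto
  next
   case False
   then have "card (B - {e}) < card D" using sum cB x xe fin by auto
   then obtain y where y: "y \<in> D - (B - {e})" "insert y (B - {e}) \<in> indeps N"
    using N.augment [OF B' D] by auto
   then have ye: "y ~= e" using eD by auto
   have "y \<notin> A" using y D A M.indeps_subset N.indeps_subset only ye by blast
   moreover have "insert y (A \<union> B) = insert e A \<union> insert y (B - {e})" using True xe by auto
   moreover have "insert e A \<inter> insert y (B - {e}) = {}" using AB \<open>y \<notin> A\<close> ye by auto
   ultimately have "insert y (A \<union> B) \<in> indeps (disjoint_union M N)" unfolding union_iff using y x xe by blast
   then show ?thesis using y ye \<open>y \<notin> A\<close> by auto
  qed
 qed
qed

lemma matroid_union: "matroid (disjoint_union M N)"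
proof
 show "finite (ground (disjoint_union M N))" using M.finite_ground N.finite_ground by simp
 show "{} \<in> indeps (disjoint_union M N)" using M.empty_indep N.empty_indep by (auto simp: union_iff)
 show "I \<subseteq> ground (disjoint_union M N)" if "I \<in> indeps (disjoint_union M N)" for I
  using that M.indeps_subset N.indeps_subset unfolding union_iff by force
 show "J \<in> indeps (disjoint_union M N)" if "I \<in> indeps (disjoint_union M N)" "J \<subseteq> I" for I J
 proof -
  obtain A B where AB: "I = A \<union> B" "A \<in> indeps M" "B \<in> indeps N" "A \<inter> B = {}" using \<open>I \<in> _\<close> by (auto simp: union_iff)
  have "A \<inter> J \<in> indeps M" "B \<inter> J \<in> indeps N" using AB M.indep_subset N.indep_subset by (meson inf_le1)+
  moreover have "J = (A \<inter> J) \<union> (B \<inter> J)" "(A \<inter> J) \<inter> (B \<inter> J) = {}" using AB that by auto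
  ultimately show ?thesis unfolding union_iff by blast
 qed
 fix I J assume I: "I \<in> indeps (disjoint_union M N)" and J: "J \<in> indeps (disjoint_union M N)" and c: "card I < card J"
 obtain A B where A: "I = A \<union> B" "A \<in> indeps M" "B \<in> indeps N" "A \<inter> B = {}" using I by (auto simp: union_iff)
 obtain C D where C: "J = C \<union> D" "C \<in> indeps M" "D \<in> indeps N" "C \<inter> D = {}" using J by (auto simp: union_iff)
 have s: "card A + card B < card C + card D" using A C c by (simp add: card_Un_disjoint M.finite_indep N.finite_indep)
 then consider "card A < card C" | "card B < card D" by linarith
 then show "\<exists>x\<in>J - I. insert x I \<in> indeps (disjoint_union M N)"
 proof cases
  case 1
  show ?thesis using augment_left [OF A(2-4) C(2-4) 1 s] A C by simp
 next
  case 2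
  have "\<exists>x\<in>(D \<union> C) - (B \<union> A). insert x (B \<union> A) \<in> indeps (disjoint_union N M)"
   by (rule two_matroids.augment_left [OF swap]) (use A C 2 s in auto)
  then show ?thesis using A C by (simp add: Un_commute disjoint_union_commute [of N])
 qed
qed

sublocale U: matroid "disjoint_union M N"
 by (rule matroid_union)

text \<open>
 Disjoint bases make the ranks add up.
\<close>

lemma union_spanning:
 assumes "A0 \<in> bases M" "B0 \<in> bases N" "A0 \<inter> B0 = {}"
 shows "T \<in> spanning_sets (disjoint_union M N) \<longleftrightarrow>
  T \<subseteq> ground M \<union> ground N & (\<exists>A\<in>bases M. \<exists>B\<in>bases N. A \<inter> B = {} & A \<union> B \<subseteq> T)"
proof -
 have card: "card (A \<union> B) = card A + card B" if "A \<in> indeps M" "B \<in> indeps N" "A \<inter> B = {}" for A B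
  using that by (simp add: card_Un_disjoint M.finite_indep N.finite_indep)
 have rk: "U.rank = M.rank + N.rank"
 proof (rule le_antisym)
  obtain I where I: "I \<in> indeps (disjoint_union M N)" "card I = U.rank" using U.ex_card_rank by auto
  then obtain A B where A: "I = A \<union> B" "A \<in> indeps M" "B \<in> indeps N" "A \<inter> B = {}" by (auto simp: union_iff)
  then show "U.rank <= M.rank + N.rank" using card I M.card_indep_le N.card_indep_le by (metis add_mono)
  have b: "A0 \<in> indeps M" "B0 \<in> indeps N" "card A0 = M.rank" "card B0 = N.rank"
   using assms by (auto simp: M.bases_iff N.bases_iff)
  then have "A0 \<union> B0 \<in> indeps (disjoint_union M N)" using assms(3) by (auto simp: union_iff)
  then show "M.rank + N.rank <= U.rank" using U.card_indep_le card b assms(3) by metis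
 qed
 show ?thesis
 proof
  assume "T \<in> spanning_sets (disjoint_union M N)"
  then obtain I where I: "I \<in> indeps (disjoint_union M N)" "I \<subseteq> T" "card I = U.rank" "T \<subseteq> ground M \<union> ground N"
   by (auto simp: U.spanning_iff)
  then obtain A B where A: "I = A \<union> B" "A \<in> indeps M" "B \<in> indeps N" "A \<inter> B = {}" by (auto simp: union_iff)
  have "card A <= M.rank" "card B <= N.rank" "card A + card B = M.rank + N.rank"
   using A I rk card M.card_indep_le N.card_indep_le by auto
  then have "card A = M.rank" "card B = N.rank" by linarith+
  then have "A \<in> bases M" "B \<in> bases N" using A by (simp_all add: M.bases_iff N.bases_iff)
  then show "T \<subseteq> ground M \<union> ground N & (\<exists>A\<in>bases M. \<exists>B\<in>bases N. A \<inter> B = {} & A \<union> B \<subseteq> T)"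
   using I A by blast
 next
  assume T: "T \<subseteq> ground M \<union> ground N & (\<exists>A\<in>bases M. \<exists>B\<in>bases N. A \<inter> B = {} & A \<union> B \<subseteq> T)"
  then obtain A B where A: "A \<in> indeps M" "B \<in> indeps N" "card A = M.rank" "card B = N.rank" "A \<inter> B = {}" "A \<union> B \<subseteq> T"
   by (auto simp: M.bases_iff N.bases_iff)
  then have "A \<union> B \<in> indeps (disjoint_union M N)" by (auto simp: union_iff)
  moreover have "card (A \<union> B) = U.rank" using card rk A by simp
  ultimately show "T \<in> spanning_sets (disjoint_union M N)" using A T unfolding U.spanning_iff by auto
 qed
qed

end

lemma direct_sum_eq:
 assumes "matroid M" "matroid N" "ground M \<inter> ground N = {}"
 shows "direct_sum M N = disjoint_union M N"
proof -
 have "I \<inter> J = {}" if "I \<in> indeps M" "J \<in> indeps N" for I J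
  using matroid.indeps_subset [OF assms(1) that(1)] matroid.indeps_subset [OF assms(2) that(2)] assms(3) by auto
 then have "{I \<union> J | I J. I \<in> indeps M & J \<in> indeps N} = {I \<union> J | I J. I \<in> indeps M & J \<in> indeps N & I \<inter> J = {}}"
  by blast
 then show ?thesis by (simp add: direct_sum_def disjoint_union_def)
qed

lemma direct_sum_facts:
 assumes M: "matroid M" and N: "matroid N" and dis: "ground M \<inter> ground N = {}"
 shows "matroid (direct_sum M N)" "ground (direct_sum M N) = ground M \<union> ground N"
  and "\<And>T. T \<subseteq> ground M \<union> ground N ==>
   S_coeff (direct_sum M N) T = S_coeff M (T \<inter> ground M) * S_coeff N (T \<inter> ground N)"
  and "\<And>T. T \<subseteq> ground M \<union> ground N ==>
   C_coeff (direct_sum M N) T = C_coeff M (T \<inter> ground M) * C_coeff N (T \<inter> ground N)"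
proof -
 note eq = direct_sum_eq [OF assms]
 interpret M: matroid M by fact
 interpret N: matroid N by fact
 interpret two_matroids M N undefined by unfold_locales (use dis in auto)
 show "matroid (direct_sum M N)" unfolding eq by (rule matroid_union)
 show "ground (direct_sum M N) = ground M \<union> ground N" by (simp add: eq)
 fix T assume T: "T \<subseteq> ground M \<union> ground N"
 have sub: "\<And>A. A \<in> bases M ==> A \<subseteq> ground M" "\<And>A. A \<in> bases N ==> A \<subseteq> ground N"
  using M.indeps_subset N.indeps_subset by (auto simp: bases_def)
 obtain A0 B0 where b: "A0 \<in> bases M" "B0 \<in> bases N"
  using M.ground_spanning N.ground_spanning by (auto simp: spanning_sets_def)
 then have "A0 \<inter> B0 = {}" using sub dis by blast
 note sp = union_spanning [OF b this]
 have "T \<in> spanning_sets (disjoint_union M N) \<longleftrightarrow> T \<inter> ground M \<in> spanning_sets M & T \<inter> ground N \<in> spanning_sets N"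
  unfolding sp
 proof
  assume "T \<inter> ground M \<in> spanning_sets M & T \<inter> ground N \<in> spanning_sets N"
  then obtain A B where AB: "A \<in> bases M" "A \<subseteq> T" "B \<in> bases N" "B \<subseteq> T" by (auto simp: spanning_sets_def)
  moreover have "A \<inter> B = {}" using AB sub dis by blast
  ultimately show "T \<subseteq> ground M \<union> ground N & (\<exists>A\<in>bases M. \<exists>B\<in>bases N. A \<inter> B = {} & A \<union> B \<subseteq> T)"
   using T by blast
 next
  assume "T \<subseteq> ground M \<union> ground N & (\<exists>A\<in>bases M. \<exists>B\<in>bases N. A \<inter> B = {} & A \<union> B \<subseteq> T)"
  then obtain A B where AB: "A \<in> bases M" "B \<in> bases N" "A \<subseteq> T" "B \<subseteq> T" by auto
  then have "A \<subseteq> T \<inter> ground M" "B \<subseteq> T \<inter> ground N" using sub by auto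
  then show "T \<inter> ground M \<in> spanning_sets M & T \<inter> ground N \<in> spanning_sets N"
   using AB unfolding spanning_sets_def by blast
 qed
 then show "S_coeff (direct_sum M N) T = S_coeff M (T \<inter> ground M) * S_coeff N (T \<inter> ground N)"
  by (simp add: S_coeff_def eq)
 have "ground M \<union> ground N - T \<in> indeps (disjoint_union M N) \<longleftrightarrow>
   ground M - T \<inter> ground M \<in> indeps M & ground N - T \<inter> ground N \<in> indeps N"
 proof
  assume "ground M \<union> ground N - T \<in> indeps (disjoint_union M N)"
  then obtain A B where AB: "ground M \<union> ground N - T = A \<union> B" "A \<in> indeps M" "B \<in> indeps N" by (auto simp: union_iff)
  have "A \<subseteq> ground M" "B \<subseteq> ground N" using AB M.indeps_subset N.indeps_subset by auto
  then have "ground M - T \<inter> ground M = A" "ground N - T \<inter> ground N = B" using AB(1) dis by blast+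
  then show "ground M - T \<inter> ground M \<in> indeps M & ground N - T \<inter> ground N \<in> indeps N" using AB by simp
 next
  have "ground M \<union> ground N - T = (ground M - T \<inter> ground M) \<union> (ground N - T \<inter> ground N)"
   "(ground M - T \<inter> ground M) \<inter> (ground N - T \<inter> ground N) = {}" using dis by auto
  moreover assume "ground M - T \<inter> ground M \<in> indeps M & ground N - T \<inter> ground N \<in> indeps N"
  ultimately show "ground M \<union> ground N - T \<in> indeps (disjoint_union M N)" unfolding union_iff by blast
 qed
 then show "C_coeff (direct_sum M N) T = C_coeff M (T \<inter> ground M) * C_coeff N (T \<inter> ground N)"
  using T by (simp add: C_coeff_def eq)
qed

lemma gard_direct_sum:
 assumes M: "matroid M" and N: "matroid N" and dis: "ground M \<inter> ground N = {}"
 shows "gard (ground M) (S_coeff M) ==> gard (ground N) (S_coeff N) ==>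
   gard (ground M \<union> ground N) (S_coeff (direct_sum M N))"
  and "gard (ground M) (C_coeff M) ==> gard (ground N) (C_coeff N) ==>
   gard (ground M \<union> ground N) (C_coeff (direct_sum M N))"
proof -
 assume "gard (ground M) (S_coeff M)" "gard (ground N) (S_coeff N)"
 from gard_prod [OF this dis] show "gard (ground M \<union> ground N) (S_coeff (direct_sum M N))"
  by (rule gard_cong [THEN iffD1, rotated]) (simp add: direct_sum_facts [OF assms])
next
 assume "gard (ground M) (C_coeff M)" "gard (ground N) (C_coeff N)"
 from gard_prod [OF this dis] show "gard (ground M \<union> ground N) (C_coeff (direct_sum M N))"
  by (rule gard_cong [THEN iffD1, rotated]) (simp add: direct_sum_facts [OF assms])
qed

section \<open>Series and parallel connections\<close>

context matroid
begin

lemma ex_circuit: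
 assumes D: "D \<subseteq> ground M" "D \<notin> indeps M"
 shows "\<exists>C\<in>circuits M. C \<subseteq> D"
proof -
 have "finite D" using D finite_ground finite_subset by blast
 then show ?thesis using D
 proof (induction D rule: finite_psubset_induct)
  case (psubset D)
  show ?case
  proof (cases "\<forall>D'. D' \<subset> D --> D' \<in> indeps M")
   case True
   then show ?thesis using psubset by (auto simp: circuits_def)
  next
   case False
   then obtain D' where D': "D' \<subset> D" "D' \<notin> indeps M" by auto
   then obtain C where "C \<in> circuits M" "C \<subseteq> D'" using psubset.IH [of D'] psubset.prems by auto
   then show ?thesis using D' by (intro bexI [of _ C]) auto
  qed
 qed
qed

lemma circuitD: "C \<in> circuits M ==> C \<subseteq> ground M" "C \<in> circuits M ==> C \<notin> indeps M"
 by (auto simp: circuits_def)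

lemma circuit_not_subset: "C \<in> circuits M ==> I \<in> indeps M ==> \<not> C \<subseteq> I"
 using circuitD indep_subset by blast

lemma circuits_delete: "C \<in> circuits (delete M {e}) \<longleftrightarrow> C \<in> circuits M & e \<notin> C"
 unfolding circuits_def delete_def by auto

lemma not_coloop_spanning:
 assumes "e \<in> ground M" "\<not> is_coloop M e"
 shows "ground M - {e} \<in> spanning_sets M"
proof -
 obtain B where "B \<in> bases M" "e \<notin> B" using assms by (auto simp: is_coloop_def)
 then show ?thesis using indeps_subset by (auto simp: spanning_sets_def bases_def)
qed

lemma ex_basis_containing: "I \<in> indeps M ==> \<exists>B\<in>bases M. I \<subseteq> B"
 using indep_extends [of I] bases_iff by blast

end

locale connected_pair = M: matroid M + N: matroid N for M N :: "'a set_system" +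
 fixes e :: 'a
 assumes inter_eq: "ground M \<inter> ground N = {e}"
begin

sublocale two_matroids M N e
 by unfold_locales (use inter_eq in auto)

lemma e_in: "e \<in> ground M" "e \<in> ground N"
 using inter_eq by auto

lemma only_e: "x \<in> ground M ==> x \<in> ground N ==> x = e"
 using inter_eq by auto

lemma union_indep_iff:
 assumes I: "I \<subseteq> ground M \<union> ground N"
 shows "I \<in> indeps (disjoint_union M N) \<longleftrightarrow>
  (I \<inter> ground M - {e} \<in> indeps M & I \<inter> ground N \<in> indeps N) \<or>
  (I \<inter> ground M \<in> indeps M & I \<inter> ground N - {e} \<in> indeps N)" (is "_ \<longleftrightarrow> ?R")
proof
 assume "I \<in> indeps (disjoint_union M N)"
 then obtain A B where AB: "I = A \<union> B" "A \<in> indeps M" "B \<in> indeps N" "A \<inter> B = {}" by (auto simp: union_iff)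
 then have s: "A \<subseteq> ground M" "B \<subseteq> ground N" using M.indeps_subset N.indeps_subset by auto
 show ?R
 proof (cases "e \<in> B")
  case True
  then have "I \<inter> ground M - {e} \<subseteq> A" "I \<inter> ground N \<subseteq> B" using AB(1,4) s only_e by auto
  then show ?thesis using AB M.indep_subset N.indep_subset by blast
 next
  case False
  then have "I \<inter> ground M \<subseteq> A" "I \<inter> ground N - {e} \<subseteq> B" using AB(1,4) s only_e by auto
  then show ?thesis using AB M.indep_subset N.indep_subset by blast
 qed
next
 have 1: "I = (I \<inter> ground M - {e}) \<union> (I \<inter> ground N)" "(I \<inter> ground M - {e}) \<inter> (I \<inter> ground N) = {}"
  and 2: "I = (I \<inter> ground M) \<union> (I \<inter> ground N - {e})" "(I \<inter> ground M) \<inter> (I \<inter> ground N - {e}) = {}"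
  using I inter_eq by blast+
 assume ?R
 then show "I \<in> indeps (disjoint_union M N)"
  unfolding union_iff using 1 2 by meson
qed

lemma C_coeff_union:
 assumes T: "T \<subseteq> ground M \<union> ground N"
 shows "C_coeff (disjoint_union M N) T = par_coeff e (ground M) (ground N) (C_coeff M) (C_coeff N) T"
proof -
 have I: "ground M \<union> ground N - T \<subseteq> ground M \<union> ground N" by auto
 have eqs: "(ground M \<union> ground N - T) \<inter> ground M = ground M - T \<inter> ground M"
  "(ground M \<union> ground N - T) \<inter> ground N = ground N - T \<inter> ground N"
  "ground M - T \<inter> ground M - {e} = ground M - insert e (T \<inter> ground M)"
  "ground N - T \<inter> ground N - {e} = ground N - insert e (T \<inter> ground N)" by auto
 have "C_coeff M (T \<inter> ground M) <= C_coeff M (insert e (T \<inter> ground M))"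
  "C_coeff N (T \<inter> ground N) <= C_coeff N (insert e (T \<inter> ground N))"
  using e_in by (auto intro!: M.coeff_mono N.coeff_mono)
 moreover have "e \<in> T ==> insert e (T \<inter> ground M) = T \<inter> ground M" "e \<in> T ==> insert e (T \<inter> ground N) = T \<inter> ground N"
  using e_in by auto
 ultimately show ?thesis using T e_in
  unfolding C_coeff_def par_coeff_def by (simp add: union_indep_iff [OF I] eqs split: if_splits)
qed

lemma S_coeff_union:
 assumes T: "T \<subseteq> ground M \<union> ground N" and b: "A0 \<in> bases M" "B0 \<in> bases N" "A0 \<inter> B0 = {}"
 shows "S_coeff (disjoint_union M N) T = ser_coeff e (ground M) (ground N) (S_coeff M) (S_coeff N) T"
proof -
 have sub: "\<And>A. A \<in> bases M ==> A \<subseteq> ground M" "\<And>A. A \<in> bases N ==> A \<subseteq> ground N"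
  using M.indeps_subset N.indeps_subset by (auto simp: bases_def)
 have spM: "A \<in> bases M ==> A \<subseteq> X \<inter> ground M ==> X \<inter> ground M \<in> spanning_sets M"
  and spN: "A \<in> bases N ==> A \<subseteq> X \<inter> ground N ==> X \<inter> ground N \<in> spanning_sets N" for A X
  unfolding spanning_sets_def by auto
 have sp: "T \<in> spanning_sets (disjoint_union M N) \<longleftrightarrow>
  ((T - {e}) \<inter> ground M \<in> spanning_sets M & T \<inter> ground N \<in> spanning_sets N) \<or>
  (T \<inter> ground M \<in> spanning_sets M & (T - {e}) \<inter> ground N \<in> spanning_sets N)" (is "_ \<longleftrightarrow> ?R")
  unfolding union_spanning [OF b]
 proof
  assume "T \<subseteq> ground M \<union> ground N & (\<exists>A\<in>bases M. \<exists>B\<in>bases N. A \<inter> B = {} & A \<union> B \<subseteq> T)"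
  then obtain A B where AB: "A \<in> bases M" "B \<in> bases N" "A \<inter> B = {}" "A \<subseteq> T" "B \<subseteq> T" by auto
  show ?R
  proof (cases "e \<in> A")
   case True
   then have "A \<subseteq> T \<inter> ground M" "B \<subseteq> (T - {e}) \<inter> ground N" using AB sub by auto
   then show ?thesis using spM [OF AB(1)] spN [OF AB(2)] by blast
  next
   case False
   then have "A \<subseteq> (T - {e}) \<inter> ground M" "B \<subseteq> T \<inter> ground N" using AB sub by auto
   then show ?thesis using spM [OF AB(1)] spN [OF AB(2)] by blast
  qed
 next
  assume ?R
  then obtain A B where AB: "A \<in> bases M" "B \<in> bases N" "A \<subseteq> T" "B \<subseteq> T" "e \<notin> A \<or> e \<notin> B"
   unfolding spanning_sets_def by blast
  moreover have "A \<inter> B = {}" using AB sub only_e by blast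
  ultimately show "T \<subseteq> ground M \<union> ground N & (\<exists>A\<in>bases M. \<exists>B\<in>bases N. A \<inter> B = {} & A \<union> B \<subseteq> T)"
   using T by blast
 qed
 have "S_coeff M ((T - {e}) \<inter> ground M) <= S_coeff M (T \<inter> ground M)"
  "S_coeff N ((T - {e}) \<inter> ground N) <= S_coeff N (T \<inter> ground N)"
  by (auto intro!: M.coeff_mono N.coeff_mono)
 moreover have "e \<in> T ==> insert e ((T - {e}) \<inter> ground M) = T \<inter> ground M"
  "e \<in> T ==> insert e ((T - {e}) \<inter> ground N) = T \<inter> ground N" "e \<notin> T ==> T - {e} = T"
  using e_in by auto
 ultimately show ?thesis using T e_in
  unfolding S_coeff_def par_coeff_def ser_coeff_def by (simp add: sp split: if_splits)
qed

end

text \<open>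
 The generic case, in which the connections are defined by their circuits.
\<close>

locale proper_pair = connected_pair +
 assumes no_loop: "\<not> is_loop M e" "\<not> is_loop N e"
  and no_coloop: "\<not> is_coloop M e" "\<not> is_coloop N e"
begin

lemma e_indep: "{e} \<in> indeps M" "{e} \<in> indeps N"
 using no_loop e_in by (auto simp: is_loop_def)

lemma disjoint_bases: "\<exists>A\<in>bases M. \<exists>B\<in>bases N. A \<inter> B = {}"
proof -
 obtain A where A: "A \<in> bases M" "e \<notin> A" using no_coloop e_in by (auto simp: is_coloop_def)
 obtain B where B: "B \<in> bases N" using N.ground_spanning by (auto simp: spanning_sets_def)
 have "A \<subseteq> ground M" "B \<subseteq> ground N" using A B M.indeps_subset N.indeps_subset by (auto simp: bases_def)
 then have "A \<inter> B = {}" using A only_e by blast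
 then show ?thesis using A B by blast
qed

lemma series_eq: "series_connection e M N = disjoint_union M N"
proof -
 define \<C> where "\<C> = circuits (delete M {e}) \<union> circuits (delete N {e}) \<union>
     {C1 \<union> C2 | C1 C2. C1 \<in> circuits M & e \<in> C1 & C2 \<in> circuits N & e \<in> C2}"
 have ind: "\<not> (\<exists>C\<in>\<C>. C \<subseteq> I) \<longleftrightarrow> I \<in> indeps (disjoint_union M N)" if I: "I \<subseteq> ground M \<union> ground N" for I
 proof
  assume no: "\<not> (\<exists>C\<in>\<C>. C \<subseteq> I)"
  have A: "I \<inter> ground M - {e} \<in> indeps M"
  proof (rule ccontr)
   assume "I \<inter> ground M - {e} \<notin> indeps M"
   then obtain C where "C \<in> circuits M" "C \<subseteq> I \<inter> ground M - {e}" using M.ex_circuit by (metis Diff_subset inf_le2 subset_trans)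
   moreover from this have "C \<in> \<C>" unfolding \<C>_def Un_iff M.circuits_delete by blast
   ultimately show False using no by blast
  qed
  have B: "I \<inter> ground N - {e} \<in> indeps N"
  proof (rule ccontr)
   assume "I \<inter> ground N - {e} \<notin> indeps N"
   then obtain C where "C \<in> circuits N" "C \<subseteq> I \<inter> ground N - {e}" using N.ex_circuit by (metis Diff_subset inf_le2 subset_trans)
   moreover from this have "C \<in> \<C>" unfolding \<C>_def Un_iff N.circuits_delete by blast
   ultimately show False using no by blast
  qed
  have "I \<inter> ground M \<in> indeps M \<or> I \<inter> ground N \<in> indeps N"
  proof (rule ccontr)
   assume "\<not> ?thesis"
   then obtain C D where CD: "C \<in> circuits M" "C \<subseteq> I \<inter> ground M" "D \<in> circuits N" "D \<subseteq> I \<inter> ground N"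
    using M.ex_circuit N.ex_circuit by (meson inf_le2)
   moreover have "e \<in> C" "e \<in> D"
    using M.circuit_not_subset [OF CD(1) A] N.circuit_not_subset [OF CD(3) B] CD by auto
   ultimately have "C \<union> D \<in> \<C>" unfolding \<C>_def by blast
   then show False using no CD by blast
  qed
  then show "I \<in> indeps (disjoint_union M N)" using A B by (auto simp: union_indep_iff [OF I])
 next
  assume "I \<in> indeps (disjoint_union M N)"
  then have R: "(I \<inter> ground M - {e} \<in> indeps M & I \<inter> ground N \<in> indeps N) \<or>
   (I \<inter> ground M \<in> indeps M & I \<inter> ground N - {e} \<in> indeps N)" by (simp only: union_indep_iff [OF I])
  then have E: "I \<inter> ground M - {e} \<in> indeps M" "I \<inter> ground N - {e} \<in> indeps N"
   using M.indep_subset [OF _ Diff_subset] N.indep_subset [OF _ Diff_subset] by blast+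
  have c: "\<And>C. C \<in> circuits M ==> C \<subseteq> I ==> C \<subseteq> I \<inter> ground M" "\<And>C. C \<in> circuits N ==> C \<subseteq> I ==> C \<subseteq> I \<inter> ground N"
   using M.circuitD(1) N.circuitD(1) by blast+
  have ab: "\<And>C. C \<in> circuits M ==> e \<notin> C ==> \<not> C \<subseteq> I" "\<And>C. C \<in> circuits N ==> e \<notin> C ==> \<not> C \<subseteq> I"
  proof -
   have x: "C \<subseteq> X ==> e \<notin> C ==> C \<subseteq> X - {e}" for C X by auto
   show "\<And>C. C \<in> circuits M ==> e \<notin> C ==> \<not> C \<subseteq> I"
    using x c(1) M.circuit_not_subset [OF _ E(1)] by metis
   show "\<And>C. C \<in> circuits N ==> e \<notin> C ==> \<not> C \<subseteq> I"
    using x c(2) N.circuit_not_subset [OF _ E(2)] by metis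
  qed
  have "\<And>C D. C \<in> circuits M ==> D \<in> circuits N ==> \<not> C \<union> D \<subseteq> I"
  proof
   fix C D assume CD: "C \<in> circuits M" "D \<in> circuits N" "C \<union> D \<subseteq> I"
   then have "C \<subseteq> I \<inter> ground M" "D \<subseteq> I \<inter> ground N" using c by auto
   then show False using R M.circuit_not_subset [OF CD(1)] N.circuit_not_subset [OF CD(2)] by blast
  qed
  with ab show "\<not> (\<exists>C\<in>\<C>. C \<subseteq> I)" unfolding \<C>_def using M.circuits_delete N.circuits_delete by blast
 qed
 have "{I. I \<subseteq> ground M \<union> ground N & \<not> (\<exists>C\<in>\<C>. C \<subseteq> I)} = indeps (disjoint_union M N)"
  using ind U.indeps_subset by auto
 then show ?thesis using no_loop no_coloop
  by (simp add: series_connection_def of_circuits_def flip: \<C>_def)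
qed

lemma dual_pair: "connected_pair (dual M) (dual N) e"
proof -
 interpret d: matroid "dual M" by (rule M.matroid_dual)
 interpret d': matroid "dual N" by (rule N.matroid_dual)
 show ?thesis by unfold_locales (simp add: inter_eq)
qed

sublocale D: connected_pair "dual M" "dual N" e
 by (rule dual_pair)

lemma dual_disjoint_bases: "\<exists>A\<in>bases (dual M). \<exists>B\<in>bases (dual N). A \<inter> B = {}"
proof -
 obtain A where A: "A \<in> bases M" "e \<in> A" using M.ex_basis_containing e_indep by blast
 obtain B where B: "B \<in> bases N" using N.ground_spanning by (auto simp: spanning_sets_def)
 have "A \<subseteq> ground M" "B \<subseteq> ground N" using A B M.indeps_subset N.indeps_subset by (auto simp: bases_def)
 then have "ground M - A \<in> bases (dual M)" "ground N - B \<in> bases (dual N)"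
  using A B by (simp_all add: M.bases_dual N.bases_dual double_diff)
 moreover have "(ground M - A) \<inter> (ground N - B) = {}" using A only_e by blast
 ultimately show ?thesis by blast
qed

lemma dual_union_indep:
 "I \<in> indeps (dual (disjoint_union (dual M) (dual N))) \<longleftrightarrow> I \<subseteq> ground M \<union> ground N \<and>
  ((insert e (I \<inter> ground M) \<in> indeps M & I \<inter> ground N \<in> indeps N) \<or>
   (I \<inter> ground M \<in> indeps M & insert e (I \<inter> ground N) \<in> indeps N))" (is "_ \<longleftrightarrow> _ & ?R")
proof -
 obtain A0 B0 where b: "A0 \<in> bases (dual M)" "B0 \<in> bases (dual N)" "A0 \<inter> B0 = {}" using dual_disjoint_bases by auto
 have "(\<exists>A\<in>bases (dual M). \<exists>B\<in>bases (dual N). A \<inter> B = {} & A \<union> B \<subseteq> ground M \<union> ground N - I) \<longleftrightarrow> ?R"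
  if I: "I \<subseteq> ground M \<union> ground N"
 proof
  assume "\<exists>A\<in>bases (dual M). \<exists>B\<in>bases (dual N). A \<inter> B = {} & A \<union> B \<subseteq> ground M \<union> ground N - I"
  then obtain A B where AB: "A \<in> bases (dual M)" "B \<in> bases (dual N)" "A \<inter> B = {}" "A \<inter> I = {}" "B \<inter> I = {}" by blast
  then have "ground M - A \<in> bases M" "ground N - B \<in> bases N" by (simp_all only: M.bases_dual N.bases_dual)
  then have ind: "ground M - A \<in> indeps M" "ground N - B \<in> indeps N" by (simp_all add: bases_def)
  have "I \<inter> ground M \<subseteq> ground M - A" "I \<inter> ground N \<subseteq> ground N - B" using AB by auto
  moreover have "e \<in> ground M - A \<or> e \<in> ground N - B" using AB e_in by auto
  ultimately have "(insert e (I \<inter> ground M) \<subseteq> ground M - A & I \<inter> ground N \<subseteq> ground N - B) \<or>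
   (I \<inter> ground M \<subseteq> ground M - A & insert e (I \<inter> ground N) \<subseteq> ground N - B)" by auto
  then show ?R using M.indep_subset [OF ind(1)] N.indep_subset [OF ind(2)] by blast
 next
  assume ?R
  then obtain A B where AB: "A \<in> bases M" "B \<in> bases N" "I \<inter> ground M \<subseteq> A" "I \<inter> ground N \<subseteq> B" "e \<in> A \<or> e \<in> B"
   using M.ex_basis_containing N.ex_basis_containing by (meson insert_subset)
  have "A \<subseteq> ground M" "B \<subseteq> ground N" using AB M.indeps_subset N.indeps_subset by (auto simp: bases_def)
  then have "ground M - A \<in> bases (dual M)" "ground N - B \<in> bases (dual N)"
   using AB by (simp_all add: M.bases_dual N.bases_dual double_diff)
  moreover have "(ground M - A) \<inter> (ground N - B) = {}" using AB only_e by blast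
  moreover have "(ground M - A) \<union> (ground N - B) \<subseteq> ground M \<union> ground N - I" using AB(3,4) by auto
  ultimately show "\<exists>A\<in>bases (dual M). \<exists>B\<in>bases (dual N). A \<inter> B = {} & A \<union> B \<subseteq> ground M \<union> ground N - I" by blast
 qed
 moreover have "I \<in> indeps (dual (disjoint_union (dual M) (dual N))) \<longleftrightarrow> I \<subseteq> ground M \<union> ground N \<and>
  (\<exists>A\<in>bases (dual M). \<exists>B\<in>bases (dual N). A \<inter> B = {} & A \<union> B \<subseteq> ground M \<union> ground N - I)"
  by (simp add: dual_def [of "disjoint_union (dual M) (dual N)"] D.union_spanning [OF b] Diff_subset)
 ultimately show ?thesis by blast
qed

text \<open>
 Parallel connection is dual to series connection; with this form it inherits the matroid axioms and its
 coefficients from \<open>disjoint_union\<close>.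
\<close>

lemma parallel_eq: "parallel_connection e M N = dual (disjoint_union (dual M) (dual N))"
proof -
 define \<C> where "\<C> = circuits M \<union> circuits N \<union>
     {(C1 \<union> C2) - {e} | C1 C2. C1 \<in> circuits M & e \<in> C1 & C2 \<in> circuits N & e \<in> C2}"
 have ind: "\<not> (\<exists>C\<in>\<C>. C \<subseteq> I) \<longleftrightarrow> I \<in> indeps (dual (disjoint_union (dual M) (dual N)))"
  if I: "I \<subseteq> ground M \<union> ground N" for I
 proof
  assume no: "\<not> (\<exists>C\<in>\<C>. C \<subseteq> I)"
  have A: "I \<inter> ground M \<in> indeps M" and B: "I \<inter> ground N \<in> indeps N"
   using no M.ex_circuit [of "I \<inter> ground M"] N.ex_circuit [of "I \<inter> ground N"] unfolding \<C>_def by auto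
  have "insert e (I \<inter> ground M) \<in> indeps M \<or> insert e (I \<inter> ground N) \<in> indeps N"
  proof (rule ccontr)
   assume "\<not> ?thesis"
   then obtain C D where CD: "C \<in> circuits M" "C \<subseteq> insert e (I \<inter> ground M)" "D \<in> circuits N" "D \<subseteq> insert e (I \<inter> ground N)"
    using M.ex_circuit [of "insert e (I \<inter> ground M)"] N.ex_circuit [of "insert e (I \<inter> ground N)"] e_in by blast
   moreover have "e \<in> C" "e \<in> D"
    using M.circuit_not_subset [OF CD(1) A] N.circuit_not_subset [OF CD(3) B] CD by auto
   ultimately have "C \<union> D - {e} \<in> \<C>" unfolding \<C>_def by blast
   moreover have "C \<union> D - {e} \<subseteq> I" using CD(2,4) by auto
   ultimately show False using no by blast
  qed
  then show "I \<in> indeps (dual (disjoint_union (dual M) (dual N)))" using A B I by (auto simp: dual_union_indep)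
 next
  assume "I \<in> indeps (dual (disjoint_union (dual M) (dual N)))"
  then have R: "(insert e (I \<inter> ground M) \<in> indeps M & I \<inter> ground N \<in> indeps N) \<or>
   (I \<inter> ground M \<in> indeps M & insert e (I \<inter> ground N) \<in> indeps N)" by (simp add: dual_union_indep)
  then have AB: "I \<inter> ground M \<in> indeps M" "I \<inter> ground N \<in> indeps N"
   using M.indep_subset N.indep_subset by blast+
  have "\<not> C \<subseteq> I" if "C \<in> circuits M \<union> circuits N" for C
   using that M.circuit_not_subset [OF _ AB(1)] N.circuit_not_subset [OF _ AB(2)] M.circuitD N.circuitD by blast
  moreover have "\<not> C \<union> D - {e} \<subseteq> I" if "C \<in> circuits M" "D \<in> circuits N" for C D
  proof
   assume "C \<union> D - {e} \<subseteq> I"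
   then have "C \<subseteq> insert e (I \<inter> ground M)" "D \<subseteq> insert e (I \<inter> ground N)"
    using M.circuitD(1) [OF that(1)] N.circuitD(1) [OF that(2)] by blast+
   then show False using R M.circuit_not_subset [OF that(1)] N.circuit_not_subset [OF that(2)] by blast
  qed
  ultimately show "\<not> (\<exists>C\<in>\<C>. C \<subseteq> I)" unfolding \<C>_def by blast
 qed
 have "{I. I \<subseteq> ground M \<union> ground N & \<not> (\<exists>C\<in>\<C>. C \<subseteq> I)} = indeps (dual (disjoint_union (dual M) (dual N)))"
  using ind dual_union_indep by auto
 then show ?thesis using no_loop no_coloop
  by (simp add: parallel_connection_def of_circuits_def flip: \<C>_def)
qed

lemma parallel_facts:
 "matroid (parallel_connection e M N)" "ground (parallel_connection e M N) = ground M \<union> ground N"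
 "T \<subseteq> ground M \<union> ground N ==>
  S_coeff (parallel_connection e M N) T = par_coeff e (ground M) (ground N) (S_coeff M) (S_coeff N) T"
 "T \<subseteq> ground M \<union> ground N ==>
  C_coeff (parallel_connection e M N) T = ser_coeff e (ground M) (ground N) (C_coeff M) (C_coeff N) T"
proof -
 show "matroid (parallel_connection e M N)" unfolding parallel_eq by (rule D.U.matroid_dual)
 show "ground (parallel_connection e M N) = ground M \<union> ground N" by (simp add: parallel_eq)
 assume T: "T \<subseteq> ground M \<union> ground N"
 show "S_coeff (parallel_connection e M N) T = par_coeff e (ground M) (ground N) (S_coeff M) (S_coeff N) T"
  using D.C_coeff_union [of T] T by (simp add: parallel_eq D.U.S_coeff_dual M.C_coeff_dual N.C_coeff_dual)
 obtain A0 B0 where b: "A0 \<in> bases (dual M)" "B0 \<in> bases (dual N)" "A0 \<inter> B0 = {}" using dual_disjoint_bases by auto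
 show "C_coeff (parallel_connection e M N) T = ser_coeff e (ground M) (ground N) (C_coeff M) (C_coeff N) T"
  using D.S_coeff_union [OF _ b, of T] T by (simp add: parallel_eq D.U.C_coeff_dual M.S_coeff_dual N.S_coeff_dual)
qed

lemma insert_mono:
 "T \<subseteq> ground M ==> S_coeff M T <= S_coeff M (insert e T)" "T \<subseteq> ground N ==> S_coeff N T <= S_coeff N (insert e T)"
 "T \<subseteq> ground M ==> C_coeff M T <= C_coeff M (insert e T)" "T \<subseteq> ground N ==> C_coeff N T <= C_coeff N (insert e T)"
 using e_in by (auto intro!: M.coeff_mono N.coeff_mono)

lemma gard_connections:
 "gard (ground M) (S_coeff M) ==> gard (ground N) (S_coeff N) ==>
  gard (ground M \<union> ground N) (S_coeff (parallel_connection e M N))"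
 "gard (ground M) (C_coeff M) ==> gard (ground N) (C_coeff N) ==>
  gard (ground M \<union> ground N) (C_coeff (parallel_connection e M N))"
 "gard (ground M) (S_coeff M) ==> gard (ground N) (S_coeff N) ==>
  gard (ground M \<union> ground N) (S_coeff (series_connection e M N))"
 "gard (ground M) (C_coeff M) ==> gard (ground N) (C_coeff N) ==>
  gard (ground M \<union> ground N) (C_coeff (series_connection e M N))"
proof -
 have e: "ground M - (ground M - {e}) = {e}" using e_in by auto
 obtain A0 B0 where b: "A0 \<in> bases M" "B0 \<in> bases N" "A0 \<inter> B0 = {}" using disjoint_bases by auto
 show "gard (ground M \<union> ground N) (S_coeff (parallel_connection e M N))"
  if "gard (ground M) (S_coeff M)" "gard (ground N) (S_coeff N)"
  by (rule gard_cong [THEN iffD2, OF _ gard_parallel [OF that inter_eq]]) (use parallel_facts insert_mono in auto)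
 show "gard (ground M \<union> ground N) (C_coeff (parallel_connection e M N))"
  if "gard (ground M) (C_coeff M)" "gard (ground N) (C_coeff N)"
  by (rule gard_cong [THEN iffD2, OF _ gard_series [OF that inter_eq]])
   (use parallel_facts insert_mono e e_indep in \<open>auto simp: C_coeff_def [of M "ground M - {e}"]\<close>)
 show "gard (ground M \<union> ground N) (S_coeff (series_connection e M N))"
  if "gard (ground M) (S_coeff M)" "gard (ground N) (S_coeff N)"
  by (rule gard_cong [THEN iffD2, OF _ gard_series [OF that inter_eq]])
   (use S_coeff_union [OF _ b] insert_mono M.not_coloop_spanning no_coloop e_in in
    \<open>auto simp: series_eq S_coeff_def [of M "ground M - {e}"]\<close>)
 show "gard (ground M \<union> ground N) (C_coeff (series_connection e M N))"
  if "gard (ground M) (C_coeff M)" "gard (ground N) (C_coeff N)"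
  by (rule gard_cong [THEN iffD2, OF _ gard_parallel [OF that inter_eq]])
   (use C_coeff_union insert_mono in \<open>auto simp: series_eq\<close>)
qed

end

text \<open>
 One predicate for both generating functions, for \<open>F = S_coeff\<close> and \<open>F = C_coeff\<close>.
\<close>

definition gmat :: "('a set_system => 'a set => real) => 'a set_system => bool" where
 "gmat F M \<longleftrightarrow> matroid M & gard (ground M) (F M)"

lemma gmat_direct_sum:
 assumes "F = S_coeff \<or> F = C_coeff" "gmat F M" "gmat F N" "ground M \<inter> ground N = {}"
 shows "gmat F (direct_sum M N)"
 using assms gard_direct_sum [of M N] direct_sum_facts(1,2) [of M N] unfolding gmat_def by metis

lemma gmat_minors:
 assumes F: "F = S_coeff \<or> F = C_coeff" and M: "gmat F M" and D: "D \<subseteq> ground M"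
 shows "gmat F (delete M D)" "gmat F (contract M D)"
proof -
 interpret matroid M using M by (simp add: gmat_def)
 show "gmat F (delete M D)" "gmat F (contract M D)"
  using F M gard_S_minors [OF _ D] gard_C_minors [OF _ D] matroid_delete matroid_contract [OF D]
  unfolding gmat_def ground_minors by metis+
qed

text \<open>
 In the degenerate cases the connections are direct sums of minors.
\<close>

lemma gmat_connections:
 assumes F: "F = S_coeff \<or> F = C_coeff" and M: "gmat F M" and N: "gmat F N" and int: "ground M \<inter> ground N = {e}"
 shows "gmat F (parallel_connection e M N)" "gmat F (series_connection e M N)"
proof -
 have e: "{e} \<subseteq> ground M" "{e} \<subseteq> ground N" using int by auto
 note m = gmat_minors [OF F M e(1)] gmat_minors [OF F N e(2)]
 have d: "(ground M - {e}) \<inter> ground N = {}" "ground M \<inter> (ground N - {e}) = {}" using int by auto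
 have proper: "gmat F (parallel_connection e M N) & gmat F (series_connection e M N)"
  if "\<not> is_loop M e" "\<not> is_loop N e" "\<not> is_coloop M e" "\<not> is_coloop N e"
 proof -
  interpret M: matroid M using M by (simp add: gmat_def)
  interpret N: matroid N using N by (simp add: gmat_def)
  interpret proper_pair M N e by unfold_locales (use int that in auto)
  show ?thesis using F M N gard_connections parallel_facts(1,2) matroid_union series_eq
   unfolding gmat_def by (metis ground_disjoint_union)
 qed
 have "gmat F (direct_sum (delete M {e}) N)" "gmat F (direct_sum (contract M {e}) N)"
  "gmat F (direct_sum M (delete N {e}))" "gmat F (direct_sum M (contract N {e}))"
  by (rule gmat_direct_sum [OF F]; use m M N d in simp)+
 then have "gmat F (parallel_connection e M N) & gmat F (series_connection e M N)"
  if "is_loop M e \<or> is_loop N e \<or> is_coloop M e \<or> is_coloop N e"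
  using that by (auto simp: parallel_connection_def series_connection_def)
 then show "gmat F (parallel_connection e M N)" "gmat F (series_connection e M N)"
  using proper by blast+
qed

section \<open>Uniform matroids and single-element extensions\<close>

text \<open>
 Both properties are proved together because duality exchanges them.
\<close>

definition doubly_garding :: "'a set_system => bool" where
 "doubly_garding M \<longleftrightarrow> matroid M & gard (ground M) (S_coeff M) & gard (ground M) (C_coeff M)"

lemma doubly_garding_gmat: "doubly_garding M \<longleftrightarrow> gmat S_coeff M & gmat C_coeff M"
 by (auto simp: doubly_garding_def gmat_def)

lemma doubly_garding_dual: "doubly_garding M ==> doubly_garding (dual M)"
 unfolding doubly_garding_def using matroid.matroid_dual [of M] matroid.S_coeff_dual [of M] matroid.C_coeff_dual [of M]
 by (metis ground_dual)

lemma doubly_garding_uniform: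
 assumes M: "matroid M" and r: "r <= card (ground M)" and ind: "\<And>I. I \<in> indeps M \<longleftrightarrow> I \<subseteq> ground M & card I <= r"
 shows "doubly_garding M"
proof -
 interpret matroid M by fact
 have rk: "rank = r"
 proof (rule le_antisym)
  show "rank <= r" using ex_card_rank ind by auto
  obtain I where "I \<subseteq> ground M" "card I = r" using r by (meson obtain_subset_with_card_n)
  then show "r <= rank" using card_indep_le ind by auto
 qed
 have "gard (ground M) (S_coeff M)"
 proof (rule gard_cong [THEN iffD1, OF _ gard_uniform [OF finite_ground r]])
  fix T assume T: "T \<subseteq> ground M"
  have "T \<in> spanning_sets M \<longleftrightarrow> r <= card T"
  proof
   assume "T \<in> spanning_sets M"
   then obtain I where "I \<subseteq> T" "card I = r" by (auto simp: spanning_iff rk)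
   then show "r <= card T" using T finite_ground card_mono finite_subset by metis
  next
   assume "r <= card T"
   then obtain I where "I \<subseteq> T" "card I = r" by (meson obtain_subset_with_card_n)
   then show "T \<in> spanning_sets M" using T unfolding spanning_iff rk ind by (intro conjI bexI [of _ I]) (auto simp: ind)
  qed
  then show "uc r T = S_coeff M T" by (simp add: uc_def S_coeff_def)
 qed
 moreover have "gard (ground M) (C_coeff M)"
 proof (rule gard_cong [THEN iffD1, OF _ gard_uniform [OF finite_ground, of "card (ground M) - r"]])
  fix T assume T: "T \<subseteq> ground M"
  then have "card (ground M - T) = card (ground M) - card T" "card T <= card (ground M)"
   using finite_ground by (auto intro: card_Diff_subset card_mono finite_subset)
  then show "uc (card (ground M) - r) T = C_coeff M T" using T r by (auto simp: uc_def C_coeff_def ind)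
 qed simp
 ultimately show ?thesis using M by (simp add: doubly_garding_def)
qed

text \<open>
 The new element \<open>g\<close> is a copy of \<open>f\<close>: a set containing \<open>g\<close> but not \<open>f\<close> is tested after replacing
 \<open>g\<close> by \<open>f\<close>.
\<close>

definition parallel_extension :: "'a => 'a => 'a set_system => 'a set_system" where
 "parallel_extension f g M = \<lparr>ground = insert g (ground M),
   indeps = {I. I \<subseteq> insert g (ground M) & \<not> {f, g} \<subseteq> I & (if g \<in> I then insert f (I - {g}) else I) \<in> indeps M}\<rparr>"

definition series_extension :: "'a => 'a => 'a set_system => 'a set_system" where
 "series_extension f g M = dual (parallel_extension f g (dual M))"

lemma ground_extensions [simp]:
 "ground (parallel_extension f g M) = insert g (ground M)" "ground (series_extension f g M) = insert g (ground M)"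
 by (simp_all add: parallel_extension_def series_extension_def)

context matroid
begin

lemma matroid_parallel_extension:
 assumes f: "f \<in> ground M" and g: "g \<notin> ground M"
 shows "matroid (parallel_extension f g M)"
proof -
 define \<phi> where "\<phi> I = (if g \<in> I then insert f (I - {g}) else I)" for I
 have fg: "f ~= g" using f g by auto
 have ind: "I \<in> indeps (parallel_extension f g M) \<longleftrightarrow> I \<subseteq> insert g (ground M) & \<not> {f, g} \<subseteq> I & \<phi> I \<in> indeps M" for I
  by (simp add: parallel_extension_def \<phi>_def)
 have card: "card (\<phi> I) = card I" if "I \<in> indeps (parallel_extension f g M)" for I
 proof (cases "g \<in> I")
  case True
  then have "f \<notin> I" "finite I" using that finite_ground finite_subset by (auto simp: ind)
  then show ?thesis using True card.remove [of I g] by (simp add: \<phi>_def)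
 qed (simp add: \<phi>_def)
 show ?thesis
 proof
  show "finite (ground (parallel_extension f g M))" using finite_ground by simp
  show "I \<subseteq> ground (parallel_extension f g M)" if "I \<in> indeps (parallel_extension f g M)" for I
   using that by (simp add: ind)
  show "{} \<in> indeps (parallel_extension f g M)" using empty_indep by (simp add: ind \<phi>_def)
  show "J \<in> indeps (parallel_extension f g M)" if "I \<in> indeps (parallel_extension f g M)" "J \<subseteq> I" for I J
  proof -
   have "\<phi> J \<subseteq> \<phi> I" using that by (auto simp: \<phi>_def)
   then show ?thesis using that indep_subset unfolding ind by blast
  qed
  fix I J assume I: "I \<in> indeps (parallel_extension f g M)" and J: "J \<in> indeps (parallel_extension f g M)"
   and c: "card I < card J"
  then obtain x where x: "x \<in> \<phi> J - \<phi> I" "insert x (\<phi> I) \<in> indeps M"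
   using augment [of "\<phi> I" "\<phi> J"] card by (auto simp: ind)
  have gM: "g \<notin> \<phi> I" for I using fg by (simp add: \<phi>_def)
  have xJ: "insert x I \<subseteq> insert g (ground M)" "x ~= g" using x I J indeps_subset [OF x(2)] gM by (auto simp: ind)
  show "\<exists>x\<in>J - I. insert x I \<in> indeps (parallel_extension f g M)"
  proof (cases "x = f")
   case False
   then have "\<phi> (insert x I) = insert x (\<phi> I)" "x \<in> J - I" using x xJ by (auto simp: \<phi>_def split: if_splits)
   then show ?thesis using x xJ False I by (intro bexI [of _ x]) (auto simp: ind)
  next
   case True
   then have no: "f \<notin> I" "g \<notin> I" using x by (auto simp: \<phi>_def split: if_splits)
   then have "\<phi> (insert f I) = insert x (\<phi> I)" "\<phi> (insert g I) = insert x (\<phi> I)" using True fg by (auto simp: \<phi>_def)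
   moreover have "f \<in> J \<or> g \<in> J" using x True by (auto simp: \<phi>_def split: if_splits)
   ultimately show ?thesis using x no I f fg unfolding ind by auto
  qed
 qed
qed

lemma spanning_parallel_extension:
 assumes f: "f \<in> ground M" and g: "g \<notin> ground M" and T: "T \<subseteq> insert g (ground M)"
 shows "T \<in> spanning_sets (parallel_extension f g M) \<longleftrightarrow> (if g \<in> T then insert f (T - {g}) else T) \<in> spanning_sets M"
proof -
 define \<phi> where "\<phi> I = (if g \<in> I then insert f (I - {g}) else I)" for I
 have fg: "f ~= g" using f g by auto
 interpret p: matroid "parallel_extension f g M" using f g by (rule matroid_parallel_extension)
 have ind: "I \<in> indeps (parallel_extension f g M) \<longleftrightarrow> I \<subseteq> insert g (ground M) & \<not> {f, g} \<subseteq> I & \<phi> I \<in> indeps M" for I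
  by (simp add: parallel_extension_def \<phi>_def)
 have card: "card (\<phi> I) = card I" if "I \<in> indeps (parallel_extension f g M)" for I
 proof (cases "g \<in> I")
  case True
  then have "f \<notin> I" "finite I" using that p.finite_indep by (auto simp: ind)
  then show ?thesis using True card.remove [of I g] by (simp add: \<phi>_def)
 qed (simp add: \<phi>_def)
 have M: "I \<in> indeps (parallel_extension f g M)" "\<phi> I = I" if "I \<in> indeps M" for I
  using that indeps_subset [OF that] g by (auto simp: ind \<phi>_def)
 have rk: "p.rank = rank"
 proof (rule le_antisym)
  obtain I where I: "I \<in> indeps (parallel_extension f g M)" "card I = p.rank" using p.ex_card_rank by auto
  then show "p.rank <= rank" using card [OF I(1)] card_indep_le [of "\<phi> I"] by (simp add: ind)
  obtain I where "I \<in> indeps M" "card I = rank" using ex_card_rank by auto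
  then show "rank <= p.rank" using p.card_indep_le M by metis
 qed
 have "T \<in> spanning_sets (parallel_extension f g M) \<longleftrightarrow> \<phi> T \<in> spanning_sets M"
 proof
  assume "T \<in> spanning_sets (parallel_extension f g M)"
  then obtain I where I: "I \<in> indeps (parallel_extension f g M)" "I \<subseteq> T" "card I = rank" by (auto simp: p.spanning_iff rk)
  then have "\<phi> I \<in> indeps M" "\<phi> I \<subseteq> \<phi> T" "card (\<phi> I) = rank" using card by (auto simp: ind \<phi>_def)
  moreover have "\<phi> T \<subseteq> ground M" using T f g by (auto simp: \<phi>_def)
  ultimately show "\<phi> T \<in> spanning_sets M" unfolding spanning_iff by blast
 next
  assume "\<phi> T \<in> spanning_sets M"
  then obtain J where J: "J \<in> indeps M" "J \<subseteq> \<phi> T" "card J = rank" by (auto simp: spanning_iff)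
  have gJ: "g \<notin> J" using J g indeps_subset by auto
  show "T \<in> spanning_sets (parallel_extension f g M)"
  proof (cases "J \<subseteq> T")
   case True
   then show ?thesis using M [OF J(1)] J T unfolding p.spanning_iff rk by auto
  next
   case False
   then have fg': "f \<in> J" "f \<notin> T" "g \<in> T" using J by (auto simp: \<phi>_def split: if_splits)
   define I where "I = insert g (J - {f})"
   have "\<phi> I = J" using gJ fg' by (auto simp: \<phi>_def I_def)
   then have I: "I \<in> indeps (parallel_extension f g M)" "I \<subseteq> T"
    using J fg' fg indeps_subset [OF J(1)] by (auto simp: ind I_def \<phi>_def)
   moreover have "card I = rank" using card [OF I(1)] J \<open>\<phi> I = J\<close> by simp
   ultimately show ?thesis using T unfolding p.spanning_iff rk by auto
  qed
 qed
 then show ?thesis by (simp add: \<phi>_def)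
qed

end

text \<open>
 The extension is the parallel connection with two parallel elements, at the level of
 coefficients also when \<open>f\<close> is a loop or a coloop.
\<close>

lemma doubly_garding_parallel_extension:
 assumes M: "doubly_garding M" and f: "f \<in> ground M" and g: "g \<notin> ground M"
 shows "doubly_garding (parallel_extension f g M)"
proof -
 interpret matroid M using M by (simp add: doubly_garding_def)
 have fg: "f ~= g" using f g by auto
 have u: "gard {f, g} (uc 1)" by (rule gard_uniform) (use fg in auto)
 have int: "ground M \<inter> {f, g} = {f}" "{f, g} \<inter> ground M = {f}" using f g by auto
 have un: "ground M \<union> {f, g} = insert g (ground M)" "{f, g} \<union> ground M = insert g (ground M)" using f by auto
 have um: "uc 1 T <= uc 1 (insert f T)" if "T \<subseteq> {f, g}" for T
  using that finite_subset [OF that] by (auto simp: uc_def card_insert_if)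
 have uval: "uc 1 (T \<inter> {f, g}) = (if f \<in> T \<or> g \<in> T then 1 else 0)" for T
  by (cases "f \<in> T"; cases "g \<in> T") (auto simp: uc_def fg)
 have uval': "uc 1 (insert f X) = 1" if "X \<subseteq> {f, g}" for X
  using finite_subset [OF that] by (auto simp: uc_def card_insert_if Suc_le_eq card_gt_0_iff)
 have uval'': "uc (Suc 0) {g} = 1" "uc (Suc 0) ({} :: 'a set) = 0" by (simp_all add: uc_def)
 have S: "gard (insert g (ground M)) (S_coeff (parallel_extension f g M))"
 proof (rule gard_cong [THEN iffD1, OF _ gard_parallel [of "ground M" "S_coeff M" "{f,g}" "uc 1" f, unfolded un]])
  fix T assume T: "T \<subseteq> insert g (ground M)"
  have "T \<inter> ground M = T - {g}" using T g by auto
  moreover have "g \<in> T ==> f \<in> T ==> insert f (T - {g}) = T - {g}" "g \<notin> T ==> T - {g} = T" using fg by auto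
  ultimately show "par_coeff f (ground M) {f, g} (S_coeff M) (uc 1) T = S_coeff (parallel_extension f g M) T"
   using uval' [of "T \<inter> {f, g}"] uval'' by (cases "f \<in> T"; cases "g \<in> T") (simp_all add: par_coeff_def S_coeff_def spanning_parallel_extension [OF f g T] uval)
 qed (use M f int u um in \<open>auto simp: doubly_garding_def intro!: coeff_mono\<close>)
 have C: "gard (insert g (ground M)) (C_coeff (parallel_extension f g M))"
 proof (rule gard_cong [THEN iffD1, OF _ gard_series [of "{f,g}" "uc 1" "ground M" "C_coeff M" f, unfolded un]])
  fix T assume T: "T \<subseteq> insert g (ground M)"
  define X where "X = insert g (ground M) - T"
  have ind: "X \<in> indeps (parallel_extension f g M) \<longleftrightarrow>
    (g \<in> T & X \<in> indeps M) \<or> (g \<notin> T & f \<in> T & insert f (X - {g}) \<in> indeps M)"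
   using f by (auto simp: parallel_extension_def X_def)
  have e: "ground M - (T \<inter> ground M) = X - {g}" "ground M - ((T - {f}) \<inter> ground M) = insert f (X - {g})"
   "ground M - insert f ((T - {f}) \<inter> ground M) = X - {g} - {f}" "g \<in> T ==> X - {g} = X" "f \<in> T ==> X - {g} - {f} = X - {g}"
   using g f fg by (auto simp: X_def)
  have "insert f (X - {g}) \<in> indeps M ==> X - {g} \<in> indeps M" using indep_subset by blast
  note sub = this
  have v: "C_coeff M (T \<inter> ground M) = (if X - {g} \<in> indeps M then 1 else 0)"
   "C_coeff M ((T - {f}) \<inter> ground M) = (if insert f (X - {g}) \<in> indeps M then 1 else 0)"
   "f \<in> T ==> C_coeff M (insert f ((T - {f}) \<inter> ground M)) = (if X - {g} \<in> indeps M then 1 else 0)"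
   using f e by (simp_all add: C_coeff_def)
  have w: "C_coeff (parallel_extension f g M) T = (if X \<in> indeps (parallel_extension f g M) then 1 else 0)"
   using T by (simp add: C_coeff_def X_def)
  have u: "uc 1 ((T - {f}) \<inter> {f, g}) = (if g \<in> T then 1 else 0)" "uc 1 (insert f ((T - {f}) \<inter> {f, g})) = 1"
   using uval [of "T - {f}"] uval' [of "(T - {f}) \<inter> {f, g}"] fg by auto
  show "ser_coeff f {f, g} (ground M) (uc 1) (C_coeff M) T = C_coeff (parallel_extension f g M) T"
   unfolding ser_coeff_def par_coeff_def uval u w ind v(1,2)
   using sub e(4) v(3) fg fg [symmetric] by (cases "f \<in> T"; cases "g \<in> T") (simp_all split del: if_split)
 next
  have "{f, g} - {f} = {g}" using fg by auto
  then show "0 < uc 1 ({f, g} - {f})" by (simp add: uc_def)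
 qed (use M f int u um in \<open>auto simp: doubly_garding_def intro!: coeff_mono\<close>)
 show ?thesis using S C matroid_parallel_extension [OF f g] by (simp add: doubly_garding_def)
qed

lemma doubly_garding_series_extension:
 assumes M: "doubly_garding M" and f: "f \<in> ground M" and g: "g \<notin> ground M"
 shows "doubly_garding (series_extension f g M)"
 unfolding series_extension_def
 using assms by (intro doubly_garding_dual doubly_garding_parallel_extension) auto

lemma (in matroid) series_extension_indeps:
 assumes f: "f \<in> ground M" and g: "g \<notin> ground M"
 shows "I \<in> indeps (series_extension f g M) \<longleftrightarrow>
  I \<subseteq> insert g (ground M) & (if g \<in> I then I - {g} else I - {f}) \<in> indeps M"
proof -
 interpret d: matroid "dual M" by (rule matroid_dual)
 have "insert g (ground M) - I \<in> spanning_sets (parallel_extension f g (dual M)) \<longleftrightarrow>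
   (if g \<in> I then I - {g} else I - {f}) \<in> indeps M" if I: "I \<subseteq> insert g (ground M)"
 proof -
  have e: "g \<in> I ==> ground M - (ground M - I) = I - {g}" "ground M - (insert g (ground M) - I) = I - {g}" "g \<in> I ==> insert g (ground M) - I \<subseteq> ground M"
   "g \<notin> I ==> ground M - insert f (insert g (ground M) - I - {g}) = I - {f}"
   "insert f (insert g (ground M) - I - {g}) \<subseteq> ground M" using I f g by auto
  show ?thesis
   using d.spanning_parallel_extension [of f g "insert g (ground M) - I"] f g e by (simp add: spanning_dual)
 qed
 then show ?thesis by (auto simp: series_extension_def dual_def [of "parallel_extension f g (dual M)"])
qed

section \<open>Series-parallel networks\<close>

definition path :: "('a => 'v set) => 'v list => 'a list => bool" where
 "path \<phi> vs fs \<longleftrightarrow> length vs = Suc (length fs) & (\<forall>i<length fs. \<phi> (fs ! i) = {vs ! i, vs ! Suc i})"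

lemma path_cong: "(\<And>h. h \<in> set fs ==> \<phi> h = \<psi> h) ==> path \<phi> vs fs \<longleftrightarrow> path \<psi> vs fs"
 by (auto simp: path_def)

lemma path_snoc:
 "path \<phi> (vs @ [w]) (fs @ [f]) \<longleftrightarrow> path \<phi> vs fs & \<phi> f = {last vs, w}"
proof (cases "length vs = Suc (length fs)")
 case True
 then have "last vs = vs ! length fs" by (metis diff_Suc_1 last_conv_nth length_0_conv nat.distinct(1))
 then show ?thesis using True by (auto simp: path_def nth_append All_less_Suc)
qed (simp add: path_def)

lemma path_rev:
 assumes "path \<phi> vs fs" shows "path \<phi> (rev vs) (rev fs)"
 unfolding path_def
proof (intro conjI allI impI)
 show "length (rev vs) = Suc (length (rev fs))" using assms by (simp add: path_def)
 fix i assume i: "i < length (rev fs)"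
 define j where "j = length fs - Suc i"
 have j: "j < length fs" "Suc j = length fs - i" using i by (auto simp: j_def)
 then have "\<phi> (fs ! j) = {vs ! j, vs ! Suc j}" using assms by (simp add: path_def)
 moreover have "rev fs ! i = fs ! j" "rev vs ! i = vs ! Suc j" "rev vs ! Suc i = vs ! j"
  using i j assms by (auto simp: path_def rev_nth j_def)
 ultimately show "\<phi> (rev fs ! i) = {rev vs ! i, rev vs ! Suc i}" by (simp add: insert_commute)
qed

text \<open>
 A cycle cut open at the edge \<open>h\<close>, as a path joining the ends of \<open>h\<close>. Every edge of a cycle can play the role of
 \<open>h\<close>, so edges can be exchanged or subdivided at the end of the path.
\<close>

definition closed_by :: "('v, 'a) multigraph => 'a => 'v list => 'a list => bool" where
 "closed_by G h vs fs \<longleftrightarrow> path (ends G) vs fs & distinct vs & distinct fs & h \<notin> set fs & set vs \<subseteq> verts G \<and>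
   insert h (set fs) \<subseteq> edges G & ends G h = {last vs, hd vs}"

lemma closed_by_rev: "closed_by G h vs fs ==> closed_by G h (rev vs) (rev fs)"
 by (auto simp: closed_by_def path_rev last_rev hd_rev)

lemma is_cycle_closed_by:
 "is_cycle G C & h \<in> C \<longleftrightarrow> (\<exists>vs fs. closed_by G h vs fs & C = insert h (set fs))"
proof
 assume "is_cycle G C & h \<in> C"
 then obtain vs fs where c: "vs ~= []" "length fs = length vs" "distinct vs" "distinct fs"
   "set vs \<subseteq> verts G" "set fs \<subseteq> edges G" "set fs = C"
   "\<forall>i<length vs. ends G (fs ! i) = {vs ! i, vs ! ((i + 1) mod length vs)}" and h: "h \<in> C"
  by (auto simp: is_cycle_def)
 define n where "n = length vs"
 have n: "0 < n" using c by (simp add: n_def)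
 obtain i where i: "i < n" "fs ! i = h" using h c by (metis in_set_conv_nth n_def)
 define us where "us = rotate (Suc i) vs"
 define gs where "gs = rotate (Suc i) fs"
 have len: "length us = n" "length gs = n" using c by (simp_all add: us_def gs_def n_def)
 have nth: "us ! j = vs ! ((Suc i + j) mod n)" "gs ! j = fs ! ((Suc i + j) mod n)" if "j < n" for j
  using that c by (simp_all only: us_def gs_def n_def nth_rotate)
 have ends: "ends G (gs ! j) = {us ! j, us ! ((j + 1) mod n)}" if "j < n" for j
 proof -
  have "((Suc i + j) mod n + 1) mod n = (Suc i + (j + 1) mod n) mod n" by (metis add.assoc mod_add_left_eq mod_add_right_eq)
  then show ?thesis using c(8) that n nth [of j] nth [of "(j + 1) mod n"] by (simp add: n_def [symmetric])
 qed
 have ne: "us ~= []" "gs ~= []" using len n by auto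
 have lst: "last gs = h" using nth(2) [of "n - 1"] i n len ne by (simp add: last_conv_nth)
 have gs: "gs = butlast gs @ [h]" using lst ne by (metis append_butlast_last_id)
 have dist: "distinct (butlast gs @ [h])" using c gs by (metis distinct_rotate gs_def)
 have "set gs = C" using c by (simp add: gs_def)
 then have setC: "C = insert h (set (butlast gs))" using gs by (metis Un_insert_right list.simps(15) set_append sup_bot_right list.set(1))
 have "path (ends G) us (butlast gs)"
  unfolding path_def using ends len n by (auto simp: nth_butlast)
 moreover have "ends G h = {last us, hd us}"
  using ends [of "n - 1"] n lst len ne by (simp add: last_conv_nth hd_conv_nth)
 ultimately have "closed_by G h us (butlast gs)"
  using c setC dist by (auto simp: closed_by_def us_def)
 then show "\<exists>vs fs. closed_by G h vs fs & C = insert h (set fs)" using setC by blast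
next
 assume "\<exists>vs fs. closed_by G h vs fs & C = insert h (set fs)"
 then obtain vs fs where c: "closed_by G h vs fs" and C: "C = insert h (set fs)" by auto
 have len: "length vs = Suc (length fs)" using c by (simp add: closed_by_def path_def)
 then have ne: "vs ~= []" by auto
 have "ends G ((fs @ [h]) ! i) = {vs ! i, vs ! ((i + 1) mod length vs)}" if "i < length vs" for i
 proof (cases "i = length fs")
  case True
  then show ?thesis using c len ne by (simp add: closed_by_def last_conv_nth hd_conv_nth)
 next
  case False
  then show ?thesis using c that len by (simp add: closed_by_def path_def nth_append)
 qed
 then have "is_cycle G C" unfolding is_cycle_def using c C len ne
  by (intro exI [of _ vs] exI [of _ "fs @ [h]"]) (auto simp: closed_by_def)
 then show "is_cycle G C & h \<in> C" using C by auto
qed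

lemmas cycle_closed_by = is_cycle_closed_by [THEN iffD1, OF conjI]

lemma closed_by_is_cycle: "closed_by G h vs fs ==> is_cycle G (insert h (set fs))"
proof -
 assume "closed_by G h vs fs"
 then have "\<exists>vs' fs'. closed_by G h vs' fs' & insert h (set fs) = insert h (set fs')"
  by (intro exI [of _ vs] exI [of _ fs]) simp
 then show ?thesis using is_cycle_closed_by [of G "insert h (set fs)" h] by simp
qed

lemma is_cycle_nonempty: "is_cycle G C ==> C ~= {}" "is_cycle G C ==> C \<subseteq> edges G"
 by (auto simp: is_cycle_def)

text \<open>
 A cycle only sees its own edges.
\<close>

lemma is_cycle_transfer:
 assumes "is_cycle G C" "C \<subseteq> edges H" "\<And>h. h \<in> C ==> ends H h = ends G h" "\<And>h. h \<in> C ==> ends G h \<subseteq> verts H"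
 shows "is_cycle H C"
proof -
 obtain vs fs where c: "vs ~= []" "length fs = length vs" "distinct vs" "distinct fs"
   "set vs \<subseteq> verts G" "set fs \<subseteq> edges G" "set fs = C"
   "\<forall>i<length vs. ends G (fs ! i) = {vs ! i, vs ! ((i + 1) mod length vs)}"
  using assms(1) by (auto simp: is_cycle_def)
 have mem: "fs ! i \<in> C" if "i < length vs" for i using that c by (metis nth_mem)
 have "set vs \<subseteq> verts H"
 proof
  fix v assume "v \<in> set vs"
  then obtain i where i: "i < length vs" "v = vs ! i" by (auto simp: in_set_conv_nth)
  then have "v \<in> ends G (fs ! i)" using c by simp
  then show "v \<in> verts H" using assms(4) mem i by blast
 qed
 then show ?thesis unfolding is_cycle_def using c assms mem
  by (intro exI [of _ vs] exI [of _ fs]) auto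
qed

lemma cycle_matroid_indeps:
 "I \<in> indeps (cycle_matroid G) \<longleftrightarrow> I \<subseteq> edges G & \<not> (\<exists>C. is_cycle G C & C \<subseteq> I)"
 by (auto simp: cycle_matroid_def of_circuits_def)

lemma ground_cycle_matroid [simp]: "ground (cycle_matroid G) = edges G"
 by (simp add: cycle_matroid_def of_circuits_def)

definition proper_ends :: "('v, 'a) multigraph => bool" where
 "proper_ends G \<longleftrightarrow> (\<forall>h\<in>edges G. \<exists>u\<in>verts G. \<exists>v\<in>verts G. ends G h = {u, v})"

lemma proper_ends_subset: "proper_ends G ==> h \<in> edges G ==> ends G h \<subseteq> verts G"
 by (force simp: proper_ends_def)

lemma set_system_eqI: "ground M = ground N ==> (\<And>I. I \<in> indeps M \<longleftrightarrow> I \<in> indeps N) ==> M = N"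
 for M N :: "'a set_system"
 by (cases M; cases N) auto

context
 fixes G H :: "('v, 'a) multigraph" and f g :: 'a
 assumes wf: "proper_ends G" and f: "f \<in> edges G" and g: "g \<notin> edges G"
begin

lemma cycle_matroid_add_parallel:
 assumes H: "H = \<lparr>verts = verts G, edges = insert g (edges G), ends = (ends G)(g := ends G f)\<rparr>"
 shows "cycle_matroid H = parallel_extension f g (cycle_matroid G)"
proof (rule set_system_eqI)
 have fg: "f ~= g" using f g by auto
 have HG: "is_cycle G C" if "is_cycle H C" "g \<notin> C" for C
  using that(1) by (rule is_cycle_transfer) (use that(2) is_cycle_nonempty(2) [OF that(1)] proper_ends_subset [OF wf] in \<open>auto simp: H\<close>)
 have GH: "is_cycle H C" if "is_cycle G C" for C
  using that by (rule is_cycle_transfer) (use g is_cycle_nonempty(2) [OF that] proper_ends_subset [OF wf] in \<open>auto simp: H\<close>)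
 have swap: "is_cycle H (insert g (C - {f}))" if C: "is_cycle G C" "f \<in> C" for C
 proof -
  obtain vs fs where c: "closed_by G f vs fs" "C = insert f (set fs)" using cycle_closed_by [OF C] by blast
  have "path (ends H) vs fs \<longleftrightarrow> path (ends G) vs fs" by (rule path_cong) (use c g in \<open>auto simp: H closed_by_def\<close>)
  then have "closed_by H g vs fs" using c g by (auto simp: closed_by_def H)
  moreover have "insert g (C - {f}) = insert g (set fs)" using c by (auto simp: closed_by_def)
  ultimately show ?thesis using closed_by_is_cycle by metis
 qed
 have swap': "is_cycle G (insert f (C - {g}))" if C: "is_cycle H C" "g \<in> C" and "f \<notin> C" for C
 proof -
  obtain vs fs where c: "closed_by H g vs fs" "C = insert g (set fs)" using cycle_closed_by [OF C] by blast
  have "path (ends H) vs fs \<longleftrightarrow> path (ends G) vs fs" by (rule path_cong) (use c in \<open>auto simp: H closed_by_def\<close>)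
  then have "closed_by G f vs fs" using c f that by (auto simp: closed_by_def H)
  moreover have "insert f (C - {g}) = insert f (set fs)" using c by (auto simp: closed_by_def)
  ultimately show ?thesis using closed_by_is_cycle by metis
 qed
 have pair: "\<exists>C. is_cycle H C & C \<subseteq> {f, g}"
 proof -
  obtain u v where uv: "u \<in> verts G" "v \<in> verts G" "ends G f = {u, v}" using wf f by (auto simp: proper_ends_def)
  show ?thesis
  proof (cases "u = v")
   case True
   then have "closed_by H f [u] []" using uv f fg by (auto simp: closed_by_def path_def H)
   then show ?thesis using closed_by_is_cycle by fastforce
  next
   case False
   then have "closed_by H g [u, v] [f]" using uv f fg by (auto simp: closed_by_def path_def H)
   then show ?thesis using closed_by_is_cycle by fastforce
  qed
 qed
 fix I
 have "(\<exists>C. is_cycle H C & C \<subseteq> I) \<longleftrightarrow> (\<exists>C. is_cycle G C & C \<subseteq> insert f (I - {g}))" if I: "g \<in> I" "f \<notin> I"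
 proof
  assume "\<exists>C. is_cycle H C & C \<subseteq> I"
  then obtain C where C: "is_cycle H C" "C \<subseteq> I" by auto
  show "\<exists>C. is_cycle G C & C \<subseteq> insert f (I - {g})"
  proof (cases "g \<in> C")
   case True
   moreover have "insert f (C - {g}) \<subseteq> insert f (I - {g})" using C by auto
   ultimately show ?thesis using swap' [OF C(1)] C I by blast
  qed (use C HG in blast)
 next
  assume "\<exists>C. is_cycle G C & C \<subseteq> insert f (I - {g})"
  then obtain C where C: "is_cycle G C" "C \<subseteq> insert f (I - {g})" by auto
  show "\<exists>C. is_cycle H C & C \<subseteq> I"
  proof (cases "f \<in> C")
   case True
   moreover have "insert g (C - {f}) \<subseteq> I" using C I by auto
   ultimately show ?thesis using swap [OF C(1)] by blast
  qed (use C GH in blast)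
 qed
 moreover have "(\<exists>C. is_cycle H C & C \<subseteq> I) \<longleftrightarrow> (\<exists>C. is_cycle G C & C \<subseteq> I)" if "g \<notin> I"
  using HG GH that by blast
 ultimately show "I \<in> indeps (cycle_matroid H) \<longleftrightarrow> I \<in> indeps (parallel_extension f g (cycle_matroid G))"
  using pair f g by (cases "g \<in> I"; cases "f \<in> I") (auto simp: cycle_matroid_indeps parallel_extension_def H [THEN arg_cong, of edges])
qed (simp add: H)

text \<open>
 A cycle through one half of the subdivided edge meets the new vertex, where the other half is the only
 way on; contracting it gives a cycle of the original graph.
\<close>

lemma cycle_matroid_subdivide:
 assumes H: "H = \<lparr>verts = insert w (verts G), edges = insert g (edges G), ends = (ends G)(f := {u, w}, g := {w, v})\<rparr>"
  and uv: "ends G f = {u, v}" and w: "w \<notin> verts G" and M: "matroid (cycle_matroid G)"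
 shows "cycle_matroid H = series_extension f g (cycle_matroid G)"
proof (rule set_system_eqI)
 have fg: "f ~= g" using f g by auto
 have uvw: "u ~= w" "v ~= w" "u \<in> verts G" "v \<in> verts G" using w uv proper_ends_subset [OF wf f] by auto
 have GH: "is_cycle H C" if "is_cycle G C" "f \<notin> C" for C
  using that(1) by (rule is_cycle_transfer) (use that(2) g is_cycle_nonempty(2) [OF that(1)] proper_ends_subset [OF wf] in \<open>auto simp: H\<close>)
 have HG: "is_cycle G C" if "is_cycle H C" "f \<notin> C" "g \<notin> C" for C
  using that(1) by (rule is_cycle_transfer) (use that is_cycle_nonempty(2) [OF that(1)] proper_ends_subset [OF wf] in \<open>auto simp: H\<close>)
 have grow: "is_cycle H (insert g C)" if C: "is_cycle G C" "f \<in> C" for C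
 proof -
  obtain vs fs where c: "closed_by G f vs fs" "C = insert f (set fs)" using cycle_closed_by [OF C] by blast
  obtain vs fs where c: "closed_by G f vs fs" "C = insert f (set fs)" "last vs = u" "hd vs = v"
  proof (cases "last vs = u & hd vs = v")
   case False
   then have "last vs = v" "hd vs = u" using c(1) uv by (auto simp: closed_by_def doubleton_eq_iff)
   then show ?thesis using that [OF closed_by_rev [OF c(1)]] c by (simp add: last_rev hd_rev)
  qed (use c that in blast)
  have ne: "vs ~= []" using c by (auto simp: closed_by_def path_def)
  have "path (ends H) vs fs \<longleftrightarrow> path (ends G) vs fs" by (rule path_cong) (use c g in \<open>auto simp: H closed_by_def\<close>)
  then have "closed_by H g (vs @ [w]) (fs @ [f])"
   using c g f fg w ne by (auto simp: closed_by_def path_snoc H)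
  moreover have "insert g C = insert g (set (fs @ [f]))" using c by auto
  ultimately show ?thesis using closed_by_is_cycle by metis
 qed
 have shrink: "k \<in> C & is_cycle G (insert f (C - {h, k}))"
  if C: "is_cycle H C" "h \<in> C" and hk: "{h, k} = {f, g}" "ends H h = {w, p}" "ends H k = {w, q}" "ends G f = {q, p}"
  for C h k p q
 proof -
  obtain vs fs where c: "closed_by H h vs fs" "C = insert h (set fs)" using cycle_closed_by [OF C] by blast
  obtain vs fs where c: "closed_by H h vs fs" "C = insert h (set fs)" "last vs = w" "hd vs = p"
  proof (cases "last vs = w & hd vs = p")
   case False
   then have "last vs = p" "hd vs = w" using c(1) hk by (auto simp: closed_by_def doubleton_eq_iff)
   then show ?thesis using that [OF closed_by_rev [OF c(1)]] c by (simp add: last_rev hd_rev)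
  qed (use c that in blast)
  have pq: "p ~= w" "q ~= w" using hk(4) uv uvw by (metis doubleton_eq_iff)+
  have pth: "path (ends H) vs fs" "distinct fs" "h \<notin> set fs" "set fs \<subseteq> edges H" "set vs \<subseteq> verts H" "distinct vs"
   using c by (auto simp: closed_by_def)
  have "fs ~= []"
  proof
   assume "fs = []"
   then obtain x where "vs = [x]" using pth(1) by (auto simp: path_def length_Suc_conv)
   then show False using c pq by simp
  qed
  then obtain fs' j where fs: "fs = fs' @ [j]" by (metis append_butlast_last_id)
  have "vs ~= []" using pth(1) by (auto simp: path_def)
  then obtain vs' where vs: "vs = vs' @ [w]" using c(3) by (metis append_butlast_last_id)
  have p': "path (ends H) vs' fs'" "ends H j = {last vs', w}" using pth(1) unfolding fs vs path_snoc by auto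
  have "j = k"
  proof (rule ccontr)
   assume "j ~= k"
   then have "j ~= f" "j ~= g" using pth(3) hk(1) fs by (auto simp: doubleton_eq_iff)
   then have "ends H j \<subseteq> verts G" using pth(4) proper_ends_subset [OF wf] fs by (auto simp: H)
   then show False using p'(2) w by auto
  qed
  then have q: "q = last vs'" using p'(2) hk(3) pq by (auto simp: doubleton_eq_iff)
  have ne: "vs' ~= []" using p' by (auto simp: path_def)
  have no: "f \<notin> set fs'" "g \<notin> set fs'" using pth hk(1) \<open>j = k\<close> by (auto simp: fs doubleton_eq_iff)
  have "path (ends H) vs' fs' \<longleftrightarrow> path (ends G) vs' fs'" by (rule path_cong) (use no in \<open>auto simp: H\<close>)
  then have "closed_by G f vs' fs'"
   using p' pth no f hk(4) q c(4) ne by (auto simp: closed_by_def fs vs H)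
  moreover have "insert f (C - {h, k}) = insert f (set fs')" using c pth(2,3) \<open>j = k\<close> by (auto simp: fs)
  moreover have "k \<in> C" using c(2) \<open>j = k\<close> by (auto simp: fs)
  ultimately show ?thesis using closed_by_is_cycle by metis
 qed
 have both: "f \<in> C & g \<in> C & is_cycle G (C - {g})" if C: "is_cycle H C" "f \<in> C \<or> g \<in> C" for C
 proof -
  have "f \<in> C & g \<in> C & is_cycle G (insert f (C - {f, g}))"
  proof (cases "g \<in> C")
   case True
   then show ?thesis using shrink [OF C(1) True, of f v u] uv fg by (auto simp: H insert_commute)
  next
   case False
   then show ?thesis using shrink [OF C(1), of f g u v] C uv fg by (auto simp: H insert_commute)
  qed
  moreover have "insert f (C - {f, g}) = C - {g}" if "f \<in> C" using that fg by auto
  ultimately show ?thesis by simp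
 qed
 fix I
 have "(\<exists>C. is_cycle H C & C \<subseteq> I) \<longleftrightarrow> (\<exists>C. is_cycle G C & C \<subseteq> I - {g})" if "g \<in> I"
 proof
  assume "\<exists>C. is_cycle H C & C \<subseteq> I"
  then obtain C where C: "is_cycle H C" "C \<subseteq> I" by auto
  then show "\<exists>C. is_cycle G C & C \<subseteq> I - {g}" using both [OF C(1)] HG [OF C(1)] by blast
 next
  assume "\<exists>C. is_cycle G C & C \<subseteq> I - {g}"
  then obtain C where C: "is_cycle G C" "C \<subseteq> I - {g}" by auto
  then show "\<exists>C. is_cycle H C & C \<subseteq> I" using grow [OF C(1)] GH [OF C(1)] \<open>g \<in> I\<close> by blast
 qed
 moreover have "(\<exists>C. is_cycle H C & C \<subseteq> I) \<longleftrightarrow> (\<exists>C. is_cycle G C & C \<subseteq> I - {f})" if "g \<notin> I"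
  using both HG GH that by blast
 moreover have "edges H = insert g (edges G)" by (simp add: H)
 ultimately show "I \<in> indeps (cycle_matroid H) \<longleftrightarrow> I \<in> indeps (series_extension f g (cycle_matroid G))"
  using f g by (cases "g \<in> I") (auto simp: cycle_matroid_indeps matroid.series_extension_indeps [OF M])
qed (simp add: H)

end

lemma doubly_garding_single_edge:
 assumes G: "G = \<lparr>verts = V, edges = {f}, ends = \<phi>\<rparr>" "\<phi> f = {u, v}" "V = {u, v}"
 shows "doubly_garding (cycle_matroid G)"
proof -
 have cyc: "is_cycle G C \<longleftrightarrow> C = {f} & u = v" for C
 proof
  assume C: "is_cycle G C"
  then have "C = {f}" using is_cycle_nonempty [OF C] by (auto simp: G)
  then obtain vs fs where c: "closed_by G f vs fs" using cycle_closed_by [OF C] by blast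
  then have "set fs \<subseteq> {f}" "f \<notin> set fs" by (auto simp: closed_by_def G)
  then have "fs = []" by (cases fs) auto
  moreover have "path (ends G) vs fs" using c by (simp add: closed_by_def)
  ultimately obtain x where "vs = [x]" by (auto simp: path_def length_Suc_conv)
  then have "u = v" using c G by (auto simp: closed_by_def)
  then show "C = {f} & u = v" using \<open>C = {f}\<close> by simp
 next
  assume C: "C = {f} & u = v"
  then have "closed_by G f [u] []" using G by (auto simp: closed_by_def path_def)
  then show "is_cycle G C" using closed_by_is_cycle C by fastforce
 qed
 have eG: "edges G = {f}" by (simp add: G)
 define r :: nat where "r = (if u = v then 0 else 1)"
 have ind: "I \<in> indeps (cycle_matroid G) \<longleftrightarrow> I \<subseteq> ground (cycle_matroid G) & card I <= r" for I
  by (cases "I = {f}") (auto simp: cycle_matroid_indeps cyc r_def eG subset_singleton_iff)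
 have "matroid (cycle_matroid G)"
 proof
  fix I J assume "I \<in> indeps (cycle_matroid G)" "J \<in> indeps (cycle_matroid G)" and c: "card I < card J"
  then have "I \<subseteq> {f}" "J \<subseteq> {f}" by (simp_all add: ind eG)
  then have "I = {}" "J = {f}" using c by (auto simp: subset_singleton_iff)
  then show "\<exists>x\<in>J - I. insert x I \<in> indeps (cycle_matroid G)" using \<open>J \<in> _\<close> by auto
 qed (auto simp: cycle_matroid_indeps eG cyc)
 then show ?thesis by (rule doubly_garding_uniform [OF _ _ ind]) (simp add: r_def G)
qed

theorem doubly_garding_series_parallel:
 "series_parallel_network G ==> proper_ends G & doubly_garding (cycle_matroid G)"
proof (induction rule: series_parallel_network.induct)
 case (single_loop \<phi> f u)
 then show ?case using doubly_garding_single_edge [OF refl, of \<phi> f u u "{u}"] by (simp add: proper_ends_def)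
next
 case (K\<^sub>2 u v \<phi> f)
 then show ?case using doubly_garding_single_edge [OF refl, of \<phi> f u v "{u,v}"] by (auto simp: proper_ends_def)
next
 case (add_parallel G f g)
 then show ?case
  using cycle_matroid_add_parallel [OF _ _ _ refl, of G f g] doubly_garding_parallel_extension [of "cycle_matroid G" f g]
  by (auto simp: proper_ends_def)
next
 case (subdivide G f g u v w)
 let ?H = "\<lparr>verts = insert w (verts G), edges = insert g (edges G), ends = (ends G)(f := {u, w}, g := {w, v})\<rparr>"
 from subdivide have uv: "matroid (cycle_matroid G)" "u \<in> verts G" "v \<in> verts G"
  using proper_ends_subset [of G f] by (auto simp: doubly_garding_def)
 have "proper_ends ?H"
  unfolding proper_ends_def
 proof
  fix h assume "h \<in> edges ?H"
  then consider "h = f" "h ~= g" | "h = g" | "h \<in> edges G" "h ~= f" "h ~= g" by auto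
  then show "\<exists>u\<in>verts ?H. \<exists>v\<in>verts ?H. ends ?H h = {u, v}"
  proof cases
   case 3
   then obtain a b where "a \<in> verts G" "b \<in> verts G" "ends G h = {a, b}"
    using subdivide.IH by (auto simp: proper_ends_def)
   then show ?thesis using 3 by (intro bexI [of _ a] bexI [of _ b]) auto
  qed (use uv in auto)
 qed
 moreover have "doubly_garding (cycle_matroid ?H)"
  using subdivide uv(1) cycle_matroid_subdivide [OF _ _ _ refl, of G f g u v w] doubly_garding_series_extension [of "cycle_matroid G" f g] by auto
 ultimately show ?case by blast
qed

section \<open>Few non-bases\<close>

definition sparse_nonbases :: "'a set_system => nat => 'a set set => bool" where
 "sparse_nonbases M r \<H> \<longleftrightarrow> 1 <= r & bases M = {B. B \<subseteq> ground M & card B = r} - \<H> \<and>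
   (\<forall>H\<in>\<H>. H \<subseteq> ground M & card H = r) & (\<forall>H\<in>\<H>. \<forall>H'\<in>\<H>. H ~= H' --> card (H \<inter> H') + 1 < r)"

text \<open>
 A set of more than \<open>r\<close> elements contains two \<open>r\<close>-subsets that differ by one exchange, and these
 cannot both be non-bases.
\<close>

lemma (in matroid) S_coeff_sparse:
 assumes sp: "sparse_nonbases M r \<H>" and T: "T \<subseteq> ground M"
 shows "S_coeff M T = minus_coeff r \<H> T"
proof -
 have r: "1 <= r" and b: "\<And>B. B \<in> bases M \<longleftrightarrow> B \<subseteq> ground M & card B = r & B \<notin> \<H>"
  and H: "\<And>H. H \<in> \<H> ==> card H = r" and HH: "\<And>H H'. H \<in> \<H> ==> H' \<in> \<H> ==> H ~= H' ==> card (H \<inter> H') + 1 < r"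
  using sp by (auto simp: sparse_nonbases_def)
 have finT: "finite T" using T finite_ground finite_subset by blast
 have "T \<in> spanning_sets M \<longleftrightarrow> r <= card T & T \<notin> \<H>"
 proof
  assume "T \<in> spanning_sets M"
  then obtain B where B: "B \<subseteq> T" "card B = r" "B \<notin> \<H>" by (auto simp: spanning_sets_def b)
  have "r <= card T" using B finT card_mono by metis
  moreover have "T \<notin> \<H>" using B finT H card_subset_eq by metis
  ultimately show "r <= card T & T \<notin> \<H>" by simp
 next
  assume a: "r <= card T & T \<notin> \<H>"
  then obtain B where B: "B \<subseteq> T" "card B = r" by (meson obtain_subset_with_card_n)
  have "\<exists>B'\<subseteq>T. card B' = r & B' \<notin> \<H>"
  proof (cases "B \<in> \<H>")
   case True
   then have "B ~= T" using a by auto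
   then obtain y where y: "y \<in> T" "y \<notin> B" using B by auto
   have finB: "finite B" using B finT finite_subset by blast
   obtain x where x: "x \<in> B" using B r by fastforce
   define B' where "B' = insert y (B - {x})"
   have c: "card (B - {x}) = r - 1" using x B finB by simp
   have "card B' = r" using c y finB r by (simp add: B'_def)
   moreover have "B' \<notin> \<H>"
   proof
    assume "B' \<in> \<H>"
    moreover have "B' ~= B" using y by (auto simp: B'_def)
    ultimately have "card (B' \<inter> B) + 1 < r" using HH True by blast
    moreover have "B' \<inter> B = B - {x}" using y by (auto simp: B'_def)
    ultimately show False using c by simp
   qed
   moreover have "B' \<subseteq> T" using B y by (auto simp: B'_def)
   ultimately show ?thesis by blast
  qed (use B in blast)
  then show "T \<in> spanning_sets M" using T by (auto simp: spanning_sets_def b)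
 qed
 then show ?thesis by (auto simp: S_coeff_def minus_coeff_def uc_def)
qed

lemma doubly_garding_uniform_matroid:
 assumes "uniform_matroid M" shows "doubly_garding M"
proof -
 interpret matroid M using assms by (simp add: uniform_matroid_def)
 obtain r where r: "r <= card (ground M)" "bases M = {B. B \<subseteq> ground M & card B = r}"
  using assms by (auto simp: uniform_matroid_def)
 have "I \<in> indeps M \<longleftrightarrow> I \<subseteq> ground M & card I <= r" for I
 proof
  assume "I \<in> indeps M"
  then obtain B where "B \<in> bases M" "I \<subseteq> B" using ex_basis_containing by blast
  then show "I \<subseteq> ground M & card I <= r" using r finite_ground by (auto intro: card_mono finite_subset)
 next
  assume I: "I \<subseteq> ground M & card I <= r"
  then obtain B where "I \<subseteq> B" "B \<subseteq> ground M" "card B = r"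
   using r(1) finite_ground by (metis exists_subset_between)
  then show "I \<in> indeps M" using r(2) indep_subset [of B I] by (auto simp: bases_def)
 qed
 then show ?thesis using r by (intro doubly_garding_uniform) (unfold_locales, auto)
qed

lemma uniform_minus_basis_dual:
 assumes "uniform_minus_basis M" shows "uniform_minus_basis (dual M)"
proof -
 interpret matroid M using assms by (simp add: uniform_minus_basis_def)
 obtain r A where A: "1 <= r" "r <= card (ground M) - 1" "A \<subseteq> ground M" "card A = r"
  "bases M = {B. B \<subseteq> ground M & card B = r} - {A}" using assms by (auto simp: uniform_minus_basis_def)
 have card: "card (ground M - B) = card (ground M) - card B" "card B <= card (ground M)" if "B \<subseteq> ground M" for B
  using that finite_ground by (auto intro: card_Diff_subset card_mono finite_subset)
 have "B \<in> bases (dual M) \<longleftrightarrow> B \<in> {B. B \<subseteq> ground M & card B = card (ground M) - r} - {ground M - A}" for B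
 proof (cases "B \<subseteq> ground M")
  case True
  then have "card (ground M - B) = r \<longleftrightarrow> card B = card (ground M) - r" using card [OF True] A by auto
  moreover have "ground M - B = A \<longleftrightarrow> B = ground M - A" using True A by auto
  ultimately show ?thesis using True by (auto simp: bases_dual A(5))
 qed (auto simp: bases_dual)
 then have "bases (dual M) = {B. B \<subseteq> ground M & card B = card (ground M) - r} - {ground M - A}" by blast
 moreover have "1 <= card (ground M) - r" "card (ground M) - r <= card (ground M) - 1" using A by auto
 ultimately show ?thesis using matroid_dual A card(1) [OF A(3)] unfolding uniform_minus_basis_def
  by (intro conjI exI [of _ "card (ground M) - r"] exI [of _ "ground M - A"]) auto
qed

lemma doubly_garding_uniform_minus_basis:
 assumes "uniform_minus_basis M" shows "doubly_garding M"
proof -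
 have S: "gard (ground N) (S_coeff N)" if N: "uniform_minus_basis N" for N :: "'a set_system"
 proof -
  interpret N: matroid N using N by (simp add: uniform_minus_basis_def)
  obtain r A where A: "1 <= r" "r <= card (ground N) - 1" "A \<subseteq> ground N" "card A = r"
   "bases N = {B. B \<subseteq> ground N & card B = r} - {A}" using N by (auto simp: uniform_minus_basis_def)
  then have "sparse_nonbases N r {A}" by (simp add: sparse_nonbases_def)
  then have eq: "T \<subseteq> ground N ==> (if T = A then 0 else uc r T) = S_coeff N T" for T
   using N.S_coeff_sparse [of r "{A}" T] by (simp add: minus_coeff_def)
  have "gard (ground N) (\<lambda>T. if T = A then 0 else uc r T)"
   by (rule gard_uniform_minus) (use A N.finite_ground in auto)
  then show ?thesis by (rule gard_cong [THEN iffD1, rotated]) (rule eq)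
 qed
 interpret matroid M using assms by (simp add: uniform_minus_basis_def)
 show ?thesis using S [OF assms] S [OF uniform_minus_basis_dual [OF assms]]
  by (simp add: doubly_garding_def S_coeff_dual matroid_axioms)
qed

section \<open>Matroids with at most six elements\<close>

lemma card_Int_1D: "card (A \<inter> B) = 1 ==> c \<in> A ==> c \<in> B ==> A \<inter> B = {c}"
 by (metis IntI card_1_singletonE singletonD)

lemma three_or_four: "A \<subseteq> {p, q, r, s} ==> p \<in> A ==> q \<in> A ==> r \<in> A ==> A = {p, q, r} \<or> A = {p, q, r, s}"
 by auto

text \<open>
 Classification of the families of triples of a six-element set that meet pairwise in at most one point:
 empty, one triple, two disjoint ones, or two, three or four triples of the graph \<open>K4\<close>.
\<close>

lemma gard_rank_three_six:
 fixes E :: "'a set"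
 assumes E: "finite E" "card E = 6" and H: "\<And>H. H \<in> \<H> ==> H \<subseteq> E & card H = 3"
  and HH: "\<And>H H'. H \<in> \<H> ==> H' \<in> \<H> ==> H ~= H' ==> card (H \<inter> H') <= 1"
  and lk: "\<And>e. e \<in> E ==> gard (E - {e}) (link (minus_coeff 3 \<H>) {e})"
 shows "gard E (minus_coeff 3 \<H>)"
proof -
 have fin: "finite H" if "H \<in> \<H>" for H using H [OF that] E finite_subset by blast
 consider "\<H> = {}" | H where "\<H> = {H}" | H K where "H \<in> \<H>" "K \<in> \<H>" "H ~= K" "H \<inter> K = {}"
  | H K where "H \<in> \<H>" "K \<in> \<H>" "H ~= K" "\<And>A B. A \<in> \<H> ==> B \<in> \<H> ==> A ~= B ==> A \<inter> B ~= {}"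
 proof -
  have "(\<exists>H K. H \<in> \<H> & K \<in> \<H> & H ~= K) \<or> \<H> = {} \<or> (\<exists>H. \<H> = {H})" by blast
  moreover have "(\<forall>A B. A \<in> \<H> --> B \<in> \<H> --> A ~= B --> A \<inter> B ~= {}) \<or>
   (\<exists>H K. H \<in> \<H> & K \<in> \<H> & H ~= K & H \<inter> K = {})" by meson
  ultimately show ?thesis using that by metis
 qed
 then show ?thesis
 proof cases
  case 1
  have "minus_coeff 3 \<H> = uc 3" by (rule ext) (simp add: minus_coeff_def 1)
  then show ?thesis using gard_uniform [OF E(1), of 3] E by simp
 next
  case 2
  have "minus_coeff 3 \<H> = (\<lambda>T. if T = H then 0 else uc 3 T)" by (rule ext) (simp add: minus_coeff_def 2)
  then show ?thesis using gard_uniform_minus [OF E(1), of H 3] H 2 E by simp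
 next
  case 3
  have c3: "card H = 3" "card K = 3" "H \<subseteq> E" "K \<subseteq> E" using H 3 by auto
  have "card (H \<union> K) = 6" using c3 3 fin by (simp add: card_Un_disjoint)
  then have EHK: "H \<union> K = E" using c3 E by (intro card_subset_eq) auto
  have "L = H \<or> L = K" if L: "L \<in> \<H>" for L
  proof (rule ccontr)
   assume "\<not> (L = H \<or> L = K)"
   then have "card (L \<inter> H) <= 1" "card (L \<inter> K) <= 1" using HH L 3 by auto
   moreover have "card L <= card (L \<inter> H) + card (L \<inter> K)"
    using card_Un_le [of "L \<inter> H" "L \<inter> K"] H [OF L] EHK by (metis Int_Un_distrib inf.absorb1)
   ultimately show False using H [OF L] by simp
  qed
  then have eq: "\<H> = {H, K}" using 3 by auto
  obtain c a b where h: "H = {c, a, b}" "c ~= a" "a ~= b" "b ~= c" using c3 by (auto simp: card_3_iff)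
  obtain d f g where k: "K = {d, f, g}" "d ~= f" "f ~= g" "g ~= d" using c3 by (auto simp: card_3_iff)
  have "distinct [a,b,c,d,f,g]" using h k 3(4) by auto
  moreover have E': "E = {a,b,c,d,f,g}" using EHK h k by auto
  moreover have "\<H> = {{c,a,b},{d,f,g}}" using eq h k by simp
  ultimately show ?thesis by (rule gard_two_disjoint_lines [OF _ _ _ lk lk]) (simp_all add: E')
 next
  case 4
  have c1: "card (A \<inter> B) = 1" if "A \<in> \<H>" "B \<in> \<H>" "A ~= B" for A B
  proof -
   have "card (A \<inter> B) ~= 0" using fin [OF that(1)] 4(4) [OF that] by simp
   then show ?thesis using HH [OF that] by linarith
  qed
  obtain c where c: "H \<inter> K = {c}" using c1 [OF 4(1-3)] by (auto simp: card_1_singleton_iff)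
  have "card (H - {c}) = 2" "card (K - {c}) = 2" using H [OF 4(1)] H [OF 4(2)] c by (auto simp: card_Diff_singleton_if)
  then obtain a b d f where ab: "H - {c} = {a, b}" "a ~= b" "K - {c} = {d, f}" "d ~= f" by (metis card_2_iff)
  have hk: "H = {c, a, b}" "K = {c, d, f}" using ab c by blast+
  have "{c, a, b} \<inter> {c, d, f} = {c}" "c \<notin> {a, b}" "c \<notin> {d, f}" using c ab hk by blast+
  then have dist5: "distinct [a,b,c,d,f]" using ab by auto
  have "card (E - {a,b,c,d,f}) = 1"
   using E H [OF 4(1)] H [OF 4(2)] dist5 unfolding hk by (subst card_Diff_subset) auto
  then obtain g where g: "E - {a,b,c,d,f} = {g}" by (auto simp: card_1_singleton_iff)
  have Eg: "E = {a,b,c,d,f,g}" "g \<notin> {a,b,c,d,f}" using g H [OF 4(1)] H [OF 4(2)] hk by blast+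
  have third: "\<exists>x\<in>{a,b}. \<exists>y\<in>{d,f}. L = {x,y,g}" if L: "L \<in> \<H>" "L ~= H" "L ~= K" for L
  proof -
   have LE: "L \<subseteq> {a,b,c,d,f,g}" "card L = 3" using H [OF L(1)] Eg by auto
   have cL: "c \<notin> L"
   proof
    assume "c \<in> L"
    then have "L \<inter> H = {c}" "L \<inter> K = {c}" using card_Int_1D c1 L 4 hk by (metis insertI1)+
    then have "L \<subseteq> {c, g}" using LE hk by blast
    then have "card L <= card {c, g}" by (intro card_mono) auto
    then show False using LE by (simp add: card_insert_if split: if_splits)
   qed
   obtain x where x: "L \<inter> H = {x}" using c1 L 4 by (metis card_1_singleton_iff One_nat_def)
   obtain y where y: "L \<inter> K = {y}" using c1 L 4 by (metis card_1_singleton_iff One_nat_def)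
   have "L \<subseteq> {x, y, g}" using LE x y cL hk by blast
   moreover have "card {x, y, g} <= 3" by (simp add: card_insert_if)
   ultimately have "L = {x, y, g}" using LE by (intro card_seteq) auto
   moreover have "x \<in> L" "x \<in> H" "y \<in> L" "y \<in> K" using x y by blast+
   then have "x \<in> {a, b}" "y \<in> {d, f}" using cL hk by auto
   ultimately show ?thesis by blast
  qed
  show ?thesis
  proof (cases "\<exists>L\<in>\<H>. L ~= H & L ~= K")
   case False
   then have "\<H> = {{c,a,b},{c,d,f}}" using 4 hk by auto
   moreover have "distinct [a,b,c,d,f,g]" using dist5 Eg by auto
   ultimately show ?thesis by (intro gard_two_meeting_lines [OF _ Eg(1) _ lk lk]) (simp_all add: Eg(1))
  next
   case True
   then obtain L where L: "L \<in> \<H>" "L ~= H" "L ~= K" by auto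
   then obtain x y where xy: "x \<in> {a,b}" "y \<in> {d,f}" "L = {x,y,g}" using third by blast
   obtain x' where x': "{a,b} = {x,x'}" using xy by blast
   obtain y' where y': "{d,f} = {y,y'}" using xy by blast
   have hk': "H = {c,x,x'}" "K = {c,y,y'}" "E = {x,x',c,y,y',g}" using hk x' y' Eg by auto
   have dist: "distinct [x,x',c,y,y',g]" using dist5 Eg x' y' by (auto simp: doubleton_eq_iff)
   have "N = {x',y',g}" if N: "N \<in> \<H>" "N ~= H" "N ~= K" "N ~= L" for N
   proof -
    obtain p q where pq: "p \<in> {x,x'}" "q \<in> {y,y'}" "N = {p,q,g}" using third [OF N(1-3)] x' y' by auto
    have "N \<inter> L = {g}" using card_Int_1D [OF c1 [OF N(1) L(1) N(4)]] pq xy by blast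
    then have "x \<notin> N" "y \<notin> N" using xy dist by auto
    then show ?thesis using pq by blast
   qed
   then have "\<H> \<subseteq> {H, K, L, {x',y',g}}" by auto
   then have "\<H> = {H, K, L} \<or> \<H> = {H, K, L, {x',y',g}}" using 4(1,2) L(1) by (rule three_or_four)
   then show ?thesis
   proof
    assume "\<H> = {H, K, L}"
    then have "\<H> = {{c,x,x'},{c,y,y'},{x,y,g}}" using hk' xy by simp
    then show ?thesis by (rule gard_whirl [OF dist hk'(3) _ lk lk]) (simp_all add: hk'(3))
   next
    assume "\<H> = {H, K, L, {x',y',g}}"
    then have "\<H> = {{c,x,x'},{c,y,y'},{x,y,g},{x',y',g}}" using hk' xy by simp
    then show ?thesis by (rule gard_K4 [OF dist hk'(3) _ lk lk]) (simp_all add: hk'(3))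
   qed
  qed
 qed
qed

context matroid
begin

lemma split_loop_coloop:
 assumes e: "is_loop M e \<or> is_coloop M e"
 shows "M = direct_sum (delete M {e}) (delete M (ground M - {e}))"
proof (rule set_system_eqI)
 have eg: "e \<in> ground M" using e by (auto simp: is_loop_def is_coloop_def)
 then show "ground M = ground (direct_sum (delete M {e}) (delete M (ground M - {e})))" by (auto simp: direct_sum_def)
 have key: "A \<union> B \<in> indeps M" if A: "A \<in> indeps M" "e \<notin> A" "B \<in> indeps M" "B \<subseteq> {e}" for A B
 proof (cases "B = {}")
  case False
  then have B: "B = {e}" using A by auto
  then have "\<not> is_loop M e" using A by (simp add: is_loop_def)
  then obtain C where "C \<in> bases M" "A \<subseteq> C" "e \<in> C" using e ex_basis_containing [OF A(1)] by (auto simp: is_coloop_def)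
  then show ?thesis using B indep_subset [of C "A \<union> B"] by (auto simp: bases_def)
 qed (use A in simp)
 have aux: "B \<in> indeps M ==> B \<inter> (ground M - {e}) = {} \<longleftrightarrow> B \<subseteq> {e}" for B using indeps_subset by blast
 fix I
 have mem: "I \<in> indeps (direct_sum (delete M {e}) (delete M (ground M - {e}))) \<longleftrightarrow>
   (\<exists>A B. I = A \<union> B & A \<in> indeps M & e \<notin> A & B \<in> indeps M & B \<subseteq> {e})"
  by (simp add: direct_sum_def delete_def aux cong: conj_cong)
 show "I \<in> indeps M \<longleftrightarrow> I \<in> indeps (direct_sum (delete M {e}) (delete M (ground M - {e})))"
 proof
  assume I: "I \<in> indeps M"
  have "I = (I - {e}) \<union> (I \<inter> {e})" "I - {e} \<in> indeps M" "I \<inter> {e} \<in> indeps M"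
   using indep_subset [OF I] by auto
  then show "I \<in> indeps (direct_sum (delete M {e}) (delete M (ground M - {e})))" unfolding mem by blast
 next
  assume "I \<in> indeps (direct_sum (delete M {e}) (delete M (ground M - {e})))"
  then obtain A B where "I = A \<union> B" "A \<in> indeps M" "e \<notin> A" "B \<in> indeps M" "B \<subseteq> {e}" unfolding mem by auto
  then show "I \<in> indeps M" using key [of A B] by simp
 qed
qed

lemma parallel_swap:
 assumes fg: "{f} \<in> indeps M" "{f, g} \<notin> indeps M" and I: "I \<in> indeps M" "g \<in> I"
 shows "insert f (I - {g}) \<in> indeps M"
proof -
 have fI: "f \<notin> I" using fg I indep_subset [of I "{f, g}"] by auto
 have finI: "finite I" using I finite_indep by auto
 then have "card {f} <= card I" using I by (auto simp: Suc_le_eq card_gt_0_iff)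
 then obtain K where K: "K \<in> indeps M" "f \<in> K" "K \<subseteq> insert f I" "card K = card I"
  using augment_to_card [OF fg(1) I(1)] by auto
 have "g \<notin> K" using fg K indep_subset [of K "{f, g}"] by auto
 then have "K \<subseteq> insert f (I - {g})" using K by auto
 moreover have "card (insert f (I - {g})) = card K" using card_insert_disjoint [of "I - {g}" f] card.remove [OF finI I(2)] finI fI K(4) by (metis Diff_iff finite_Diff)
 ultimately have "K = insert f (I - {g})" using finI by (intro card_subset_eq) auto
 then show ?thesis using K by simp
qed

lemma parallel_pair_extension:
 assumes ne: "f ~= g" and f: "{f} \<in> indeps M" and g: "{g} \<in> indeps M" and fg: "{f, g} \<notin> indeps M"
 shows "M = parallel_extension f g (delete M {g})"
proof (rule set_system_eqI)
 have G: "f \<in> ground M" "g \<in> ground M" using f g indeps_subset by auto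
 then show "ground M = ground (parallel_extension f g (delete M {g}))" by auto
 fix I
 have "I \<in> indeps M ==> \<not> {f, g} \<subseteq> I" using fg indep_subset by blast
 moreover have "I \<in> indeps M \<longleftrightarrow> insert f (I - {g}) \<in> indeps M" if "g \<in> I" "f \<notin> I"
 proof
  assume "insert f (I - {g}) \<in> indeps M"
  then have "insert g (insert f (I - {g}) - {f}) \<in> indeps M"
   using parallel_swap [OF g, of f "insert f (I - {g})"] fg by (simp add: insert_commute)
  moreover have "insert g (insert f (I - {g}) - {f}) = I" using that by auto
  ultimately show "I \<in> indeps M" by simp
 next
  assume "I \<in> indeps M"
  then show "insert f (I - {g}) \<in> indeps M" using parallel_swap [OF f fg] that by simp
 qed
 ultimately show "I \<in> indeps M \<longleftrightarrow> I \<in> indeps (parallel_extension f g (delete M {g}))"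
  using ne G indeps_subset [of I] by (cases "g \<in> I"; cases "f \<in> I") (auto simp: parallel_extension_def delete_def)
qed

lemma doubly_garding_rank_le_2:
 assumes "rank <= 2" and single: "\<And>e. e \<in> ground M ==> {e} \<in> indeps M"
  and pair: "\<And>f g. f \<in> ground M ==> g \<in> ground M ==> {f, g} \<in> indeps M"
 shows "doubly_garding M"
proof (rule doubly_garding_uniform [of M rank])
 show "matroid M" by unfold_locales
 obtain B where "B \<in> indeps M" "card B = rank" using ex_card_rank by auto
 then show "rank <= card (ground M)" using indeps_subset finite_ground card_mono by metis
 fix I show "I \<in> indeps M \<longleftrightarrow> I \<subseteq> ground M & card I <= rank"
 proof
  assume I: "I \<subseteq> ground M & card I <= rank"
  then have "finite I" using finite_ground finite_subset by blast
  have "card I \<in> {0, 1, 2}" using I assms(1) by auto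
  then consider "card I = 0" | "card I = 1" | "card I = 2" by auto
  then show "I \<in> indeps M"
  proof cases
   case 1 then show ?thesis using \<open>finite I\<close> empty_indep by simp
  next
   case 2 then show ?thesis using single I by (auto simp: card_1_singleton_iff)
  next
   case 3 then show ?thesis using pair I by (auto simp: card_2_iff)
  qed
 qed (use card_indep_le indeps_subset in auto)
qed

end

lemma (in matroid) rank_dual:
 assumes "matroid.rank (dual M) = q" shows "rank + q = card (ground M)"
proof -
 interpret d: matroid "dual M" by (rule matroid_dual)
 obtain B where B: "B \<in> indeps M" "card B = rank" using ex_card_rank by auto
 then have sub: "B \<subseteq> ground M" using indeps_subset by auto
 have "ground M - B \<in> bases (dual M)" using B sub by (simp add: bases_dual bases_iff double_diff)
 then have "card (ground M - B) = q" using assms by (simp add: d.bases_iff)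
 moreover have "card (ground M - B) = card (ground M) - card B" "card B <= card (ground M)"
  using sub finite_ground by (auto intro: card_Diff_subset card_mono finite_subset)
 ultimately show ?thesis using B by simp
qed

text \<open>
 Without parallel pairs, two non-bases meeting in two points span a set of rank two and four points, whose
 complement would then be a series pair.
\<close>

lemma (in matroid) gard_S_six:
 assumes E: "card (ground M) = 6" and rk: "rank = 3"
  and pair: "\<And>f g. f \<in> ground M ==> g \<in> ground M ==> {f, g} \<in> indeps M"
  and dpair: "\<And>f g. f \<in> ground M ==> g \<in> ground M ==> {f, g} \<in> indeps (dual M)"
  and contr: "\<And>e. e \<in> ground M ==> gard (ground M - {e}) (S_coeff (contract M {e}))"
 shows "gard (ground M) (S_coeff M)"
proof -
 define \<H> where "\<H> = {H. H \<subseteq> ground M & card H = 3 & H \<notin> indeps M}"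
 have HH: "card (H \<inter> H') <= 1" if "H \<in> \<H>" "H' \<in> \<H>" "H ~= H'" for H H'
 proof (rule ccontr)
  assume big: "\<not> card (H \<inter> H') <= 1"
  have h: "H \<subseteq> ground M" "H' \<subseteq> ground M" "card H = 3" "card H' = 3" "H \<notin> indeps M" "H' \<notin> indeps M"
   using that by (auto simp: \<H>_def)
  have fin: "finite H" "finite H'" using h finite_ground finite_subset by auto
  have "card (H \<inter> H') < card H"
  proof (rule psubset_card_mono)
   show "H \<inter> H' \<subset> H" using that(3) h fin card_subset_eq [of H' H] by auto
  qed (use fin in auto)
  then have c2: "card (H \<inter> H') = 2" using big h by simp
  then obtain p q where pq: "H \<inter> H' = {p, q}" "p ~= q" by (metis card_2_iff)
  have "p \<in> ground M" "q \<in> ground M" using pq h by auto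
  then have ind: "H \<inter> H' \<in> indeps M" using pq pair by simp
  have "card (H \<union> H') = 4" using card_Un_Int [of H H'] fin h c2 by simp
  then have "card (ground M - (H \<union> H')) = 2" using E h fin by (subst card_Diff_subset) auto
  then obtain s t where st: "ground M - (H \<union> H') = {s, t}" by (metis card_2_iff)
  then have "s \<in> ground M" "t \<in> ground M" by auto
  then have "{s, t} \<in> indeps (dual M)" by (rule dpair)
  then have "ground M - {s, t} \<in> spanning_sets M" by (simp add: dual_def)
  moreover have "ground M - {s, t} = H \<union> H'" using st h by blast
  ultimately obtain B where B: "B \<in> indeps M" "H \<inter> H' \<subseteq> B" "B \<subseteq> H \<union> H'" "card B = 3"
   using extend_in_spanning [OF ind, of "H \<union> H'"] rk by auto
  have "B ~= H \<inter> H'" using B c2 by auto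
  then obtain x where x: "x \<in> B" "x \<notin> H \<inter> H'" using B by auto
  have sub: "insert x (H \<inter> H') \<in> indeps M" using x B indep_subset [of B "insert x (H \<inter> H')"] by auto
  have c3: "card (insert x (H \<inter> H')) = 3" using x fin c2 by simp
  have "x \<in> H \<or> x \<in> H'" using x B by auto
  then show False
  proof
   assume "x \<in> H"
   then have "insert x (H \<inter> H') = H" using c3 fin h by (intro card_subset_eq) auto
   then show False using sub h by simp
  next
   assume "x \<in> H'"
   then have "insert x (H \<inter> H') = H'" using c3 fin h by (intro card_subset_eq) auto
   then show False using sub h by simp
  qed
 qed
 have "B \<in> bases M \<longleftrightarrow> B \<in> {B. B \<subseteq> ground M & card B = 3} - \<H>" for B
  using indeps_subset [of B] by (auto simp: bases_iff rk \<H>_def)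
 then have "bases M = {B. B \<subseteq> ground M & card B = 3} - \<H>" by blast
 moreover have "\<forall>H\<in>\<H>. \<forall>H'\<in>\<H>. H ~= H' --> card (H \<inter> H') + 1 < 3"
 proof (intro ballI impI)
  fix H H' assume "H \<in> \<H>" "H' \<in> \<H>" "H ~= H'"
  from HH [OF this] show "card (H \<inter> H') + 1 < 3" by simp
 qed
 moreover have "\<forall>H\<in>\<H>. H \<subseteq> ground M & card H = 3" by (simp add: \<H>_def)
 ultimately have "sparse_nonbases M 3 \<H>" unfolding sparse_nonbases_def by simp
 then have eq: "T \<subseteq> ground M ==> S_coeff M T = minus_coeff 3 \<H> T" for T by (rule S_coeff_sparse)
 have "gard (ground M) (minus_coeff 3 \<H>)"
 proof (rule gard_rank_three_six [OF finite_ground E])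
  fix e assume e: "e \<in> ground M"
  have "S_coeff (contract M {e}) T = link (minus_coeff 3 \<H>) {e} T" if "T \<subseteq> ground M - {e}" for T
  proof -
   have "S_coeff M (T \<union> {e}) = minus_coeff 3 \<H> (T \<union> {e})" using e that by (intro eq) auto
   then show ?thesis using contract_spanning [of "{e}" T] e that by (simp add: link_def S_coeff_def)
  qed
  then show "gard (ground M - {e}) (link (minus_coeff 3 \<H>) {e})"
   using contr [OF e] gard_cong [of "ground M - {e}"] by metis
 qed (use HH in \<open>auto simp: \<H>_def\<close>)
 then show ?thesis using eq gard_cong [of "ground M"] by metis
qed

theorem doubly_garding_at_most_six:
 "matroid M ==> card (ground M) <= 6 ==> doubly_garding M"
proof (induction "card (ground M)" arbitrary: M rule: less_induct)
 case less
 interpret matroid M by (rule less.prems)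
 interpret d: matroid "dual M" by (rule matroid_dual)
 have IH: "doubly_garding N" if "matroid N" "card (ground N) < card (ground M)" for N :: "'a set_system"
  using less.hyps [OF that(2,1)] that less.prems by simp
 have smaller: "card (ground M - {e}) < card (ground M)" if "e \<in> ground M" for e
  using that finite_ground by (rule card_Diff1_less [rotated])
 have par: "doubly_garding N"
  if N: "matroid N" "ground N = ground M" and fg: "f ~= g" "{f} \<in> indeps N" "{g} \<in> indeps N" "{f, g} \<notin> indeps N" for N f g
 proof -
  interpret N: matroid N by (rule N)
  have G: "f \<in> ground N" "g \<in> ground N" using fg N.indeps_subset by auto
  then have "doubly_garding (delete N {g})" using smaller N by (intro IH N.matroid_delete) simp
  then have "doubly_garding (parallel_extension f g (delete N {g}))"
   using G fg by (intro doubly_garding_parallel_extension) auto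
  then show ?thesis using N.parallel_pair_extension [OF fg] by simp
 qed
 show ?case
 proof (cases "\<exists>e. is_loop M e \<or> is_coloop M e")
  case True
  then obtain e where e: "is_loop M e \<or> is_coloop M e" by auto
  then have eg: "e \<in> ground M" by (auto simp: is_loop_def is_coloop_def)
  then have ground: "ground M - (ground M - {e}) = {e}" by auto
  have 1: "doubly_garding (delete M {e})" using smaller [OF eg] by (intro IH matroid_delete) simp
  have "doubly_garding (delete M (ground M - {e}))"
  proof (rule doubly_garding_uniform [OF matroid_delete, where r = "if {e} \<in> indeps M then 1 else 0"])
   fix I show "I \<in> indeps (delete M (ground M - {e})) \<longleftrightarrow>
     I \<subseteq> ground (delete M (ground M - {e})) & card I <= (if {e} \<in> indeps M then 1 else 0)"
    using indeps_subset [of I] empty_indep ground by (cases "I \<subseteq> {e}") (auto simp: delete_def subset_singleton_iff)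
  qed (simp add: ground)
  then have "doubly_garding (direct_sum (delete M {e}) (delete M (ground M - {e})))"
   using 1 ground unfolding doubly_garding_gmat by (auto intro!: gmat_direct_sum)
  then show ?thesis using split_loop_coloop [OF e] by simp
 next
  case False
  have single: "{e} \<in> indeps M" if "e \<in> ground M" for e using False that by (auto simp: is_loop_def)
  have dsingle: "{e} \<in> indeps (dual M)" if "e \<in> ground M" for e
   using False that not_coloop_spanning [OF that] by (auto simp: dual_def)
  show ?thesis
  proof (cases "\<forall>f\<in>ground M. \<forall>g\<in>ground M. {f, g} \<in> indeps M & {f, g} \<in> indeps (dual M)")
   case False
   then obtain f g where fg: "f \<in> ground M" "g \<in> ground M" "{f, g} \<notin> indeps M \<or> {f, g} \<notin> indeps (dual M)" by auto
   then have "f ~= g" using single dsingle by auto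
   then have "doubly_garding M \<or> doubly_garding (dual M)"
    using fg single dsingle par [of M f g] par [of "dual M" f g] less.prems(1) matroid_dual by auto
   then show ?thesis using doubly_garding_dual dual_dual by metis
  next
   case True
   then have pair: "\<And>f g. f \<in> ground M ==> g \<in> ground M ==> {f, g} \<in> indeps M"
    and dpair: "\<And>f g. f \<in> ground M ==> g \<in> ground M ==> {f, g} \<in> indeps (dual M)" by auto
   have sum: "rank + d.rank = card (ground M)" by (rule rank_dual) simp
   consider "rank <= 2" | "d.rank <= 2" | "rank = 3" "d.rank = 3" "card (ground M) = 6"
    using sum less.prems(2) by linarith
   then show ?thesis
   proof cases
    case 1
    then show ?thesis using single pair by (rule doubly_garding_rank_le_2)
   next
    case 2
    have "doubly_garding (dual M)" by (rule d.doubly_garding_rank_le_2) (use 2 dsingle dpair in auto)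
    then show ?thesis using doubly_garding_dual dual_dual by metis
   next
    case 3
    have c: "gard (ground M - {e}) (S_coeff (contract M {e}))" "gard (ground M - {e}) (S_coeff (contract (dual M) {e}))"
     if e: "e \<in> ground M" for e
    proof -
     have "doubly_garding (contract M {e})" "doubly_garding (contract (dual M) {e})"
      using e smaller [OF e] by (auto intro!: IH matroid_contract d.matroid_contract)
     then show "gard (ground M - {e}) (S_coeff (contract M {e}))" "gard (ground M - {e}) (S_coeff (contract (dual M) {e}))"
      by (auto simp: doubly_garding_def)
    qed
    have "gard (ground M) (S_coeff M)" using 3 pair dpair c by (intro gard_S_six) auto
    moreover have "gard (ground (dual M)) (S_coeff (dual M))"
     by (rule d.gard_S_six) (use 3 pair dpair c in \<open>auto simp: dual_dual\<close>)
    ultimately show ?thesis using less.prems(1) by (simp add: doubly_garding_def S_coeff_dual)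
   qed
  qed
 qed
qed

section \<open>Bases as a limit\<close>

definition B_coeff :: "'a set_system => 'a set => real" where
 "B_coeff M T = (if T \<in> bases M then 1 else 0)"

definition I_coeff :: "'a set_system => 'a set => real" where
 "I_coeff M T = (if T \<in> indeps M then 1 else 0)"

text \<open>
 Multiplying by a positive constant changes none of the signs.
\<close>

lemma gard_const:
 assumes g: "gard E c" and k: "0 < k"
 shows "gard E (\<lambda>T. k * c T)"
proof -
 have pd: "pd E (\<lambda>T. k * c T) T x = k * pd E c T x" for T x
  by (simp add: pd_def ma_def link_def sum_distrib_left mult.assoc)
 then have ma: "ma E (\<lambda>T. k * c T) x = k * ma E c x" for x using pd [of "{}" x] by simp
 have "nnR E (\<lambda>T. k * c T) = nnR E c" "posR E (\<lambda>T. k * c T) = posR E c"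
  using k by (auto simp: nnR_def posR_def pd zero_le_mult_iff zero_less_mult_iff)
 then show ?thesis using g k by (auto simp: gard_def ma zero_less_mult_iff)
qed

context matroid
begin

text \<open>
 Substitute \<open>\<epsilon> x\<close> and divide by \<open>\<epsilon>\<close> to the rank: as \<open>\<epsilon>\<close> tends to \<open>0\<close> only the
 spanning sets of minimal size survive.
\<close>

lemma basis_approximation:
 assumes g: "gard (ground M) (S_coeff M)"
 shows "\<exists>c. (\<forall>n::nat. gard (ground M) (c n)) & (\<forall>T\<subseteq>ground M. (\<lambda>n. c n T) \<longlonglongrightarrow> B_coeff M T)"
proof -
 define c where "c n T = (1 + real n) ^ rank * (S_coeff M T * prod (\<lambda>_. 1 / (1 + real n)) T)" for n T
 have "gard (ground M) (c n)" for n
  unfolding c_def by (intro gard_const gard_scale g) auto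
 moreover have "(\<lambda>n. c n T) \<longlonglongrightarrow> B_coeff M T" if T: "T \<subseteq> ground M" for T
 proof (cases "T \<in> spanning_sets M")
  case True
  then obtain I where I: "I \<in> indeps M" "I \<subseteq> T" "card I = rank" by (auto simp: spanning_iff)
  have finT: "finite T" using T finite_ground finite_subset by blast
  then have le: "rank <= card T" using I card_mono by metis
  have val: "c n T = (1 / (1 + real n)) ^ (card T - rank)" for n
  proof -
   have "(1 + real n) ^ rank * (1 / (1 + real n)) ^ card T = (1 / (1 + real n)) ^ (card T - rank)"
    using le by (simp add: power_diff power_one_over field_simps)
   then show ?thesis using True by (simp add: c_def S_coeff_def)
  qed
  show ?thesis
  proof (cases "card T = rank")
   case True
   then have "T \<in> bases M" using I finT card_subset_eq [of T I] by (auto simp: bases_iff)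
   then show ?thesis using True by (simp add: val B_coeff_def)
  next
   case False
   then have "0 < card T - rank" using le by simp
   moreover have "(\<lambda>n. 1 / (1 + real n)) \<longlonglongrightarrow> 0"
    using LIMSEQ_inverse_real_of_nat by (simp add: inverse_eq_divide)
   ultimately have "(\<lambda>n. (1 / (1 + real n)) ^ (card T - rank)) \<longlonglongrightarrow> 0 ^ (card T - rank)"
    by (intro tendsto_power)
   moreover have "T \<notin> bases M" using False by (simp add: bases_iff)
   moreover have "(0::real) ^ (card T - rank) = 0" using \<open>0 < card T - rank\<close> by simp
   ultimately show ?thesis by (simp only: val B_coeff_def if_False)
  qed
 next
  case False
  then have "T \<notin> bases M" using T by (auto simp: spanning_sets_def)
  then show ?thesis using False by (simp add: c_def S_coeff_def B_coeff_def)
 qed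
 ultimately show ?thesis by blast
qed

lemma B_poly_eq: "B_poly M x = ma (ground M) (B_coeff M) x"
 unfolding B_poly_def B_coeff_def [abs_def]
 by (rule gen_fun_eq_ma) (use finite_ground indeps_subset in \<open>auto simp: bases_def\<close>)

lemma I_poly_eq: "I_poly M x = ma (ground M) (I_coeff M) x"
 unfolding I_poly_def I_coeff_def [abs_def]
 by (rule gen_fun_eq_ma) (use finite_ground indeps_subset in auto)

lemma garding_B:
 assumes g: "gard (ground M) (S_coeff M)"
 shows "garding (ground M) (B_poly M)"
proof -
 obtain c where c: "\<And>n::nat. gard (ground M) (c n)" "\<And>T. T \<subseteq> ground M ==> (\<lambda>n. c n T) \<longlonglongrightarrow> B_coeff M T"
  using basis_approximation [OF g] by blast
 then have w: "wgard (ground M) (B_coeff M)" by (rule wgard_limit)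
 obtain B where "B \<in> bases M" using ground_spanning by (auto simp: spanning_sets_def)
 then have "B \<subseteq> ground M" "0 < B_coeff M B" using indeps_subset by (auto simp: B_coeff_def bases_def)
 then show ?thesis by (rule garding_of_wgard [OF w]) (simp add: B_poly_eq)
qed

end

section \<open>The Rayleigh property\<close>

lemma deriv_affine: "deriv (\<lambda>t::real. p + t * q) s = q"
 by (rule DERIV_imp_deriv) (auto intro!: derivative_eq_intros)

lemma partial_deriv_ma:
 assumes "finite E" "i \<in> E"
 shows "partial_deriv i (ma E c) = pd E c {i}"
 by (rule ext) (simp add: partial_deriv_def ma_update [OF assms] deriv_affine)

lemma partial_deriv_pd:
 assumes "finite E" "i \<in> E" "j \<in> E" "i ~= j"
 shows "partial_deriv i (pd E c {j}) = pd E c {i,j}"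
proof -
 have "pd E c {j} = ma (E - {j}) (link c {j})" by (rule ext) (simp add: pd_def)
 then have "partial_deriv i (pd E c {j}) = pd (E - {j}) (link c {j}) {i}" using assms by (simp add: partial_deriv_ma)
 also have "\<dots> = pd E c {i,j}" by (rule ext) (simp add: pd_link insert_commute)
 finally show ?thesis .
qed

text \<open>
 The Rayleigh inequality with the two variables \<open>i\<close>, \<open>j\<close> eliminated; in this form it is
 visibly stable under limits and inversion.
\<close>

definition rayleigh_coeff :: "'a set => ('a set => real) => bool" where
 "rayleigh_coeff E c \<longleftrightarrow> (\<forall>i\<in>E. \<forall>j\<in>E. i ~= j --> (\<forall>x. (\<forall>e\<in>E. 0 < x e) -->
   ma (E - {i,j}) c x * ma (E - {i,j}) (link c {i,j}) x
    <= ma (E - {i,j}) (link c {i}) x * ma (E - {i,j}) (link c {j}) x))"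

lemma rayleigh_of_coeff:
 assumes E: "finite E" and nn: "\<And>T. T \<subseteq> E ==> 0 <= c T" and f: "f = ma E c" and R: "rayleigh_coeff E c"
 shows "rayleigh E f"
proof -
 have "multi_affine_with E c f" using E by (simp add: multi_affine_with_def f ma_def)
 moreover have "f x * partial_deriv i (partial_deriv j f) x - partial_deriv i f x * partial_deriv j f x <= 0"
  if ij: "i \<in> E" "j \<in> E" "i ~= j" and x: "x \<in> pos_orthant E" for i j x
 proof -
  define P where "P = ma (E - {i,j}) c x"
  define Q where "Q = ma (E - {i,j}) (link c {i}) x"
  define Q' where "Q' = ma (E - {i,j}) (link c {j}) x"
  define S where "S = ma (E - {i,j}) (link c {i,j}) x"
  have sets: "E - {j} - {i} = E - {i,j}" "E - {i} - {j} = E - {i,j}" by auto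
  have i: "pd E c {i} x = Q + x j * S" and j: "pd E c {j} x = Q' + x i * S" and s: "pd E c {i,j} x = S"
   using pd_split [of E j "{i}" c x] pd_split [of E i "{j}" c x] E ij sets
   by (simp_all add: Q_def Q'_def S_def pd_def insert_commute)
  have "ma (E - {j}) c x = P + x i * Q"
   using ma_split [of "E - {j}" i c x] E ij sets by (simp add: P_def Q_def pd_def)
  then have m: "ma E c x = P + x i * Q + x j * (Q' + x i * S)"
   using ma_split [OF E ij(2), of c x] j by simp
  have "\<forall>e\<in>E. 0 < x e" using x by (auto simp: pos_orthant_def PiE_iff)
  then have "P * S <= Q * Q'" using R ij by (auto simp: rayleigh_coeff_def P_def Q_def Q'_def S_def)
  moreover have "ma E c x * S - (Q + x j * S) * (Q' + x i * S) = P * S - Q * Q'"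
   unfolding m by (simp add: algebra_simps)
  ultimately show ?thesis
   using E ij by (simp add: f partial_deriv_ma partial_deriv_pd i j s)
 qed
 ultimately show ?thesis using nn unfolding rayleigh_def by blast
qed

lemma rayleigh_coeff_gard: "gard E c ==> rayleigh_coeff E c"
 unfolding rayleigh_coeff_def
proof (intro ballI impI allI)
 fix i j x assume g: "gard E c" and ij: "i \<in> E" "j \<in> E" "i ~= j" and x: "\<forall>e\<in>E. 0 < (x e :: real)"
 have "gard (E - {i,j}) (link c {i,j})" using g ij by (intro gard_link) auto
 then have "x \<in> posR (E - {i,j}) (link c {i,j})" using x by (intro gard_orthant) auto
 from gard_rayleigh [OF g ij this]
 show "ma (E - {i,j}) c x * ma (E - {i,j}) (link c {i,j}) x
    <= ma (E - {i,j}) (link c {i}) x * ma (E - {i,j}) (link c {j}) x"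
  by (simp add: pd_def Diff_insert2 [symmetric] insert_commute)
qed

lemma ma_limit:
 assumes "\<And>T. T \<subseteq> E ==> (\<lambda>n. c n T) \<longlonglongrightarrow> b T"
 shows "(\<lambda>n. ma E (c n) x) \<longlonglongrightarrow> ma E b x"
 unfolding ma_def by (intro tendsto_sum tendsto_mult_right assms) auto

lemma rayleigh_coeff_limit:
 assumes R: "\<And>n::nat. rayleigh_coeff E (c n)" and lim: "\<And>T. T \<subseteq> E ==> (\<lambda>n. c n T) \<longlonglongrightarrow> b T"
 shows "rayleigh_coeff E b"
 unfolding rayleigh_coeff_def
proof (intro ballI impI allI)
 fix i j x assume ij: "i \<in> E" "j \<in> E" "i ~= j" and x: "\<forall>e\<in>E. 0 < (x e :: real)"
 have l: "(\<lambda>n. ma (E - {i,j}) (link (c n) S) x) \<longlonglongrightarrow> ma (E - {i,j}) (link b S) x" if "S \<subseteq> E" for S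
  by (rule ma_limit) (use that in \<open>auto simp: link_def intro!: lim\<close>)
 have l0: "(\<lambda>n. ma (E - {i,j}) (c n) x) \<longlonglongrightarrow> ma (E - {i,j}) b x"
  by (rule ma_limit) (auto intro!: lim)
 show "ma (E - {i,j}) b x * ma (E - {i,j}) (link b {i,j}) x <= ma (E - {i,j}) (link b {i}) x * ma (E - {i,j}) (link b {j}) x"
  by (rule LIMSEQ_le [OF tendsto_mult [OF l0 l] tendsto_mult [OF l l]])
   (use R ij x in \<open>auto simp: rayleigh_coeff_def\<close>)
qed

lemma sum_complement:
 assumes "finite D"
 shows "(\<Sum>T\<in>Pow D. h (D - T)) = (\<Sum>T\<in>Pow D. h T)"
 by (rule sum.reindex_bij_witness [where i = "\<lambda>T. D - T" and j = "\<lambda>T. D - T"]) (auto simp: double_diff)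

lemma prod_inverse_complement:
 fixes x :: "'a => real"
 assumes "finite D" "T \<subseteq> D" "\<And>e. e \<in> D ==> 0 < x e"
 shows "prod x (D - T) = prod x D * prod (\<lambda>e. 1 / x e) T"
proof -
 have "prod x D = prod x (D - T) * prod x T" using assms by (intro prod.subset_diff) auto
 moreover have "prod x T ~= 0" using assms finite_subset [OF assms(2,1)] by (auto simp: prod_zero_iff) force
 ultimately show ?thesis by (simp add: prod_dividef)
qed

lemma ma_inversion:
 assumes D: "finite D" and x: "\<And>e. e \<in> D ==> 0 < x e"
 shows "ma D (\<lambda>T. c (D - T)) x = prod x D * ma D c (\<lambda>e. 1 / x e)"
proof -
 have "ma D (\<lambda>T. c (D - T)) x = (\<Sum>T\<in>Pow D. c T * prod x (D - T))"
  unfolding ma_def sum_complement [OF D, of "\<lambda>T. c T * prod x (D - T)", symmetric]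
  by (intro sum.cong) (auto simp: double_diff)
 also have "\<dots> = prod x D * ma D c (\<lambda>e. 1 / x e)"
  unfolding ma_def sum_distrib_left by (rule sum.cong) (use prod_inverse_complement [OF D _ x] in \<open>auto simp: mult_ac\<close>)
 finally show ?thesis .
qed

text \<open>
 Inversion exchanges the four parts in pairs and multiplies each by the monomial of the remaining
 variables.
\<close>

lemma rayleigh_coeff_inversion:
 assumes E: "finite E" and R: "rayleigh_coeff E c"
 shows "rayleigh_coeff E (\<lambda>T. c (E - T))"
 unfolding rayleigh_coeff_def
proof (intro ballI impI allI)
 fix i j x assume ij: "i \<in> E" "j \<in> E" "i ~= j" and x: "\<forall>e\<in>E. 0 < (x e :: real)"
 define D where "D = E - {i,j}"
 define y where "y e = 1 / x e" for e
 have D: "finite D" "\<And>e. e \<in> D ==> 0 < x e" using E x by (auto simp: D_def)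
 have inv: "ma D (link (\<lambda>T. c (E - T)) S) x = prod x D * ma D (link c ({i,j} - S)) y" if "S \<subseteq> {i,j}" for S
 proof -
  have "ma D (link (\<lambda>T. c (E - T)) S) x = ma D (\<lambda>T. link c ({i,j} - S) (D - T)) x"
  proof (rule ma_cong [OF _ refl])
   fix T assume "T \<subseteq> D"
   then have "E - (T \<union> S) = D - T \<union> ({i,j} - S)" using ij that by (auto simp: D_def)
   then show "link (\<lambda>T. c (E - T)) S T = link c ({i,j} - S) (D - T)" by (simp add: link_def)
  qed
  then show ?thesis unfolding y_def using ma_inversion [OF D] by simp
 qed
 have e: "link c {} = c" "link (\<lambda>T. c (E - T)) {} = (\<lambda>T. c (E - T))" "{i,j} - {i} = {j}" "{i,j} - {j} = {i}"
  using ij by (auto simp: link_def)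
 note inv' = inv [of "{}", unfolded e] inv [of "{i,j}", unfolded Diff_cancel e] inv [of "{i}", unfolded e] inv [of "{j}", unfolded e]
 have "ma D c y * ma D (link c {i,j}) y <= ma D (link c {i}) y * ma D (link c {j}) y"
  using R ij x unfolding rayleigh_coeff_def D_def by (simp add: y_def)
 then have "(prod x D)\<^sup>2 * (ma D c y * ma D (link c {i,j}) y) <= (prod x D)\<^sup>2 * (ma D (link c {i}) y * ma D (link c {j}) y)"
  by (intro mult_left_mono) auto
 then show "ma (E - {i,j}) (\<lambda>T. c (E - T)) x * ma (E - {i,j}) (link (\<lambda>T. c (E - T)) {i,j}) x
   <= ma (E - {i,j}) (link (\<lambda>T. c (E - T)) {i}) x * ma (E - {i,j}) (link (\<lambda>T. c (E - T)) {j}) x"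
  unfolding D_def [symmetric] using inv' by (simp add: power2_eq_square mult_ac)
qed

section \<open>Ultra log-concavity\<close>

definition level_sum :: "'a set => ('a set => real) => ('a => real) => nat => real" where
 "level_sum E c a k = (\<Sum>T | T \<subseteq> E & card T = k. c T * prod a T)"

lemma ma_on_ray:
 assumes E: "finite E"
 shows "ma E c (\<lambda>e\<in>E. t * a e) = (\<Sum>k\<le>card E. level_sum E c a k * t ^ k)"
proof -
 have "ma E c (\<lambda>e\<in>E. t * a e) = (\<Sum>T\<in>Pow E. c T * prod a T * t ^ card T)"
  unfolding ma_def
 proof (rule sum.cong [OF refl])
  fix T assume T: "T \<in> Pow E"
  then have "prod (\<lambda>e\<in>E. t * a e) T = (\<Prod>e\<in>T. t * a e)" by (intro prod.cong) auto
  then show "c T * prod (\<lambda>e\<in>E. t * a e) T = c T * prod a T * t ^ card T" by (simp add: prod.distrib)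
 qed
 also have "\<dots> = (\<Sum>k\<le>card E. \<Sum>T | T \<in> Pow E & card T = k. c T * prod a T * t ^ card T)"
  by (rule sum.group [symmetric]) (use E in \<open>auto intro: card_mono\<close>)
 also have "\<dots> = (\<Sum>k\<le>card E. level_sum E c a k * t ^ k)"
  unfolding level_sum_def sum_distrib_right by (intro sum.cong) auto
 finally show ?thesis .
qed

definition newton :: "'a set => ('a set => real) => ('a => real) => bool" where
 "newton E c a \<longleftrightarrow> (\<forall>k. 1 <= k & k < card E -->
   (level_sum E c a (k - 1) / real (card E choose (k - 1))) * (level_sum E c a (k + 1) / real (card E choose (k + 1)))
    <= (level_sum E c a k / real (card E choose k))\<^sup>2)"

lemma newton_of_gard: "gard E c ==> (\<And>e. e \<in> E ==> 0 < a e) ==> newton E c a"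
 using newton_gard [OF gard_scale, of E c a] by (simp add: newton_def level_sum_def)

lemma newton_limit:
 assumes N: "\<And>n::nat. newton E (c n) (a n)"
  and c: "\<And>T. T \<subseteq> E ==> (\<lambda>n. c n T) \<longlonglongrightarrow> b T" and a: "\<And>e. e \<in> E ==> (\<lambda>n. a n e) \<longlonglongrightarrow> a' e"
 shows "newton E b a'"
 unfolding newton_def
proof (intro allI impI)
 fix k assume k: "1 <= k & k < card E"
 have l: "(\<lambda>n. level_sum E (c n) (a n) j / real (card E choose j)) \<longlonglongrightarrow> level_sum E b a' j / real (card E choose j)"
  if "j <= card E" for j
  unfolding level_sum_def using that by (intro tendsto_divide tendsto_sum tendsto_mult c tendsto_prod a tendsto_const) auto
 show "(level_sum E b a' (k - 1) / real (card E choose (k - 1))) * (level_sum E b a' (k + 1) / real (card E choose (k + 1)))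
    <= (level_sum E b a' k / real (card E choose k))\<^sup>2"
  by (rule LIMSEQ_le [OF tendsto_mult [OF l l] tendsto_power [OF l]]) (use N k in \<open>auto simp: newton_def\<close>)
qed

text \<open>
 Zero entries are limits of positive ones.
\<close>

lemma newton_boundary:
 assumes N: "\<And>a. (\<And>e. e \<in> E ==> 0 < a e) ==> newton E c a" and a: "\<And>e. e \<in> E ==> 0 <= a e"
 shows "newton E c a"
proof (rule newton_limit [where a = "\<lambda>n e. a e + 1 / (1 + real n)" and c = "\<lambda>_. c"])
 show "newton E c (\<lambda>e. a e + 1 / (1 + real n))" for n using a by (intro N add_nonneg_pos) auto
 have "(\<lambda>n. 1 / (1 + real n)) \<longlonglongrightarrow> 0" using LIMSEQ_inverse_real_of_nat by (simp add: inverse_eq_divide)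
 then have "(\<lambda>n. a e + 1 / (1 + real n)) \<longlonglongrightarrow> a e + 0" for e by (intro tendsto_add tendsto_const)
 then show "(\<lambda>n. a e + 1 / (1 + real n)) \<longlonglongrightarrow> a e" for e by simp
qed simp

lemma level_sum_inversion:
 assumes E: "finite E" and a: "\<And>e. e \<in> E ==> 0 < a e" and k: "k <= card E"
 shows "level_sum E (\<lambda>T. c (E - T)) a k = prod a E * level_sum E c (\<lambda>e. 1 / a e) (card E - k)"
proof -
 have card: "card (E - T) = card E - card T" "card T <= card E" if "T \<subseteq> E" for T
  using that E by (auto intro: card_Diff_subset card_mono finite_subset)
 have "level_sum E (\<lambda>T. c (E - T)) a k = (\<Sum>T | T \<subseteq> E & card T = card E - k. c T * prod a (E - T))"
  unfolding level_sum_def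
  by (rule sum.reindex_bij_witness [where i = "\<lambda>T. E - T" and j = "\<lambda>T. E - T"])
   (use card k in \<open>auto simp: double_diff\<close>)
 also have "\<dots> = prod a E * level_sum E c (\<lambda>e. 1 / a e) (card E - k)"
  unfolding level_sum_def sum_distrib_left
  by (rule sum.cong) (use prod_inverse_complement [OF E _ a] in \<open>auto simp: mult_ac\<close>)
 finally show ?thesis .
qed

text \<open>
 Inversion reverses the sequence of level sums, and binomial coefficients are symmetric.
\<close>

lemma newton_inversion:
 assumes E: "finite E" and N: "\<And>a. (\<And>e. e \<in> E ==> 0 < a e) ==> newton E c a" and a: "\<And>e. e \<in> E ==> 0 < a e"
 shows "newton E (\<lambda>T. c (E - T)) a"
 unfolding newton_def
proof (intro allI impI)
 fix k assume k: "1 <= k & k < card E"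
 define j where "j = card E - k"
 have j: "1 <= j" "j < card E" "card E - (k - 1) = j + 1" "card E - (k + 1) = j - 1" using k by (auto simp: j_def)
 have ch: "card E choose k = card E choose j" "card E choose (k - 1) = card E choose (j + 1)"
  "card E choose (k + 1) = card E choose (j - 1)"
  using k binomial_symmetric [of k "card E"] binomial_symmetric [of "k - 1" "card E"] binomial_symmetric [of "k + 1" "card E"]
  by (auto simp: j(3,4) j_def Suc_diff_le)
 define f where "f i = level_sum E c (\<lambda>e. 1 / a e) i / real (card E choose i)" for i
 have "newton E c (\<lambda>e. 1 / a e)" using a by (intro N) simp
 then have "f (j - 1) * f (j + 1) <= (f j)\<^sup>2" using j by (simp add: newton_def f_def)
 then have "(prod a E)\<^sup>2 * (f (j - 1) * f (j + 1)) <= (prod a E)\<^sup>2 * (f j)\<^sup>2" by (intro mult_left_mono) auto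
 moreover have L: "i <= card E ==> level_sum E (\<lambda>T. c (E - T)) a i = prod a E * level_sum E c (\<lambda>e. 1 / a e) (card E - i)" for i
  by (rule level_sum_inversion [OF E a])
 have "level_sum E (\<lambda>T. c (E - T)) a k / real (card E choose k) = prod a E * f j"
  "level_sum E (\<lambda>T. c (E - T)) a (k - 1) / real (card E choose (k - 1)) = prod a E * f (j + 1)"
  "level_sum E (\<lambda>T. c (E - T)) a (k + 1) / real (card E choose (k + 1)) = prod a E * f (j - 1)"
  using k j by (simp_all only: ch f_def) (simp_all add: L j_def)
 ultimately show "(level_sum E (\<lambda>T. c (E - T)) a (k - 1) / real (card E choose (k - 1))) *
   (level_sum E (\<lambda>T. c (E - T)) a (k + 1) / real (card E choose (k + 1)))
    <= (level_sum E (\<lambda>T. c (E - T)) a k / real (card E choose k))\<^sup>2"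
  by (simp only:) (simp add: power2_eq_square mult_ac)
qed

text \<open>
 Holds for coefficients of families closed under supersets or under subsets, and for families of
 constant size; the bound by \<open>T \<union> U\<close> keeps the new set inside the support of the direction.
\<close>

definition no_gaps :: "'a set => ('a set => real) => bool" where
 "no_gaps E c \<longleftrightarrow> (\<forall>T U j. T \<subseteq> E --> U \<subseteq> E --> 0 < c T --> 0 < c U --> card T < j --> j < card U -->
   (\<exists>V\<subseteq>T \<union> U. card V = j & 0 < c V))"

lemma ultra_log_concave_level_sums:
 assumes E: "finite E" and nn: "\<And>T. T \<subseteq> E ==> 0 <= c T" and gaps: "no_gaps E c"
  and a: "\<And>e. e \<in> E ==> 0 <= a e" and N: "newton E c a"
  and b: "\<And>k. k <= card E ==> b k = level_sum E c a k"
 shows "ultra_log_concave (card E) b"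
proof -
 have nna: "0 <= prod a T" if "T \<subseteq> E" for T using that a by (intro prod_nonneg) auto
 have fin: "finite {T. T \<subseteq> E & card T = k}" for k using E by simp
 have nnb: "0 <= b k" if "k <= card E" for k
  using nn nna by (simp add: b that level_sum_def) (intro sum_nonneg, auto)
 have supp: "\<exists>T\<subseteq>E. card T = k & 0 < c T & (\<forall>e\<in>T. 0 < a e)" if "0 < b k" "k <= card E" for k
 proof -
  have "(\<Sum>T | T \<subseteq> E & card T = k. c T * prod a T) ~= 0" using that by (simp add: b level_sum_def)
  then obtain T where T: "T \<subseteq> E" "card T = k" "c T * prod a T ~= 0"
   by (metis (mono_tags, lifting) mem_Collect_eq sum.neutral)
  then have "0 < c T" using nn [of T] by (auto simp: less_le)
  moreover have "0 < a e" if "e \<in> T" for e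
  proof -
   have "finite T" using T E finite_subset by blast
   then have "a e ~= 0" using T(3) that by (auto simp: prod_zero_iff)
   then show ?thesis using a [of e] T that by (auto simp: less_le)
  qed
  ultimately show ?thesis using T by blast
 qed
 have mid: "b j ~= 0" if ijk: "i < j" "j < k" "k <= card E" "0 < b i" "0 < b k" for i j k
 proof -
  obtain T U where T: "T \<subseteq> E" "card T = i" "0 < c T" "\<forall>e\<in>T. 0 < a e"
   and U: "U \<subseteq> E" "card U = k" "0 < c U" "\<forall>e\<in>U. 0 < a e"
   using supp [of i] supp [of k] ijk by auto
  then obtain V where V: "V \<subseteq> T \<union> U" "card V = j" "0 < c V" 
   using gaps [unfolded no_gaps_def, rule_format, OF T(1) U(1) T(3) U(3), of j] ijk T(2) U(2) by auto
  then have "0 < c V * prod a V" using T U by (intro mult_pos_pos prod_pos) auto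
  also have "\<dots> <= (\<Sum>T | T \<subseteq> E & card T = j. c T * prod a T)"
   using V T U nn nna by (intro member_le_sum fin) auto
  finally show ?thesis using b [of j] ijk by (simp add: level_sum_def)
 qed
 show ?thesis
  unfolding ultra_log_concave_def log_concave_def
 proof (intro conjI allI impI)
  fix k assume "k <= card E" then show "0 <= b k / real (card E choose k)" using nnb by simp
 next
  fix i j k
  assume "i < j & j < k & k <= card E & 0 < b i / real (card E choose i) & 0 < b k / real (card E choose k)"
  then show "b j / real (card E choose j) ~= 0" using mid [of i j k] by (auto simp: zero_less_divide_iff)
 next
  fix k assume k: "1 <= k & k < card E"
  then have "b (k - 1) = level_sum E c a (k - 1)" "b k = level_sum E c a k" "b (k + 1) = level_sum E c a (k + 1)"
   by (auto intro!: b)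
  with k show "b (k - 1) / real (card E choose (k - 1)) * (b (k + 1) / real (card E choose (k + 1)))
    <= (b k / real (card E choose k))\<^sup>2"
   using N unfolding newton_def by simp
 qed
qed

lemma ultra_log_concave_ray:
 assumes E: "finite E" and nn: "\<And>T. T \<subseteq> E ==> 0 <= c T" and gaps: "no_gaps E c"
  and N: "\<And>a. (\<And>e. e \<in> E ==> 0 < a e) ==> newton E c a"
  and a: "a \<in> E \<rightarrow>\<^sub>E {0..}" and b: "\<And>t. ma E c (\<lambda>e\<in>E. t * a e) = (\<Sum>k=0..card E. b k * t ^ k)"
 shows "ultra_log_concave (card E) b"
proof (rule ultra_log_concave_level_sums [OF E nn gaps])
 show a': "0 <= a e" if "e \<in> E" for e using a that by auto
 show "newton E c a" using N a' by (rule newton_boundary)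
 have "(\<Sum>k\<le>card E. b k * t ^ k) = (\<Sum>k\<le>card E. level_sum E c a k * t ^ k)" for t
  using b [of t] ma_on_ray [OF E, of c t a] by (simp add: atLeast0AtMost)
 then show "b k = level_sum E c a k" if "k <= card E" for k
  using that polyfun_eq_coeffs [of b "card E" "level_sum E c a"] by blast
qed

lemma no_gaps_up_closed:
 assumes E: "finite E" and m: "\<And>T U. T \<subseteq> U ==> U \<subseteq> E ==> c T <= c U"
 shows "no_gaps E c"
 unfolding no_gaps_def
proof (intro allI impI)
 fix T U j assume TU: "T \<subseteq> E" "U \<subseteq> E" "0 < c T" "0 < c U" "card T < j" "j < card U"
 have fin: "finite (T \<union> U)" using TU E finite_subset [of "T \<union> U" E] by auto
 then have "j <= card (T \<union> U)" using TU card_mono [of "T \<union> U" U] by auto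
 then obtain V where V: "T \<subseteq> V" "V \<subseteq> T \<union> U" "card V = j"
  using exists_subset_between [of T j "T \<union> U"] TU fin by auto
 moreover have "V \<subseteq> E" using V TU by blast
 ultimately show "\<exists>V\<subseteq>T \<union> U. card V = j & 0 < c V" using m [of T V] TU by (intro exI [of _ V]) auto
qed

lemma binomial_ratio:
 assumes k: "1 <= k" "k < n"
 shows "(real (n choose k))\<^sup>2 = (1 + 1 / real k) * (1 + 1 / real (n - k)) * real (n choose (k - 1)) * real (n choose (k + 1))"
proof -
 have step: "(j + 1) * (n choose (j + 1)) = (n - j) * (n choose j)" for j
 proof (cases n)
  case (Suc m)
  then show ?thesis using Suc_times_binomial [of j m] binomial_absorb_comp [of n j]
   by (simp only: Suc_eq_plus1 [symmetric] diff_Suc_1)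
 qed simp
 have "k * (n choose k) = (n - k + 1) * (n choose (k - 1))"
  using step [of "k - 1"] k by (simp add: Suc_diff_le)
 then have 1: "real k * real (n choose k) = (real (n - k) + 1) * real (n choose (k - 1))"
  by (metis of_nat_mult of_nat_add of_nat_1)
 have 2: "(real k + 1) * real (n choose (k + 1)) = real (n - k) * real (n choose k)"
  using step [of k] by (metis of_nat_mult of_nat_add of_nat_1)
 have p: "0 < real k" "0 < real (n - k)" using k by auto
 have "real (n choose k) = (real (n - k) + 1) * real (n choose (k - 1)) / real k"
  using 1 p(1) by (metis less_irrefl nonzero_mult_div_cancel_left)
 moreover have "real (n choose k) = (real k + 1) * real (n choose (k + 1)) / real (n - k)"
  using 2 p(2) by (metis less_irrefl nonzero_mult_div_cancel_left)
 ultimately have "real (n choose k) * real (n choose k) =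
   ((real (n - k) + 1) * real (n choose (k - 1)) / real k) * ((real k + 1) * real (n choose (k + 1)) / real (n - k))"
  by (rule arg_cong2)
 also have "\<dots> = (1 + 1 / real k) * (1 + 1 / real (n - k)) * real (n choose (k - 1)) * real (n choose (k + 1))"
  using p by (simp add: divide_simps)
 finally show ?thesis by (simp add: power2_eq_square)
qed

context matroid
begin

lemma I_coeff_eq: "T \<subseteq> ground M ==> I_coeff M T = C_coeff M (ground M - T)"
 by (simp add: I_coeff_def C_coeff_def double_diff)

lemma level_sum_I: "level_sum (ground M) (I_coeff M) (\<lambda>_. 1) k = real (card {I \<in> indeps M. card I = k})"
proof -
 have "level_sum (ground M) (I_coeff M) (\<lambda>_. 1) k = (\<Sum>T | T \<subseteq> ground M & card T = k. if T \<in> indeps M then 1 else 0)"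
  by (simp add: level_sum_def I_coeff_def)
 also have "\<dots> = real (card ({T. T \<subseteq> ground M & card T = k} \<inter> indeps M))"
  using finite_ground by (subst sum.inter_restrict [symmetric]) auto
 also have "{T. T \<subseteq> ground M & card T = k} \<inter> indeps M = {I \<in> indeps M. card I = k}" using indeps_subset by auto
 finally show ?thesis .
qed

lemma newton_I:
 assumes g: "gard (ground M) (C_coeff M)" and a: "\<And>e. e \<in> ground M ==> 0 < a e"
 shows "newton (ground M) (I_coeff M) a"
proof -
 have "newton (ground M) (\<lambda>T. C_coeff M (ground M - T)) a"
  by (rule newton_inversion [OF finite_ground newton_of_gard [OF g] a])
 moreover have "level_sum (ground M) (I_coeff M) a = level_sum (ground M) (\<lambda>T. C_coeff M (ground M - T)) a"
  unfolding level_sum_def by (rule ext, rule sum.cong) (auto simp: I_coeff_eq)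
 ultimately show ?thesis by (simp add: newton_def)
qed

lemma mason_inequality:
 assumes g: "gard (ground M) (C_coeff M)" and k: "1 <= k" "k < card (ground M)"
 shows "(1 + 1 / real k) * (1 + 1 / real (card (ground M) - k)) * real (card {I \<in> indeps M. card I = k - 1})
   * real (card {I \<in> indeps M. card I = k + 1}) <= (real (card {I \<in> indeps M. card I = k}))\<^sup>2"
proof -
 define n where "n = card (ground M)"
 define f where "f j = real (card {I \<in> indeps M. card I = j})" for j
 define b where "b j = real (n choose j)" for j
 define r where "r = (1 + 1 / real k) * (1 + 1 / real (n - k))"
 have bk: "(b k)\<^sup>2 = r * b (k - 1) * b (k + 1)"
  using binomial_ratio [of k n] k by (simp add: b_def n_def r_def)
 have b: "0 < b (k - 1)" "0 < b k" "0 < b (k + 1)" using k by (auto simp: b_def n_def)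
 have "newton (ground M) (I_coeff M) (\<lambda>_. 1)" by (rule newton_I [OF g]) simp
 then have "f (k - 1) / b (k - 1) * (f (k + 1) / b (k + 1)) <= (f k / b k)\<^sup>2"
  using k by (simp add: newton_def level_sum_I f_def b_def n_def)
 then have "(b k)\<^sup>2 * (f (k - 1) / b (k - 1) * (f (k + 1) / b (k + 1))) <= (b k)\<^sup>2 * (f k / b k)\<^sup>2"
  by (intro mult_left_mono) auto
 also have "(b k)\<^sup>2 * (f k / b k)\<^sup>2 = (f k)\<^sup>2" using b by (simp add: power_divide)
 also have "(b k)\<^sup>2 * (f (k - 1) / b (k - 1) * (f (k + 1) / b (k + 1)))
   = r * f (k - 1) * f (k + 1)"
  unfolding bk using b by (simp add: field_simps)
 finally show ?thesis by (simp add: f_def n_def r_def)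
qed

lemma doubly_garding_consequences:
 assumes g: "doubly_garding M"
 shows "\<forall>X\<in>{S_poly, C_poly, B_poly}. garding (ground M) (X M)"
  and "\<forall>X\<in>{S_poly, C_poly, B_poly, I_poly}. \<exists>c. X M = ma (ground M) c & (\<forall>T\<subseteq>ground M. 0 <= c T) \<and>
   rayleigh_coeff (ground M) c & no_gaps (ground M) c & (\<forall>a. (\<forall>e\<in>ground M. 0 < a e) --> newton (ground M) c a)"
proof -
 have S: "gard (ground M) (S_coeff M)" and C: "gard (ground M) (C_coeff M)" using g by (auto simp: doubly_garding_def)
 show "\<forall>X\<in>{S_poly, C_poly, B_poly}. garding (ground M) (X M)"
  using S C garding_S garding_C garding_B by simp
 obtain c where c: "\<And>n::nat. gard (ground M) (c n)" "\<And>T. T \<subseteq> ground M ==> (\<lambda>n. c n T) \<longlonglongrightarrow> B_coeff M T"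
  using basis_approximation [OF S] by blast
 have RB: "rayleigh_coeff (ground M) (B_coeff M)"
  using rayleigh_coeff_gard [OF c(1)] c(2) by (rule rayleigh_coeff_limit)
 have NB: "newton (ground M) (B_coeff M) a" if "\<forall>e\<in>ground M. 0 < a e" for a
  by (rule newton_limit [where c = c and a = "\<lambda>_. a"]) (use newton_of_gard [OF c(1)] c(2) that in auto)
 have RI: "rayleigh_coeff (ground M) (I_coeff M)"
 proof -
  have "rayleigh_coeff (ground M) (\<lambda>T. C_coeff M (ground M - T))"
   by (rule rayleigh_coeff_inversion [OF finite_ground rayleigh_coeff_gard [OF C]])
  moreover have "ma (ground M - {i,j}) (I_coeff M) x = ma (ground M - {i,j}) (\<lambda>T. C_coeff M (ground M - T)) x" for i j x
   by (rule ma_cong [OF _ refl]) (auto intro!: I_coeff_eq)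
  moreover have "ma (ground M - {i,j}) (link (I_coeff M) S) x
    = ma (ground M - {i,j}) (link (\<lambda>T. C_coeff M (ground M - T)) S) x" if "S \<subseteq> ground M" for i j x S
   by (rule ma_cong [OF _ refl]) (use that in \<open>auto simp: link_def intro!: I_coeff_eq\<close>)
  ultimately show ?thesis unfolding rayleigh_coeff_def by simp
 qed
 have GB: "no_gaps (ground M) (B_coeff M)" unfolding no_gaps_def B_coeff_def by (auto simp: bases_iff)
 have GI: "no_gaps (ground M) (I_coeff M)" unfolding no_gaps_def
 proof (intro allI impI)
  fix T U j assume TU: "U \<subseteq> ground M" "0 < I_coeff M U" "j < card U"
  then obtain V where "V \<subseteq> U" "card V = j" by (meson less_imp_le obtain_subset_with_card_n)
  moreover have "U \<in> indeps M" using TU by (auto simp: I_coeff_def split: if_splits)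
  ultimately show "\<exists>V\<subseteq>T \<union> U. card V = j & 0 < I_coeff M V"
   using indep_subset [of U V] by (intro exI [of _ V]) (auto simp: I_coeff_def)
 qed
 have GS: "no_gaps (ground M) (S_coeff M)" and GC: "no_gaps (ground M) (C_coeff M)"
  by (rule no_gaps_up_closed [OF finite_ground]; simp add: coeff_mono)+
 have fS: "S_poly M = ma (ground M) (S_coeff M)" "C_poly M = ma (ground M) (C_coeff M)"
  "B_poly M = ma (ground M) (B_coeff M)" "I_poly M = ma (ground M) (I_coeff M)"
  by (rule ext, simp add: S_poly_eq C_poly_eq B_poly_eq I_poly_eq)+
 show "\<forall>X\<in>{S_poly, C_poly, B_poly, I_poly}. \<exists>c. X M = ma (ground M) c & (\<forall>T\<subseteq>ground M. 0 <= c T) \<and>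
   rayleigh_coeff (ground M) c & no_gaps (ground M) c & (\<forall>a. (\<forall>e\<in>ground M. 0 < a e) --> newton (ground M) c a)"
 proof (intro ballI)
  fix X :: "'a set_system => ('a => real) => real"
  assume "X \<in> {S_poly, C_poly, B_poly, I_poly}"
  then consider "X = S_poly" | "X = C_poly" | "X = B_poly" | "X = I_poly" by auto
  then show "\<exists>c. X M = ma (ground M) c & (\<forall>T\<subseteq>ground M. 0 <= c T) \<and>
   rayleigh_coeff (ground M) c & no_gaps (ground M) c & (\<forall>a. (\<forall>e\<in>ground M. 0 < a e) --> newton (ground M) c a)"
  proof cases
   case 1 then show ?thesis using fS(1) rayleigh_coeff_gard [OF S] GS newton_of_gard [OF S]
    by (intro exI [of _ "S_coeff M"]) (simp add: coeff_nonneg)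
  next
   case 2 then show ?thesis using fS(2) rayleigh_coeff_gard [OF C] GC newton_of_gard [OF C]
    by (intro exI [of _ "C_coeff M"]) (simp add: coeff_nonneg)
  next
   case 3 then show ?thesis using fS(3) RB GB NB by (intro exI [of _ "B_coeff M"]) (simp add: B_coeff_def)
  next
   case 4 then show ?thesis using fS(4) RI GI newton_I [OF C] by (intro exI [of _ "I_coeff M"]) (simp add: I_coeff_def)
  qed
 qed
qed

end

lemma garding_matroid_gmat: "garding_matroid S_poly M \<longleftrightarrow> gmat S_coeff M" "garding_matroid C_poly M \<longleftrightarrow> gmat C_coeff M"
 by (simp_all only: garding_matroid_iff gmat_def)



theorem theorem1p3:
  shows
    "(\<forall>X \<in> {S_poly, C_poly :: 'a set_system \<Rightarrow> ('a \<Rightarrow> real) \<Rightarrow> real}.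
       (\<forall>M\<^sub>1 M\<^sub>2. garding_matroid X M\<^sub>1 \<and> garding_matroid X M\<^sub>2 \<and> ground M\<^sub>1 \<inter> ground M\<^sub>2 = {}
          \<longrightarrow> garding_matroid X (direct_sum M\<^sub>1 M\<^sub>2)) \<and>
       (\<forall>M\<^sub>1 M\<^sub>2 e. garding_matroid X M\<^sub>1 \<and> garding_matroid X M\<^sub>2 \<and> ground M\<^sub>1 \<inter> ground M\<^sub>2 = {e}
          \<longrightarrow> garding_matroid X (series_connection e M\<^sub>1 M\<^sub>2)) \<and>
       (\<forall>M\<^sub>1 M\<^sub>2 e. garding_matroid X M\<^sub>1 \<and> garding_matroid X M\<^sub>2 \<and> ground M\<^sub>1 \<inter> ground M\<^sub>2 = {e}
          \<longrightarrow> garding_matroid X (parallel_connection e M\<^sub>1 M\<^sub>2)) \<and>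
       (\<forall>M D. garding_matroid X M \<and> D \<subseteq> ground M \<longrightarrow> garding_matroid X (delete M D)) \<and>
       (\<forall>M D. garding_matroid X M \<and> D \<subseteq> ground M \<longrightarrow> garding_matroid X (contract M D)))
     \<and>
     (\<forall>(M :: 'a set_system) E n.
       matroid M \<and> E = ground M \<and> n = card E \<and>
       ((\<exists>G :: ('v, 'a) multigraph. series_parallel_network G \<and> M = cycle_matroid G)
        \<or> uniform_matroid M \<or> uniform_minus_basis M \<or> n \<le> 6)
       \<longrightarrow>
       (\<forall>X \<in> {S_poly, C_poly, B_poly}. garding E (X M)) \<and>
       (\<forall>X \<in> {S_poly, C_poly, B_poly, I_poly}. rayleigh E (X M)) \<and>
       (\<forall>X \<in> {S_poly, C_poly, B_poly, I_poly}. \<forall>a \<in> E \<rightarrow>\<^sub>E {0..}. \<forall>c :: nat \<Rightarrow> real.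
          (\<exists>t. X M (\<lambda>e\<in>E. t * a e) \<noteq> 0) \<and>
          (\<forall>t. X M (\<lambda>e\<in>E. t * a e) = (\<Sum>k=0..n. c k * t ^ k))
          \<longrightarrow> ultra_log_concave n c) \<and>
       (\<forall>k \<in> {1..n - 1}.
          (real (card {I \<in> indeps M. card I = k}))\<^sup>2
            \<ge> (1 + 1 / real k) * (1 + 1 / real (n - k))
                * real (card {I \<in> indeps M. card I = k - 1})
                * real (card {I \<in> indeps M. card I = k + 1})))"
proof (rule conjI, goal_cases)
 case 1
 have closed: "(\<forall>M N. gmat F M & gmat F N & ground M \<inter> ground N = {} --> gmat F (direct_sum M N)) \<and>
   (\<forall>M N e. gmat F M & gmat F N & ground M \<inter> ground N = {e} --> gmat F (series_connection e M N)) \<and>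
   (\<forall>M N e. gmat F M & gmat F N & ground M \<inter> ground N = {e} --> gmat F (parallel_connection e M N)) \<and>
   (\<forall>M D. gmat F M & D \<subseteq> ground M --> gmat F (delete M D)) \<and>
   (\<forall>M D. gmat F M & D \<subseteq> ground M --> gmat F (contract M D))"
  if F: "F = S_coeff \<or> F = C_coeff" for F :: "'a set_system => 'a set => real"
  using gmat_direct_sum [OF F] gmat_connections [OF F] gmat_minors [OF F] by simp
 show ?case
  unfolding ball_simps garding_matroid_gmat using closed [OF disjI1 [OF refl]] closed [OF disjI2 [OF refl]] by blast
next
 case 2
 show ?case
 proof (intro allI impI, elim conjE, goal_cases)
  case (1 M E n)
  note M = 1(1) and E = 1(2) and n = 1(3) and cls = 1(4)
  interpret matroid M by (rule M)
  have g: "doubly_garding M"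
   using cls doubly_garding_series_parallel doubly_garding_uniform_matroid doubly_garding_uniform_minus_basis
    doubly_garding_at_most_six [OF M] E n by blast
  have C: "gard E (C_coeff M)" using g E by (simp add: doubly_garding_def)
  have coeffs: "\<exists>c. X M = ma E c & (\<forall>T\<subseteq>E. 0 <= c T) \<and>
   rayleigh_coeff E c & no_gaps E c & (\<forall>a. (\<forall>e\<in>E. 0 < a e) --> newton E c a)"
   if "X \<in> {S_poly, C_poly, B_poly, I_poly}" for X
   using doubly_garding_consequences(2) [OF g] that unfolding E by blast
  have finE: "finite E" using finite_ground E by simp
  have R: "rayleigh E (X M)" if "X \<in> {S_poly, C_poly, B_poly, I_poly}" for X
   using coeffs [OF that] rayleigh_of_coeff [OF finE] by metis
  have U: "ultra_log_concave n c"
   if X: "X \<in> {S_poly, C_poly, B_poly, I_poly}" and a: "a \<in> E \<rightarrow>\<^sub>E {0..}"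
    and c: "\<forall>t. X M (\<lambda>e\<in>E. t * a e) = (\<Sum>k=0..n. c k * t ^ k)" for X a and c :: "nat => real"
  proof -
   from coeffs [OF X] obtain d where d: "X M = ma E d & (\<forall>T\<subseteq>E. 0 <= d T) \<and>
    rayleigh_coeff E d & no_gaps E d & (\<forall>a. (\<forall>e\<in>E. 0 < a e) --> newton E d a)" ..
   show ?thesis unfolding n
   proof (rule ultra_log_concave_ray [OF finE _ _ _ a])
    show "\<And>T. T \<subseteq> E ==> 0 <= d T" "no_gaps E d" using d by simp_all
    show "newton E d a" if "\<And>e. e \<in> E ==> 0 < a e" for a using d that by simp
    have "X M = ma E d" using d by (rule conjunct1)
    then show "ma E d (\<lambda>e\<in>E. t * a e) = (\<Sum>k=0..card E. c k * t ^ k)" for t using c unfolding n by simp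
   qed
  qed
  show ?case
  proof (intro conjI)
   show "\<forall>X\<in>{S_poly, C_poly, B_poly}. garding E (X M)" using doubly_garding_consequences(1) [OF g] E by simp
   show "\<forall>X\<in>{S_poly, C_poly, B_poly, I_poly}. rayleigh E (X M)" by (intro ballI R)
   show "\<forall>X \<in> {S_poly, C_poly, B_poly, I_poly}. \<forall>a \<in> E \<rightarrow>\<^sub>E {0..}. \<forall>c :: nat => real.
     (\<exists>t. X M (\<lambda>e\<in>E. t * a e) ~= 0) \<and>
     (\<forall>t. X M (\<lambda>e\<in>E. t * a e) = (\<Sum>k=0..n. c k * t ^ k)) --> ultra_log_concave n c"
    by (intro ballI allI impI, elim conjE) (rule U)
   show "\<forall>k \<in> {1..n - 1}. (1 + 1 / real k) * (1 + 1 / real (n - k)) * real (card {I \<in> indeps M. card I = k - 1})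
    * real (card {I \<in> indeps M. card I = k + 1}) <= (real (card {I \<in> indeps M. card I = k}))\<^sup>2"
   proof
    fix k assume "k \<in> {1..n - 1}"
    then have "1 <= k" "k < card (ground M)" by (auto simp: E n)
    from mason_inequality [OF _ this] C
    show "(1 + 1 / real k) * (1 + 1 / real (n - k)) * real (card {I \<in> indeps M. card I = k - 1})
     * real (card {I \<in> indeps M. card I = k + 1}) <= (real (card {I \<in> indeps M. card I = k}))\<^sup>2"
     by (simp only: E n)
   qed
  qed
 qed
qed

end
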